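(* Let $G$ be a finite group and let $(\mu_k)_{k\in\mathbb{N}}$ be a sequence of random rooted simplicial $G$-complexes (on $\mathcal{SC}_*^D(G)$). If every $\mu_k$ is sofic and the sequence converges weakly to $\mu_\infty$, then \[ \lim_{k\to \infty} m_n^{(2)}(\rho,\mu_k) = m_n^{(2)}(\rho, \mu_\infty) \] for every $n \in \mathbb{N}_0$ and every irreducible complex representation $\rho$ of $G$.
   Context: **Rooted $G$-complexes.** $G$ is a finite group and $D>0$ a fixed constant. Simplicial complexes are nonempty; $K^{(0)}$ is the vertex set of $K$; the degree of a vertex is the number of $1$-simplices containing it, and the vertex degree of $K$ is the supremum of the degrees. A simplicial $G$-complex is a simplicial complex with an action of $G$ by simplicial automorphisms. For $\emptyset\neq V\subseteq K^{(0)}$ and $r>0$, $B_r(K,V)$ is the full subcomplex of $K$ on all vertices of path distance at most $r$ from some vertex of $V$. A rooted simplicial $G$-complex is a pair $(K,o)$ of a simplicial $G$-complex $K$ and a $G$-orbit $o\subseteq K^{(0)}$ meeting every connected component of $K$. An isomorphism $(K,o)\cong_G(L,o')$ is a $G$-equivariant simplicial isomorphism $K\to L$ mapping $o$ onto $o'$. $\mathcal{SC}_*^D(G)$ is the set of isomorphism classes $[K,o]$ with vertex degree at most $D$, with the (possibly infinite-valued) metric $d([K,o],[L,o'])=\inf\{2^{-r} : (B_r(K,o),o)\cong_G (B_r(L,o'),o')\}$; it is compact and totally disconnected. Similarly, $\mathcal{SC}_{**}^D(G)$ is the space of isomorphism classes $[K,o,o']$ of simplicial $G$-complexes of vertex degree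 at most $D$ with two vertex orbits each meeting every connected component (isomorphisms preserve both orbits; the topology is defined in the same way using balls $B_r(K,o\cup o')$). A random rooted simplicial $G$-complex is a Borel probability measure $\mu$ on $\mathcal{SC}_*^D(G)$ that is unimodular: for all Borel $f\colon\mathcal{SC}_{**}^D(G)\to\mathbb{R}_{\ge0}$, \[\int\sum_{x\in K^{(0)}}f([K,o,Gx])\,d\mu([K,o])=\int\sum_{x\in K^{(0)}}f([K,Gx,o])\,d\mu([K,o]).\] Weak limits of random rooted simplicial $G$-complexes are again random rooted simplicial $G$-complexes. **Sofic.** For a finite simplicial $G$-complex $K$ of vertex degree at most $D$, let $\mu_K^G=\frac{1}{|K^{(0)}|}\sum_{x\in K^{(0)}}\delta_{[K,Gx]}$, where $[K,Gx]$ denotes the class of the union of those connected components of $K$ that meet $Gx$, rooted at $Gx$. A random rooted simplicial $G$-complex is sofic if it is the weak limit of $\mu^G_{K_j}$ for some sequence $(K_j)_j$ of finite simplicial $G$-complexes of vertex degree at most $D$. **$\ell^2$-chains.** Let $\mathrm{Orb}(G)$ be the finite set of isomorphism classes of transitive $G$-sets (with fixed representatives), $\mathbb{N}_G=\bigsqcup_{X\in\mathrm{Orb}(G)}\mathbb{N}_0\times X$ with $G$ acting on the second coordinate, and $\Delta^D(\mathbb{N}_G)$ the simplicial $G$-complex of all nonempty subsets of $\mathbb{N}_G$ with at most $D+1$ elements; $\Delta^D(\mathbb{N}_G)(n)$ is its set of $n$-simplices. Let $\mathrm{Sub}(\Delta^D(\mathbb{N}_G))\subseteq\{0,1\}^{\Delta^D(\mathbb{N}_G)}$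 (product topology) be the space of (indicator functions of) $G$-invariant subcomplexes containing exactly one orbit of the form $\{0\}\times X$. Fix a continuous map $\Psi\colon\mathcal{SC}_*^D(G)\to\mathrm{Sub}(\Delta^D(\mathbb{N}_G))$ such that $(\Psi([K,o]),\{0\}\times X)$ represents $[K,o]$, where $X\cong o$ (such a map exists). For a simplicial complex $L$, $C_n^{(2)}(L)$ is the complex Hilbert space of square-summable oriented $n$-chains. For an oriented $n$-simplex $s$ of $\Delta^D(\mathbb{N}_G)$ put $\xi_s([K,o])=s$ if $s$ belongs to $\Psi([K,o])$ and $0$ otherwise. The $\xi_s$ form a fundamental sequence of a measurable field of Hilbert spaces $[K,o]\mapsto C_n^{(2)}(\Psi([K,o]))$; let $C_n^{(2)}(\mathcal{SC}_*^D(G),\mu)=\int^\oplus C_n^{(2)}(\Psi([K,o]))\,d\mu$ be the direct integral, with the fibrewise unitary $G$-action. The fibrewise boundary maps and their adjoints give bounded $G$-equivariant operators $\partial_n\colon C_n^{(2)}\to C_{n-1}^{(2)}$ and $d_n=\partial_n^*$; the Laplacian is $\Delta_n=\partial_{n+1}d_{n+1}+d_n\partial_n$, and $H_n^{(2)}(\mathcal{SC}_*^D(G),\mu)=\ker\Delta_n$. **Trace and multiplicities.** Let $\mathcal{A}_n(\mu)$ be the von Neumann algebra of bounded decomposable operators $T=\int^\oplus T_{[K,o]}d\mu$ on $C_n^{(2)}(\mathcal{SC}_*^D(G),\mu)$ which are compatible (almost everywhere) with all isomorphisms of simplicial $G$-complexes $\phi\colon\Psi([K,o])\to\Psi([K,o'])$,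 i.e. $\langle T_{[K,o]}\sigma,\sigma\rangle=\langle T_{[K,o']}\phi_\sharp\sigma,\phi_\sharp\sigma\rangle$, where $\phi_\sharp$ is the induced chain map. It carries the finite faithful normal trace \[\mathrm{tr}(T)=\sum_{X\in\mathrm{Orb}(G)}\sum_{x\in X}\ \sum_{s\in\Delta^D(\mathbb{N}_G)(n),\,(0,x)\in s}\frac{\langle T\xi_s,\xi_s\rangle}{|X|(n+1)}\] (each $s$ given an arbitrary orientation). For a subspace $\mathcal{K}$ whose orthogonal projection $\mathrm{pr}_{\mathcal{K}}$ lies in $\mathcal{A}_n(\mu)$, $\dim_{\mathrm{vN}}\mathcal{K}=\mathrm{tr}(\mathrm{pr}_{\mathcal{K}})$. For an irreducible complex representation $\rho$ of $G$ with character $\chi_\rho$, the $\ell^2$-multiplicity is $m_n^{(2)}(\rho,\mu)=\frac{1}{\chi_\rho(1)}\dim_{\mathrm{vN}}H_n^{(2)}(\mathcal{SC}_*^D(G),\mu)_\rho$, where the subscript $\rho$ denotes the $\rho$-isotypic component, i.e. the image of $P_\rho=\frac{\chi_\rho(1)}{|G|}\sum_{g\in G}\overline{\chi_\rho(g)}\,g$. *)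

theory Defs
  imports
    "HOL-Analysis.Analysis"
    "HOL-Probability.Probability_Measure"
    "HOL-Algebra.Group_Action"
begin

section \<open>Simplicial complexes with a group action and marked orbits\<close>

text \<open>
  A complex is given by its set of simplices, each of which is a finite nonempty vertex set. The
  field \<open>roots\<close> lists the distinguished vertex orbits: it is empty for a plain complex, \<open>[o]\<close> for a
  rooted complex \<open>(K, o)\<close> and \<open>[o, o']\<close> for a birooted complex \<open>(K, o, o')\<close>. This treats the spaces
  \<open>SC\<^sub>*\<close> and \<open>SC\<^sub>*\<^sub>*\<close> at once.
\<close>

record ('g, 'v) gcomplex =
  simps :: "'v set set"
  action :: "'g \<Rightarrow> 'v \<Rightarrow> 'v"
  roots :: "'v set list"

definition simplicial_cx :: "'v set set \<Rightarrow> bool" where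
  "simplicial_cx K \<longleftrightarrow> K \<noteq> {} \<and>
     (\<forall>s\<in>K. s \<noteq> {} \<and> finite s \<and> (\<forall>t. t \<noteq> {} \<and> t \<subseteq> s \<longrightarrow> t \<in> K))"

definition verts :: "'v set set \<Rightarrow> 'v set" where
  "verts K = {v. {v} \<in> K}"

definition edges_at :: "'v set set \<Rightarrow> 'v \<Rightarrow> 'v set set" where
  "edges_at K v = {e \<in> K. card e = 2 \<and> v \<in> e}"

definition vertex_degree_le :: "'v set set \<Rightarrow> nat \<Rightarrow> bool" where
  "vertex_degree_le K D \<longleftrightarrow> (\<forall>v\<in>verts K. finite (edges_at K v) \<and> card (edges_at K v) \<le> D)"

definition adj :: "'v set set \<Rightarrow> ('v \<times> 'v) set" where
  "adj K = {(u, v). u \<noteq> v \<and> {u, v} \<in> K}"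

definition meets_every_component :: "'v set set \<Rightarrow> 'v set \<Rightarrow> bool" where
  "meets_every_component K W \<longleftrightarrow> (\<forall>v\<in>verts K. \<exists>u\<in>W. (u, v) \<in> (adj K)\<^sup>*)"

definition simplicial_gcx :: "('g, 'm) monoid_scheme \<Rightarrow> nat \<Rightarrow> ('g, 'v) gcomplex \<Rightarrow> bool" where
  "simplicial_gcx G D A \<longleftrightarrow>
     simplicial_cx (simps A) \<and>
     group_action G (verts (simps A)) (action A) \<and>
     (\<forall>g\<in>carrier G. \<forall>s\<in>simps A. action A g ` s \<in> simps A) \<and>
     vertex_degree_le (simps A) D"

definition marked_gcx ::
    "('g, 'm) monoid_scheme \<Rightarrow> nat \<Rightarrow> nat \<Rightarrow> ('g, 'v) gcomplex \<Rightarrow> bool" where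
  "marked_gcx G D m A \<longleftrightarrow>
     simplicial_gcx G D A \<and> length (roots A) = m \<and>
     (\<forall>W\<in>set (roots A). W \<in> orbits G (verts (simps A)) (action A) \<and>
                         meets_every_component (simps A) W)"

definition gcx_iso ::
    "('g, 'm) monoid_scheme \<Rightarrow> ('g, 'v) gcomplex \<Rightarrow> ('g, 'w) gcomplex \<Rightarrow> bool" where
  "gcx_iso G A B \<longleftrightarrow>
     (\<exists>f. bij_betw f (verts (simps A)) (verts (simps B)) \<and>
          (\<lambda>s. f ` s) ` simps A = simps B \<and>
          (\<forall>g\<in>carrier G. \<forall>v\<in>verts (simps A). f (action A g v) = action B g (f v)) \<and>
          map (\<lambda>W. f ` W) (roots A) = roots B)"

text \<open>
  Full subcomplex on a vertex set. The action is cut down with \<^term>\<open>restrict\<close>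
  because \<open>group_action\<close> requires maps that are extensional on the set acted upon.
\<close>

definition full_sub :: "('g, 'v) gcomplex \<Rightarrow> 'v set \<Rightarrow> ('g, 'v) gcomplex" where
  "full_sub A W = A\<lparr>simps := {s \<in> simps A. s \<subseteq> W}, action := (\<lambda>g. restrict (action A g) W)\<rparr>"

definition ball_cx :: "real \<Rightarrow> ('g, 'v) gcomplex \<Rightarrow> ('g, 'v) gcomplex" where
  "ball_cx r A = full_sub A
     {v \<in> verts (simps A). \<exists>u\<in>\<Union>(set (roots A)). \<exists>k::nat. real k \<le> r \<and> (u, v) \<in> adj (simps A) ^^ k}"

section \<open>The spaces of isomorphism classes\<close>

text \<open>
  Bounded degree and the root condition force countably many vertices, so every isomorphism class
  has a representative with vertices in \<^typ>\<open>nat\<close>.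
\<close>

type_synonym 'g gclass = "('g, nat) gcomplex set"

definition iso_rel ::
    "('g, 'm) monoid_scheme \<Rightarrow> nat \<Rightarrow> nat \<Rightarrow> (('g, nat) gcomplex \<times> ('g, nat) gcomplex) set" where
  "iso_rel G D m = {(A, B). marked_gcx G D m A \<and> marked_gcx G D m B \<and> gcx_iso G A B}"

definition SC :: "('g, 'm) monoid_scheme \<Rightarrow> nat \<Rightarrow> nat \<Rightarrow> 'g gclass set" where
  "SC G D m = {A. marked_gcx G D m A} // iso_rel G D m"

definition cls ::
    "('g, 'm) monoid_scheme \<Rightarrow> nat \<Rightarrow> nat \<Rightarrow> ('g, nat) gcomplex \<Rightarrow> 'g gclass" where
  "cls G D m A = iso_rel G D m `` {A}"

definition SC_dist :: "('g, 'm) monoid_scheme \<Rightarrow> 'g gclass \<Rightarrow> 'g gclass \<Rightarrow> ennreal" where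
  "SC_dist G a b = Inf {ennreal (2 powr (- r)) | r.
     r > 0 \<and> (\<exists>A\<in>a. \<exists>B\<in>b. gcx_iso G (ball_cx r A) (ball_cx r B))}"

definition SC_top :: "('g, 'm) monoid_scheme \<Rightarrow> nat \<Rightarrow> nat \<Rightarrow> 'g gclass topology" where
  "SC_top G D m = topology_generated_by
     {{b \<in> SC G D m. SC_dist G a b < ennreal e} | a e. a \<in> SC G D m \<and> e > 0}"

definition borel_of_top :: "'a topology \<Rightarrow> 'a measure" where
  "borel_of_top X = sigma (topspace X) {U. openin X U}"

abbreviation SC_borel :: "('g, 'm) monoid_scheme \<Rightarrow> nat \<Rightarrow> nat \<Rightarrow> 'g gclass measure" where
  "SC_borel G D m \<equiv> borel_of_top (SC_top G D m)"

section \<open>Random rooted complexes and soficity\<close>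

definition borel_prob_on_SC :: "('g, 'm) monoid_scheme \<Rightarrow> nat \<Rightarrow> 'g gclass measure \<Rightarrow> bool" where
  "borel_prob_on_SC G D \<mu> \<longleftrightarrow> prob_space \<mu> \<and> sets \<mu> = sets (SC_borel G D 1)"

definition some_rep :: "'g gclass \<Rightarrow> ('g, nat) gcomplex" where
  "some_rep a = (SOME A. A \<in> a)"

text \<open>
  Since \<open>G\<close> permutes the components transitively, every orbit meets every component as soon as one
  does, so the birooted classes below are points of \<^term>\<open>SC G D 2\<close>.
\<close>

definition unimodular :: "('g, 'm) monoid_scheme \<Rightarrow> nat \<Rightarrow> 'g gclass measure \<Rightarrow> bool" where
  "unimodular G D \<mu> \<longleftrightarrow>
     (\<forall>f :: 'g gclass \<Rightarrow> real. f \<in> borel_measurable (SC_borel G D 2) \<and> (\<forall>b. 0 \<le> f b) \<longrightarrow>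
       (\<integral>\<^sup>+ a. (let A = some_rep a in \<Sum>\<^sub>\<infinity>x\<in>verts (simps A).
            ennreal (f (cls G D 2 (A\<lparr>roots := roots A @ [orbit G (action A) x]\<rparr>)))) \<partial>\<mu>)
       = (\<integral>\<^sup>+ a. (let A = some_rep a in \<Sum>\<^sub>\<infinity>x\<in>verts (simps A).
            ennreal (f (cls G D 2 (A\<lparr>roots := [orbit G (action A) x] @ roots A\<rparr>)))) \<partial>\<mu>))"

definition random_rooted_gcx :: "('g, 'm) monoid_scheme \<Rightarrow> nat \<Rightarrow> 'g gclass measure \<Rightarrow> bool" where
  "random_rooted_gcx G D \<mu> \<longleftrightarrow> borel_prob_on_SC G D \<mu> \<and> unimodular G D \<mu>"

definition weakly_converges ::
    "('g, 'm) monoid_scheme \<Rightarrow> nat \<Rightarrow> (nat \<Rightarrow> 'g gclass measure) \<Rightarrow> 'g gclass measure \<Rightarrow> bool" where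
  "weakly_converges G D M N \<longleftrightarrow>
     (\<forall>k. borel_prob_on_SC G D (M k)) \<and> borel_prob_on_SC G D N \<and>
     (\<forall>f. continuous_map (SC_top G D 1) euclideanreal f \<and> bounded (f ` topspace (SC_top G D 1)) \<longrightarrow>
        (\<lambda>k. \<integral>a. f a \<partial>M k) \<longlonglongrightarrow> (\<integral>a. f a \<partial>N))"

definition rooted_component ::
    "('g, 'm) monoid_scheme \<Rightarrow> ('g, 'v) gcomplex \<Rightarrow> 'v \<Rightarrow> ('g, 'v) gcomplex" where
  "rooted_component G A x =
     (let W = orbit G (action A) x
      in (full_sub A {v. \<exists>u\<in>W. (u, v) \<in> (adj (simps A))\<^sup>*})\<lparr>roots := [W]\<rparr>)"

text \<open>The average of the Dirac measures at \<open>[K, Gx]\<close> is the push-forward of the uniform measure.\<close>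

definition finite_cx_measure ::
    "('g, 'm) monoid_scheme \<Rightarrow> nat \<Rightarrow> ('g, nat) gcomplex \<Rightarrow> 'g gclass measure" where
  "finite_cx_measure G D A =
     distr (uniform_count_measure (verts (simps A))) (SC_borel G D 1)
       (\<lambda>x. cls G D 1 (rooted_component G A x))"

definition sofic :: "('g, 'm) monoid_scheme \<Rightarrow> nat \<Rightarrow> 'g gclass measure \<Rightarrow> bool" where
  "sofic G D \<mu> \<longleftrightarrow>
     (\<exists>K :: nat \<Rightarrow> ('g, nat) gcomplex.
        (\<forall>j. simplicial_gcx G D (K j) \<and> finite (simps (K j))) \<and>
        weakly_converges G D (\<lambda>j. finite_cx_measure G D (K j)) \<mu>)"

section \<open>The universal complex and the realization map\<close>

text \<open>Transitive \<open>G\<close>-sets are finite, so up to isomorphism their points may be taken in \<^typ>\<open>nat\<close>.\<close>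

type_synonym 'g gset = "nat set \<times> ('g \<Rightarrow> nat \<Rightarrow> nat)"

definition transitive_gsets :: "('g, 'm) monoid_scheme \<Rightarrow> 'g gset set" where
  "transitive_gsets G = {(X, \<phi>). X \<noteq> {} \<and> transitive_action G X \<phi>}"

definition gset_iso_rel :: "('g, 'm) monoid_scheme \<Rightarrow> ('g gset \<times> 'g gset) set" where
  "gset_iso_rel G = {((X, \<phi>), (Y, \<psi>)).
     (X, \<phi>) \<in> transitive_gsets G \<and> (Y, \<psi>) \<in> transitive_gsets G \<and>
     (\<exists>f. bij_betw f X Y \<and> (\<forall>g\<in>carrier G. \<forall>x\<in>X. f (\<phi> g x) = \<psi> g (f x)))}"

definition Orb :: "('g, 'm) monoid_scheme \<Rightarrow> 'g gset set set" where
  "Orb G = transitive_gsets G // gset_iso_rel G"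

definition orb_pts :: "'g gset set \<Rightarrow> nat set" where
  "orb_pts c = fst (SOME X. X \<in> c)"

definition orb_act :: "'g gset set \<Rightarrow> 'g \<Rightarrow> nat \<Rightarrow> nat" where
  "orb_act c = snd (SOME X. X \<in> c)"

text \<open>A vertex \<open>(c, k, x)\<close> is the point \<open>(k, x)\<close> of the summand of \<open>\<nat>\<^sub>G\<close> indexed by \<open>c\<close>.\<close>

type_synonym 'g nvert = "'g gset set \<times> nat \<times> nat"

definition NG :: "('g, 'm) monoid_scheme \<Rightarrow> 'g nvert set" where
  "NG G = {(c, k, x). c \<in> Orb G \<and> x \<in> orb_pts c}"

definition NG_act :: "'g \<Rightarrow> 'g nvert \<Rightarrow> 'g nvert" where
  "NG_act g = (\<lambda>(c, k, x). (c, k, orb_act c g x))"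

definition zero_orbit :: "'g gset set \<Rightarrow> 'g nvert set" where
  "zero_orbit c = {(c, 0, x) | x. x \<in> orb_pts c}"

definition Delta :: "('g, 'm) monoid_scheme \<Rightarrow> nat \<Rightarrow> 'g nvert set set" where
  "Delta G D = {s. s \<noteq> {} \<and> s \<subseteq> NG G \<and> finite s \<and> card s \<le> D + 1}"

definition Sub :: "('g, 'm) monoid_scheme \<Rightarrow> nat \<Rightarrow> 'g nvert set set set" where
  "Sub G D = {S. S \<subseteq> Delta G D \<and> simplicial_cx S \<and>
     (\<forall>g\<in>carrier G. \<forall>s\<in>S. NG_act g ` s \<in> S) \<and>
     (\<exists>!c. c \<in> Orb G \<and> zero_orbit c \<subseteq> verts S)}"

text \<open>Subspace topology inherited from \<open>{0,1}\<^bsup>Delta\<^esup>\<close> via indicator functions.\<close>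

definition Sub_top :: "('g, 'm) monoid_scheme \<Rightarrow> nat \<Rightarrow> 'g nvert set set topology" where
  "Sub_top G D = pullback_topology (Sub G D) (\<lambda>S. restrict (\<lambda>s. s \<in> S) (Delta G D))
     (product_topology (\<lambda>_. discrete_topology (UNIV :: bool set)) (Delta G D))"

definition sub_gcx :: "'g nvert set set \<Rightarrow> 'g gset set \<Rightarrow> ('g, 'g nvert) gcomplex" where
  "sub_gcx S c = \<lparr>simps = S, action = (\<lambda>g. restrict (NG_act g) (verts S)), roots = [zero_orbit c]\<rparr>"

text \<open>The isomorphism of the root orbits makes \<open>c\<close> the isomorphism type of \<open>o\<close>.\<close>

definition realization_map ::
    "('g, 'm) monoid_scheme \<Rightarrow> nat \<Rightarrow> ('g gclass \<Rightarrow> 'g nvert set set) \<Rightarrow> bool" where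
  "realization_map G D \<Psi> \<longleftrightarrow>
     continuous_map (SC_top G D 1) (Sub_top G D) \<Psi> \<and>
     (\<forall>a\<in>SC G D 1. \<forall>A\<in>a. \<exists>c\<in>Orb G. gcx_iso G A (sub_gcx (\<Psi> a) c))"

section \<open>Square-summable oriented chains\<close>

text \<open>
  An ordered simplex is a list of distinct vertices; a chain is an alternating function of ordered
  simplices, so that no orientations need to be chosen and its value at a list \<open>l\<close> is the
  coefficient of the simplex oriented by \<open>l\<close>.
\<close>

type_synonym 'v chain = "'v list \<Rightarrow> complex"

definition orient :: "'v set \<Rightarrow> 'v list" where
  "orient s = (SOME l. distinct l \<and> set l = s)"

definition elem_chain :: "'v list \<Rightarrow> 'v chain" where
  "elem_chain l = (\<lambda>u. \<Sum>p | p permutes {..<length l} \<and> u = permute_list p l. of_int (sign p))"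

definition chains2 :: "'v set set \<Rightarrow> nat \<Rightarrow> 'v chain set" where
  "chains2 L n = {c.
     (\<forall>l. c l \<noteq> 0 \<longrightarrow> distinct l \<and> length l = n + 1 \<and> set l \<in> L) \<and>
     (\<forall>l p. p permutes {..<length l} \<longrightarrow> c (permute_list p l) = of_int (sign p) * c l) \<and>
     (\<lambda>s. (cmod (c (orient s)))\<^sup>2) summable_on L}"

definition chain_inner :: "'v set set \<Rightarrow> 'v chain \<Rightarrow> 'v chain \<Rightarrow> complex" where
  "chain_inner L a b = (\<Sum>\<^sub>\<infinity>s\<in>L. a (orient s) * cnj (b (orient s)))"

text \<open>Extension of a map on ordered simplices to chains by (infinite) linearity.\<close>

definition lin_ext :: "'v set set \<Rightarrow> ('v list \<Rightarrow> 'w chain) \<Rightarrow> 'v chain \<Rightarrow> 'w chain" where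
  "lin_ext L F c = (\<lambda>u. \<Sum>\<^sub>\<infinity>s\<in>L. c (orient s) * F (orient s) u)"

definition simplex_boundary :: "'v list \<Rightarrow> 'v chain" where
  "simplex_boundary l = (\<lambda>u. \<Sum>i<length l. (-1) ^ i * elem_chain (take i l @ drop (Suc i) l) u)"

text \<open>The chain complex is not augmented: the boundary of a 0-chain is zero.\<close>

definition boundary :: "'v set set \<Rightarrow> nat \<Rightarrow> 'v chain \<Rightarrow> 'v chain" where
  "boundary L n c = (if n = 0 then (\<lambda>_. 0) else lin_ext L simplex_boundary c)"

text \<open>\<open>coboundary L n\<close> is the adjoint of \<open>boundary L n\<close>; it raises the degree to \<open>n\<close>.\<close>

definition coboundary :: "'v set set \<Rightarrow> nat \<Rightarrow> 'v chain \<Rightarrow> 'v chain" where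
  "coboundary L n c = (THE b. b \<in> chains2 L n \<and>
     (\<forall>a\<in>chains2 L n. chain_inner L b a = chain_inner L c (boundary L n a)))"

definition laplacian :: "'v set set \<Rightarrow> nat \<Rightarrow> 'v chain \<Rightarrow> 'v chain" where
  "laplacian L n c = (\<lambda>u. boundary L (n + 1) (coboundary L (n + 1) c) u
                        + coboundary L n (boundary L n c) u)"

definition push_chain :: "'v set set \<Rightarrow> ('v \<Rightarrow> 'w) \<Rightarrow> 'v chain \<Rightarrow> 'w chain" where
  "push_chain L \<phi> = lin_ext L (\<lambda>l. elem_chain (map \<phi> l))"

section \<open>The direct integral\<close>

text \<open>
  Elements of the direct integral are represented by square-integrable measurable sections. Sections
  that agree almost everywhere are not identified; all notions below are insensitive to null sets.
\<close>

type_synonym 'g csection = "'g gclass \<Rightarrow> 'g nvert chain"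

definition xi :: "('g gclass \<Rightarrow> 'g nvert set set) \<Rightarrow> 'g nvert list \<Rightarrow> 'g csection" where
  "xi \<Psi> l = (\<lambda>a. if set l \<in> \<Psi> a then elem_chain l else (\<lambda>_. 0))"

definition dint_chains ::
    "('g, 'm) monoid_scheme \<Rightarrow> nat \<Rightarrow> ('g gclass \<Rightarrow> 'g nvert set set) \<Rightarrow> nat \<Rightarrow>
     'g gclass measure \<Rightarrow> 'g csection set" where
  "dint_chains G D \<Psi> n \<mu> = {\<sigma>.
     (\<forall>a\<in>space \<mu>. \<sigma> a \<in> chains2 (\<Psi> a) n) \<and>
     (\<forall>s\<in>Delta G D. card s = n + 1 \<longrightarrow>
        (\<lambda>a. chain_inner (\<Psi> a) (\<sigma> a) (xi \<Psi> (orient s) a)) \<in> borel_measurable \<mu>) \<and>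
     integrable \<mu> (\<lambda>a. chain_inner (\<Psi> a) (\<sigma> a) (\<sigma> a))}"

definition dint_inner ::
    "('g gclass \<Rightarrow> 'g nvert set set) \<Rightarrow> 'g gclass measure \<Rightarrow> 'g csection \<Rightarrow> 'g csection \<Rightarrow> complex" where
  "dint_inner \<Psi> \<mu> \<sigma> \<tau> = (\<integral>a. chain_inner (\<Psi> a) (\<sigma> a) (\<tau> a) \<partial>\<mu>)"

definition l2_homology ::
    "('g, 'm) monoid_scheme \<Rightarrow> nat \<Rightarrow> ('g gclass \<Rightarrow> 'g nvert set set) \<Rightarrow> nat \<Rightarrow>
     'g gclass measure \<Rightarrow> 'g csection set" where
  "l2_homology G D \<Psi> n \<mu> =
     {\<sigma> \<in> dint_chains G D \<Psi> n \<mu>. AE a in \<mu>. laplacian (\<Psi> a) n (\<sigma> a) = (\<lambda>_. 0)}"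

text \<open>Orthogonal projection onto a closed subspace of sections, determined up to null sets.\<close>

definition pr ::
    "('g gclass \<Rightarrow> 'g nvert set set) \<Rightarrow> 'g gclass measure \<Rightarrow> 'g csection set \<Rightarrow>
     'g csection \<Rightarrow> 'g csection" where
  "pr \<Psi> \<mu> K \<sigma> = (SOME \<tau>. \<tau> \<in> K \<and> (\<forall>\<kappa>\<in>K. dint_inner \<Psi> \<mu> (\<lambda>a u. \<sigma> a u - \<tau> a u) \<kappa> = 0))"

definition vn_trace ::
    "('g, 'm) monoid_scheme \<Rightarrow> nat \<Rightarrow> ('g gclass \<Rightarrow> 'g nvert set set) \<Rightarrow> nat \<Rightarrow>
     'g gclass measure \<Rightarrow> ('g csection \<Rightarrow> 'g csection) \<Rightarrow> complex" where
  "vn_trace G D \<Psi> n \<mu> T =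
     (\<Sum>c\<in>Orb G. \<Sum>x\<in>orb_pts c.
        \<Sum>\<^sub>\<infinity>s\<in>{s \<in> Delta G D. card s = n + 1 \<and> (c, 0, x) \<in> s}.
          dint_inner \<Psi> \<mu> (T (xi \<Psi> (orient s))) (xi \<Psi> (orient s))
            / of_nat (card (orb_pts c) * (n + 1)))"

definition dim_vN ::
    "('g, 'm) monoid_scheme \<Rightarrow> nat \<Rightarrow> ('g gclass \<Rightarrow> 'g nvert set set) \<Rightarrow> nat \<Rightarrow>
     'g gclass measure \<Rightarrow> 'g csection set \<Rightarrow> complex" where
  "dim_vN G D \<Psi> n \<mu> K = vn_trace G D \<Psi> n \<mu> (pr \<Psi> \<mu> K)"

section \<open>Irreducible representations and multiplicities\<close>

definition irreducible_rep :: "('g, 'm) monoid_scheme \<Rightarrow> ('g \<Rightarrow> complex^'d^'d) \<Rightarrow> bool" where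
  "irreducible_rep G \<rho> \<longleftrightarrow>
     \<rho> \<one>\<^bsub>G\<^esub> = mat 1 \<and>
     (\<forall>g\<in>carrier G. \<forall>h\<in>carrier G. \<rho> (g \<otimes>\<^bsub>G\<^esub> h) = \<rho> g ** \<rho> h) \<and>
     (\<forall>W. vec.subspace W \<and> (\<forall>g\<in>carrier G. \<forall>w\<in>W. \<rho> g *v w \<in> W) \<longrightarrow> W = {0} \<or> W = UNIV)"

definition character :: "('g \<Rightarrow> complex^'d^'d) \<Rightarrow> 'g \<Rightarrow> complex" where
  "character \<rho> g = trace (\<rho> g)"

definition isotypic_proj ::
    "('g, 'm) monoid_scheme \<Rightarrow> ('g gclass \<Rightarrow> 'g nvert set set) \<Rightarrow> ('g \<Rightarrow> complex^'d^'d) \<Rightarrow>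
     'g csection \<Rightarrow> 'g csection" where
  "isotypic_proj G \<Psi> \<rho> \<sigma> = (\<lambda>a u.
     character \<rho> \<one>\<^bsub>G\<^esub> / of_nat (card (carrier G)) *
     (\<Sum>g\<in>carrier G. cnj (character \<rho> g) * push_chain (\<Psi> a) (NG_act g) (\<sigma> a) u))"

definition l2_multiplicity ::
    "('g, 'm) monoid_scheme \<Rightarrow> nat \<Rightarrow> ('g gclass \<Rightarrow> 'g nvert set set) \<Rightarrow> nat \<Rightarrow>
     ('g \<Rightarrow> complex^'d^'d) \<Rightarrow> 'g gclass measure \<Rightarrow> complex" where
  "l2_multiplicity G D \<Psi> n \<rho> \<mu> =
     1 / character \<rho> \<one>\<^bsub>G\<^esub> *
     dim_vN G D \<Psi> n \<mu> (isotypic_proj G \<Psi> \<rho> ` l2_homology G D \<Psi> n \<mu>)"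

end

theory Submission
  imports Defs "Jordan_Normal_Form.Schur_Decomposition" "Jordan_Normal_Form.Spectral_Radius"
begin

text \<open>
  The multiplicity is the limit for \<open>m \<rightarrow> \<infinity>\<close> of the integrals of the local traces of
  \<open>P\<^sub>\<rho> T\<^sup>m\<close>, where \<open>T = 1 - \<Delta>/c\<close> is a positive contraction with fixed space \<open>ker \<Delta>\<close>. For fixed \<open>m\<close>
  the local trace depends only on the ball of radius \<open>m + 1\<close> around the root orbit, so its integral
  is weakly continuous in the measure. It remains to see that the limit \<open>m \<rightarrow> \<infinity>\<close> is uniform over
  sofic measures, and here Lueck's argument applies: on a finite complex with \<open>N\<close> simplices, \<open>\<Delta>\<close> is an
  integral matrix, so its nonzero eigenvalues have product at least 1, and at most
  \<open>N ln c / ln (1/\<epsilon>)\<close> of them are small relative to \<open>\<epsilon>\<close>. This bound is independent of the complex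
  after normalization and survives weak limits. Since a positive kernel satisfies
  \<open>2 |A(s, t)| \<le> A(s, s) + A(t, t)\<close>, the estimate for the full trace also controls the traces
  twisted by group elements; in particular, no integrality of the character is needed.
\<close>


section \<open>Signs of ordered simplices\<close>

hide_const (open) Matrix.vec Matrix.mat
no_notation Matrix.vec_index (infixl "$" 100)

text \<open>The constant \<open>c\<close> is \<open>lapl_bound D\<close>, that is 2 D (D + 1): a row
  of the incidence matrix has at most \<open>D\<close> nonzero entries, a column at most
  \<open>D + 1\<close>, all of modulus 1. It depends on \<open>D\<close> alone, so one polynomial in
  the Laplacian serves every complex of the given degree and local traces of different complexes can
  be compared. Powers of \<open>T\<close> combine two features: each factor propagates by one step
  only, and the forms \<langle>T^m f, f\<rangle> decrease in \<open>m\<close>, which makes T^m f a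
  Cauchy sequence with limit the harmonic projection of f. The estimates concern functions of
  unordered simplices, whereas chains are alternating functions of ordered ones. The translation
  fixes an arbitrary orientation of each simplex, which vertex maps respect only up to a sign; these
  signs obey a cocycle rule and cancel in traces. The eigenvalue count dictates the order of the
  choices at the end: first \<epsilon> with ln c / ln (1/\<epsilon>) small, then \<open>m\<close>
  with (1 - \<epsilon>)^m small, and neither choice sees the complex.\<close>

lemma elem_chain_permute:
  assumes "distinct l" "q permutes {..<length l}"
  shows "elem_chain l (permute_list q l) = of_int (sign q)"
proof -
  have "{p. p permutes {..<length l} \<and> permute_list q l = permute_list p l} = {q}"
  proof safe
    fix p x assume p: "p permutes {..<length l}" and eq: "permute_list q l = permute_list p l"
    have "p i = q i" for i
    proof (cases "i < length l")
      case True
      with eq p assms(2) have "l ! p i = l ! q i"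
        by (metis permute_list_nth)
      moreover have "p i < length l" "q i < length l"
        using True p assms(2) by (metis lessThan_iff permutes_in_image)+
      ultimately show ?thesis using assms(1) nth_eq_iff_index_eq by blast
    next
      case False
      then show ?thesis using p assms(2) by (simp add: permutes_def)
    qed
    then show "p = q" by auto
  qed (use assms in auto)
  then show ?thesis unfolding elem_chain_def by simp
qed

lemma elem_chain_eq_0: "mset u \<noteq> mset l \<Longrightarrow> elem_chain l u = 0"
  unfolding elem_chain_def by (rule sum.neutral) (auto simp: mset_permute_list)

lemma mset_eq_permute:
  assumes "mset u = mset l"
  obtains p where "p permutes {..<length l}" "u = permute_list p l"
  using mset_eq_permutation[OF assms] by metis

lemma elem_chain_cases:
  assumes "distinct l"
  shows "elem_chain l u \<in> {-1, 0, 1}"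
proof (cases "mset u = mset l")
  case True
  then obtain p where "p permutes {..<length l}" "u = permute_list p l" by (rule mset_eq_permute)
  then show ?thesis using elem_chain_permute[OF assms] by (auto simp: sign_def)
qed (simp add: elem_chain_eq_0)

lemma elem_chain_nonzero:
  assumes "distinct l" "distinct u" "set u = set l"
  shows "elem_chain l u \<in> {-1, 1}"
proof -
  have "mset u = mset l" using assms set_eq_iff_mset_eq_distinct by blast
  then obtain p where "p permutes {..<length l}" "u = permute_list p l" by (rule mset_eq_permute)
  then show ?thesis using elem_chain_permute[OF assms(1)] by (auto simp: sign_def)
qed

lemma elem_chain_same [simp]: "distinct l \<Longrightarrow> elem_chain l l = 1"
  using elem_chain_permute[of l id] by (simp add: permutes_id)

lemma elem_chain_nonzeroD:
  assumes "distinct l" "elem_chain l u \<noteq> 0"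
  shows "distinct u" "set u = set l" "length u = length l"
proof -
  have "mset u = mset l" using assms(2) elem_chain_eq_0 by blast
  then show "distinct u" "set u = set l" "length u = length l"
    using assms(1) mset_eq_imp_distinct_iff mset_eq_setD mset_eq_length by metis+
qed

text \<open>Multiplicativity of \<open>sign\<close> turns orientations into a cocycle. Later changes
  of orientation reduce to this rule.\<close>

lemma elem_chain_trans:
  assumes "distinct l" "distinct u" "set u = set l"
  shows "elem_chain l u * elem_chain u w = elem_chain l w"
proof -
  have mu: "mset u = mset l" using assms set_eq_iff_mset_eq_distinct by blast
  then obtain p where p: "p permutes {..<length l}" "u = permute_list p l" by (rule mset_eq_permute)
  show ?thesis
  proof (cases "mset w = mset u")
    case True
    then obtain q where q: "q permutes {..<length u}" "w = permute_list q u" by (rule mset_eq_permute)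
    have len: "length u = length l" using p by simp
    have w: "w = permute_list (p \<circ> q) l"
      using q p len by (simp add: permute_list_compose)
    have "sign (p \<circ> q) = sign p * sign q"
      using p(1) q(1) len by (intro sign_compose) (auto simp: permutation_permutes)
    moreover have "(p \<circ> q) permutes {..<length l}"
      using p(1) q(1) len by (simp add: permutes_compose)
    ultimately show ?thesis
      using elem_chain_permute[OF assms(1) p(1)] elem_chain_permute[OF assms(2) q(1)]
        elem_chain_permute[OF assms(1), of "p \<circ> q"] by (simp add: w[symmetric] q(2)[symmetric] p(2)[symmetric])
  next
    case False
    then show ?thesis using mu by (simp add: elem_chain_eq_0)
  qed
qed

lemma elem_chain_sym:
  assumes "distinct l" "distinct u"
  shows "elem_chain l u = elem_chain u l"
proof (cases "set u = set l")
  case True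
  have "elem_chain l u * elem_chain u l = 1" using elem_chain_trans[OF assms True, of l] assms by simp
  moreover have "elem_chain l u \<in> {-1,1}" by (rule elem_chain_nonzero) (use assms True in auto)
  moreover have "elem_chain u l \<in> {-1,1}" by (rule elem_chain_nonzero) (use assms True in auto)
  ultimately show ?thesis by auto
next
  case False
  then show ?thesis using elem_chain_nonzeroD(2) assms by metis
qed

lemma elem_chain_map:
  assumes "distinct l" "inj_on f (set l \<union> set u)"
  shows "elem_chain (map f l) (map f u) = elem_chain l u"
proof (cases "mset u = mset l")
  case True
  then obtain p where p: "p permutes {..<length l}" "u = permute_list p l" by (rule mset_eq_permute)
  have "map f u = permute_list p (map f l)" using p by (simp add: permute_list_map)
  moreover have "distinct (map f l)" using assms by (simp add: distinct_map inj_on_Un)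
  ultimately show ?thesis
    using p elem_chain_permute[of l p] elem_chain_permute[of "map f l" p] assms(1) by simp
next
  case False
  have "mset (map f u) \<noteq> mset (map f l)"
  proof
    assume "mset (map f u) = mset (map f l)"
    moreover have "distinct (map f l)" using assms by (simp add: distinct_map inj_on_Un)
    ultimately have "distinct (map f u)" "f ` set u = f ` set l"
      by (metis mset_eq_imp_distinct_iff, metis mset_eq_setD set_map)
    then have "distinct u" "set u = set l"
      using assms(2) inj_on_Un_image_eq_iff[of f "set u" "set l"] by (auto simp: distinct_map Un_commute)
    then have "mset u = mset l" using assms(1) set_eq_iff_mset_eq_distinct by blast
    then show False using False by simp
  qed
  then show ?thesis using False by (simp add: elem_chain_eq_0)
qed

text \<open>Moving entry \<open>i\<close> to the front passes \<open>i\<close> other entries, which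
  costs the sign \<open>(-1) ^ i\<close>. In terms of permutations,
  \<open>permutation_insert 0 i p\<close> sends 0 to \<open>i\<close> and follows \<open>p\<close>
  on the remaining positions.\<close>

lemma elem_chain_remove_nth:
  assumes "distinct l" "i < length l"
  shows "elem_chain l (l ! i # u) = (-1) ^ i * elem_chain (take i l @ drop (Suc i) l) u"
proof -
  define l' where "l' = take i l @ drop (Suc i) l"
  obtain n where n: "length l = Suc n" using assms(2) by (cases "length l") auto
  have len: "length l' = n" using n assms(2) by (simp add: l'_def)
  have l'nth: "l' ! j = (if j < i then l ! j else l ! Suc j)" if "j < n" for j
    using that n assms(2) by (auto simp: l'_def nth_append)
  have ms: "mset l = add_mset (l ! i) (mset l')"
    using assms(2) by (metis add_mset_add_single append_take_drop_id Cons_nth_drop_Suc l'_def mset.simps(2) mset_append union_mset_add_mset_right)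
  have dl': "distinct l'" using assms unfolding l'_def
    by (metis append_take_drop_id Cons_nth_drop_Suc distinct_append distinct.simps(2) disjoint_insert(1) list.set(2))
  show ?thesis
  proof (cases "mset u = mset l'")
    case True
    then obtain p where p: "p permutes {..<n}" "u = permute_list p l'"
      using mset_eq_permute[of u l'] len by metis
    define q where "q = permutation_insert 0 i p"
    have q: "q permutes {..<Suc n}"
      using permutation_insert_permutes[of p n 0 i] p(1) assms(2) n
      by (simp add: q_def atLeast0LessThan)
    have sq: "signof q = ((-1) ^ i * signof p :: complex)"
      using signof_permutation_insert[of p n 0 i] p(1) assms(2) n
      by (simp add: q_def atLeast0LessThan)
    have "l ! i # u = permute_list q l"
    proof (rule nth_equalityI)
      show "length (l ! i # u) = length (permute_list q l)" using n len p(2) by simp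
      fix k assume k: "k < length (l ! i # u)"
      then have kn: "k < Suc n" using len p(2) by simp
      show "(l ! i # u) ! k = permute_list q l ! k"
      proof (cases k)
        case 0
        then show ?thesis using n q by (simp add: permute_list_nth q_def)
      next
        case (Suc j)
        then have j: "j < n" using kn by simp
        then have pj: "p j < n" using p(1) by (metis lessThan_iff permutes_in_image)
        have "q (Suc j) = (if p j < i then p j else Suc (p j))"
          by (simp add: q_def permutation_insert_expand)
        then show ?thesis using j pj n q p len Suc kn l'nth[OF pj] by (auto simp: permute_list_nth)
      qed
    qed
    then have "elem_chain l (l ! i # u) = of_int (sign q)"
      using elem_chain_permute[OF assms(1), of q] q n by simp
    moreover have "elem_chain l' u = of_int (sign p)"
      using elem_chain_permute[OF dl', of p] p len by simp
    ultimately show ?thesis using sq by (simp add: l'_def)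
  next
    case False
    then have "mset (l ! i # u) \<noteq> mset l" using ms by simp
    then show ?thesis using False by (simp add: elem_chain_eq_0 l'_def)
  qed
qed

section \<open>Boundaries of ordered simplices\<close>

lemma elem_chain_Cons_Cons:
  assumes "distinct (v # l)"
  shows "elem_chain (v # l) (v # u) = elem_chain l u"
  using elem_chain_remove_nth[of "v # l" 0 u] assms by simp

text \<open>A sum over vertices makes no reference to positions, so naturality and changes of
  orientation follow from the rules for \<open>elem_chain\<close>.\<close>

lemma simplex_boundary_alt:
  assumes "distinct l"
  shows "simplex_boundary l u = (\<Sum>v\<in>set l. elem_chain l (v # u))"
proof -
  have "(\<Sum>v\<in>set l. elem_chain l (v # u)) = (\<Sum>i<length l. elem_chain l (l ! i # u))"
    using bij_betw_nth[OF assms refl refl] by (intro sum.reindex_bij_betw[symmetric]) simp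
  then show ?thesis
    using assms by (simp add: simplex_boundary_def elem_chain_remove_nth)
qed

lemma simplex_boundary_nonzeroD:
  assumes "distinct l" "simplex_boundary l u \<noteq> 0"
  shows "distinct u" "\<exists>v. v \<notin> set u \<and> set l = insert v (set u)"
proof -
  obtain v where "elem_chain l (v # u) \<noteq> 0"
    using assms by (metis simplex_boundary_alt sum.neutral)
  from elem_chain_nonzeroD[OF assms(1) this]
  show "distinct u" "\<exists>v. v \<notin> set u \<and> set l = insert v (set u)" by auto
qed

text \<open>For every other vertex \<open>w\<close> of \<open>l\<close> the list
  \<open>w # u\<close> has a repetition, so the sum over vertices collapses to one term.\<close>

lemma simplex_boundary_eq:
  assumes "distinct l" "v \<notin> set u" "set l = insert v (set u)"
  shows "simplex_boundary l u = elem_chain l (v # u)"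
proof -
  have "elem_chain l (w # u) = 0" if "w \<in> set l - {v}" for w
    using that assms elem_chain_nonzeroD(1)[OF assms(1), of "w # u"] by auto
  then show ?thesis
    unfolding simplex_boundary_alt[OF assms(1)] using assms(3)
    by (subst sum.remove[of _ v]) (auto intro!: sum.neutral)
qed

lemma simplex_boundary_cases:
  assumes "distinct l"
  shows "simplex_boundary l u \<in> {-1, 0, 1}"
proof (cases "simplex_boundary l u = 0")
  case False
  then show ?thesis
    using simplex_boundary_nonzeroD[OF assms False] simplex_boundary_eq[OF assms] elem_chain_cases[OF assms]
    by metis
qed simp

lemma simplex_boundary_reorder_left:
  assumes "distinct l" "distinct l'" "set l' = set l"
  shows "simplex_boundary l' u = elem_chain l' l * simplex_boundary l u"
  using elem_chain_trans[of l' l] assms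
  by (simp add: simplex_boundary_alt sum_distrib_left)

text \<open>Prepending a common vertex leaves the relative sign of \<open>u\<close> and
  \<open>u'\<close> unchanged. A vertex that does not complete \<open>u\<close> to \<open>l\<close>
  contributes 0 on both sides.\<close>

lemma simplex_boundary_reorder_right:
  assumes "distinct l" "distinct u" "distinct u'" "set u' = set u"
  shows "simplex_boundary l u' = simplex_boundary l u * elem_chain u u'"
proof -
  have "elem_chain l (v # u') = elem_chain l (v # u) * elem_chain u u'" if "v \<in> set l" for v
  proof (cases "v \<notin> set u \<and> set l = insert v (set u)")
    case True
    then have "elem_chain l (v # u) * elem_chain (v # u) (v # u') = elem_chain l (v # u')"
      using assms by (intro elem_chain_trans) auto
    then show ?thesis using elem_chain_Cons_Cons[of v u u'] True assms by simp
  next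
    case False
    then have "elem_chain l (v # u) = 0" "elem_chain l (v # u') = 0"
      using elem_chain_nonzeroD[OF assms(1), of "v # u"] elem_chain_nonzeroD[OF assms(1), of "v # u'"] assms
      by auto
    then show ?thesis by simp
  qed
  then show ?thesis using assms by (simp add: simplex_boundary_alt sum_distrib_right)
qed

lemma simplex_boundary_map:
  assumes "distinct l" "inj_on f (set l \<union> set u)"
  shows "simplex_boundary (map f l) (map f u) = simplex_boundary l u"
proof -
  have d: "distinct (map f l)" using assms by (simp add: distinct_map inj_on_Un)
  have "(\<Sum>v\<in>f ` set l. elem_chain (map f l) (v # map f u)) = (\<Sum>v\<in>set l. elem_chain (map f l) (f v # map f u))"
    using assms(2) by (subst sum.reindex) (auto simp: inj_on_Un)
  also have "\<dots> = (\<Sum>v\<in>set l. elem_chain l (v # u))"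
  proof (rule sum.cong[OF refl])
    fix v assume "v \<in> set l"
    then have "inj_on f (set l \<union> set (v # u))" using assms(2) by (simp add: insert_absorb)
    then show "elem_chain (map f l) (f v # map f u) = elem_chain l (v # u)"
      using elem_chain_map[OF assms(1), of f "v # u"] by simp
  qed
  finally show ?thesis using assms(1) d by (simp add: simplex_boundary_alt)
qed

lemma elem_chain_permute_right:
  assumes "distinct l" "p permutes {..<length u}"
  shows "elem_chain l (permute_list p u) = of_int (sign p) * elem_chain l u"
proof (cases "mset u = mset l")
  case True
  then have "distinct u" "set u = set l"
    using assms(1) mset_eq_imp_distinct_iff mset_eq_setD by metis+
  from elem_chain_trans[OF assms(1) this, of "permute_list p u"] elem_chain_permute[OF \<open>distinct u\<close> assms(2)]
  show ?thesis by (simp add: mult.commute)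
next
  case False
  moreover have "mset (permute_list p u) = mset u" using assms(2) by (rule mset_permute_list)
  ultimately show ?thesis by (simp add: elem_chain_eq_0)
qed

lemma orient:
  assumes "finite s"
  shows "distinct (orient s)" "set (orient s) = s" "length (orient s) = card s"
proof -
  have "\<exists>l. distinct l \<and> set l = s" using finite_distinct_list[OF assms] by auto
  then have *: "distinct (orient s) \<and> set (orient s) = s" unfolding orient_def by (rule someI_ex)
  then show "distinct (orient s)" "set (orient s) = s" by auto
  then show "length (orient s) = card s" using distinct_card by metis
qed

section \<open>Square-summable functions and banded kernels\<close>

text \<open>Functions live on the whole index type and vanish outside the complex in question.
  Operators that belong to different complexes then act on one common space and can be compared
  there.\<close>

definition ell2 :: "('i \<Rightarrow> complex) \<Rightarrow> bool" where
  "ell2 f \<longleftrightarrow> (\<lambda>i. (cmod (f i))\<^sup>2) summable_on UNIV"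

definition norm2 :: "('i \<Rightarrow> complex) \<Rightarrow> real" where
  "norm2 f = (\<Sum>\<^sub>\<infinity>i. (cmod (f i))\<^sup>2)"

definition ell2_inner :: "('i \<Rightarrow> complex) \<Rightarrow> ('i \<Rightarrow> complex) \<Rightarrow> complex" where
  "ell2_inner f g = (\<Sum>\<^sub>\<infinity>i. f i * cnj (g i))"

lemma norm2_nonneg [simp]: "0 \<le> norm2 f"
  unfolding norm2_def by (rule infsum_nonneg) simp

lemma sum_le_norm2: "ell2 f \<Longrightarrow> finite F \<Longrightarrow> (\<Sum>i\<in>F. (cmod (f i))\<^sup>2) \<le> norm2 f"
  unfolding norm2_def ell2_def by (rule finite_sum_le_infsum) auto

lemma ell2_bounded:
  assumes "\<And>F. finite F \<Longrightarrow> (\<Sum>i\<in>F. (cmod (f i))\<^sup>2) \<le> B"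
  shows "ell2 f" "norm2 f \<le> B"
proof -
  show "ell2 f" unfolding ell2_def
    by (rule nonneg_bdd_above_summable_on) (use assms in \<open>auto intro!: bdd_aboveI\<close>)
  then show "norm2 f \<le> B" unfolding norm2_def ell2_def
    by (rule infsum_le_finite_sums) (use assms in auto)
qed

lemma entry_le_norm2: "ell2 f \<Longrightarrow> (cmod (f i))\<^sup>2 \<le> norm2 f"
  using sum_le_norm2[of f "{i}"] by simp

lemma norm2_eq_0: "ell2 f \<Longrightarrow> norm2 f = 0 \<Longrightarrow> f = (\<lambda>_. 0)"
  using entry_le_norm2 by fastforce

lemma sum_inner_le:
  assumes "ell2 f" "ell2 g" "finite F"
  shows "(\<Sum>i\<in>F. cmod (f i * cnj (g i))) \<le> sqrt (norm2 f) * sqrt (norm2 g)"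
proof -
  have "(\<Sum>i\<in>F. cmod (f i * cnj (g i))) \<le> L2_set (\<lambda>i. cmod (f i)) F * L2_set (\<lambda>i. cmod (g i)) F"
    using L2_set_mult_ineq[of "\<lambda>i. cmod (f i)" "\<lambda>i. cmod (g i)" F] by (simp add: norm_mult)
  also have "\<dots> \<le> sqrt (norm2 f) * sqrt (norm2 g)"
    unfolding L2_set_def
    by (intro mult_mono real_sqrt_le_mono sum_le_norm2 assms) (auto intro: sum_nonneg)
  finally show ?thesis .
qed

lemma ell2_inner_summable:
  assumes "ell2 f" "ell2 g"
  shows "(\<lambda>i. cmod (f i * cnj (g i))) summable_on UNIV"
  by (rule nonneg_bdd_above_summable_on) (use sum_inner_le[OF assms] in \<open>auto intro!: bdd_aboveI\<close>)

lemma ell2_inner_summable': "ell2 f \<Longrightarrow> ell2 g \<Longrightarrow> (\<lambda>i. f i * cnj (g i)) summable_on UNIV"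
  by (rule abs_summable_summable[OF ell2_inner_summable])

lemma ell2_Cauchy_Schwarz:
  assumes "ell2 f" "ell2 g"
  shows "cmod (ell2_inner f g) \<le> sqrt (norm2 f) * sqrt (norm2 g)"
proof -
  have "cmod (ell2_inner f g) \<le> (\<Sum>\<^sub>\<infinity>i. cmod (f i * cnj (g i)))"
    unfolding ell2_inner_def by (rule norm_infsum_bound[OF ell2_inner_summable[OF assms]])
  also have "\<dots> \<le> sqrt (norm2 f) * sqrt (norm2 g)"
    by (rule infsum_le_finite_sums[OF ell2_inner_summable[OF assms]]) (rule sum_inner_le[OF assms])
  finally show ?thesis .
qed

lemma ell2_inner_cnj: "cnj (ell2_inner f g) = ell2_inner g f"
  unfolding ell2_inner_def by (simp flip: infsum_cnj add: mult.commute)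

lemma infsum_complex_of_real: "(\<Sum>\<^sub>\<infinity>i\<in>A. complex_of_real (f i)) = of_real (infsum f A)"
proof (rule infsum_bounded_linear_strong[OF _ bounded_linear_of_real])
  show "((\<lambda>i. complex_of_real (f i)) summable_on A) = (f summable_on A)"
    using summable_on_Re[of "\<lambda>i. complex_of_real (f i)" A] summable_on_of_real[of f A] by auto
qed

lemma ell2_inner_self: "ell2_inner f f = of_real (norm2 f)"
proof -
  have "ell2_inner f f = (\<Sum>\<^sub>\<infinity>i. of_real ((cmod (f i))\<^sup>2))"
    unfolding ell2_inner_def complex_norm_square ..
  then show ?thesis unfolding norm2_def infsum_complex_of_real .
qed

lemma ell2_zero [simp]: "ell2 (\<lambda>_. 0)" unfolding ell2_def by simp

lemma ell2_scale: "ell2 f \<Longrightarrow> ell2 (\<lambda>i. c * f i)"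
  unfolding ell2_def norm_mult power_mult_distrib by (rule summable_on_cmult_right)

lemma norm2_scale: "norm2 (\<lambda>i. c * f i) = (cmod c)\<^sup>2 * norm2 f"
  unfolding norm2_def norm_mult power_mult_distrib by (rule infsum_cmult_right')

lemma cmod_add_square_le: "(cmod (x + y))\<^sup>2 \<le> 2 * (cmod x)\<^sup>2 + 2 * (cmod y)\<^sup>2"
proof -
  have "(cmod (x + y))\<^sup>2 \<le> (cmod x + cmod y)\<^sup>2" by (intro power_mono norm_triangle_ineq) auto
  also have "\<dots> \<le> 2 * (cmod x)\<^sup>2 + 2 * (cmod y)\<^sup>2"
    using sum_squares_bound[of "cmod x" "cmod y"] by (simp add: power2_sum)
  finally show ?thesis .
qed

lemma norm2_add_le:
  assumes "ell2 f" "ell2 g"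
  shows "ell2 (\<lambda>i. f i + g i)" "norm2 (\<lambda>i. f i + g i) \<le> 2 * norm2 f + 2 * norm2 g"
proof -
  have "(\<Sum>i\<in>F. (cmod (f i + g i))\<^sup>2) \<le> 2 * norm2 f + 2 * norm2 g" if "finite F" for F
  proof -
    have "(\<Sum>i\<in>F. (cmod (f i + g i))\<^sup>2) \<le> (\<Sum>i\<in>F. 2 * (cmod (f i))\<^sup>2 + 2 * (cmod (g i))\<^sup>2)"
      by (intro sum_mono cmod_add_square_le)
    also have "\<dots> = 2 * (\<Sum>i\<in>F. (cmod (f i))\<^sup>2) + 2 * (\<Sum>i\<in>F. (cmod (g i))\<^sup>2)"
      by (simp add: sum.distrib sum_distrib_left)
    also have "\<dots> \<le> 2 * norm2 f + 2 * norm2 g"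
      using sum_le_norm2[OF assms(1) that] sum_le_norm2[OF assms(2) that] by simp
    finally show ?thesis .
  qed
  from ell2_bounded[OF this]
  show "ell2 (\<lambda>i. f i + g i)" "norm2 (\<lambda>i. f i + g i) \<le> 2 * norm2 f + 2 * norm2 g" by auto
qed

lemmas ell2_add = norm2_add_le(1)

lemma ell2_diff: "ell2 f \<Longrightarrow> ell2 g \<Longrightarrow> ell2 (\<lambda>i. f i - g i)"
  using ell2_add[of f "\<lambda>i. -1 * g i"] ell2_scale[of g "-1"] by simp

lemma ell2_sum: "(\<And>x. x \<in> X \<Longrightarrow> ell2 (f x)) \<Longrightarrow> ell2 (\<lambda>i. \<Sum>x\<in>X. f x i)"
  by (induction X rule: infinite_finite_induct) (auto intro: ell2_add)

lemma ell2_inner_add_left: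
  "ell2 f \<Longrightarrow> ell2 g \<Longrightarrow> ell2 h \<Longrightarrow> ell2_inner (\<lambda>i. f i + g i) h = ell2_inner f h + ell2_inner g h"
  unfolding ell2_inner_def distrib_right by (intro infsum_add ell2_inner_summable')

lemma ell2_inner_scale_left: "ell2_inner (\<lambda>i. c * f i) h = c * ell2_inner f h"
  unfolding ell2_inner_def mult.assoc by (rule infsum_cmult_right')

lemma ell2_inner_scale_right: "ell2_inner f (\<lambda>i. c * h i) = cnj c * ell2_inner f h"
  by (metis ell2_inner_cnj ell2_inner_scale_left complex_cnj_mult)

lemma ell2_inner_diff_left:
  "ell2 f \<Longrightarrow> ell2 g \<Longrightarrow> ell2 h \<Longrightarrow> ell2_inner (\<lambda>i. f i - g i) h = ell2_inner f h - ell2_inner g h"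
  using ell2_inner_add_left[of f "\<lambda>i. -1 * g i" h] ell2_scale[of g "-1"]
    ell2_inner_scale_left[of "-1" g h] by simp

lemma ell2_inner_sum_left:
  "(\<And>x. x \<in> X \<Longrightarrow> ell2 (f x)) \<Longrightarrow> ell2 h \<Longrightarrow>
    ell2_inner (\<lambda>i. \<Sum>x\<in>X. f x i) h = (\<Sum>x\<in>X. ell2_inner (f x) h)"
proof (induction X rule: infinite_finite_induct)
  case (insert x F)
  then show ?case using ell2_inner_add_left[of "f x" "\<lambda>i. \<Sum>x\<in>F. f x i" h]
    by (auto simp: ell2_sum)
qed (auto simp: ell2_inner_def)

lemma ell2_inner_sum_right:
  assumes "\<And>x. x \<in> X \<Longrightarrow> ell2 (f x)" "ell2 h"
  shows "ell2_inner h (\<lambda>i. \<Sum>x\<in>X. f x i) = (\<Sum>x\<in>X. ell2_inner h (f x))"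
  using arg_cong[where f = cnj, OF ell2_inner_sum_left[OF assms]] by (simp add: ell2_inner_cnj)

lemma ell2_inner_diff_right:
  "ell2 f \<Longrightarrow> ell2 g \<Longrightarrow> ell2 h \<Longrightarrow> ell2_inner h (\<lambda>i. f i - g i) = ell2_inner h f - ell2_inner h g"
  using arg_cong[where f = cnj, OF ell2_inner_diff_left[of f g h]] by (simp add: ell2_inner_cnj)

lemma norm2_diff:
  assumes "ell2 f" "ell2 g"
  shows "norm2 (\<lambda>i. f i - g i) = norm2 f - 2 * Re (ell2_inner f g) + norm2 g"
proof -
  have "complex_of_real (norm2 (\<lambda>i. f i - g i)) =
      ell2_inner f f - ell2_inner f g - (ell2_inner g f - ell2_inner g g)"
    unfolding ell2_inner_self[symmetric, of "\<lambda>i. f i - g i"]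
      ell2_inner_diff_left[OF assms ell2_diff[OF assms]]
      ell2_inner_diff_right[OF assms assms(1)] ell2_inner_diff_right[OF assms assms(2)] ..
  moreover have "Re (ell2_inner g f) = Re (ell2_inner f g)"
    by (subst ell2_inner_cnj[symmetric]) simp
  ultimately show ?thesis
    unfolding ell2_inner_self by (simp add: complex_eq_iff)
qed

definition delta :: "'i \<Rightarrow> 'i \<Rightarrow> complex" where
  "delta s = (\<lambda>i. if i = s then 1 else 0)"

lemma ell2_delta [simp]: "ell2 (delta s)"
proof (rule ell2_bounded(1))
  fix F :: "'a set" assume "finite F"
  then show "(\<Sum>i\<in>F. (cmod (delta s i))\<^sup>2) \<le> 1"
    by (simp add: delta_def if_distrib[of cmod] if_distrib[of "\<lambda>x. x\<^sup>2"] sum.delta cong: if_cong)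
qed

lemma ell2_inner_delta [simp]: "ell2_inner f (delta s) = f s"
proof -
  have "ell2_inner f (delta s) = infsum (\<lambda>i. f i * cnj (delta s i)) {s}"
    unfolding ell2_inner_def by (rule infsum_cong_neutral) (auto simp: delta_def)
  then show ?thesis by (simp add: delta_def)
qed

lemma norm2_delta [simp]: "norm2 (delta s) = 1"
proof -
  have "complex_of_real (norm2 (delta s)) = delta s s" by (simp flip: ell2_inner_self)
  then show ?thesis by (simp add: delta_def)
qed

section \<open>Operators with banded kernels\<close>

definition band :: "nat \<Rightarrow> nat \<Rightarrow> ('i \<Rightarrow> 'j \<Rightarrow> complex) \<Rightarrow> bool" where
  "band p q b \<longleftrightarrow> (\<forall>t s. cmod (b t s) \<le> 1) \<and>
     (\<forall>t. finite {s. b t s \<noteq> 0} \<and> card {s. b t s \<noteq> 0} \<le> p) \<and>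
     (\<forall>s. finite {t. b t s \<noteq> 0} \<and> card {t. b t s \<noteq> 0} \<le> q)"

text \<open>Summing over the support of a row gives a finite sum for every function, square-summable
  or not, and lets pointwise limits pass through the operator.\<close>

definition kop :: "('i \<Rightarrow> 'j \<Rightarrow> complex) \<Rightarrow> ('j \<Rightarrow> complex) \<Rightarrow> 'i \<Rightarrow> complex" where
  "kop b f t = (\<Sum>s | b t s \<noteq> 0. b t s * f s)"

definition kadj :: "('i \<Rightarrow> 'j \<Rightarrow> complex) \<Rightarrow> 'j \<Rightarrow> 'i \<Rightarrow> complex" where
  "kadj b s t = cnj (b t s)"

lemma kadj_kadj [simp]: "kadj (kadj b) = b"
  by (intro ext) (simp add: kadj_def)

lemma band_kadj: "band p q b \<Longrightarrow> band q p (kadj b)"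
  unfolding band_def kadj_def by simp

lemma kop_add: "kop b (\<lambda>i. f i + g i) = (\<lambda>t. kop b f t + kop b g t)"
  unfolding kop_def by (simp add: distrib_left sum.distrib)

lemma kop_scale: "kop b (\<lambda>i. c * f i) = (\<lambda>t. c * kop b f t)"
  unfolding kop_def by (simp add: sum_distrib_left mult.left_commute)

lemma cmod_kop_le:
  assumes "band p q b"
  shows "(cmod (kop b f t))\<^sup>2 \<le> real p * (\<Sum>s | b t s \<noteq> 0. (cmod (f s))\<^sup>2)"
proof -
  have "cmod (kop b f t) \<le> (\<Sum>s | b t s \<noteq> 0. cmod (b t s * f s))"
    unfolding kop_def by (rule norm_sum)
  also have "\<dots> \<le> (\<Sum>s | b t s \<noteq> 0. 1 * cmod (f s))"
    unfolding norm_mult using assms by (intro sum_mono mult_right_mono) (auto simp: band_def)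
  finally have "(cmod (kop b f t))\<^sup>2 \<le> (\<Sum>s | b t s \<noteq> 0. cmod (f s))\<^sup>2"
    by (intro power_mono) auto
  also have "\<dots> \<le> (\<Sum>s | b t s \<noteq> 0. (cmod (f s))\<^sup>2) * (\<Sum>s | b t s \<noteq> 0. 1\<^sup>2)"
    using Cauchy_Schwarz_ineq_sum[of "\<lambda>s. cmod (f s)" "\<lambda>_. 1" "{s. b t s \<noteq> 0}"] by simp
  also have "\<dots> = real (card {s. b t s \<noteq> 0}) * (\<Sum>s | b t s \<noteq> 0. (cmod (f s))\<^sup>2)" by simp
  also have "\<dots> \<le> real p * (\<Sum>s | b t s \<noteq> 0. (cmod (f s))\<^sup>2)"
    using assms by (intro mult_right_mono sum_nonneg) (auto simp: band_def)
  finally show ?thesis .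
qed

text \<open>After the exchange of the sums, \<open>w s\<close> occurs once for each nonzero entry of
  column \<open>s\<close>, hence at most \<open>q\<close> times.\<close>

lemma sum_band_le:
  fixes w :: "'j \<Rightarrow> real"
  assumes "band p q (b :: 'i \<Rightarrow> 'j \<Rightarrow> complex)" "\<And>s. 0 \<le> w s" "finite F"
    and W: "\<And>S. finite S \<Longrightarrow> sum w S \<le> W"
  shows "(\<Sum>t\<in>F. \<Sum>s | b t s \<noteq> 0. w s) \<le> real q * W"
proof -
  define S where "S = (\<Union>t\<in>F. {s. b t s \<noteq> 0})"
  have S: "finite S" using assms by (auto simp: S_def band_def)
  have "(\<Sum>t\<in>F. \<Sum>s | b t s \<noteq> 0. w s) = (\<Sum>t\<in>F. \<Sum>s\<in>S. if b t s \<noteq> 0 then w s else 0)"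
  proof (rule sum.cong[OF refl])
    fix t assume t: "t \<in> F"
    have "(\<Sum>s\<in>S. if b t s \<noteq> 0 then w s else 0) = sum w (S \<inter> {s. b t s \<noteq> 0})"
      using S by (simp add: sum.inter_restrict)
    moreover have "S \<inter> {s. b t s \<noteq> 0} = {s. b t s \<noteq> 0}" using t by (auto simp: S_def)
    ultimately show "(\<Sum>s | b t s \<noteq> 0. w s) = (\<Sum>s\<in>S. if b t s \<noteq> 0 then w s else 0)" by simp
  qed
  also have "\<dots> = (\<Sum>s\<in>S. \<Sum>t\<in>F. if b t s \<noteq> 0 then w s else 0)" by (rule sum.swap)
  also have "\<dots> = (\<Sum>s\<in>S. real (card (F \<inter> {t. b t s \<noteq> 0})) * w s)"
    using sum.inter_restrict[OF assms(3), of "\<lambda>_. w s" "{t. b t s \<noteq> 0}" for s] by simp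
  also have "\<dots> \<le> (\<Sum>s\<in>S. real q * w s)"
  proof (intro sum_mono mult_right_mono)
    fix s
    have "card (F \<inter> {t. b t s \<noteq> 0}) \<le> card {t. b t s \<noteq> 0}"
      using assms(1) by (intro card_mono) (auto simp: band_def)
    also have "\<dots> \<le> q" using assms(1) by (auto simp: band_def)
    finally show "real (card (F \<inter> {t. b t s \<noteq> 0})) \<le> real q" by simp
  qed (use assms in auto)
  also have "\<dots> = real q * sum w S" by (simp add: sum_distrib_left)
  also have "\<dots> \<le> real q * W" by (intro mult_left_mono W S) simp
  finally show ?thesis .
qed

lemma sum_if_le:
  fixes w :: "'i \<Rightarrow> real"
  assumes "finite B" "finite {s. P s}" "\<And>s. 0 \<le> w s"
  shows "(\<Sum>s\<in>B. if P s then w s else 0) \<le> (\<Sum>s | P s. w s)"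
proof -
  have "(\<Sum>s\<in>B. if P s then w s else 0) = sum w (B \<inter> {s. P s})"
    using sum.inter_restrict[OF assms(1), of w "{s. P s}"] by simp
  also have "\<dots> \<le> (\<Sum>s | P s. w s)" using assms by (intro sum_mono2) auto
  finally show ?thesis .
qed

text \<open>A form of the Schur test: Cauchy-Schwarz in each row costs the factor \<open>p\<close>,
  and counting along the columns costs the factor \<open>q\<close>.\<close>

lemma kop_bounded:
  assumes "band p q b" "ell2 f"
  shows "ell2 (kop b f)" "norm2 (kop b f) \<le> real (p * q) * norm2 f"
proof -
  have "(\<Sum>t\<in>F. (cmod (kop b f t))\<^sup>2) \<le> real (p * q) * norm2 f" if F: "finite F" for F
  proof -
    have "(\<Sum>t\<in>F. (cmod (kop b f t))\<^sup>2) \<le> (\<Sum>t\<in>F. real p * (\<Sum>s | b t s \<noteq> 0. (cmod (f s))\<^sup>2))"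
      by (intro sum_mono cmod_kop_le[OF assms(1)])
    also have "\<dots> = real p * (\<Sum>t\<in>F. \<Sum>s | b t s \<noteq> 0. (cmod (f s))\<^sup>2)"
      by (simp add: sum_distrib_left)
    also have "\<dots> \<le> real p * (real q * norm2 f)"
      by (intro mult_left_mono sum_band_le[OF assms(1)] F sum_le_norm2[OF assms(2)]) auto
    finally show ?thesis by simp
  qed
  from ell2_bounded[OF this] show "ell2 (kop b f)" "norm2 (kop b f) \<le> real (p * q) * norm2 f" by auto
qed

lemma kop_infsum:
  assumes "band p q b"
  shows "kop b f t = (\<Sum>\<^sub>\<infinity>s. b t s * f s)"
proof -
  have "(\<Sum>\<^sub>\<infinity>s. b t s * f s) = infsum (\<lambda>s. b t s * f s) {s. b t s \<noteq> 0}"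
    by (rule infsum_cong_neutral) auto
  then show ?thesis using assms by (simp add: kop_def band_def)
qed

text \<open>The exchange of the two sums rests on absolute summability over pairs. On the support of
  the kernel a term is at most |f s|^2 + |g t|^2, and the row and column counts bound the sums of
  the two squares separately.\<close>

lemma kop_adjoint:
  assumes "band p q b" "ell2 f" "ell2 g"
  shows "ell2_inner (kop b f) g = ell2_inner f (kop (kadj b) g)"
proof -
  define h where "h t s = b t s * f s * cnj (g t)" for t s
  have abs: "(\<lambda>x. norm (case x of (t, s) \<Rightarrow> h t s)) summable_on UNIV \<times> UNIV"
  proof (rule nonneg_bdd_above_summable_on)
    show "bdd_above (sum (\<lambda>x. norm (case x of (t, s) \<Rightarrow> h t s)) ` {F. F \<subseteq> UNIV \<times> UNIV \<and> finite F})"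
    proof (rule bdd_aboveI, clarsimp)
      fix F :: "('a \<times> 'b) set" assume F: "finite F"
      define A where "A = fst ` F"
      define B where "B = snd ` F"
      have fin: "finite A" "finite B" using F by (auto simp: A_def B_def)
      have row: "finite {s. b t s \<noteq> 0}" for t using assms(1) by (auto simp: band_def)
      have col: "finite {t. b t s \<noteq> 0}" for s using assms(1) by (auto simp: band_def)
      have h_le: "cmod (h t s) \<le> (if b t s \<noteq> 0 then (cmod (f s))\<^sup>2 + (cmod (g t))\<^sup>2 else 0)" for t s
      proof (cases "b t s = 0")
        case False
        have "cmod (h t s) \<le> 1 * cmod (f s) * cmod (g t)"
          unfolding h_def norm_mult using assms(1)
          by (intro mult_mono) (auto simp: band_def)
        also have "\<dots> \<le> (cmod (f s))\<^sup>2 + (cmod (g t))\<^sup>2"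
          using sum_squares_bound[of "cmod (f s)" "cmod (g t)"]
            mult_nonneg_nonneg[OF norm_ge_zero norm_ge_zero, of "f s" "g t"]
          by linarith
        finally show ?thesis using False by simp
      qed (simp add: h_def)
      have "(\<Sum>x\<in>F. cmod (case x of (t, s) \<Rightarrow> h t s)) \<le> (\<Sum>x\<in>A \<times> B. cmod (case x of (t, s) \<Rightarrow> h t s))"
        using fin by (intro sum_mono2) (force simp: A_def B_def)+
      also have "\<dots> = (\<Sum>t\<in>A. \<Sum>s\<in>B. cmod (h t s))" by (simp add: sum.cartesian_product case_prod_beta)
      also have "\<dots> \<le> (\<Sum>t\<in>A. \<Sum>s\<in>B. (if b t s \<noteq> 0 then (cmod (f s))\<^sup>2 else 0) + (if b t s \<noteq> 0 then (cmod (g t))\<^sup>2 else 0))"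
        by (intro sum_mono order_trans[OF h_le]) auto
      also have "\<dots> = (\<Sum>t\<in>A. \<Sum>s\<in>B. if b t s \<noteq> 0 then (cmod (f s))\<^sup>2 else 0) + (\<Sum>s\<in>B. \<Sum>t\<in>A. if b t s \<noteq> 0 then (cmod (g t))\<^sup>2 else 0)"
        by (simp add: sum.distrib, rule sum.swap)
      also have "\<dots> \<le> (\<Sum>t\<in>A. \<Sum>s | b t s \<noteq> 0. (cmod (f s))\<^sup>2) + (\<Sum>s\<in>B. \<Sum>t | kadj b s t \<noteq> 0. (cmod (g t))\<^sup>2)"
        unfolding kadj_def complex_cnj_zero_iff
        by (intro add_mono sum_mono sum_if_le fin row col) auto
      also have "\<dots> \<le> real q * norm2 f + real p * norm2 g"
        by (intro add_mono sum_band_le[OF assms(1)] sum_band_le[OF band_kadj[OF assms(1)]] fin sum_le_norm2 assms) auto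
      finally show "(\<Sum>x\<in>F. cmod (case x of (t, s) \<Rightarrow> h t s)) \<le> real q * norm2 f + real p * norm2 g" .
    qed
  qed auto
  have "ell2_inner (kop b f) g = (\<Sum>\<^sub>\<infinity>t. \<Sum>\<^sub>\<infinity>s. h t s)"
    unfolding ell2_inner_def kop_infsum[OF assms(1)] h_def
    by (simp flip: infsum_cmult_left')
  also have "\<dots> = (\<Sum>\<^sub>\<infinity>s. \<Sum>\<^sub>\<infinity>t. h t s)"
    by (rule infsum_swap_banach) (use abs in \<open>rule abs_summable_summable\<close>)
  also have "\<dots> = ell2_inner f (kop (kadj b) g)"
    unfolding ell2_inner_def kop_infsum[OF band_kadj[OF assms(1)]] h_def kadj_def
    by (simp flip: infsum_cmult_right' infsum_cnj add: mult_ac)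
  finally show ?thesis .
qed

lemma kop_tendsto:
  assumes "\<And>s. (\<lambda>m. f m s) \<longlonglongrightarrow> g s"
  shows "(\<lambda>m. kop b (f m) t) \<longlonglongrightarrow> kop b g t"
  unfolding kop_def by (rule tendsto_sum, rule tendsto_mult[OF tendsto_const assms])

section \<open>Powers of positive contractions\<close>

text \<open>In operator terms, \<open>norm2_le\<close> says T^2 \<le> T and \<open>inner_le\<close>
  says T \<le> 1, a form of 0 \<le> T \<le> 1 that can be checked by norm estimates. The axiom
  \<open>pointwise\<close> is continuity for entrywise limits, which kernels with finite rows
  possess.\<close>

locale positive_contraction =
  fixes T :: "('i \<Rightarrow> complex) \<Rightarrow> 'i \<Rightarrow> complex"
  assumes add: "T (\<lambda>i. f i + g i) = (\<lambda>i. T f i + T g i)"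
    and scale: "T (\<lambda>i. c * f i) = (\<lambda>i. c * T f i)"
    and ell2: "ell2 f \<Longrightarrow> ell2 (T f)"
    and self_adjoint: "ell2 f \<Longrightarrow> ell2 g \<Longrightarrow> ell2_inner (T f) g = ell2_inner f (T g)"
    and norm2_le: "ell2 f \<Longrightarrow> norm2 (T f) \<le> Re (ell2_inner (T f) f)"
    and inner_le: "ell2 f \<Longrightarrow> Re (ell2_inner (T f) f) \<le> norm2 f"
    and pointwise: "(\<And>i. (\<lambda>m. F m i) \<longlonglongrightarrow> f i) \<Longrightarrow> (\<lambda>m. T (F m) i) \<longlonglongrightarrow> T f i"
begin

lemma ell2_pow: "ell2 f \<Longrightarrow> ell2 ((T ^^ m) f)"
  by (induction m) (auto intro: ell2)

lemma pow_scale: "(T ^^ m) (\<lambda>i. c * f i) = (\<lambda>i. c * (T ^^ m) f i)"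
  by (induction m) (auto simp: scale)

lemma pow_add: "(T ^^ m) (\<lambda>i. f i + g i) = (\<lambda>i. (T ^^ m) f i + (T ^^ m) g i)"
  by (induction m) (auto simp: add)

lemma pow_fixed: "T k = k \<Longrightarrow> (T ^^ m) k = k"
  by (induction m) auto

lemma inner_pow: "ell2 f \<Longrightarrow> ell2 g \<Longrightarrow> ell2_inner ((T ^^ m) f) g = ell2_inner f ((T ^^ m) g)"
proof (induction m arbitrary: g)
  case (Suc m)
  then show ?case
    using self_adjoint[OF ell2_pow[OF Suc.prems(1)] Suc.prems(2), of m] Suc.IH[OF Suc.prems(1) ell2[OF Suc.prems(2)]]
    by (simp flip: funpow_swap1)
qed simp

lemma inner_pow_pow:
  assumes "ell2 f"
  shows "ell2_inner ((T ^^ m) f) ((T ^^ k) f) = ell2_inner ((T ^^ (m + k)) f) f"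
  using inner_pow[OF ell2_pow[OF assms, of m] assms, of k] by (simp add: funpow_add add.commute[of m])

definition form :: "nat \<Rightarrow> ('i \<Rightarrow> complex) \<Rightarrow> real" where
  "form m f = Re (ell2_inner ((T ^^ m) f) f)"

lemma form_even: "ell2 f \<Longrightarrow> form (2 * m) f = norm2 ((T ^^ m) f)"
  using inner_pow_pow[of f m m] ell2_inner_self[of "(T ^^ m) f"] unfolding form_def mult_2
  by (metis Re_complex_of_real)

lemma form_odd: "ell2 f \<Longrightarrow> form (2 * m + 1) f = Re (ell2_inner (T ((T ^^ m) f)) ((T ^^ m) f))"
  using inner_pow_pow[of f "Suc m" m] unfolding form_def by (simp add: mult_2)

text \<open>With k = 2m the claim is T \<le> 1 tested on T^m f; with k = 2m + 1 it is T^2 \<le> T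
  tested on T^m f.\<close>

lemma form_Suc_le:
  assumes "ell2 f"
  shows "form (Suc k) f \<le> form k f"
proof (cases "even k")
  case True
  then obtain m where "k = 2 * m" by blast
  then show ?thesis
    using form_even[OF assms, of m] form_odd[OF assms, of m] inner_le[OF ell2_pow[OF assms, of m]] by simp
next
  case False
  then obtain m where "k = 2 * m + 1" by (metis oddE)
  then show ?thesis
    using form_even[OF assms, of "Suc m"] form_odd[OF assms, of m] norm2_le[OF ell2_pow[OF assms, of m]] by simp
qed

lemma form_antimono: "ell2 f \<Longrightarrow> m \<le> k \<Longrightarrow> form k f \<le> form m f"
  by (rule lift_Suc_antimono_le[of "\<lambda>m. form m f"]) (auto intro: form_Suc_le)

text \<open>By monotonicity the value at \<open>k\<close> dominates the value at
  \<open>2 * k\<close>, which is a squared norm.\<close>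

lemma form_nonneg: "ell2 f \<Longrightarrow> 0 \<le> form k f"
proof -
  assume "ell2 f"
  then show "0 \<le> form k f"
    using form_antimono[of f k "2 * k"] form_even[of f k] norm2_nonneg[of "(T ^^ k) f"] by linarith
qed

lemma norm2_pow_le: "ell2 f \<Longrightarrow> norm2 ((T ^^ m) f) \<le> norm2 f"
  using form_even[of f m] form_antimono[of f 0 "2 * m"] form_even[of f 0] by simp

lemma norm2_pow_diff:
  assumes "ell2 f"
  shows "norm2 (\<lambda>i. (T ^^ m) f i - (T ^^ k) f i) = form (2 * m) f - 2 * form (m + k) f + form (2 * k) f"
proof -
  have "Re (ell2_inner ((T ^^ m) f) ((T ^^ k) f)) = form (m + k) f"
    unfolding inner_pow_pow[OF assms] form_def ..
  then show ?thesis
    unfolding norm2_diff[OF ell2_pow[OF assms] ell2_pow[OF assms]] form_even[OF assms] by simp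
qed

section \<open>The limit of the powers\<close>

definition lim_pow :: "('i \<Rightarrow> complex) \<Rightarrow> 'i \<Rightarrow> complex" where
  "lim_pow f i = lim (\<lambda>m. (T ^^ m) f i)"

text \<open>The squared distance of two powers is a second difference of the sequence
  \<open>form\<close>, which is decreasing and bounded below, hence convergent. A second difference
  is a sum of two first differences, whence e / 2.\<close>

lemma norm2_pow_Cauchy:
  assumes "ell2 f" "e > 0"
  obtains N where "\<And>m k. m \<ge> N \<Longrightarrow> k \<ge> N \<Longrightarrow> norm2 (\<lambda>i. (T ^^ m) f i - (T ^^ k) f i) < e"
proof -
  have "convergent (\<lambda>m. form m f)"
    using form_nonneg[OF assms(1)] form_Suc_le[OF assms(1)]
    by (intro Bseq_monoseq_convergent Bseq_eq_bounded decseq_imp_monoseq decseq_SucI) (auto intro!: BseqI'[of _ "form 0 f"] form_antimono[OF assms(1)])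
  then have "Cauchy (\<lambda>m. form m f)" by (rule convergent_Cauchy)
  then obtain N where N: "\<And>m k. m \<ge> N \<Longrightarrow> k \<ge> N \<Longrightarrow> \<bar>form m f - form k f\<bar> < e / 2"
    using assms(2) unfolding Cauchy_def dist_real_def by (metis half_gt_zero)
  have "norm2 (\<lambda>i. (T ^^ m) f i - (T ^^ k) f i) < e" if "m \<ge> N" "k \<ge> N" for m k
    using N[of "2 * m" "m + k"] N[of "2 * k" "m + k"] that
    unfolding norm2_pow_diff[OF assms(1)] by linarith
  then show thesis by (rule that)
qed

lemma pow_tendsto:
  assumes "ell2 f"
  shows "(\<lambda>m. (T ^^ m) f i) \<longlonglongrightarrow> lim_pow f i"
proof -
  have "Cauchy (\<lambda>m. (T ^^ m) f i)"
  proof (rule metric_CauchyI)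
    fix e :: real assume "e > 0"
    then obtain N where N: "\<And>m k. m \<ge> N \<Longrightarrow> k \<ge> N \<Longrightarrow> norm2 (\<lambda>i. (T ^^ m) f i - (T ^^ k) f i) < e\<^sup>2"
      using norm2_pow_Cauchy[OF assms, of "e\<^sup>2"] by (metis zero_less_power)
    have "dist ((T ^^ m) f i) ((T ^^ k) f i) < e" if "m \<ge> N" "k \<ge> N" for m k
    proof -
      have "(cmod ((T ^^ m) f i - (T ^^ k) f i))\<^sup>2 < e\<^sup>2"
        using entry_le_norm2[OF ell2_diff[OF ell2_pow[OF assms] ell2_pow[OF assms]], of m i k] N[OF that] by linarith
      then show ?thesis using \<open>e > 0\<close> by (simp add: dist_norm power_less_imp_less_base)
    qed
    then show "\<exists>M. \<forall>m\<ge>M. \<forall>n\<ge>M. dist ((T ^^ m) f i) ((T ^^ n) f i) < e" by blast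
  qed
  then show ?thesis unfolding lim_pow_def by (simp add: Cauchy_convergent_iff convergent_LIMSEQ_iff)
qed

lemma T_lim_pow: "ell2 f \<Longrightarrow> T (lim_pow f) = lim_pow f"
proof
  fix i assume f: "ell2 f"
  have "(\<lambda>m. T ((T ^^ m) f) i) \<longlonglongrightarrow> T (lim_pow f) i" by (rule pointwise) (rule pow_tendsto[OF f])
  moreover have "(\<lambda>m. (T ^^ Suc m) f i) \<longlonglongrightarrow> lim_pow f i"
    using pow_tendsto[OF f] by (rule LIMSEQ_Suc)
  ultimately show "T (lim_pow f) i = lim_pow f i" using LIMSEQ_unique by fastforce
qed

text \<open>As in the lemma of Fatou: finite partial sums of the Cauchy estimate pass to the
  entrywise limit in the second index, and the bound survives for the full sum.\<close>

lemma norm2_pow_lim_diff: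
  assumes "ell2 f" "e > 0"
  obtains N where "\<And>m. m \<ge> N \<Longrightarrow> ell2 (\<lambda>i. (T ^^ m) f i - lim_pow f i)"
    "\<And>m. m \<ge> N \<Longrightarrow> norm2 (\<lambda>i. (T ^^ m) f i - lim_pow f i) \<le> e"
proof -
  obtain N where N: "\<And>m k. m \<ge> N \<Longrightarrow> k \<ge> N \<Longrightarrow> norm2 (\<lambda>i. (T ^^ m) f i - (T ^^ k) f i) < e"
    using norm2_pow_Cauchy[OF assms] by metis
  have "(\<Sum>i\<in>F. (cmod ((T ^^ m) f i - lim_pow f i))\<^sup>2) \<le> e" if F: "finite F" and m: "m \<ge> N" for F m
  proof (rule LIMSEQ_le_const2)
    show "(\<lambda>k. \<Sum>i\<in>F. (cmod ((T ^^ m) f i - (T ^^ k) f i))\<^sup>2) \<longlonglongrightarrow> (\<Sum>i\<in>F. (cmod ((T ^^ m) f i - lim_pow f i))\<^sup>2)"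
      by (rule tendsto_sum, intro tendsto_power tendsto_norm tendsto_diff tendsto_const pow_tendsto assms)
    have "(\<Sum>i\<in>F. (cmod ((T ^^ m) f i - (T ^^ k) f i))\<^sup>2) \<le> e" if "k \<ge> N" for k
      using sum_le_norm2[OF ell2_diff[OF ell2_pow[OF assms(1)] ell2_pow[OF assms(1)]] F, of m k] N[OF m that] by linarith
    then show "\<exists>N. \<forall>k\<ge>N. (\<Sum>i\<in>F. (cmod ((T ^^ m) f i - (T ^^ k) f i))\<^sup>2) \<le> e" by blast
  qed
  from ell2_bounded[OF this] show thesis using that by blast
qed

lemma ell2_lim_pow:
  assumes "ell2 f"
  shows "ell2 (lim_pow f)"
proof -
  have "0 < (1 :: real)" by simp
  from norm2_pow_lim_diff[OF assms this] obtain N where "ell2 (\<lambda>i. (T ^^ N) f i - lim_pow f i)"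
    by (metis order_refl)
  from ell2_diff[OF ell2_pow[OF assms, of N] this] show ?thesis by simp
qed

lemma inner_pow_tendsto:
  assumes "ell2 f" "ell2 g"
  shows "(\<lambda>m. ell2_inner ((T ^^ m) f) g) \<longlonglongrightarrow> ell2_inner (lim_pow f) g"
proof (rule LIMSEQ_I)
  fix r :: real assume "r > 0"
  \<comment> \<open>The summand 1 keeps the later quotient by \<open>A\<close> meaningful when
    \<open>g\<close> is 0.\<close>
  define A where "A = 1 + sqrt (norm2 g)"
  have pos: "A > 0" by (simp add: A_def add_pos_nonneg)
  define e where "e = (r / (2 * A))\<^sup>2"
  have e: "e > 0" using pos \<open>r > 0\<close> by (simp add: e_def)
  have sqrt_e: "sqrt e = r / (2 * A)" using pos \<open>r > 0\<close> by (simp add: e_def)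
  obtain N where N: "\<And>m. m \<ge> N \<Longrightarrow> ell2 (\<lambda>i. (T ^^ m) f i - lim_pow f i)"
    "\<And>m. m \<ge> N \<Longrightarrow> norm2 (\<lambda>i. (T ^^ m) f i - lim_pow f i) \<le> e"
    using norm2_pow_lim_diff[OF assms(1) e] by blast
  have "norm (ell2_inner ((T ^^ m) f) g - ell2_inner (lim_pow f) g) < r" if m: "m \<ge> N" for m
  proof -
    have "norm (ell2_inner ((T ^^ m) f) g - ell2_inner (lim_pow f) g) = cmod (ell2_inner (\<lambda>i. (T ^^ m) f i - lim_pow f i) g)"
      by (simp add: ell2_inner_diff_left ell2_pow ell2_lim_pow assms)
    also have "\<dots> \<le> sqrt (norm2 (\<lambda>i. (T ^^ m) f i - lim_pow f i)) * sqrt (norm2 g)"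
      by (rule ell2_Cauchy_Schwarz[OF N(1)[OF m] assms(2)])
    also have "\<dots> \<le> sqrt e * sqrt (norm2 g)"
      by (intro mult_right_mono real_sqrt_le_mono N(2)[OF m]) simp
    also have "\<dots> \<le> sqrt e * A" using e by (intro mult_left_mono) (auto simp: A_def)
    also have "\<dots> = r / 2" using pos by (simp add: sqrt_e)
    also have "\<dots> < r" using \<open>r > 0\<close> by simp
    finally show ?thesis .
  qed
  then show "\<exists>N. \<forall>m\<ge>N. norm (ell2_inner ((T ^^ m) f) g - ell2_inner (lim_pow f) g) < r" by blast
qed

text \<open>Self-adjointness moves the powers onto the fixed vector. Together with
  \<open>T_lim_pow\<close> this identifies \<open>lim_pow f\<close> as the orthogonal projection of
  \<open>f\<close> onto the fixed space.\<close>

lemma inner_lim_pow_fixed: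
  assumes "ell2 f" "ell2 k" "T k = k"
  shows "ell2_inner (lim_pow f) k = ell2_inner f k"
proof -
  have "(\<lambda>m. ell2_inner ((T ^^ m) f) k) = (\<lambda>_. ell2_inner f k)"
    using inner_pow[OF assms(1,2)] pow_fixed[OF assms(3)] by simp
  with inner_pow_tendsto[OF assms(1,2)] have "(\<lambda>_::nat. ell2_inner f k) \<longlonglongrightarrow> ell2_inner (lim_pow f) k"
    by simp
  from LIMSEQ_unique[OF this tendsto_const] show ?thesis .
qed

text \<open>By \<open>form_antimono\<close> the difference of the two powers is a positive form.
  Testing it on \<open>c * delta s - delta t\<close> with a suitable unit \<open>c\<close> bounds an
  off-diagonal entry by the two diagonal ones.\<close>

lemma cmod_pow_diff_delta:
  assumes "m \<le> m'"
  shows "2 * cmod ((T ^^ m) (delta s) t - (T ^^ m') (delta s) t) \<le>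
    (form m (delta s) - form m' (delta s)) + (form m (delta t) - form m' (delta t))"
proof -
  define d where "d f g = ell2_inner ((T ^^ m) f) g - ell2_inner ((T ^^ m') f) g" for f g
  have dd: "0 \<le> Re (d f f)" if "ell2 f" for f
    using form_antimono[OF that assms] by (simp add: d_def form_def)
  define z where "z = d (delta s) (delta t)"
  have sym: "d (delta t) (delta s) = cnj z"
    unfolding z_def d_def by (simp add: inner_pow ell2_inner_cnj del: ell2_inner_delta)
  \<comment> \<open>The phase that makes \<open>c * z\<close> equal to the modulus of
    \<open>z\<close>; for z = 0 any unit would serve.\<close>
  define c where "c = (if z = 0 then 1 else cnj z / cmod z)"
  have cn: "c * cnj c = 1"
  proof -
    have "cmod c = 1" by (simp add: c_def norm_divide)
    then show ?thesis using complex_norm_square[of c] by simp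
  qed
  have cz: "c * z = of_real (cmod z)" "cnj c * cnj z = of_real (cmod z)"
    using complex_norm_square[of z] by (auto simp: c_def power2_eq_square mult.commute field_simps)
  define f where "f = (\<lambda>i. c * delta s i - delta t i)"
  have ef: "ell2 (\<lambda>i. c * delta s i)" "ell2 (\<lambda>i. -1 * delta t i)" by (intro ell2_scale ell2_delta)+
  have f': "f = (\<lambda>i. c * delta s i + -1 * delta t i)" by (simp add: f_def)
  have *: "ell2_inner ((T ^^ k) f) f = ell2_inner ((T ^^ k) (delta s)) (delta s)
     - c * ell2_inner ((T ^^ k) (delta s)) (delta t) - cnj c * ell2_inner ((T ^^ k) (delta t)) (delta s)
     + ell2_inner ((T ^^ k) (delta t)) (delta t)" for k
  proof -
    have 1: "(T ^^ k) f = (\<lambda>i. c * (T ^^ k) (delta s) i - (T ^^ k) (delta t) i)"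
      unfolding f' pow_add pow_scale by simp
    have "ell2_inner ((T ^^ k) f) f = c * cnj c * ell2_inner ((T ^^ k) (delta s)) (delta s)
     - c * ell2_inner ((T ^^ k) (delta s)) (delta t) - cnj c * ell2_inner ((T ^^ k) (delta t)) (delta s)
     + ell2_inner ((T ^^ k) (delta t)) (delta t)"
      unfolding 1 unfolding f_def
      by (simp add: ell2_inner_diff_left ell2_inner_diff_right ell2_inner_scale_left ell2_inner_scale_right
          ell2_scale ell2_pow ell2_diff algebra_simps del: ell2_inner_delta)
    then show ?thesis using cn by simp
  qed
  have "d f f = d (delta s) (delta s) - c * z - cnj c * d (delta t) (delta s) + d (delta t) (delta t)"
    unfolding z_def d_def * by (simp add: algebra_simps del: ell2_inner_delta)
  then have "d f f = d (delta s) (delta s) - c * z - cnj c * cnj z + d (delta t) (delta t)"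
    unfolding sym .
  then have "Re (d f f) = Re (d (delta s) (delta s)) - 2 * cmod z + Re (d (delta t) (delta t))"
    unfolding cz by simp
  moreover have "0 \<le> Re (d f f)" by (rule dd) (unfold f', intro ell2_add ef)
  ultimately have "2 * cmod z \<le> Re (d (delta s) (delta s)) + Re (d (delta t) (delta t))" by simp
  then show ?thesis by (simp add: z_def d_def form_def)
qed

end

section \<open>Traces of powers of integral matrices\<close>

definition mat_trace :: "'a::comm_ring_1 mat \<Rightarrow> 'a" where
  "mat_trace A = (\<Sum>i<dim_row A. A $$ (i, i))"

lemma mat_trace_comm:
  assumes "A \<in> carrier_mat n n" "B \<in> carrier_mat n n"
  shows "mat_trace (A * B) = mat_trace (B * A)"
proof -
  have "mat_trace (A * B) = (\<Sum>i<n. \<Sum>k<n. A $$ (i, k) * B $$ (k, i))"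
    using assms by (simp add: mat_trace_def scalar_prod_def atLeast0LessThan)
  also have "\<dots> = (\<Sum>k<n. \<Sum>i<n. B $$ (k, i) * A $$ (i, k))"
    by (subst sum.swap) (simp add: mult.commute)
  also have "\<dots> = mat_trace (B * A)"
    using assms by (simp add: mat_trace_def scalar_prod_def atLeast0LessThan)
  finally show ?thesis .
qed

lemma mat_trace_similar:
  assumes "A \<in> carrier_mat n n" "similar_mat_wit A B P Q"
  shows "mat_trace A = mat_trace B"
proof -
  note w = similar_mat_witD2[OF assms]
  have "mat_trace A = mat_trace (Q * (P * B))"
    unfolding w(3) by (rule mat_trace_comm[OF mult_carrier_mat[OF w(6,5)] w(7)])
  also have "Q * (P * B) = Q * P * B" by (rule assoc_mult_mat[OF w(7,6,5), symmetric])
  also have "\<dots> = B" unfolding w(2) by (rule left_mult_one_mat[OF w(5)])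
  finally show ?thesis .
qed

lemma upper_triangular_mult:
  assumes "A \<in> carrier_mat n n" "B \<in> carrier_mat n n" "upper_triangular A" "upper_triangular B"
  shows "upper_triangular (A * B)" "i < n \<Longrightarrow> (A * B) $$ (i, i) = A $$ (i, i) * B $$ (i, i)"
proof -
  have prod: "(A * B) $$ (i, j) = (\<Sum>k<n. A $$ (i, k) * B $$ (k, j))" if "i < n" "j < n" for i j
    using assms that by (simp add: scalar_prod_def atLeast0LessThan)
  show "upper_triangular (A * B)"
  proof (rule upper_triangularI)
    fix i j assume ij: "j < i" "i < dim_row (A * B)"
    then have "A $$ (i, k) * B $$ (k, j) = 0" if "k < n" for k
      using that assms upper_triangularD[OF assms(3), of k i] upper_triangularD[OF assms(4), of j k]
      by (cases "k < i") auto
    then show "(A * B) $$ (i, j) = 0" using ij assms prod[of i j] by simp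
  qed
  assume i: "i < n"
  have "A $$ (i, k) * B $$ (k, i) = 0" if "k < n" "k \<noteq> i" for k
    using that i assms upper_triangularD[OF assms(3), of k i] upper_triangularD[OF assms(4), of i k]
    by (cases "k < i") auto
  then show "(A * B) $$ (i, i) = A $$ (i, i) * B $$ (i, i)"
    using i by (simp add: prod sum.remove[of "{..<n}" i])
qed

lemma upper_triangular_pow:
  assumes "A \<in> carrier_mat n n" "upper_triangular A"
  shows "upper_triangular (A ^\<^sub>m k) \<and> (\<forall>i<n. (A ^\<^sub>m k) $$ (i, i) = (A $$ (i, i)) ^ k)"
proof (induction k)
  case 0
  then show ?case using assms by simp
next
  case (Suc k)
  have "A ^\<^sub>m k \<in> carrier_mat n n" by (rule pow_carrier_mat[OF assms(1)])
  then show ?case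
    using upper_triangular_mult[of "A ^\<^sub>m k" n A] assms Suc
    by (auto simp: power_commutes simp del: index_mult_mat)
qed

text \<open>A Schur decomposition makes \<open>A\<close> upper triangular. The affine expression and
  its powers stay triangular in the same basis, so the diagonal lists the transformed eigenvalues
  with multiplicity.\<close>

lemma mat_trace_affine_pow:
  fixes A :: "complex mat"
  assumes A: "A \<in> carrier_mat n n" and cp: "char_poly A = (\<Prod>e\<leftarrow>es. [:- e, 1:])" and len: "length es = n"
  shows "mat_trace ((1\<^sub>m n - c \<cdot>\<^sub>m A) ^\<^sub>m k) = (\<Sum>e\<leftarrow>es. (1 - c * e) ^ k)"
proof -
  obtain U P Q where sd: "schur_decomposition A es = (U, P, Q)" by (cases "schur_decomposition A es")
  have U: "similar_mat_wit A U P Q" "upper_triangular U" "diag_mat U = es"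
    using schur_decomposition[OF A cp sd] by auto
  note w = similar_mat_witD2[OF A U(1)]
  define A' where "A' = 1\<^sub>m n - c \<cdot>\<^sub>m A"
  define U' where "U' = 1\<^sub>m n - c \<cdot>\<^sub>m U"
  have car: "A' \<in> carrier_mat n n" "U' \<in> carrier_mat n n" using A w by (auto simp: A'_def U'_def)
  have "P * U' * Q = (P * 1\<^sub>m n - P * (c \<cdot>\<^sub>m U)) * Q"
    unfolding U'_def using w by (subst mult_minus_distrib_mat[of _ n n _ n]) auto
  also have "\<dots> = P * 1\<^sub>m n * Q - P * (c \<cdot>\<^sub>m U) * Q"
    using w by (subst minus_mult_distrib_mat[of _ n n _ _ n]) auto
  also have "P * (c \<cdot>\<^sub>m U) * Q = c \<cdot>\<^sub>m A"
    using w by (simp add: mult_smult_distrib[of _ n n _ n] mult_smult_assoc_mat[of _ n n _ n])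
  also have "P * 1\<^sub>m n * Q = 1\<^sub>m n" using w by simp
  finally have "A' = P * U' * Q" by (simp add: A'_def)
  then have "similar_mat_wit A' U' P Q"
    using w car unfolding similar_mat_wit_def Let_def by auto
  from similar_mat_wit_pow[OF this, of k] mat_trace_similar[OF pow_carrier_mat[OF car(1), of k]]
  have "mat_trace (A' ^\<^sub>m k) = mat_trace (U' ^\<^sub>m k)" by blast
  also have "\<dots> = (\<Sum>i<n. (U' $$ (i, i)) ^ k)"
  proof -
    have "upper_triangular U'"
      using U(2) w by (intro upper_triangularI) (auto simp: U'_def upper_triangularD)
    from upper_triangular_pow[OF car(2) this, of k] pow_carrier_mat[OF car(2), of k]
    show ?thesis using carrier_matD(1)[OF car(2)] by (simp add: mat_trace_def)
  qed
  also have "\<dots> = (\<Sum>i<n. (1 - c * es ! i) ^ k)"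
    using w U(3) by (intro sum.cong refl) (auto simp: U'_def diag_mat_def)
  also have "\<dots> = (\<Sum>e\<leftarrow>es. (1 - c * e) ^ k)"
    using len by (simp add: sum_list_sum_nth atLeast0LessThan)
  finally show ?thesis by (simp add: A'_def)
qed

section \<open>Small eigenvalues of integral matrices\<close>

lemma prod_linear_split:
  "(\<Prod>e\<leftarrow>es. [:- e, 1:]) = monom 1 (length (filter (\<lambda>e. e = 0) es)) * (\<Prod>e\<leftarrow>filter (\<lambda>e. e \<noteq> 0) es. [:- e, 1 :: complex:])"
proof (induction es)
  case (Cons e es)
  define X where "X = (\<Prod>e\<leftarrow>filter (\<lambda>e. e \<noteq> 0) es. [:- e, 1 :: complex:])"
  define k where "k = length (filter (\<lambda>e. e = 0) es)"
  have "(\<Prod>e\<leftarrow>e # es. [:- e, 1:]) = [:- e, 1:] * (monom 1 k * X)"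
    using Cons unfolding X_def k_def by simp
  also have "\<dots> = (if e = 0 then monom 1 (Suc k) * X else monom 1 k * ([:- e, 1:] * X))"
    by (simp add: monom_Suc mult.left_commute del: mult_pCons_left mult_pCons_right)
       (simp add: monom_Suc)
  finally show ?case by (simp add: X_def k_def del: mult_pCons_left mult_pCons_right)
qed simp

lemma coeff_0_prod_linear: "coeff (\<Prod>e\<leftarrow>es. [:- e, 1 :: complex:]) 0 = (\<Prod>e\<leftarrow>es. - e)"
  by (induction es) (auto simp: coeff_mult_0)

lemma cmod_prod_list: "cmod (\<Prod>e\<leftarrow>es. f e) = (\<Prod>e\<leftarrow>es. cmod (f e))"
  by (induction es) (auto simp: norm_mult)

text \<open>The lowest nonvanishing coefficient of an integral characteristic polynomial is a nonzero integer.\<close>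
lemma prod_nonzero_eigenvalues_ge_1:
  assumes A: "(A :: int mat) \<in> carrier_mat n n"
    and cp: "char_poly (map_mat of_int A) = (\<Prod>e\<leftarrow>es. [:- e, 1 :: complex:])"
  shows "1 \<le> (\<Prod>e\<leftarrow>filter (\<lambda>e. e \<noteq> 0) es. cmod e)"
proof -
  define k where "k = length (filter (\<lambda>e. e = 0) es)"
  define es' where "es' = filter (\<lambda>e. e \<noteq> 0) es"
  have "char_poly (map_mat of_int A) = map_poly (of_int :: int \<Rightarrow> complex) (char_poly A)"
    by (rule of_int_hom.char_poly_hom[OF A])
  then have "of_int (coeff (char_poly A) k) = coeff (\<Prod>e\<leftarrow>es. [:- e, 1 :: complex:]) k"
    unfolding cp[symmetric] by (simp add: coeff_map_poly)
  also have "\<dots> = (\<Prod>e\<leftarrow>es'. - e)"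
    unfolding prod_linear_split[of es] k_def[symmetric] es'_def[symmetric]
    using coeff_0_prod_linear[of es'] by (simp add: coeff_monom_mult)
  finally have eq: "(of_int (coeff (char_poly A) k) :: complex) = (\<Prod>e\<leftarrow>es'. - e)" .
  have norm: "cmod (\<Prod>e\<leftarrow>es'. - e) = (\<Prod>e\<leftarrow>es'. cmod e)"
    by (simp add: cmod_prod_list)
  have "(\<Prod>e\<leftarrow>es'. - e) \<noteq> 0" by (auto simp: es'_def prod_list_zero_iff)
  then have "coeff (char_poly A) k \<noteq> 0" using eq by auto
  then have "1 \<le> \<bar>coeff (char_poly A) k\<bar>" by linarith
  then have "1 \<le> cmod (of_int (coeff (char_poly A) k))" by (simp del: of_int_abs flip: of_int_abs)
  then show ?thesis using eq norm by (simp add: es'_def)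
qed

text \<open>The terms are split at x / c = \<epsilon>. Above it a term is at most (1 -
  \<epsilon>)^m. Below it a term is at most 1, and 1 \<le> (ln c - ln x) / ln (1/\<epsilon>), a
  Markov inequality on the logarithmic scale. In the sum the logarithms of the entries add up to the
  logarithm of the product, which is nonnegative and enters with a minus sign.\<close>

lemma sum_pow_le_of_prod_ge_1:
  fixes xs :: "real list"
  assumes "\<And>x. x \<in> set xs \<Longrightarrow> 0 < x \<and> x \<le> c" "1 \<le> prod_list xs" "1 \<le> c" "0 < \<epsilon>" "\<epsilon> < 1"
  shows "(\<Sum>x\<leftarrow>xs. (1 - x / c) ^ m) \<le> real (length xs) * (ln c / ln (1 / \<epsilon>) + (1 - \<epsilon> ) ^ m)"
proof -
  have L: "ln (1 / \<epsilon>) > 0" using assms(4,5) by simp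
  have "(1 - x / c) ^ m \<le> (ln c - ln x) / ln (1 / \<epsilon>) + (1 - \<epsilon>) ^ m" if x: "x \<in> set xs" for x
  proof -
    have x: "0 < x" "x \<le> c" using assms(1)[OF x] by auto
    have r: "0 \<le> (ln c - ln x) / ln (1 / \<epsilon>)" using x L by simp
    show ?thesis
    proof (cases "x / c < \<epsilon>")
      case True
      then have "1 / \<epsilon> < c / x" using x assms(3,4) by (simp add: field_simps)
      then have "ln (1 / \<epsilon>) \<le> ln (c / x)" using assms(4) by (intro ln_mono) auto
      also have "\<dots> = ln c - ln x" using x assms(3) by (simp add: ln_div)
      finally have "1 \<le> (ln c - ln x) / ln (1 / \<epsilon>)" using L by simp
      moreover have "(1 - x / c) ^ m \<le> 1" using x assms(3) by (intro power_le_one) auto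
      moreover have "0 \<le> (1 - \<epsilon>) ^ m" using assms(5) by simp
      ultimately show ?thesis by linarith
    next
      case False
      then have "(1 - x / c) ^ m \<le> (1 - \<epsilon>) ^ m" using x assms(3) by (intro power_mono) auto
      then show ?thesis using r by linarith
    qed
  qed
  then have "(\<Sum>x\<leftarrow>xs. (1 - x / c) ^ m) \<le> (\<Sum>x\<leftarrow>xs. (ln c - ln x) / ln (1 / \<epsilon>) + (1 - \<epsilon>) ^ m)"
    by (rule sum_list_mono)
  also have "\<dots> = (real (length xs) * ln c - (\<Sum>x\<leftarrow>xs. ln x)) / ln (1 / \<epsilon>) + real (length xs) * (1 - \<epsilon>) ^ m"
    by (induction xs) (auto simp: algebra_simps diff_divide_distrib add_divide_distrib)
  also have "(\<Sum>x\<leftarrow>xs. ln x) = ln (prod_list xs)"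
    using assms(1)
  proof (induction xs)
    case (Cons x xs)
    have "(\<And>x. x \<in> set xs \<Longrightarrow> 0 < x) \<Longrightarrow> 0 < prod_list xs" for xs :: "real list"
      by (induction xs) auto
    then have "0 < prod_list xs" using Cons.prems by auto
    then have "ln (x * prod_list xs) = ln x + ln (prod_list xs)"
      using Cons.prems by (intro ln_mult_pos) auto
    then show ?case using Cons by simp
  qed simp
  also have "(real (length xs) * ln c - ln (prod_list xs)) / ln (1 / \<epsilon>) \<le> (real (length xs) * ln c) / ln (1 / \<epsilon>)"
    using assms(2) L by (intro divide_right_mono) auto
  finally show ?thesis by (simp add: algebra_simps)
qed

text \<open>Each eigenvalue 0 contributes 1 to both traces and cancels in the difference. Of the
  nonzero eigenvalues, the contribution to the second trace is nonnegative and is dropped, so that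
  only the first is estimated.\<close>

lemma trace_pow_diff_le:
  fixes A :: "int mat"
  assumes A: "A \<in> carrier_mat n n" and c: "1 \<le> c"
    and ev: "\<And>e. eigenvalue (map_mat complex_of_int A) e \<Longrightarrow> \<exists>x. e = complex_of_real x \<and> 0 \<le> x \<and> x \<le> c"
    and m: "m \<le> m'" and eps: "0 < \<epsilon>" "\<epsilon> < 1"
  defines "B \<equiv> 1\<^sub>m n - complex_of_real (1 / c) \<cdot>\<^sub>m map_mat complex_of_int A"
  shows "Re (mat_trace (B ^\<^sub>m m) - mat_trace (B ^\<^sub>m m')) \<le> real n * (ln c / ln (1 / \<epsilon>) + (1 - \<epsilon>) ^ m)"
proof -
  define A' where "A' = map_mat complex_of_int A"
  have A': "A' \<in> carrier_mat n n" using A by (simp add: A'_def)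
  obtain es where es: "char_poly A' = (\<Prod>e\<leftarrow>es. [:- e, 1:])" "length es = n"
    using char_poly_factorized[OF A'] by blast
  define xs where "xs = map Re es"
  have "eigenvalue A' e" if "e \<in> set es" for e
    unfolding eigenvalue_root_char_poly[OF A'] es(1) poly_prod_list using that
    by (auto simp: prod_list_zero_iff image_iff intro!: bexI[of _ "[:- e, 1:]"])
  then have ex: "e = complex_of_real (Re e) \<and> 0 \<le> Re e \<and> Re e \<le> c" if "e \<in> set es" for e
    using ev[folded A'_def] that by fastforce
  have tr: "mat_trace (B ^\<^sub>m k) = complex_of_real (\<Sum>x\<leftarrow>xs. (1 - x / c) ^ k)" for k
  proof -
    have "mat_trace (B ^\<^sub>m k) = (\<Sum>e\<leftarrow>es. (1 - complex_of_real (1 / c) * e) ^ k)"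
      unfolding B_def A'_def[symmetric] by (rule mat_trace_affine_pow[OF A' es])
    also have "\<dots> = (\<Sum>e\<leftarrow>es. complex_of_real ((1 - Re e / c) ^ k))"
      using ex by (intro arg_cong[where f = sum_list] map_cong refl) (auto simp: complex_eq_iff)
    also have "\<dots> = complex_of_real (\<Sum>x\<leftarrow>xs. (1 - x / c) ^ k)"
      unfolding xs_def by (induction es) auto
    finally show ?thesis .
  qed
  have xs: "0 \<le> x \<and> x \<le> c" if "x \<in> set xs" for x using that ex by (auto simp: xs_def)
  define ys where "ys = filter (\<lambda>x. x \<noteq> 0) xs"
  have split: "(\<Sum>x\<leftarrow>xs. (1 - x / c) ^ k) = real (length (filter (\<lambda>x. x = 0) xs)) + (\<Sum>x\<leftarrow>ys. (1 - x / c) ^ k)" for k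
    unfolding ys_def by (induction xs) auto
  have "map Re (filter (\<lambda>e. e \<noteq> 0) es) = ys"
  proof -
    have "(e \<noteq> 0) = (Re e \<noteq> 0)" if "e \<in> set es" for e
      using ex[OF that] by (simp add: complex_eq_iff)
    then have "filter (\<lambda>e. e \<noteq> 0) es = filter (\<lambda>e. Re e \<noteq> 0) es" by (rule filter_cong[OF refl])
    then show ?thesis by (simp add: ys_def xs_def filter_map o_def)
  qed
  moreover have "(\<Prod>e\<leftarrow>filter (\<lambda>e. e \<noteq> 0) es. cmod e) = prod_list (map Re (filter (\<lambda>e. e \<noteq> 0) es))"
  proof (intro arg_cong[where f = prod_list] map_cong refl)
    fix e assume "e \<in> set (filter (\<lambda>e. e \<noteq> 0) es)"
    then have "e \<in> set es" by simp
    from ex[OF this] show "cmod e = Re e" by (metis abs_of_nonneg norm_of_real)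
  qed
  ultimately have "1 \<le> prod_list ys"
    using prod_nonzero_eigenvalues_ge_1[OF A es(1)[unfolded A'_def]] by simp
  then have "(\<Sum>x\<leftarrow>ys. (1 - x / c) ^ m) \<le> real (length ys) * (ln c / ln (1 / \<epsilon>) + (1 - \<epsilon>) ^ m)"
    using xs c eps by (intro sum_pow_le_of_prod_ge_1) (auto simp: ys_def less_le)
  also have "\<dots> \<le> real n * (ln c / ln (1 / \<epsilon>) + (1 - \<epsilon>) ^ m)"
    using c eps es(2) length_filter_le[of "\<lambda>x. x \<noteq> 0" xs]
    by (intro mult_right_mono add_nonneg_nonneg divide_nonneg_nonneg) (auto simp: ys_def xs_def)
  finally have 1: "(\<Sum>x\<leftarrow>ys. (1 - x / c) ^ m) \<le> real n * (ln c / ln (1 / \<epsilon>) + (1 - \<epsilon>) ^ m)" .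
  have "0 \<le> (\<Sum>x\<leftarrow>ys. (1 - x / c) ^ m')"
    using xs c by (intro sum_list_nonneg) (auto simp: ys_def)
  then show ?thesis using 1 unfolding tr split by simp
qed

section \<open>Characters\<close>

text \<open>An enumeration of the finite index type transfers the question to matrices indexed by
  numbers, where the spectrum is nonempty; the eigenvector is carried back along the
  enumeration.\<close>

lemma complex_matrix_eigenvector:
  fixes M :: "complex^'d^'d"
  obtains k w where "w \<noteq> 0" "M *v w = k *s w"
proof -
  define n where "n = CARD('d)"
  obtain h :: "nat \<Rightarrow> 'd" where h: "bij_betw h {..<n} UNIV"
    using ex_bij_betw_nat_finite[of "UNIV :: 'd set"] by (auto simp: n_def atLeast0LessThan)
  define J where "J = Matrix.mat n n (\<lambda>(i, j). M $ h i $ h j)"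
  have J: "J \<in> carrier_mat n n" by (simp add: J_def)
  have "0 < n" by (simp add: n_def)
  then obtain k where "eigenvalue J k"
    using spectrum_non_empty[OF J] by (auto simp: spectrum_def)
  then obtain v where v: "v \<in> carrier_vec n" "v \<noteq> 0\<^sub>v n" "J *\<^sub>v v = k \<cdot>\<^sub>v v"
    using J by (auto simp: eigenvalue_def eigenvector_def)
  define w :: "complex^'d" where "w = (\<chi> i. vec_index v (the_inv_into {..<n} h i))"
  have w: "w $ h i = vec_index v i" if "i < n" for i
    using that h by (simp add: w_def the_inv_into_f_f bij_betw_def)
  have hs: "\<exists>i<n. x = h i" for x using h by (auto simp: bij_betw_def)
  obtain i where i: "i < n" "vec_index v i \<noteq> 0"
    using v(1,2) by (metis carrier_vecD eq_vecI index_zero_vec)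
  then have "w \<noteq> 0" using w[OF i(1)] by auto
  moreover have "M *v w = k *s w"
  proof (subst Finite_Cartesian_Product.vec_eq_iff, rule allI)
    fix x
    obtain i where i: "i < n" "x = h i" using hs by blast
    have "(M *v w) $ x = (\<Sum>j<n. M $ x $ h j * w $ h j)"
      unfolding matrix_vector_mult_def using sum.reindex_bij_betw[OF h, of "\<lambda>y. M $ x $ y * w $ y"] by simp
    also have "\<dots> = vec_index (J *\<^sub>v v) i"
      using i v(1) w by (simp add: J_def scalar_prod_def atLeast0LessThan)
    also have "\<dots> = k * w $ x" unfolding v(3) using i v(1) w by simp
    finally show "(M *v w) $ x = (k *s w) $ x" by simp
  qed
  ultimately show thesis by (rule that)
qed

lemma mat_matrix_vector_mult: "mat k *v x = k *s (x :: complex^'d)"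
  by (simp add: Finite_Cartesian_Product.vec_eq_iff matrix_vector_mult_def Finite_Cartesian_Product.mat_def if_distrib[of "\<lambda>c. c * _"] cong: if_cong)

text \<open>An eigenspace of \<open>M\<close> is invariant under the representation and nonzero,
  hence everything by irreducibility.\<close>

lemma schur_commuting:
  fixes \<rho> :: "'g \<Rightarrow> complex^'d^'d"
  assumes "irreducible_rep G \<rho>" "\<And>g. g \<in> carrier G \<Longrightarrow> \<rho> g ** M = M ** \<rho> g"
  obtains k where "M = mat k"
proof -
  obtain k w where w: "w \<noteq> 0" "M *v w = k *s w" by (rule complex_matrix_eigenvector)
  define W where "W = {w. M *v w = k *s w}"
  have "vec.subspace W"
    by (rule vec.subspaceI)
       (auto simp: W_def matrix_vector_right_distrib vector_add_ldistrib vector_smult_assoc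
          vector_scalar_commute mult.commute)
  moreover have "\<rho> g *v x \<in> W" if "g \<in> carrier G" "x \<in> W" for g x
  proof -
    have "M *v (\<rho> g *v x) = \<rho> g *v (M *v x)"
      using assms(2)[OF that(1)] by (simp add: matrix_vector_mul_assoc)
    then show ?thesis using that(2) by (simp add: W_def vector_scalar_commute)
  qed
  ultimately have "W = {0} \<or> W = UNIV" using assms(1) unfolding irreducible_rep_def by blast
  then have "W = UNIV" using w by (auto simp: W_def)
  then have "M = mat k" unfolding matrix_eq mat_matrix_vector_mult by (auto simp: W_def)
  then show thesis by (rule that)
qed

lemma sum_swap_pairs:
  "(\<Sum>i\<in>A. \<Sum>j\<in>B. \<Sum>h\<in>C. \<Sum>k\<in>E. F i j h k) = (\<Sum>h\<in>C. \<Sum>k\<in>E. \<Sum>i\<in>A. \<Sum>j\<in>B. F i j h k)"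
proof -
  have "(\<Sum>i\<in>A. \<Sum>j\<in>B. \<Sum>h\<in>C. \<Sum>k\<in>E. F i j h k) = (\<Sum>i\<in>A. \<Sum>h\<in>C. \<Sum>j\<in>B. \<Sum>k\<in>E. F i j h k)"
    by (intro sum.cong refl) (rule sum.swap)
  also have "\<dots> = (\<Sum>h\<in>C. \<Sum>i\<in>A. \<Sum>j\<in>B. \<Sum>k\<in>E. F i j h k)" by (rule sum.swap)
  also have "\<dots> = (\<Sum>h\<in>C. \<Sum>i\<in>A. \<Sum>k\<in>E. \<Sum>j\<in>B. F i j h k)"
    by (intro sum.cong refl) (rule sum.swap)
  also have "\<dots> = (\<Sum>h\<in>C. \<Sum>k\<in>E. \<Sum>i\<in>A. \<Sum>j\<in>B. F i j h k)"
    by (intro sum.cong refl) (rule sum.swap)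
  finally show ?thesis .
qed

section \<open>Characters of an irreducible representation\<close>

context
  fixes G :: "('g, 'm) monoid_scheme" and \<rho> :: "'g \<Rightarrow> complex^'d^'d"
  assumes group: "group G" and fin: "finite (carrier G)" and irr: "irreducible_rep G \<rho>"
begin

interpretation group G by (rule group)

lemma rep_mult:
  assumes "g \<in> carrier G" "h \<in> carrier G"
  shows "\<rho> (g \<otimes>\<^bsub>G\<^esub> h) $ i $ j = (\<Sum>k\<in>UNIV. \<rho> g $ i $ k * \<rho> h $ k $ j)"
  using irr assms by (simp add: irreducible_rep_def matrix_matrix_mult_def)

lemma rep_one: "\<rho> \<one>\<^bsub>G\<^esub> = mat 1"
  using irr by (simp add: irreducible_rep_def)

lemma sum_carrier_left_mult:
  assumes "g \<in> carrier G"
  shows "(\<Sum>h\<in>carrier G. f (g \<otimes>\<^bsub>G\<^esub> h)) = (\<Sum>h\<in>carrier G. f h)"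
  by (rule sum.reindex_bij_witness[where i = "\<lambda>h. inv\<^bsub>G\<^esub> g \<otimes>\<^bsub>G\<^esub> h" and j = "\<lambda>h. g \<otimes>\<^bsub>G\<^esub> h"])
     (use assms in \<open>auto simp: m_assoc[symmetric]\<close>)

lemma sum_carrier_right_mult:
  assumes "g \<in> carrier G"
  shows "(\<Sum>h\<in>carrier G. f (h \<otimes>\<^bsub>G\<^esub> g)) = (\<Sum>h\<in>carrier G. f h)"
  by (rule sum.reindex_bij_witness[where i = "\<lambda>h. h \<otimes>\<^bsub>G\<^esub> inv\<^bsub>G\<^esub> g" and j = "\<lambda>h. h \<otimes>\<^bsub>G\<^esub> g"])
     (use assms in \<open>auto simp: m_assoc\<close>)

lemma card_carrier_pos: "0 < card (carrier G)"
  using fin by (auto simp: card_gt_0_iff)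

text \<open>The matrix \<open>\<Phi>\<close> is the average, without normalization, of the
  conjugates of the matrix unit at (a, b). It commutes with the representation, so it is a scalar,
  and its trace determines which one.\<close>

lemma schur_orthogonality:
  "(\<Sum>h\<in>carrier G. \<rho> h $ k $ a * \<rho> (inv\<^bsub>G\<^esub> h) $ b $ l) =
    (if a = b \<and> k = l then of_nat (card (carrier G)) / of_nat CARD('d) else 0)"
proof -
  define \<Phi> :: "complex^'d^'d" where
    "\<Phi> = (\<chi> k l. \<Sum>h\<in>carrier G. \<rho> h $ k $ a * \<rho> (inv\<^bsub>G\<^esub> h) $ b $ l)"
  have "\<rho> g ** \<Phi> = \<Phi> ** \<rho> g" if g: "g \<in> carrier G" for g
  proof (subst Finite_Cartesian_Product.vec_eq_iff, rule allI, subst Finite_Cartesian_Product.vec_eq_iff, rule allI)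
    fix k l
    have "(\<rho> g ** \<Phi>) $ k $ l = (\<Sum>h\<in>carrier G. (\<Sum>i\<in>UNIV. \<rho> g $ k $ i * \<rho> h $ i $ a) * \<rho> (inv\<^bsub>G\<^esub> h) $ b $ l)"
      by (simp add: matrix_matrix_mult_def \<Phi>_def sum_distrib_left sum_distrib_right mult.assoc) (rule sum.swap)
    also have "\<dots> = (\<Sum>h\<in>carrier G. \<rho> (g \<otimes>\<^bsub>G\<^esub> h) $ k $ a * \<rho> (inv\<^bsub>G\<^esub> h) $ b $ l)"
      using g by (intro sum.cong refl) (simp add: rep_mult)
    also have "\<dots> = (\<Sum>h\<in>carrier G. \<rho> (g \<otimes>\<^bsub>G\<^esub> h) $ k $ a * \<rho> (inv\<^bsub>G\<^esub> (g \<otimes>\<^bsub>G\<^esub> h) \<otimes>\<^bsub>G\<^esub> g) $ b $ l)"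
      using g by (intro sum.cong refl) (simp add: inv_mult_group m_assoc)
    also have "\<dots> = (\<Sum>h\<in>carrier G. \<rho> h $ k $ a * \<rho> (inv\<^bsub>G\<^esub> h \<otimes>\<^bsub>G\<^esub> g) $ b $ l)"
      by (rule sum_carrier_left_mult[OF g])
    also have "\<dots> = (\<Phi> ** \<rho> g) $ k $ l"
      using g by (simp add: matrix_matrix_mult_def \<Phi>_def rep_mult sum_distrib_left sum_distrib_right mult.assoc) (rule sum.swap)
    finally show "(\<rho> g ** \<Phi>) $ k $ l = (\<Phi> ** \<rho> g) $ k $ l" .
  qed
  then obtain c where c: "\<Phi> = mat c" by (rule schur_commuting[OF irr])
  have "of_nat CARD('d) * c = (\<Sum>k\<in>UNIV. \<Phi> $ k $ k)" by (simp add: c Finite_Cartesian_Product.mat_def)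
  also have "\<dots> = (\<Sum>h\<in>carrier G. \<Sum>k\<in>UNIV. \<rho> (inv\<^bsub>G\<^esub> h) $ b $ k * \<rho> h $ k $ a)"
    by (simp add: \<Phi>_def mult.commute) (rule sum.swap)
  also have "\<dots> = (\<Sum>h\<in>carrier G. mat 1 $ b $ a)"
    by (intro sum.cong refl) (simp add: rep_one flip: rep_mult)
  also have "\<dots> = (if a = b then of_nat (card (carrier G)) else 0)" by (simp add: Finite_Cartesian_Product.mat_def)
  finally have "c = (if a = b then of_nat (card (carrier G)) / of_nat CARD('d) else 0)"
    by (auto simp: field_simps)
  moreover have "(\<Sum>h\<in>carrier G. \<rho> h $ k $ a * \<rho> (inv\<^bsub>G\<^esub> h) $ b $ l) = \<Phi> $ k $ l"
    by (simp add: \<Phi>_def)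
  ultimately show ?thesis by (simp add: c Finite_Cartesian_Product.mat_def)
qed

lemma character_one: "character \<rho> \<one>\<^bsub>G\<^esub> = of_nat CARD('d)"
  by (simp add: character_def rep_one trace_def Finite_Cartesian_Product.mat_def)

text \<open>Expanding the characters into matrix coefficients, the orthogonality relation collapses
  the sum over the group. This is what makes the isotypic projection idempotent.\<close>

lemma character_convolution:
  assumes "g \<in> carrier G"
  shows "(\<Sum>h\<in>carrier G. character \<rho> h * character \<rho> (inv\<^bsub>G\<^esub> h \<otimes>\<^bsub>G\<^esub> g)) =
    of_nat (card (carrier G)) / of_nat CARD('d) * character \<rho> g"
proof -
  have "(\<Sum>h\<in>carrier G. character \<rho> h * character \<rho> (inv\<^bsub>G\<^esub> h \<otimes>\<^bsub>G\<^esub> g)) =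
    (\<Sum>h\<in>carrier G. \<Sum>k\<in>UNIV. \<Sum>b\<in>UNIV. \<Sum>l\<in>UNIV. \<rho> g $ l $ b * (\<rho> h $ k $ k * \<rho> (inv\<^bsub>G\<^esub> h) $ b $ l))"
    using assms
    unfolding character_def trace_def sum_distrib_right
    by (intro sum.cong refl) (simp add: rep_mult sum_distrib_left mult_ac)
  also have "\<dots> = (\<Sum>k\<in>UNIV. \<Sum>b\<in>UNIV. \<Sum>l\<in>UNIV. \<rho> g $ l $ b * (\<Sum>h\<in>carrier G. \<rho> h $ k $ k * \<rho> (inv\<^bsub>G\<^esub> h) $ b $ l))"
    unfolding sum_distrib_left
    by (subst sum.swap, rule sum.cong[OF refl], subst sum.swap, rule sum.cong[OF refl], rule sum.swap)
  also have "\<dots> = (\<Sum>k\<in>UNIV. \<Sum>b\<in>UNIV. \<Sum>l\<in>UNIV. if k = b \<and> k = l then \<rho> g $ k $ k * (of_nat (card (carrier G)) / of_nat CARD('d)) else 0)"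
    unfolding schur_orthogonality by (intro sum.cong refl) auto
  also have "\<dots> = (\<Sum>k\<in>UNIV. \<rho> g $ k $ k * (of_nat (card (carrier G)) / of_nat CARD('d)))"
  proof (rule sum.cong[OF refl])
    fix k :: 'd
    have "(\<Sum>b\<in>UNIV. \<Sum>l\<in>UNIV. if k = b \<and> k = l then z else (0 :: complex)) = (\<Sum>b\<in>UNIV. if k = b then z else 0)" for z
      by (intro sum.cong refl) simp
    then show "(\<Sum>b\<in>UNIV. \<Sum>l\<in>UNIV. if k = b \<and> k = l then \<rho> g $ k $ k * (of_nat (card (carrier G)) / of_nat CARD('d)) else 0)
      = \<rho> g $ k $ k * (of_nat (card (carrier G)) / of_nat CARD('d))" by simp
  qed
  finally show ?thesis by (simp add: character_def trace_def sum_distrib_left mult.commute)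
qed

definition cadj :: "complex^'d^'d \<Rightarrow> complex^'d^'d" where
  "cadj A = (\<chi> i j. cnj (A $ j $ i))"

text \<open>The averaged Gram matrix intertwines the adjoint with the inverse.\<close>
lemma character_inv:
  assumes g: "g \<in> carrier G"
  shows "character \<rho> (inv\<^bsub>G\<^esub> g) = cnj (character \<rho> g)"
proof -
  define H :: "complex^'d^'d" where
    "H = (\<chi> i j. \<Sum>h\<in>carrier G. \<Sum>k\<in>UNIV. cnj (\<rho> h $ k $ i) * \<rho> h $ k $ j)"
  \<comment> \<open>The Hermitian form of \<open>H\<close> at \<open>v\<close> is the sum of the
    squared norms of all vectors \<open>\<rho> h *v v\<close>; it can vanish only if the summand at
    the unit, the squared norm of \<open>v\<close>, does.\<close>
  have "v = 0" if "H *v v = 0" for v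
  proof -
    have "0 = (\<Sum>i\<in>UNIV. cnj (v $ i) * (H *v v) $ i)" using that by simp
    also have "\<dots> = (\<Sum>i\<in>UNIV. \<Sum>j\<in>UNIV. \<Sum>h\<in>carrier G. \<Sum>k\<in>UNIV. cnj (v $ i) * cnj (\<rho> h $ k $ i) * (\<rho> h $ k $ j * v $ j))"
      by (simp add: matrix_vector_mult_def H_def sum_distrib_left sum_distrib_right mult_ac)
    also have "\<dots> = (\<Sum>h\<in>carrier G. \<Sum>k\<in>UNIV. \<Sum>i\<in>UNIV. \<Sum>j\<in>UNIV. cnj (v $ i) * cnj (\<rho> h $ k $ i) * (\<rho> h $ k $ j * v $ j))"
      by (rule sum_swap_pairs)
    also have "\<dots> = (\<Sum>h\<in>carrier G. \<Sum>k\<in>UNIV. cnj ((\<rho> h *v v) $ k) * (\<rho> h *v v) $ k)"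
      unfolding matrix_vector_mult_def vec_lambda_beta cnj_sum sum_product
      by (intro sum.cong refl) simp
    also have "\<dots> = of_real (\<Sum>h\<in>carrier G. \<Sum>k\<in>UNIV. (cmod ((\<rho> h *v v) $ k))\<^sup>2)"
      by (simp add: complex_norm_square mult.commute del: of_real_power)
    finally have "(\<Sum>h\<in>carrier G. \<Sum>k\<in>UNIV. (cmod ((\<rho> h *v v) $ k))\<^sup>2) = 0"
      by (rule of_real_eq_0_iff[THEN iffD1, OF sym])
    then have "(\<Sum>k\<in>UNIV. (cmod ((\<rho> h *v v) $ k))\<^sup>2) = 0" if "h \<in> carrier G" for h
      using fin that by (subst (asm) sum_nonneg_eq_0_iff) (auto intro: sum_nonneg)
    from this[OF one_closed] have "(\<Sum>k\<in>UNIV. (cmod (v $ k))\<^sup>2) = 0" by (simp add: rep_one)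
    then have "\<forall>k. v $ k = 0" by (subst (asm) sum_nonneg_eq_0_iff) auto
    then show ?thesis by (simp add: Finite_Cartesian_Product.vec_eq_iff)
  qed
  then obtain H' where "H' ** H = mat 1" using matrix_left_invertible_ker[of H] by blast
  then have HH': "H ** H' = mat 1" "H' ** H = mat 1" using matrix_left_right_inverse by blast+
  have inter: "cadj (\<rho> g) ** H = H ** \<rho> (inv\<^bsub>G\<^esub> g)"
  proof (subst Finite_Cartesian_Product.vec_eq_iff, rule allI, subst Finite_Cartesian_Product.vec_eq_iff, rule allI)
    fix i l
    have "(cadj (\<rho> g) ** H) $ i $ l = (\<Sum>h\<in>carrier G. \<Sum>k\<in>UNIV. (\<Sum>j\<in>UNIV. cnj (\<rho> g $ j $ i) * cnj (\<rho> h $ k $ j)) * \<rho> h $ k $ l)"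
      by (simp add: matrix_matrix_mult_def cadj_def H_def sum_distrib_left sum_distrib_right mult.assoc)
         (subst sum.swap, rule sum.cong[OF refl], rule sum.swap)
    also have "\<dots> = (\<Sum>h\<in>carrier G. \<Sum>k\<in>UNIV. cnj (\<rho> (h \<otimes>\<^bsub>G\<^esub> g) $ k $ i) * \<rho> h $ k $ l)"
      using g by (intro sum.cong refl) (simp add: rep_mult mult.commute)
    also have "\<dots> = (\<Sum>h\<in>carrier G. \<Sum>k\<in>UNIV. cnj (\<rho> (h \<otimes>\<^bsub>G\<^esub> g) $ k $ i) * \<rho> (h \<otimes>\<^bsub>G\<^esub> g \<otimes>\<^bsub>G\<^esub> inv\<^bsub>G\<^esub> g) $ k $ l)"
      using g by (intro sum.cong refl) (simp add: m_assoc)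
    also have "\<dots> = (\<Sum>h\<in>carrier G. \<Sum>k\<in>UNIV. cnj (\<rho> h $ k $ i) * \<rho> (h \<otimes>\<^bsub>G\<^esub> inv\<^bsub>G\<^esub> g) $ k $ l)"
      by (rule sum_carrier_right_mult[OF g])
    also have "\<dots> = (H ** \<rho> (inv\<^bsub>G\<^esub> g)) $ i $ l"
      using g by (simp add: matrix_matrix_mult_def H_def rep_mult sum_distrib_left sum_distrib_right mult.assoc)
        (rule trans[OF sum.cong[OF refl sum.swap] sum.swap])
    finally show "(cadj (\<rho> g) ** H) $ i $ l = (H ** \<rho> (inv\<^bsub>G\<^esub> g)) $ i $ l" .
  qed
  have "cnj (character \<rho> g) = trace (cadj (\<rho> g) ** (H ** H'))"
    by (simp add: HH' character_def trace_def cadj_def)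
  also have "\<dots> = trace (H ** \<rho> (inv\<^bsub>G\<^esub> g) ** H')" by (simp add: matrix_mul_assoc inter)
  also have "\<dots> = trace (H' ** (H ** \<rho> (inv\<^bsub>G\<^esub> g)))" by (rule trace_mul_sym)
  also have "\<dots> = character \<rho> (inv\<^bsub>G\<^esub> g)" by (simp add: matrix_mul_assoc HH' character_def)
  finally show ?thesis ..
qed

text \<open>The coefficients of the isotypic projection as an element of the group algebra. The two
  lemmas that follow state that this element is self-adjoint and idempotent.\<close>

definition coef :: "'g \<Rightarrow> complex" where
  "coef g = character \<rho> \<one>\<^bsub>G\<^esub> / of_nat (card (carrier G)) * cnj (character \<rho> g)"

lemma coef_inv: "g \<in> carrier G \<Longrightarrow> coef (inv\<^bsub>G\<^esub> g) = cnj (coef g)"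
  by (simp add: coef_def character_inv character_one)

lemma coef_convolution:
  assumes "g \<in> carrier G"
  shows "(\<Sum>h\<in>carrier G. coef h * coef (inv\<^bsub>G\<^esub> h \<otimes>\<^bsub>G\<^esub> g)) = coef g"
proof -
  define z :: complex where "z = of_nat CARD('d) / of_nat (card (carrier G))"
  have "(\<Sum>h\<in>carrier G. coef h * coef (inv\<^bsub>G\<^esub> h \<otimes>\<^bsub>G\<^esub> g)) =
     z\<^sup>2 * cnj (\<Sum>h\<in>carrier G. character \<rho> h * character \<rho> (inv\<^bsub>G\<^esub> h \<otimes>\<^bsub>G\<^esub> g))"
    by (simp add: coef_def character_one z_def[symmetric] sum_distrib_left power2_eq_square mult_ac)
  also have "\<dots> = coef g"
    unfolding character_convolution[OF assms]
    using card_carrier_pos by (simp add: coef_def character_one z_def power2_eq_square)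
  finally show ?thesis .
qed

end

section \<open>The Laplacian in coordinates\<close>

text \<open>The matrix of the boundary map in all degrees at once, for the orientations chosen by
  \<open>orient\<close>. In a simplicial complex the empty set is not a simplex, so vertices have
  boundary 0 as the non-augmented chain complex demands.\<close>

definition inc :: "'v set set \<Rightarrow> 'v set \<Rightarrow> 'v set \<Rightarrow> complex" where
  "inc L t s = (if t \<in> L \<and> s \<in> L then simplex_boundary (orient s) (orient t) else 0)"

definition nbrs :: "'v set set \<Rightarrow> 'v \<Rightarrow> 'v set" where
  "nbrs L u = {v. v \<noteq> u \<and> {u, v} \<in> L}"

lemma simplicial_cxD:
  assumes "simplicial_cx L" "s \<in> L"
  shows "s \<noteq> {}" "finite s" "t \<noteq> {} \<Longrightarrow> t \<subseteq> s \<Longrightarrow> t \<in> L" "s \<subseteq> verts L"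
proof -
  have *: "s \<noteq> {} \<and> finite s \<and> (\<forall>t. t \<noteq> {} \<and> t \<subseteq> s \<longrightarrow> t \<in> L)"
    using assms unfolding simplicial_cx_def by blast
  then show "s \<noteq> {}" "finite s" "t \<noteq> {} \<Longrightarrow> t \<subseteq> s \<Longrightarrow> t \<in> L" by blast+
  show "s \<subseteq> verts L"
  proof
    fix v assume "v \<in> s"
    then have "{v} \<noteq> {}" "{v} \<subseteq> s" by auto
    then show "v \<in> verts L" using * unfolding verts_def by blast
  qed
qed

lemma inc_nonzeroD:
  assumes "simplicial_cx L" "inc L t s \<noteq> 0"
  shows "t \<in> L" "s \<in> L" "\<exists>v. v \<notin> t \<and> s = insert v t"
proof -
  show "t \<in> L" "s \<in> L" using assms(2) by (auto simp: inc_def split: if_splits)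
  then have f: "finite t" "finite s" using simplicial_cxD(2)[OF assms(1)] by auto
  have "simplex_boundary (orient s) (orient t) \<noteq> 0" using assms(2) by (auto simp: inc_def split: if_splits)
  from simplex_boundary_nonzeroD(2)[OF orient(1)[OF f(2)] this] f
  show "\<exists>v. v \<notin> t \<and> s = insert v t" by (simp add: orient)
qed

lemma inc_cases: "simplicial_cx L \<Longrightarrow> inc L t s \<in> {-1, 0, 1}"
  using simplex_boundary_cases[OF orient(1), of s] simplicial_cxD(2)[of L s] by (auto simp: inc_def)

lemma kadj_inc:
  assumes "simplicial_cx L"
  shows "kadj (inc L) s t = inc L t s"
  using inc_cases[OF assms, of t s] by (auto simp: kadj_def)

context
  fixes L :: "'v set set" and D :: nat
  assumes cx: "simplicial_cx L" and deg: "vertex_degree_le L D"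
begin

lemma nbrs_bound:
  assumes "u \<in> verts L"
  shows "finite (nbrs L u)" "card (nbrs L u) \<le> D"
proof -
  have inj: "inj_on (\<lambda>v. {u, v}) (nbrs L u)" by (auto simp: inj_on_def nbrs_def doubleton_eq_iff)
  have sub: "(\<lambda>v. {u, v}) ` nbrs L u \<subseteq> edges_at L u" by (auto simp: nbrs_def edges_at_def)
  have e: "finite (edges_at L u)" "card (edges_at L u) \<le> D"
    using deg assms by (auto simp: vertex_degree_le_def)
  show "finite (nbrs L u)" using finite_imageD[OF finite_subset[OF sub e(1)] inj] .
  show "card (nbrs L u) \<le> D"
    using card_mono[OF e(1) sub] card_image[OF inj] e(2) by simp
qed

lemma simplex_subset_nbrs:
  assumes "s \<in> L" "u \<in> s"
  shows "s - {u} \<subseteq> nbrs L u" "u \<in> verts L"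
  using simplicial_cxD[OF cx assms(1)] assms(2) by (auto simp: nbrs_def)

lemma card_simplex_le:
  assumes "s \<in> L"
  shows "card s \<le> D + 1"
proof -
  note s = simplicial_cxD[OF cx assms]
  obtain u where u: "u \<in> s" using s(1) by blast
  have "card (s - {u}) \<le> D"
    using card_mono[OF nbrs_bound(1) simplex_subset_nbrs(1)[OF assms u]] nbrs_bound(2)
      simplex_subset_nbrs(2)[OF assms u] by fastforce
  then show ?thesis using u s(2) by simp
qed

text \<open>Removing \<open>u\<close> from a simplex through \<open>u\<close> leaves a set of
  neighbours of \<open>u\<close>, and there are at most \<open>D\<close> of these.\<close>

lemma card_star_le:
  assumes "u \<in> verts L"
  shows "finite {s \<in> L. u \<in> s}" "card {s \<in> L. u \<in> s} \<le> 2 ^ D"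
proof -
  note n = nbrs_bound[OF assms]
  have inj: "inj_on (\<lambda>s. s - {u}) {s \<in> L. u \<in> s}" by (rule inj_onI) (metis (mono_tags) insert_Diff mem_Collect_eq)
  have sub: "(\<lambda>s. s - {u}) ` {s \<in> L. u \<in> s} \<subseteq> Pow (nbrs L u)" using simplex_subset_nbrs by auto
  show "finite {s \<in> L. u \<in> s}" using finite_imageD[OF finite_subset[OF sub] inj] n by simp
  have "card {s \<in> L. u \<in> s} \<le> card (Pow (nbrs L u))"
    using card_mono[OF _ sub] card_image[OF inj] n(1) by simp
  also have "\<dots> \<le> 2 ^ D" using n by (simp add: card_Pow)
  finally show "card {s \<in> L. u \<in> s} \<le> 2 ^ D" .
qed

text \<open>A coface of \<open>t\<close> adds a neighbour of any fixed vertex of \<open>t\<close>,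
  which leaves at most \<open>D\<close> choices; a face of \<open>s\<close> drops one of at most
  \<open>D + 1\<close> vertices.\<close>

lemma band_inc: "band D (D + 1) (inc L)"
  unfolding band_def
proof (intro conjI allI)
  fix t s
  show "cmod (inc L t s) \<le> 1" using inc_cases[OF cx, of t s] by auto
next
  fix t
  have "finite {s. inc L t s \<noteq> 0} \<and> card {s. inc L t s \<noteq> 0} \<le> D"
  proof (cases "t \<in> L")
    case True
    then obtain u where u: "u \<in> t" using simplicial_cxD(1)[OF cx] by blast
    note v = simplex_subset_nbrs(2)[OF True u]
    have sub: "{s. inc L t s \<noteq> 0} \<subseteq> (\<lambda>v. insert v t) ` nbrs L u"
    proof
      fix s assume "s \<in> {s. inc L t s \<noteq> 0}"
      then obtain v where "s \<in> L" "v \<notin> t" "s = insert v t" using inc_nonzeroD[OF cx, of t s] by auto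
      then show "s \<in> (\<lambda>v. insert v t) ` nbrs L u" using simplex_subset_nbrs(1)[of s u] u by auto
    qed
    have "card {s. inc L t s \<noteq> 0} \<le> card (nbrs L u)"
      using card_mono[OF _ sub] card_image_le[OF nbrs_bound(1)[OF v], of "\<lambda>v. insert v t"] nbrs_bound(1)[OF v] by simp
    then show ?thesis using nbrs_bound[OF v] finite_subset[OF sub] by simp
  next
    case False
    then show ?thesis by (simp add: inc_def)
  qed
  then show "finite {s. inc L t s \<noteq> 0}" "card {s. inc L t s \<noteq> 0} \<le> D" by auto
next
  fix s
  have "finite {t. inc L t s \<noteq> 0} \<and> card {t. inc L t s \<noteq> 0} \<le> D + 1"
  proof (cases "s \<in> L")
    case True
    have sub: "{t. inc L t s \<noteq> 0} \<subseteq> (\<lambda>v. s - {v}) ` s"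
    proof
      fix t assume "t \<in> {t. inc L t s \<noteq> 0}"
      then obtain v where "v \<notin> t" "s = insert v t" using inc_nonzeroD[OF cx, of t s] by auto
      then show "t \<in> (\<lambda>v. s - {v}) ` s" by auto
    qed
    have "card {t. inc L t s \<noteq> 0} \<le> card s"
      using card_mono[OF _ sub] card_image_le[of s "\<lambda>v. s - {v}"] simplicial_cxD(2)[OF cx True] by simp
    then show ?thesis using card_simplex_le[OF True] finite_subset[OF sub] simplicial_cxD(2)[OF cx True] by simp
  next
    case False
    then show ?thesis by (simp add: inc_def)
  qed
  then show "finite {t. inc L t s \<noteq> 0}" "card {t. inc L t s \<noteq> 0} \<le> D + 1" by auto
qed

end

section \<open>The Laplacian as a bounded positive operator\<close>

definition lapl :: "'v set set \<Rightarrow> ('v set \<Rightarrow> complex) \<Rightarrow> 'v set \<Rightarrow> complex" where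
  "lapl L f = (\<lambda>s. kop (inc L) (kop (kadj (inc L)) f) s + kop (kadj (inc L)) (kop (inc L) f) s)"

text \<open>Each of the two halves of the Laplacian has norm at most D (D + 1) by
  \<open>band_inc\<close> and \<open>kop_bounded\<close>. For positive \<open>D\<close> the constant
  is at least 1, so that its logarithm is nonnegative in the eigenvalue count.\<close>

definition lapl_bound :: "nat \<Rightarrow> real" where
  "lapl_bound D = 2 * real (D * (D + 1))"

text \<open>One explicit time step of the discrete heat equation, with a step size that depends on
  the degree bound only.\<close>

definition heat :: "nat \<Rightarrow> 'v set set \<Rightarrow> ('v set \<Rightarrow> complex) \<Rightarrow> 'v set \<Rightarrow> complex" where
  "heat D L f = (\<lambda>s. f s - of_real (1 / lapl_bound D) * lapl L f s)"

lemma lapl_add: "lapl L (\<lambda>i. f i + g i) = (\<lambda>i. lapl L f i + lapl L g i)"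
  unfolding lapl_def kop_add by (simp add: add_ac)

lemma lapl_scale: "lapl L (\<lambda>i. c * f i) = (\<lambda>i. c * lapl L f i)"
  unfolding lapl_def kop_scale by (simp add: algebra_simps)

lemma lapl_tendsto:
  assumes "\<And>s. (\<lambda>m. f m s) \<longlonglongrightarrow> g s"
  shows "(\<lambda>m. lapl L (f m) t) \<longlonglongrightarrow> lapl L g t"
  unfolding lapl_def by (rule tendsto_add; rule kop_tendsto; rule kop_tendsto; rule assms)

lemma lapl_bound_ge: "0 < D \<Longrightarrow> 1 \<le> lapl_bound D"
proof -
  assume "0 < D"
  then have "1 \<le> D * (D + 1)" by simp
  then have "1 \<le> real (D * (D + 1))" using of_nat_mono[of 1 "D * (D + 1)", where 'a = real] by simp
  then show ?thesis unfolding lapl_bound_def by linarith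
qed

context
  fixes L :: "'v set set" and D :: nat
  assumes cx: "simplicial_cx L" and deg: "vertex_degree_le L D" and D: "0 < D"
begin

lemma kop_inc_bounded:
  assumes "ell2 f"
  shows "ell2 (kop (inc L) f)" "norm2 (kop (inc L) f) \<le> real (D * (D + 1)) * norm2 f"
    "ell2 (kop (kadj (inc L)) f)" "norm2 (kop (kadj (inc L)) f) \<le> real (D * (D + 1)) * norm2 f"
  using kop_bounded[OF band_inc[OF cx deg] assms] kop_bounded[OF band_kadj[OF band_inc[OF cx deg]] assms]
  by (auto simp: mult.commute)

lemma ell2_lapl: "ell2 f \<Longrightarrow> ell2 (lapl L f)"
  unfolding lapl_def by (intro ell2_add kop_inc_bounded)

lemma inner_lapl:
  assumes "ell2 f" "ell2 g"
  shows "ell2_inner (lapl L f) g = ell2_inner (kop (kadj (inc L)) f) (kop (kadj (inc L)) g) +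
    ell2_inner (kop (inc L) f) (kop (inc L) g)"
  unfolding lapl_def
    ell2_inner_add_left[OF kop_inc_bounded(1)[OF kop_inc_bounded(3)[OF assms(1)]]
      kop_inc_bounded(3)[OF kop_inc_bounded(1)[OF assms(1)]] assms(2)]
    kop_adjoint[OF band_inc[OF cx deg] kop_inc_bounded(3)[OF assms(1)] assms(2)]
    kop_adjoint[OF band_kadj[OF band_inc[OF cx deg]] kop_inc_bounded(1)[OF assms(1)] assms(2)]
  by simp

lemma lapl_self_adjoint:
  assumes "ell2 f" "ell2 g"
  shows "ell2_inner (lapl L f) g = ell2_inner f (lapl L g)"
proof -
  have "cnj (ell2_inner (lapl L g) f) = ell2_inner (lapl L f) g"
    unfolding inner_lapl[OF assms] inner_lapl[OF assms(2,1)] by (simp add: ell2_inner_cnj)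
  then show ?thesis by (simp add: ell2_inner_cnj)
qed

lemma inner_lapl_self:
  assumes "ell2 f"
  shows "Re (ell2_inner (lapl L f) f) = norm2 (kop (kadj (inc L)) f) + norm2 (kop (inc L) f)"
  unfolding inner_lapl[OF assms assms] ell2_inner_self by simp

text \<open>The operator inequality \<Delta>^2 \<le> c \<Delta>. The factor 2 of
  \<open>lapl_bound\<close> enters through |x + y|^2 \<le> 2 |x|^2 + 2 |y|^2, applied to the two
  halves of the Laplacian.\<close>

lemma norm2_lapl_le:
  assumes "ell2 f"
  shows "norm2 (lapl L f) \<le> lapl_bound D * Re (ell2_inner (lapl L f) f)"
proof -
  note b = kop_inc_bounded[OF assms]
  have "norm2 (lapl L f) \<le> 2 * norm2 (kop (inc L) (kop (kadj (inc L)) f)) + 2 * norm2 (kop (kadj (inc L)) (kop (inc L) f))"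
    unfolding lapl_def by (intro norm2_add_le kop_inc_bounded b)
  also have "\<dots> \<le> 2 * (real (D * (D + 1)) * norm2 (kop (kadj (inc L)) f)) + 2 * (real (D * (D + 1)) * norm2 (kop (inc L) f))"
    by (intro add_mono mult_left_mono kop_inc_bounded b) auto
  also have "\<dots> = lapl_bound D * Re (ell2_inner (lapl L f) f)"
    unfolding inner_lapl_self[OF assms] lapl_bound_def by (simp only: distrib_left mult.assoc)
  finally show ?thesis .
qed

lemma inner_lapl_le:
  assumes "ell2 f"
  shows "0 \<le> Re (ell2_inner (lapl L f) f)" "Re (ell2_inner (lapl L f) f) \<le> lapl_bound D * norm2 f"
proof -
  have "lapl_bound D * norm2 f = real (D * (D + 1)) * norm2 f + real (D * (D + 1)) * norm2 f"
    unfolding lapl_bound_def by simp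
  then show "Re (ell2_inner (lapl L f) f) \<le> lapl_bound D * norm2 f"
    using kop_inc_bounded(2,4)[OF assms] unfolding inner_lapl_self[OF assms] by linarith
qed (simp add: inner_lapl_self[OF assms])

text \<open>For T = 1 - \<Delta>/c the axiom T^2 \<le> T is \<Delta>^2 \<le> c \<Delta>, and T \<le>
  1 is \<Delta> \<ge> 0.\<close>

lemma positive_contraction_heat: "positive_contraction (heat D L)"
proof
  define c where "c = lapl_bound D"
  have c: "0 < c" using lapl_bound_ge[OF D] by (simp add: c_def)
  have h: "heat D L f = (\<lambda>s. f s - of_real (1 / c) * lapl L f s)" for f
    by (simp add: heat_def c_def)
  fix f g :: "'v set \<Rightarrow> complex" and z :: complex
  show "heat D L (\<lambda>i. f i + g i) = (\<lambda>i. heat D L f i + heat D L g i)"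
    unfolding h lapl_add by (simp add: algebra_simps)
  show "heat D L (\<lambda>i. z * f i) = (\<lambda>i. z * heat D L f i)"
    unfolding h lapl_scale by (simp add: algebra_simps)
  { assume f: "ell2 f"
    have e: "ell2 (\<lambda>s. of_real (1 / c) * lapl L f s)" by (intro ell2_scale ell2_lapl f)
    show "ell2 (heat D L f)" unfolding h by (intro ell2_diff f e)
    define x where "x = Re (ell2_inner (lapl L f) f)"
    have inner: "Re (ell2_inner (heat D L f) f) = norm2 f - x / c"
      unfolding h ell2_inner_diff_left[OF f e f] ell2_inner_scale_left ell2_inner_self x_def
      by (simp add: Re_divide_of_real)
    have "Re (ell2_inner f (\<lambda>s. of_real (1 / c) * lapl L f s)) = x / c"
      unfolding ell2_inner_scale_right x_def lapl_self_adjoint[OF f f] by (simp add: Re_divide_of_real)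
    then have "norm2 (heat D L f) = norm2 f - 2 * (x / c) + norm2 (lapl L f) / c\<^sup>2"
      unfolding h norm2_diff[OF f e] norm2_scale using c by (simp add: power_divide norm_divide)
    also have "norm2 (lapl L f) / c\<^sup>2 \<le> c * x / c\<^sup>2"
      using norm2_lapl_le[OF f] c by (intro divide_right_mono) (auto simp: c_def x_def)
    also have "c * x / c\<^sup>2 = x / c" using c by (simp add: power2_eq_square)
    finally show "norm2 (heat D L f) \<le> Re (ell2_inner (heat D L f) f)" unfolding inner by simp
    show "Re (ell2_inner (heat D L f) f) \<le> norm2 f"
      unfolding inner using inner_lapl_le(1)[OF f] c by (simp add: x_def)
    assume g: "ell2 g"
    show "ell2_inner (heat D L f) g = ell2_inner f (heat D L g)"
      unfolding h ell2_inner_diff_left[OF f e g] ell2_inner_diff_right[OF g ell2_scale[OF ell2_lapl[OF g]] f]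
        ell2_inner_scale_left ell2_inner_scale_right lapl_self_adjoint[OF f g] by simp }
next
  fix F :: "nat \<Rightarrow> 'v set \<Rightarrow> complex" and f i
  assume "\<And>i. (\<lambda>m. F m i) \<longlonglongrightarrow> f i"
  then show "(\<lambda>m. heat D L (F m) i) \<longlonglongrightarrow> heat D L f i"
    unfolding heat_def by (intro tendsto_diff tendsto_mult tendsto_const lapl_tendsto)
qed

lemma heat_fixed_iff: "heat D L f = f \<longleftrightarrow> lapl L f = (\<lambda>_. 0)"
  using lapl_bound_ge[OF D] by (auto simp: heat_def fun_eq_iff)

end

section \<open>Transport and localization\<close>

text \<open>Since \<open>orient\<close> is an arbitrary choice, even an automorphism need not
  preserve it; this is the resulting sign.\<close>

definition eps :: "('v \<Rightarrow> 'w) \<Rightarrow> 'v set \<Rightarrow> complex" where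
  "eps \<phi> s = elem_chain (orient (\<phi> ` s)) (map \<phi> (orient s))"

lemma eps_cases:
  assumes "finite s" "inj_on \<phi> s"
  shows "eps \<phi> s \<in> {-1, 1}"
  unfolding eps_def by (rule elem_chain_nonzero) (use assms in \<open>auto simp: orient distinct_map\<close>)

lemma eps_square [simp]:
  assumes "finite s" "inj_on \<phi> s"
  shows "eps \<phi> s * eps \<phi> s = 1"
  using eps_cases[OF assms] by auto

lemma cnj_eps: "finite s \<Longrightarrow> inj_on \<phi> s \<Longrightarrow> cnj (eps \<phi> s) = eps \<phi> s"
  using eps_cases[of s \<phi>] by auto

lemma eps_cong:
  assumes "finite s" "\<And>v. v \<in> s \<Longrightarrow> \<phi> v = \<psi> v"
  shows "eps \<phi> s = eps \<psi> s"
proof -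
  have "map \<phi> (orient s) = map \<psi> (orient s)" using assms by (simp add: orient)
  moreover have "\<phi> ` s = \<psi> ` s" using assms by auto
  ultimately show ?thesis unfolding eps_def by (simp only:)
qed

lemma eps_comp:
  assumes "finite s" "inj_on \<phi> s" "inj_on \<psi> (\<phi> ` s)"
  shows "eps (\<psi> \<circ> \<phi>) s = eps \<psi> (\<phi> ` s) * eps \<phi> s"
proof -
  have fin: "finite (\<phi> ` s)" "finite (\<psi> ` \<phi> ` s)" using assms by auto
  have "eps \<phi> s = elem_chain (map \<psi> (orient (\<phi> ` s))) (map \<psi> (map \<phi> (orient s)))"
    unfolding eps_def by (rule elem_chain_map[symmetric]) (use assms fin in \<open>auto simp: orient\<close>)
  moreover have "elem_chain (orient (\<psi> ` \<phi> ` s)) (map \<psi> (orient (\<phi> ` s))) *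
      elem_chain (map \<psi> (orient (\<phi> ` s))) (map \<psi> (map \<phi> (orient s))) =
      elem_chain (orient (\<psi> ` \<phi> ` s)) (map \<psi> (map \<phi> (orient s)))"
    by (rule elem_chain_trans) (use assms fin in \<open>auto simp: orient distinct_map\<close>)
  ultimately show ?thesis by (simp add: eps_def image_comp)
qed

lemma inc_image:
  assumes cx: "simplicial_cx L" and inj: "inj_on \<phi> (verts L)" and s: "s \<in> L" and t: "t \<in> L"
  shows "inc ((`) \<phi> ` L) (\<phi> ` t) (\<phi> ` s) = eps \<phi> t * eps \<phi> s * inc L t s"
proof -
  note s' = simplicial_cxD(2,4)[OF cx s] and t' = simplicial_cxD(2,4)[OF cx t]
  have inj': "inj_on \<phi> s" "inj_on \<phi> t" "inj_on \<phi> (s \<union> t)"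
    using s' t' inj by (auto intro: inj_on_subset)
  have "simplex_boundary (orient (\<phi> ` s)) (orient (\<phi> ` t)) =
      elem_chain (orient (\<phi> ` s)) (map \<phi> (orient s)) * simplex_boundary (map \<phi> (orient s)) (orient (\<phi> ` t))"
    by (rule simplex_boundary_reorder_left) (use s' inj' in \<open>auto simp: orient distinct_map\<close>)
  also have "simplex_boundary (map \<phi> (orient s)) (orient (\<phi> ` t)) =
      simplex_boundary (map \<phi> (orient s)) (map \<phi> (orient t)) * elem_chain (map \<phi> (orient t)) (orient (\<phi> ` t))"
    by (rule simplex_boundary_reorder_right) (use s' t' inj' in \<open>auto simp: orient distinct_map\<close>)
  also have "elem_chain (map \<phi> (orient t)) (orient (\<phi> ` t)) = eps \<phi> t"
    unfolding eps_def by (rule elem_chain_sym) (use t' inj' in \<open>auto simp: orient distinct_map\<close>)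
  also have "simplex_boundary (map \<phi> (orient s)) (map \<phi> (orient t)) = simplex_boundary (orient s) (orient t)"
    by (rule simplex_boundary_map) (use s' t' inj' in \<open>auto simp: orient\<close>)
  finally show ?thesis using s t by (simp add: inc_def eps_def)
qed

text \<open>The push-forward of chains along a simplicial isomorphism, as a relation so that no
  preimages have to be chosen.\<close>

definition transported :: "('v \<Rightarrow> 'w) \<Rightarrow> 'v set set \<Rightarrow> ('v set \<Rightarrow> complex) \<Rightarrow> ('w set \<Rightarrow> complex) \<Rightarrow> bool" where
  "transported \<phi> L f f' \<longleftrightarrow> (\<forall>s\<in>L. f' (\<phi> ` s) = eps \<phi> s * f s) \<and> (\<forall>s. s \<notin> L \<longrightarrow> f s = 0) \<and>
     (\<forall>s. s \<notin> (`) \<phi> ` L \<longrightarrow> f' s = 0)"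

text \<open>The kernel carries the signs of \<open>s\<close> and \<open>t\<close>, the function the
  sign of \<open>s\<close>. The two signs at the summation index cancel and the sign at
  \<open>t\<close> remains.\<close>

lemma transported_kop:
  assumes L: "\<And>s. s \<in> L \<Longrightarrow> finite s \<and> inj_on \<phi> s" "inj_on ((`) \<phi>) L"
    and k: "\<And>s t. s \<in> L \<Longrightarrow> t \<in> L \<Longrightarrow> k' (\<phi> ` t) (\<phi> ` s) = eps \<phi> t * eps \<phi> s * k t s"
    and supp: "\<And>s t. s \<notin> L \<or> t \<notin> L \<Longrightarrow> k t s = 0" "\<And>s t. s \<notin> (`) \<phi> ` L \<or> t \<notin> (`) \<phi> ` L \<Longrightarrow> k' t s = 0"
    and f: "transported \<phi> L f f'"
  shows "transported \<phi> L (kop k f) (kop k' f')"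
  unfolding transported_def
proof (intro conjI ballI allI impI)
  fix t assume t: "t \<in> L"
  have nz: "eps \<phi> s \<noteq> 0" if "s \<in> L" for s using eps_cases L(1)[OF that] by fastforce
  have eq: "{s'. k' (\<phi> ` t) s' \<noteq> 0} = (`) \<phi> ` {s. k t s \<noteq> 0}"
  proof (intro equalityI subsetI)
    fix s' assume "s' \<in> {s'. k' (\<phi> ` t) s' \<noteq> 0}"
    then have s'_nz: "k' (\<phi> ` t) s' \<noteq> 0" by simp
    then have "s' \<in> (`) \<phi> ` L" using supp(2)[of s' "\<phi> ` t"] by argo
    then obtain s where s: "s' = \<phi> ` s" "s \<in> L" by (rule imageE)
    then have "k t s \<noteq> 0" using k[of s t] t s'_nz by auto
    with s show "s' \<in> (`) \<phi> ` {s. k t s \<noteq> 0}" by blast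
  next
    fix s' assume "s' \<in> (`) \<phi> ` {s. k t s \<noteq> 0}"
    then obtain s where s: "k t s \<noteq> 0" "s' = \<phi> ` s" by blast
    then have "s \<in> L" using supp(1)[of s t] by argo
    then show "s' \<in> {s'. k' (\<phi> ` t) s' \<noteq> 0}" using k[of s t] t s nz by simp
  qed
  have sub: "{s. k t s \<noteq> 0} \<subseteq> L" using supp(1)[of _ t] by auto
  have "kop k' f' (\<phi> ` t) = (\<Sum>s | k t s \<noteq> 0. k' (\<phi> ` t) (\<phi> ` s) * f' (\<phi> ` s))"
    unfolding kop_def eq by (rule sum.reindex[OF inj_on_subset[OF L(2) sub], unfolded o_def])
  also have "\<dots> = (\<Sum>s | k t s \<noteq> 0. eps \<phi> t * (k t s * f s))"
  proof (rule sum.cong[OF refl])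
    fix s assume "s \<in> {s. k t s \<noteq> 0}"
    then have s: "s \<in> L" using sub by blast
    have "f' (\<phi> ` s) = eps \<phi> s * f s" using f s by (simp add: transported_def)
    then have "k' (\<phi> ` t) (\<phi> ` s) * f' (\<phi> ` s) = (eps \<phi> s * eps \<phi> s) * (eps \<phi> t * (k t s * f s))"
      unfolding k[OF s t] by (simp only: mult_ac)
    also have "\<dots> = eps \<phi> t * (k t s * f s)" using L(1)[OF s] by (simp del: mult.assoc)
    finally show "k' (\<phi> ` t) (\<phi> ` s) * f' (\<phi> ` s) = eps \<phi> t * (k t s * f s)" .
  qed
  finally show "kop k' f' (\<phi> ` t) = eps \<phi> t * kop k f t" by (simp add: kop_def sum_distrib_left)
next
  fix t assume "t \<notin> L"
  then show "kop k f t = 0" unfolding kop_def using supp(1) by simp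
next
  fix t assume "t \<notin> (`) \<phi> ` L"
  then show "kop k' f' t = 0" unfolding kop_def using supp(2) by simp
qed

lemma inj_on_image_simplices:
  assumes "simplicial_cx L" "inj_on \<phi> (verts L)"
  shows "inj_on ((`) \<phi>) L"
proof (rule inj_onI)
  fix s t assume "s \<in> L" "t \<in> L" "\<phi> ` s = \<phi> ` t"
  then show "s = t"
    using inj_on_image_eq_iff[OF assms(2)] simplicial_cxD(4)[OF assms(1)] by blast
qed

context
  fixes L :: "'v set set" and \<phi> :: "'v \<Rightarrow> 'w"
  assumes cx: "simplicial_cx L" and inj: "inj_on \<phi> (verts L)"
begin

lemma simplex_inj: "s \<in> L \<Longrightarrow> finite s \<and> inj_on \<phi> s"
  using simplicial_cxD(2,4)[OF cx] inj by (auto intro: inj_on_subset)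

lemma transported_lapl:
  assumes "transported \<phi> L f f'"
  shows "transported \<phi> L (lapl L f) (lapl ((`) \<phi> ` L) f')"
proof -
  have d: "transported \<phi> L (kop (inc L) f) (kop (inc ((`) \<phi> ` L)) f')" if "transported \<phi> L f f'" for f f'
    by (rule transported_kop[OF simplex_inj inj_on_image_simplices[OF cx inj] inc_image[OF cx inj] _ _ that])
       (auto simp: inc_def)
  have u: "transported \<phi> L (kop (kadj (inc L)) f) (kop (kadj (inc ((`) \<phi> ` L))) f')" if "transported \<phi> L f f'" for f f'
  proof (rule transported_kop[OF simplex_inj inj_on_image_simplices[OF cx inj] _ _ _ that])
    fix s t assume st: "s \<in> L" "t \<in> L"
    show "kadj (inc ((`) \<phi> ` L)) (\<phi> ` t) (\<phi> ` s) = eps \<phi> t * eps \<phi> s * kadj (inc L) t s"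
      using simplex_inj[OF st(1)] simplex_inj[OF st(2)]
      unfolding kadj_def inc_image[OF cx inj st(2,1)] by (simp add: cnj_eps mult.commute)
  qed (auto simp: kadj_def inc_def)
  show ?thesis using d[OF u[OF assms]] u[OF d[OF assms]]
    unfolding transported_def lapl_def by (simp add: distrib_left)
qed

lemma transported_heat:
  assumes "transported \<phi> L f f'"
  shows "transported \<phi> L (heat D L f) (heat D ((`) \<phi> ` L) f')"
  using assms transported_lapl[OF assms] unfolding transported_def heat_def
  by (simp add: right_diff_distrib)

lemma transported_heat_pow:
  "transported \<phi> L f f' \<Longrightarrow> transported \<phi> L ((heat D L ^^ m) f) ((heat D ((`) \<phi> ` L) ^^ m) f')"
  by (induction m) (auto intro: transported_heat)

lemma transported_delta:
  assumes "s \<in> L"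
  shows "transported \<phi> L (delta s) (\<lambda>t. eps \<phi> s * delta (\<phi> ` s) t)"
  using assms inj_on_image_simplices[OF cx inj] unfolding transported_def delta_def
  by (auto simp: inj_on_eq_iff)

end

section \<open>Finite propagation\<close>

lemma kop_cong:
  assumes "band p q b" "band p' q' b'" "\<And>s. f s \<noteq> 0 \<Longrightarrow> b t s = b' t s"
  shows "kop b f t = kop b' f t"
  unfolding kop_infsum[OF assms(1)] kop_infsum[OF assms(2)]
  using assms(3) by (intro infsum_cong) (metis mult_zero_right)

context
  fixes L :: "'v set set" and D :: nat
  assumes cx: "simplicial_cx L" and deg: "vertex_degree_le L D"
begin

lemma simplicial_cx_restrict:
  assumes "s \<in> L" "s \<subseteq> W"
  shows "simplicial_cx {s \<in> L. s \<subseteq> W}"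
  unfolding simplicial_cx_def
proof (intro conjI ballI allI impI)
  show "{s \<in> L. s \<subseteq> W} \<noteq> {}" using assms by blast
  fix s assume s: "s \<in> {s \<in> L. s \<subseteq> W}"
  then show "s \<noteq> {}" "finite s" using simplicial_cxD[OF cx] by auto
  fix t assume t: "t \<noteq> {} \<and> t \<subseteq> s"
  then have "t \<in> L" using simplicial_cxD(3)[OF cx] s by blast
  then show "t \<in> {s \<in> L. s \<subseteq> W}" using t s by blast
qed

lemma vertex_degree_le_restrict: "vertex_degree_le {s \<in> L. s \<subseteq> W} D"
  unfolding vertex_degree_le_def
proof
  fix v assume "v \<in> verts {s \<in> L. s \<subseteq> W}"
  then have "v \<in> verts L" by (simp add: verts_def)
  then have e: "finite (edges_at L v)" "card (edges_at L v) \<le> D" using deg by (auto simp: vertex_degree_le_def)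
  have sub: "edges_at {s \<in> L. s \<subseteq> W} v \<subseteq> edges_at L v" by (auto simp: edges_at_def)
  show "finite (edges_at {s \<in> L. s \<subseteq> W} v) \<and> card (edges_at {s \<in> L. s \<subseteq> W} v) \<le> D"
    using finite_subset[OF sub e(1)] card_mono[OF e(1) sub] e(2) by simp
qed

text \<open>Passing to a coface adds one neighbour of the support, passing to a face adds nothing,
  so one application of the Laplacian enlarges \<open>X\<close> to \<open>Y\<close> at most. If
  \<open>Y\<close> still lies in \<open>W\<close>, the full subcomplex on \<open>W\<close> contains
  all faces and cofaces that occur.\<close>

lemma lapl_restrict:
  assumes f: "\<And>s. f s \<noteq> 0 \<Longrightarrow> s \<in> L \<and> s \<subseteq> X" and XY: "X \<subseteq> Y" "\<And>v. v \<in> X \<Longrightarrow> nbrs L v \<subseteq> Y"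
  shows "lapl L f s \<noteq> 0 \<Longrightarrow> s \<in> L \<and> s \<subseteq> Y"
    and "Y \<subseteq> W \<Longrightarrow> \<exists>s\<in>L. s \<subseteq> W \<Longrightarrow> lapl {s \<in> L. s \<subseteq> W} f = lapl L f"
proof -
  note b = band_inc[OF cx deg]
  have kop_nz: "\<exists>s. k t s \<noteq> 0 \<and> f s \<noteq> 0" if "kop k f t \<noteq> 0" for k :: "'v set \<Rightarrow> 'v set \<Rightarrow> complex" and f t
  proof (rule ccontr)
    assume "\<not> ?thesis"
    then have "k t s * f s = 0" for s by auto
    then show False using that unfolding kop_def by simp
  qed
  have up: "s \<in> L \<and> s \<subseteq> Y" if ts: "inc L t s \<noteq> 0" "t \<in> L" "t \<subseteq> X" for t s
  proof -
    obtain v where v: "s \<in> L" "v \<notin> t" "s = insert v t" using inc_nonzeroD[OF cx ts(1)] by blast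
    obtain u where u: "u \<in> t" using simplicial_cxD(1)[OF cx ts(2)] by blast
    have "v \<in> nbrs L u" using simplex_subset_nbrs(1)[OF cx deg v(1), of u] u v by auto
    then show ?thesis using v u ts(3) XY by blast
  qed
  have down: "t \<in> L \<and> t \<subseteq> s" if "inc L t s \<noteq> 0" for t s using inc_nonzeroD[OF cx that] by blast
  have bd: "t \<in> L \<and> t \<subseteq> X" if "kop (inc L) f t \<noteq> 0" for t
    using kop_nz[OF that] f down by blast
  have cobd: "s \<in> L \<and> s \<subseteq> Y" if "kop (kadj (inc L)) f s \<noteq> 0" for s
  proof -
    from kop_nz[OF that] obtain t where "kadj (inc L) s t \<noteq> 0" "f t \<noteq> 0" by blast
    then show ?thesis using up[of t s] f[of t] by (auto simp: kadj_def)
  qed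
  show "s \<in> L \<and> s \<subseteq> Y" if "lapl L f s \<noteq> 0"
  proof (cases "kop (inc L) (kop (kadj (inc L)) f) s = 0")
    case True
    then have "kop (kadj (inc L)) (kop (inc L) f) s \<noteq> 0" using that by (auto simp: lapl_def)
    then obtain t where "kadj (inc L) s t \<noteq> 0" "kop (inc L) f t \<noteq> 0" using kop_nz by blast
    then show ?thesis using up[of t s] bd[of t] by (auto simp: kadj_def)
  next
    case False
    then obtain t where "inc L s t \<noteq> 0" "kop (kadj (inc L)) f t \<noteq> 0" using kop_nz by blast
    then show ?thesis using down[of s t] cobd[of t] by auto
  qed
  assume YW: "Y \<subseteq> W" and "\<exists>s\<in>L. s \<subseteq> W"
  then have cx': "simplicial_cx {s \<in> L. s \<subseteq> W}" using simplicial_cx_restrict by blast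
  note b' = band_inc[OF cx' vertex_degree_le_restrict]
  have same: "inc {s \<in> L. s \<subseteq> W} t s = inc L t s" if "s \<subseteq> W" for t s
  proof (cases "inc L t s = 0")
    case True
    then show ?thesis by (auto simp: inc_def)
  next
    case False
    then show ?thesis using down[OF False] that by (auto simp: inc_def)
  qed
  have same': "inc {s \<in> L. s \<subseteq> W} t s = inc L t s" if "t \<in> L" "t \<subseteq> X" for t s
  proof (cases "inc L t s = 0")
    case True
    then show ?thesis by (auto simp: inc_def)
  next
    case False
    then show ?thesis using up[OF False that] YW by (intro same) auto
  qed
  have XW: "X \<subseteq> W" using XY YW by blast
  have 1: "kop (inc {s \<in> L. s \<subseteq> W}) f = kop (inc L) f"
  proof
    fix t show "kop (inc {s \<in> L. s \<subseteq> W}) f t = kop (inc L) f t"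
      by (rule kop_cong[OF b' b], rule same) (use f XW in blast)
  qed
  have 2: "kop (kadj (inc {s \<in> L. s \<subseteq> W})) f = kop (kadj (inc L)) f"
  proof
    fix t show "kop (kadj (inc {s \<in> L. s \<subseteq> W})) f t = kop (kadj (inc L)) f t"
      by (rule kop_cong[OF band_kadj[OF b'] band_kadj[OF b]]) (use same' f in \<open>auto simp: kadj_def\<close>)
  qed
  have 3: "kop (inc {s \<in> L. s \<subseteq> W}) (kop (kadj (inc L)) f) = kop (inc L) (kop (kadj (inc L)) f)"
  proof
    fix t show "kop (inc {s \<in> L. s \<subseteq> W}) (kop (kadj (inc L)) f) t = kop (inc L) (kop (kadj (inc L)) f) t"
      by (rule kop_cong[OF b' b], rule same) (use cobd YW in blast)
  qed
  have 4: "kop (kadj (inc {s \<in> L. s \<subseteq> W})) (kop (inc L) f) = kop (kadj (inc L)) (kop (inc L) f)"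
  proof
    fix t show "kop (kadj (inc {s \<in> L. s \<subseteq> W})) (kop (inc L) f) t = kop (kadj (inc L)) (kop (inc L) f) t"
      by (rule kop_cong[OF band_kadj[OF b'] band_kadj[OF b]]) (use same' bd in \<open>auto simp: kadj_def\<close>)
  qed
  show "lapl {s \<in> L. s \<subseteq> W} f = lapl L f" unfolding lapl_def 1 2 3 4 ..
qed

definition reach :: "'v \<Rightarrow> nat \<Rightarrow> 'v set" where
  "reach x j = {v. \<exists>k\<le>j. (x, v) \<in> adj L ^^ k}"

lemma reach_mono: "i \<le> j \<Longrightarrow> reach x i \<subseteq> reach x j"
  by (auto simp: reach_def intro: le_trans)

lemma reach_0: "x \<in> reach x 0" by (simp add: reach_def)

lemma nbrs_reach: "v \<in> reach x j \<Longrightarrow> nbrs L v \<subseteq> reach x (Suc j)"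
proof
  fix w assume "v \<in> reach x j" "w \<in> nbrs L v"
  then obtain k where k: "k \<le> j" "(x, v) \<in> adj L ^^ k" "(v, w) \<in> adj L"
    by (auto simp: reach_def nbrs_def adj_def)
  then have "(x, w) \<in> adj L ^^ Suc k" by auto
  then show "w \<in> reach x (Suc j)" using k(1) unfolding reach_def by (metis (mono_tags, lifting) Suc_le_mono mem_Collect_eq)
qed

lemma simplex_reach:
  assumes "s \<in> L" "x \<in> s"
  shows "s \<subseteq> reach x 1"
proof
  fix v assume v: "v \<in> s"
  show "v \<in> reach x 1"
  proof (cases "v = x")
    case True
    then show ?thesis using reach_0 reach_mono[of 0 1] by auto
  next
    case False
    then show ?thesis
      using simplex_subset_nbrs(1)[OF cx deg assms] v nbrs_reach[OF reach_0] by auto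
  qed
qed

text \<open>The start already needs radius 1, because a simplex through \<open>x\<close> reaches the
  neighbours of \<open>x\<close>; each step adds 1. Hence \<open>m + 1\<close> and not
  \<open>m\<close>.\<close>

lemma heat_pow_restrict:
  assumes s: "s \<in> L" "x \<in> s" and W: "reach x (m + 1) \<subseteq> W"
  shows "j \<le> m \<Longrightarrow> (heat D {s \<in> L. s \<subseteq> W} ^^ j) (delta s) = (heat D L ^^ j) (delta s) \<and>
    (\<forall>t. (heat D L ^^ j) (delta s) t \<noteq> 0 \<longrightarrow> t \<in> L \<and> t \<subseteq> reach x (j + 1))"
proof (induction j)
  case 0
  then show ?case using s simplex_reach[OF s] by (simp add: delta_def)
next
  case (Suc j)
  define f where "f = (heat D L ^^ j) (delta s)"
  have f: "f t \<noteq> 0 \<Longrightarrow> t \<in> L \<and> t \<subseteq> reach x (j + 1)" for t using Suc by (simp add: f_def)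
  have "reach x (Suc (j + 1)) \<subseteq> W" using W reach_mono[of "Suc (j + 1)" "m + 1" x] Suc.prems by simp
  moreover have "\<exists>s\<in>L. s \<subseteq> W"
    using s simplex_reach[OF s] W reach_mono[of 1 "m + 1" x] by (intro bexI[of _ s]) auto
  moreover note lr = lapl_restrict[OF f reach_mono[of "j + 1" "Suc (j + 1)" x] nbrs_reach]
  ultimately have "lapl {s \<in> L. s \<subseteq> W} f = lapl L f" by auto
  then have "heat D {s \<in> L. s \<subseteq> W} f = heat D L f" by (simp add: heat_def)
  moreover have "t \<in> L \<and> t \<subseteq> reach x (Suc j + 1)" if "heat D L f t \<noteq> 0" for t
  proof (cases "f t = 0")
    case True
    then have "lapl L f t \<noteq> 0" using that by (auto simp: heat_def)
    then show ?thesis using lr(1) by simp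
  next
    case False
    then show ?thesis using f[of t] reach_mono[of "j + 1" "Suc j + 1" x] by auto
  qed
  ultimately show ?case using Suc by (simp add: f_def)
qed

end

section \<open>Local traces\<close>

definition local_trace ::
    "('g, 'm) monoid_scheme \<Rightarrow> nat \<Rightarrow> nat \<Rightarrow> ('g \<Rightarrow> complex) \<Rightarrow> nat \<Rightarrow> ('g, 'v) gcomplex \<Rightarrow> 'v \<Rightarrow> complex" where
  "local_trace G D n w m A x = (\<Sum>s | s \<in> simps A \<and> card s = n + 1 \<and> x \<in> s. \<Sum>g\<in>carrier G.
     cnj (w g) * eps (action A g) s * (heat D (simps A) ^^ m) (delta s) (action A g ` s))"

lemma local_trace_full_sub:
  assumes cx: "simplicial_cx (simps A)" and deg: "vertex_degree_le (simps A) D"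
    and W: "reach (simps A) x (m + 1) \<subseteq> W"
  shows "local_trace G D n w m (full_sub A W) x = local_trace G D n w m A x"
proof -
  have sW: "s \<subseteq> W" if "s \<in> simps A" "x \<in> s" for s
    using simplex_reach[OF cx deg that] reach_mono[OF cx deg, of 1 "m + 1" x] W by auto
  have sets: "{s. s \<in> simps (full_sub A W) \<and> card s = n + 1 \<and> x \<in> s} = {s. s \<in> simps A \<and> card s = n + 1 \<and> x \<in> s}"
    using sW by (auto simp: full_sub_def)
  show ?thesis unfolding local_trace_def sets
  proof (intro sum.cong refl)
    fix s g assume "s \<in> {s. s \<in> simps A \<and> card s = n + 1 \<and> x \<in> s}"
    then have s: "s \<in> simps A" "x \<in> s" by auto
    have "eps (action (full_sub A W) g) s = eps (action A g) s"
      using simplicial_cxD(2)[OF cx s(1)] sW[OF s] by (intro eps_cong) (auto simp: full_sub_def)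
    moreover have "action (full_sub A W) g ` s = action A g ` s"
      using sW[OF s] by (auto simp: full_sub_def)
    moreover have "(heat D (simps (full_sub A W)) ^^ m) (delta s) = (heat D (simps A) ^^ m) (delta s)"
      using heat_pow_restrict[OF cx deg s W, of m] by (simp add: full_sub_def)
    ultimately show "cnj (w g) * eps (action (full_sub A W) g) s * (heat D (simps (full_sub A W)) ^^ m) (delta s) (action (full_sub A W) g ` s)
      = cnj (w g) * eps (action A g) s * (heat D (simps A) ^^ m) (delta s) (action A g ` s)" by simp
  qed
qed

text \<open>The conditions on the action concern only simplices through \<open>x\<close>. In this
  form the lemma applies to a ball, whose action is a restriction, by inspecting the stars of its
  roots.\<close>

lemma local_trace_iso:
  fixes A :: "('g, 'v) gcomplex" and B :: "('g, 'w) gcomplex"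
  assumes cx: "simplicial_cx (simps A)" and inj: "inj_on \<phi> (verts (simps A))"
    and simps: "(\<lambda>s. \<phi> ` s) ` simps A = simps B"
    and equiv: "\<And>g v. g \<in> carrier G \<Longrightarrow> v \<in> verts (simps A) \<Longrightarrow> \<phi> (action A g v) = action B g (\<phi> v)"
    and act: "\<And>g s. g \<in> carrier G \<Longrightarrow> s \<in> simps A \<Longrightarrow> x \<in> s \<Longrightarrow> action A g ` s \<in> simps A"
    and actinj: "\<And>g s. g \<in> carrier G \<Longrightarrow> s \<in> simps A \<Longrightarrow> x \<in> s \<Longrightarrow> inj_on (action A g) s"
    and x: "x \<in> verts (simps A)"
  shows "local_trace G D n w m B (\<phi> x) = local_trace G D n w m A x"
proof -
  define S where "S = {s. s \<in> simps A \<and> card s = n + 1 \<and> x \<in> s}"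
  note simp = simplicial_cxD[OF cx]
  have sinj: "inj_on \<phi> s" if "s \<in> simps A" for s using inj simp(4)[OF that] by (rule inj_on_subset)
  have sets: "{s. s \<in> simps B \<and> card s = n + 1 \<and> \<phi> x \<in> s} = (`) \<phi> ` S"
  proof (intro equalityI subsetI)
    fix s' assume s': "s' \<in> {s. s \<in> simps B \<and> card s = n + 1 \<and> \<phi> x \<in> s}"
    then obtain s where s: "s \<in> simps A" "s' = \<phi> ` s" unfolding simps[symmetric] by blast
    then have "x \<in> s" using s' inj x simp(4)[OF s(1)] by (auto simp: inj_on_def)
    then show "s' \<in> (`) \<phi> ` S" using s s' card_image[OF sinj[OF s(1)]] by (auto simp: S_def)
  next
    fix s' assume "s' \<in> (`) \<phi> ` S"
    then show "s' \<in> {s. s \<in> simps B \<and> card s = n + 1 \<and> \<phi> x \<in> s}"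
      using card_image[OF sinj] unfolding simps[symmetric] by (auto simp: S_def)
  qed
  have Sinj: "inj_on ((`) \<phi>) S"
    using inj_on_image_simplices[OF cx inj] by (rule inj_on_subset) (auto simp: S_def)
  have term_eq: "cnj (w g) * eps (action B g) (\<phi> ` s) * (heat D (simps B) ^^ m) (delta (\<phi> ` s)) (action B g ` \<phi> ` s) =
      cnj (w g) * eps (action A g) s * (heat D (simps A) ^^ m) (delta s) (action A g ` s)"
    if "s \<in> S" "g \<in> carrier G" for s g
  proof -
    have s: "s \<in> simps A" "x \<in> s" using that by (auto simp: S_def)
    note gs = act[OF that(2) s] and gi = actinj[OF that(2) s] and f = simp(2)[OF s(1)]
    have eq: "(action B g \<circ> \<phi>) v = (\<phi> \<circ> action A g) v" if "v \<in> s" for v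
      using equiv[OF \<open>g \<in> carrier G\<close>] simp(4)[OF s(1)] that by auto
    have im: "action B g ` \<phi> ` s = \<phi> ` action A g ` s"
      using eq by (force simp: image_comp)
    have "inj_on (\<phi> \<circ> action A g) s" using gi sinj[OF gs] by (rule comp_inj_on)
    then have "inj_on (action B g \<circ> \<phi>) s" using eq by (simp cong: inj_on_cong)
    then have bi: "inj_on (action B g) (\<phi> ` s)" by (rule inj_on_imageI)
    \<comment> \<open>Both sides are the sign of the same map on \<open>s\<close>, once through
      \<open>B\<close> and once through \<open>A\<close>, by equivariance of
      \<open>\<phi>\<close>.\<close>
    have cocycle: "eps (action B g) (\<phi> ` s) * eps \<phi> s = eps \<phi> (action A g ` s) * eps (action A g) s"
      unfolding eps_comp[OF f sinj[OF s(1)] bi, symmetric] eps_comp[OF f gi sinj[OF gs], symmetric]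
      by (rule eps_cong[OF f eq])
    define u where "u = (heat D (simps B) ^^ m) (delta (\<phi> ` s)) (\<phi> ` action A g ` s)"
    define v where "v = (heat D (simps A) ^^ m) (delta s) (action A g ` s)"
    have "transported \<phi> (simps A) ((heat D (simps A) ^^ m) (delta s)) ((heat D (simps B) ^^ m) (\<lambda>t. eps \<phi> s * delta (\<phi> ` s) t))"
      using transported_heat_pow[OF cx inj transported_delta[OF cx inj s(1)], of m D] unfolding simps .
    then have "(heat D (simps B) ^^ m) (\<lambda>t. eps \<phi> s * delta (\<phi> ` s) t) (\<phi> ` action A g ` s) = eps \<phi> (action A g ` s) * v"
      using gs unfolding transported_def v_def by blast
    moreover have "(heat D (simps B) ^^ m) (\<lambda>t. z * h t) t' = z * (heat D (simps B) ^^ m) h t'" for z h t'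
    proof -
      have "heat D (simps B) (\<lambda>t. z * h t) = (\<lambda>t. z * heat D (simps B) h t)" for h
        unfolding heat_def lapl_scale by (simp add: algebra_simps)
      then have "(heat D (simps B) ^^ m) (\<lambda>t. z * h t) = (\<lambda>t. z * (heat D (simps B) ^^ m) h t)"
        by (induction m) auto
      then show ?thesis by simp
    qed
    ultimately have uv: "eps \<phi> s * u = eps \<phi> (action A g ` s) * v" by (simp add: u_def)
    have sq: "eps \<phi> s * eps \<phi> s = 1" "eps \<phi> (action A g ` s) * eps \<phi> (action A g ` s) = 1"
      using f sinj s gs simp(2)[OF gs] by auto
    have "eps (action B g) (\<phi> ` s) * u = (eps (action B g) (\<phi> ` s) * eps \<phi> s) * (eps \<phi> s * u)"
      using sq(1) by (metis mult.assoc mult.left_commute mult_1)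
    also have "\<dots> = (eps \<phi> (action A g ` s) * eps \<phi> (action A g ` s)) * (eps (action A g) s * v)"
      unfolding cocycle uv by (simp only: mult_ac)
    also have "\<dots> = eps (action A g) s * v" using sq(2) by simp
    finally show ?thesis unfolding im by (simp add: u_def v_def mult.assoc)
  qed
  show ?thesis
    unfolding local_trace_def sets sum.reindex[OF Sinj] o_def
    unfolding S_def[symmetric] by (intro sum.cong refl term_eq)
qed

section \<open>Group actions on chains\<close>

definition on_simplices :: "nat \<Rightarrow> 'v set set \<Rightarrow> ('v set \<Rightarrow> complex) \<Rightarrow> bool" where
  "on_simplices n L f \<longleftrightarrow> (\<forall>s. f s \<noteq> 0 \<longrightarrow> s \<in> L \<and> card s = n + 1)"

lemma kop_nonzeroD:
  assumes "kop k f t \<noteq> 0"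
  obtains s where "k t s \<noteq> 0" "f s \<noteq> 0"
proof -
  have "\<exists>s. k t s \<noteq> 0 \<and> f s \<noteq> 0"
  proof (rule ccontr)
    assume "\<not> ?thesis"
    then have "k t s * f s = 0" for s by auto
    then show False using assms unfolding kop_def by simp
  qed
  then show thesis using that by blast
qed

lemma inc_card:
  assumes "simplicial_cx L" "inc L t s \<noteq> 0"
  shows "card s = card t + 1"
  using inc_nonzeroD[OF assms] simplicial_cxD(2)[OF assms(1), of t] by auto

lemma on_simplices_lapl:
  assumes cx: "simplicial_cx L" and f: "on_simplices n L f"
  shows "on_simplices n L (lapl L f)"
  unfolding on_simplices_def
proof (intro allI impI)
  fix s assume "lapl L f s \<noteq> 0"
  then consider "kop (inc L) (kop (kadj (inc L)) f) s \<noteq> 0" | "kop (kadj (inc L)) (kop (inc L) f) s \<noteq> 0"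
    unfolding lapl_def by fastforce
  then show "s \<in> L \<and> card s = n + 1"
  proof cases
    case 1
    obtain w where w: "inc L s w \<noteq> 0" "kop (kadj (inc L)) f w \<noteq> 0" by (rule kop_nonzeroD[OF 1])
    obtain t where t: "kadj (inc L) w t \<noteq> 0" "f t \<noteq> 0" by (rule kop_nonzeroD[OF w(2)])
    have "inc L t w \<noteq> 0" using t by (simp add: kadj_def)
    then show ?thesis
      using inc_card[OF cx w(1)] inc_card[OF cx, of t w] inc_nonzeroD(1)[OF cx w(1)] f t(2)
      by (auto simp: on_simplices_def)
  next
    case 2
    obtain w where w: "kadj (inc L) s w \<noteq> 0" "kop (inc L) f w \<noteq> 0" by (rule kop_nonzeroD[OF 2])
    obtain t where t: "inc L w t \<noteq> 0" "f t \<noteq> 0" by (rule kop_nonzeroD[OF w(2)])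
    have "inc L w s \<noteq> 0" using w by (simp add: kadj_def)
    then show ?thesis
      using inc_card[OF cx t(1)] inc_card[OF cx, of w s] inc_nonzeroD(2)[OF cx, of w s] f t(2)
      by (auto simp: on_simplices_def)
  qed
qed

lemma on_simplices_heat:
  assumes "simplicial_cx L" "on_simplices n L f"
  shows "on_simplices n L (heat D L f)"
  unfolding on_simplices_def
proof (intro allI impI)
  fix s assume "heat D L f s \<noteq> 0"
  then have "f s \<noteq> 0 \<or> lapl L f s \<noteq> 0" by (auto simp: heat_def)
  then show "s \<in> L \<and> card s = n + 1"
    using on_simplices_lapl[OF assms] assms(2) unfolding on_simplices_def by blast
qed

lemma on_simplices_heat_pow:
  "simplicial_cx L \<Longrightarrow> on_simplices n L f \<Longrightarrow> on_simplices n L ((heat D L ^^ m) f)"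
  by (induction m) (auto intro: on_simplices_heat)

lemma on_simplices_delta: "s \<in> L \<Longrightarrow> card s = n + 1 \<Longrightarrow> on_simplices n L (delta s)"
  by (auto simp: on_simplices_def delta_def)

text \<open>The laws are imposed on vertices of the complex only and the maps need not be
  extensional, so \<open>NG_act\<close> qualifies as it stands on every invariant
  subcomplex.\<close>

locale gcx_action =
  fixes G :: "('g, 'm) monoid_scheme" and D :: nat and L :: "'v set set" and act :: "'g \<Rightarrow> 'v \<Rightarrow> 'v"
  assumes group: "group G" and fin: "finite (carrier G)" and D: "0 < D"
    and cx: "simplicial_cx L" and deg: "vertex_degree_le L D"
    and act_simplex: "g \<in> carrier G \<Longrightarrow> s \<in> L \<Longrightarrow> act g ` s \<in> L"
    and act_mult: "g \<in> carrier G \<Longrightarrow> h \<in> carrier G \<Longrightarrow> v \<in> verts L \<Longrightarrow> act (g \<otimes>\<^bsub>G\<^esub> h) v = act g (act h v)"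
    and act_one: "v \<in> verts L \<Longrightarrow> act \<one>\<^bsub>G\<^esub> v = v"
begin

interpretation group G by (rule group)

sublocale heat: positive_contraction "heat D L"
  by (rule positive_contraction_heat[OF cx deg D])

lemma act_verts: "g \<in> carrier G \<Longrightarrow> v \<in> verts L \<Longrightarrow> act g v \<in> verts L"
  using act_simplex[of g "{v}"] by (simp add: verts_def)

lemma act_inv [simp]:
  "g \<in> carrier G \<Longrightarrow> v \<in> verts L \<Longrightarrow> act (inv\<^bsub>G\<^esub> g) (act g v) = v"
  "g \<in> carrier G \<Longrightarrow> v \<in> verts L \<Longrightarrow> act g (act (inv\<^bsub>G\<^esub> g) v) = v"
  using act_mult[of "inv\<^bsub>G\<^esub> g" g v] act_mult[of g "inv\<^bsub>G\<^esub> g" v] by (auto simp: act_one)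

lemma act_inj: "g \<in> carrier G \<Longrightarrow> inj_on (act g) (verts L)"
  by (rule inj_on_inverseI[of _ "act (inv\<^bsub>G\<^esub> g)"]) simp

lemma simplex_finite: "s \<in> L \<Longrightarrow> finite s"
  using simplicial_cxD(2)[OF cx] .

lemma act_inj_simplex: "g \<in> carrier G \<Longrightarrow> s \<in> L \<Longrightarrow> inj_on (act g) s"
  using act_inj simplicial_cxD(4)[OF cx] by (rule inj_on_subset)

lemma act_image_mult:
  assumes "g \<in> carrier G" "h \<in> carrier G" "s \<in> L"
  shows "act (g \<otimes>\<^bsub>G\<^esub> h) ` s = act g ` act h ` s"
  using simplicial_cxD(4)[OF cx assms(3)] act_mult[OF assms(1,2)] by (force simp: image_comp)

lemma act_image_one: "s \<in> L \<Longrightarrow> act \<one>\<^bsub>G\<^esub> ` s = s"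
  using simplicial_cxD(4)[OF cx] act_one by force

lemma act_image_inv:
  assumes "g \<in> carrier G" "s \<in> L"
  shows "act (inv\<^bsub>G\<^esub> g) ` act g ` s = s" "act g ` act (inv\<^bsub>G\<^esub> g) ` s = s"
  using act_image_mult[of "inv\<^bsub>G\<^esub> g" g s] act_image_mult[of g "inv\<^bsub>G\<^esub> g" s] assms
  by (auto simp: act_image_one)

lemma card_act_image: "g \<in> carrier G \<Longrightarrow> s \<in> L \<Longrightarrow> card (act g ` s) = card s"
  using act_inj_simplex by (rule card_image)

lemma bij_betw_act: "g \<in> carrier G \<Longrightarrow> bij_betw (\<lambda>s. act g ` s) L L"
  by (rule bij_betwI[of _ _ _ "\<lambda>s. act (inv\<^bsub>G\<^esub> g) ` s"]) (auto simp: act_simplex act_image_inv)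

lemma act_image_complex: "g \<in> carrier G \<Longrightarrow> (`) (act g) ` L = L"
  using bij_betw_act by (auto simp: bij_betw_def)

lemma eps_act_mult:
  assumes "g \<in> carrier G" "h \<in> carrier G" "s \<in> L"
  shows "eps (act (g \<otimes>\<^bsub>G\<^esub> h)) s = eps (act g) (act h ` s) * eps (act h) s"
proof -
  have "eps (act (g \<otimes>\<^bsub>G\<^esub> h)) s = eps (act g \<circ> act h) s"
    using simplicial_cxD(4)[OF cx assms(3)] act_mult[OF assms(1,2)]
    by (intro eps_cong simplex_finite assms) auto
  also have "\<dots> = eps (act g) (act h ` s) * eps (act h) s"
    by (rule eps_comp[OF simplex_finite[OF assms(3)] act_inj_simplex[OF assms(2,3)]
          act_inj_simplex[OF assms(1) act_simplex[OF assms(2,3)]]])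
  finally show ?thesis .
qed

lemma eps_act_one: "s \<in> L \<Longrightarrow> eps (act \<one>\<^bsub>G\<^esub>) s = 1"
proof -
  assume s: "s \<in> L"
  have "eps (act \<one>\<^bsub>G\<^esub>) s = eps id s"
    using simplicial_cxD(4)[OF cx s] act_one by (intro eps_cong simplex_finite s) auto
  then show ?thesis using simplex_finite[OF s] by (simp add: eps_def orient)
qed

lemma eps_act_square: "g \<in> carrier G \<Longrightarrow> s \<in> L \<Longrightarrow> eps (act g) s * eps (act g) s = 1"
  by (rule eps_square[OF simplex_finite act_inj_simplex])

lemma cnj_eps_act: "g \<in> carrier G \<Longrightarrow> s \<in> L \<Longrightarrow> cnj (eps (act g) s) = eps (act g) s"
  by (rule cnj_eps[OF simplex_finite act_inj_simplex])

lemma cmod_eps_act: "g \<in> carrier G \<Longrightarrow> s \<in> L \<Longrightarrow> cmod (eps (act g) s) = 1"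
  using eps_cases[OF simplex_finite act_inj_simplex, of s g] by auto

lemma eps_act_inv:
  assumes "g \<in> carrier G" "s \<in> L"
  shows "eps (act g) (act (inv\<^bsub>G\<^esub> g) ` s) = eps (act (inv\<^bsub>G\<^esub> g)) s"
proof -
  have "eps (act g) (act (inv\<^bsub>G\<^esub> g) ` s) * eps (act (inv\<^bsub>G\<^esub> g)) s = 1"
    using eps_act_mult[of g "inv\<^bsub>G\<^esub> g" s] assms eps_act_one by simp
  then show ?thesis
    using eps_cases[OF simplex_finite act_inj_simplex, of s "inv\<^bsub>G\<^esub> g"] assms
      eps_cases[OF simplex_finite act_inj_simplex, of "act (inv\<^bsub>G\<^esub> g) ` s" g] act_simplex by auto
qed

text \<open>In coordinates this is the action of the inverse of \<open>g\<close>; accordingly,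
  compositions reverse the order.\<close>

definition pullback :: "'g \<Rightarrow> ('v set \<Rightarrow> complex) \<Rightarrow> 'v set \<Rightarrow> complex" where
  "pullback g f s = (if s \<in> L then eps (act g) s * f (act g ` s) else 0)"

lemma pullback_pullback:
  assumes "g \<in> carrier G" "h \<in> carrier G"
  shows "pullback g (pullback h f) = pullback (h \<otimes>\<^bsub>G\<^esub> g) f"
  using assms by (auto simp: pullback_def act_simplex act_image_mult eps_act_mult fun_eq_iff)

lemma ell2_pullback:
  assumes "g \<in> carrier G" "ell2 f"
  shows "ell2 (pullback g f)"
proof (rule ell2_bounded(1))
  fix F :: "'v set set" assume F: "finite F"
  have "(\<Sum>s\<in>F. (cmod (pullback g f s))\<^sup>2) = (\<Sum>s\<in>F \<inter> L. (cmod (f (act g ` s)))\<^sup>2)"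
    unfolding sum.inter_restrict[OF F]
    by (intro sum.cong refl) (simp add: pullback_def norm_mult cmod_eps_act assms)
  also have "\<dots> = (\<Sum>s\<in>(\<lambda>s. act g ` s) ` (F \<inter> L). (cmod (f s))\<^sup>2)"
    using bij_betw_act[OF assms(1)]
    by (subst sum.reindex) (auto simp: bij_betw_def intro: inj_on_subset)
  also have "\<dots> \<le> norm2 f" by (rule sum_le_norm2[OF assms(2)]) (simp add: F)
  finally show "(\<Sum>s\<in>F. (cmod (pullback g f s))\<^sup>2) \<le> norm2 f" .
qed

lemma inner_pullback:
  assumes g: "g \<in> carrier G"
  shows "ell2_inner (pullback g f) k = ell2_inner f (pullback (inv\<^bsub>G\<^esub> g) k)"
proof -
  have "ell2_inner (pullback g f) k = infsum (\<lambda>s. eps (act g) s * f (act g ` s) * cnj (k s)) L"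
    unfolding ell2_inner_def pullback_def by (rule infsum_cong_neutral) auto
  also have "\<dots> = infsum (\<lambda>s. eps (act g) (act (inv\<^bsub>G\<^esub> g) ` s) * f (act g ` act (inv\<^bsub>G\<^esub> g) ` s) * cnj (k (act (inv\<^bsub>G\<^esub> g) ` s))) L"
    using g by (rule infsum_reindex_bij_betw[OF bij_betw_act, symmetric, OF inv_closed])
  also have "\<dots> = infsum (\<lambda>s. f s * cnj (eps (act (inv\<^bsub>G\<^esub> g)) s * k (act (inv\<^bsub>G\<^esub> g) ` s))) L"
    using g by (intro infsum_cong) (simp add: eps_act_inv act_image_inv cnj_eps_act)
  also have "\<dots> = ell2_inner f (pullback (inv\<^bsub>G\<^esub> g) k)"
    unfolding ell2_inner_def pullback_def by (rule infsum_cong_neutral) auto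
  finally show ?thesis .
qed

lemma on_simplices_pullback:
  assumes "g \<in> carrier G" "on_simplices n L f"
  shows "on_simplices n L (pullback g f)"
  using assms(2) card_act_image[OF assms(1)] unfolding on_simplices_def pullback_def by (auto split: if_splits)

text \<open>Equivariance is transport along \<open>act g\<close>, because the complex is its own
  image.\<close>

lemma heat_pullback:
  assumes g: "g \<in> carrier G" and f: "\<And>s. s \<notin> L \<Longrightarrow> f s = 0"
  shows "heat D L (pullback g f) = pullback g (heat D L f)"
proof -
  have "transported (act g) L (pullback g f) f"
    using f eps_act_square[OF g] unfolding transported_def act_image_complex[OF g]
    by (auto simp: pullback_def simp flip: mult.assoc)
  from transported_heat[OF cx act_inj[OF g] this, of D]
  have tr: "transported (act g) L (heat D L (pullback g f)) (heat D L f)"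
    unfolding act_image_complex[OF g] .
  show ?thesis
  proof
    fix s show "heat D L (pullback g f) s = pullback g (heat D L f) s"
    proof (cases "s \<in> L")
      case True
      then have "heat D L f (act g ` s) = eps (act g) s * heat D L (pullback g f) s"
        using tr by (simp add: transported_def)
      then show ?thesis using True eps_act_square[OF g True] by (simp add: pullback_def flip: mult.assoc)
    next
      case False
      then show ?thesis using tr by (simp add: transported_def pullback_def)
    qed
  qed
qed

text \<open>The conjugate appears because pulling back along \<open>g\<close> is the action of the
  inverse, and the weights used later take conjugate values at inverse elements.\<close>

definition project :: "('g \<Rightarrow> complex) \<Rightarrow> ('v set \<Rightarrow> complex) \<Rightarrow> 'v set \<Rightarrow> complex" where
  "project w f = (\<lambda>s. \<Sum>g\<in>carrier G. cnj (w g) * pullback g f s)"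

lemma project_simplex:
  "s \<in> L \<Longrightarrow> project w f s = (\<Sum>g\<in>carrier G. cnj (w g) * eps (act g) s * f (act g ` s))"
  by (simp add: project_def pullback_def mult.assoc)

lemma ell2_project: "ell2 f \<Longrightarrow> ell2 (project w f)"
  unfolding project_def by (intro ell2_sum ell2_scale ell2_pullback)

lemma on_simplices_project:
  assumes "on_simplices n L f"
  shows "on_simplices n L (project w f)"
  unfolding on_simplices_def
proof (intro allI impI)
  fix s assume "project w f s \<noteq> 0"
  then obtain g where "g \<in> carrier G" "pullback g f s \<noteq> 0"
    unfolding project_def by (metis (no_types, lifting) mult_zero_right sum.neutral)
  then show "s \<in> L \<and> card s = n + 1" using on_simplices_pullback[OF _ assms] by (auto simp: on_simplices_def)
qed

lemma project_tendsto:
  assumes "\<And>s. (\<lambda>m. F m s) \<longlonglongrightarrow> f s"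
  shows "(\<lambda>m. project w (F m) s) \<longlonglongrightarrow> project w f s"
  unfolding project_def pullback_def
  by (rule tendsto_sum) (auto intro!: tendsto_mult tendsto_const assms)

lemma heat_project:
  assumes f: "\<And>s. s \<notin> L \<Longrightarrow> f s = 0"
  shows "heat D L (project w f) = project w (heat D L f)"
proof -
  have sum: "heat D L (\<lambda>s. \<Sum>x\<in>X. F x s) = (\<lambda>s. \<Sum>x\<in>X. heat D L (F x) s)" if "finite X"
    for X :: "'g set" and F
    using that
  proof (induction X)
    case empty
    show ?case using heat.scale[of 0 "\<lambda>_. 0"] by simp
  next
    case (insert x X)
    then show ?case using heat.add[of "F x" "\<lambda>s. \<Sum>x\<in>X. F x s"] by simp
  qed
  have "heat D L (project w f) = (\<lambda>s. \<Sum>g\<in>carrier G. heat D L (\<lambda>s. cnj (w g) * pullback g f s) s)"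
    unfolding project_def by (rule sum[OF fin])
  also have "\<dots> = project w (heat D L f)"
    unfolding project_def heat.scale using heat_pullback[OF _ f] by simp
  finally show ?thesis .
qed

section \<open>Projection to the isotypic harmonic part\<close>

context
  fixes w :: "'g \<Rightarrow> complex"
  assumes w_inv: "\<And>g. g \<in> carrier G \<Longrightarrow> w (inv\<^bsub>G\<^esub> g) = cnj (w g)"
    and w_conv: "\<And>g. g \<in> carrier G \<Longrightarrow> (\<Sum>h\<in>carrier G. w h * w (inv\<^bsub>G\<^esub> h \<otimes>\<^bsub>G\<^esub> g)) = w g"
begin

text \<open>Composing pullbacks multiplies the group elements in reverse order. The substitution k =
  h g turns the double sum into the convolution of \<open>w\<close> with itself.\<close>

lemma project_idem: "project w (project w f) = project w f"
proof
  fix s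
  show "project w (project w f) s = project w f s"
  proof (cases "s \<in> L")
    case True
    have "project w (project w f) s = (\<Sum>g\<in>carrier G. \<Sum>h\<in>carrier G. cnj (w g * w h) * pullback g (pullback h f) s)"
      using True by (simp add: project_def[of w "project w f"] pullback_def[of _ "project w f"] pullback_def[of _ "pullback _ f"])
        (simp add: project_def sum_distrib_left mult_ac)
    also have "\<dots> = (\<Sum>g\<in>carrier G. \<Sum>h\<in>carrier G. cnj (w g * w h) * pullback (h \<otimes>\<^bsub>G\<^esub> g) f s)"
      by (intro sum.cong refl) (simp add: pullback_pullback)
    also have "\<dots> = (\<Sum>h\<in>carrier G. \<Sum>g\<in>carrier G. cnj (w g * w h) * pullback (h \<otimes>\<^bsub>G\<^esub> g) f s)"
      by (rule sum.swap)
    also have "\<dots> = (\<Sum>h\<in>carrier G. \<Sum>k\<in>carrier G. cnj (w h * w (inv\<^bsub>G\<^esub> h \<otimes>\<^bsub>G\<^esub> k)) * pullback k f s)"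
    proof (rule sum.cong[OF refl])
      fix h assume h: "h \<in> carrier G"
      show "(\<Sum>g\<in>carrier G. cnj (w g * w h) * pullback (h \<otimes>\<^bsub>G\<^esub> g) f s) = (\<Sum>k\<in>carrier G. cnj (w h * w (inv\<^bsub>G\<^esub> h \<otimes>\<^bsub>G\<^esub> k)) * pullback k f s)"
        by (rule sum.reindex_bij_witness[where i = "\<lambda>k. inv\<^bsub>G\<^esub> h \<otimes>\<^bsub>G\<^esub> k" and j = "\<lambda>g. h \<otimes>\<^bsub>G\<^esub> g"])
           (use h in \<open>auto simp: m_assoc[symmetric] mult.commute\<close>)
    qed
    also have "\<dots> = (\<Sum>k\<in>carrier G. cnj (\<Sum>h\<in>carrier G. w h * w (inv\<^bsub>G\<^esub> h \<otimes>\<^bsub>G\<^esub> k)) * pullback k f s)"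
      by (subst sum.swap) (simp add: sum_distrib_right)
    also have "\<dots> = project w f s" by (simp add: w_conv project_def)
    finally show ?thesis .
  next
    case False
    then show ?thesis by (simp add: project_def pullback_def)
  qed
qed

lemma project_self_adjoint:
  assumes "ell2 f" "ell2 k"
  shows "ell2_inner (project w f) k = ell2_inner f (project w k)"
proof -
  have "ell2_inner (project w f) k = (\<Sum>g\<in>carrier G. cnj (w g) * ell2_inner (pullback g f) k)"
    unfolding project_def using assms
    by (subst ell2_inner_sum_left) (auto intro: ell2_scale ell2_pullback simp: ell2_inner_scale_left)
  also have "\<dots> = (\<Sum>g\<in>carrier G. w (inv\<^bsub>G\<^esub> g) * ell2_inner f (pullback (inv\<^bsub>G\<^esub> g) k))"
    by (intro sum.cong refl) (simp add: inner_pullback w_inv)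
  also have "\<dots> = (\<Sum>g\<in>carrier G. w g * ell2_inner f (pullback g k))"
    by (rule sum.reindex_bij_witness[where i = "\<lambda>g. inv\<^bsub>G\<^esub> g" and j = "\<lambda>g. inv\<^bsub>G\<^esub> g"]) auto
  also have "\<dots> = ell2_inner f (project w k)"
    unfolding project_def using assms
    by (subst ell2_inner_sum_right) (auto intro: ell2_scale ell2_pullback simp: ell2_inner_scale_right)
  finally show ?thesis .
qed

text \<open>The orthogonal projection of the basis vector at \<open>s\<close> to the kernel of the
  Laplacian, by \<open>lapl_harm\<close> and \<open>inner_harm\<close>.\<close>

definition harm :: "'v set \<Rightarrow> 'v set \<Rightarrow> complex" where
  "harm s = heat.lim_pow (delta s)"

lemma ell2_harm: "ell2 (harm s)"
  unfolding harm_def by (rule heat.ell2_lim_pow) simp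

lemma lapl_harm: "lapl L (harm s) = (\<lambda>_. 0)"
  using heat.T_lim_pow[OF ell2_delta] heat_fixed_iff[OF cx deg D] by (auto simp: harm_def)

lemma on_simplices_harm:
  assumes "s \<in> L" "card s = n + 1"
  shows "on_simplices n L (harm s)"
  unfolding on_simplices_def
proof (intro allI impI, rule ccontr)
  fix t assume t: "harm s t \<noteq> 0" "\<not> (t \<in> L \<and> card t = n + 1)"
  have "(heat D L ^^ m) (delta s) t = 0" for m
    using on_simplices_heat_pow[OF cx on_simplices_delta[OF assms]] t(2) unfolding on_simplices_def by blast
  then have "(\<lambda>m. 0) \<longlonglongrightarrow> harm s t" using heat.pow_tendsto[OF ell2_delta, of s t] by (simp add: harm_def)
  then have "harm s t = 0" using LIMSEQ_unique[OF _ tendsto_const] by blast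
  then show False using t by simp
qed

lemma inner_harm:
  assumes "ell2 k" "lapl L k = (\<lambda>_. 0)"
  shows "ell2_inner (harm s) k = ell2_inner (delta s) k"
  unfolding harm_def using assms
  by (intro heat.inner_lim_pow_fixed ell2_delta) (auto simp: heat_fixed_iff[OF cx deg D])

lemma lapl_project:
  assumes "on_simplices n L k" "lapl L k = (\<lambda>_. 0)"
  shows "lapl L (project w k) = (\<lambda>_. 0)"
proof -
  have "k s = 0" if "s \<notin> L" for s using assms(1) that by (auto simp: on_simplices_def)
  from heat_project[where w = w, OF this] show ?thesis
    using assms(2) by (simp add: heat_fixed_iff[OF cx deg D, symmetric])
qed

text \<open>The fibrewise orthogonality relation for \<open>project w (harm s)\<close> as the
  projection of \<open>delta s\<close> to the isotypic harmonic part. Integrated over the base it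
  yields the projection in the direct integral.\<close>

lemma inner_delta_minus_project:
  assumes k: "ell2 k" "on_simplices n L k" "lapl L k = (\<lambda>_. 0)"
  shows "ell2_inner (\<lambda>t. delta s t - project w (harm s) t) (project w k) = 0"
proof -
  note pk = ell2_project[OF k(1), of w]
  have "ell2_inner (project w (harm s)) (project w k) = ell2_inner (harm s) (project w k)"
    using project_self_adjoint[OF ell2_harm pk] by (simp add: project_idem)
  also have "\<dots> = ell2_inner (delta s) (project w k)"
    by (rule inner_harm[OF pk lapl_project[OF k(2,3)]])
  finally show ?thesis
    by (simp add: ell2_inner_diff_left ell2_project ell2_harm pk)
qed

text \<open>For a self-adjoint idempotent a diagonal entry is the squared norm of the corresponding
  column.\<close>

lemma project_harm_real:
  assumes "s \<in> L" "card s = n + 1"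
  shows "project w (harm s) s = of_real (norm2 (project w (harm s)))"
proof -
  define p where "p = project w (harm s)"
  have p: "ell2 p" "lapl L p = (\<lambda>_. 0)"
    unfolding p_def by (intro ell2_project ell2_harm lapl_project[OF on_simplices_harm[OF assms]] lapl_harm)+
  have "cnj (p s) = ell2_inner (delta s) p"
    using ell2_inner_delta[of p s] ell2_inner_cnj[of p "delta s"] by simp
  also have "\<dots> = ell2_inner (harm s) (project w p)"
    using inner_harm[OF p, of s] by (simp add: p_def project_idem)
  also have "\<dots> = ell2_inner p p"
    using project_self_adjoint[OF ell2_harm p(1), of s] by (simp add: p_def)
  finally show ?thesis unfolding ell2_inner_self p_def[symmetric]
    by (metis complex_cnj_cnj complex_cnj_complex_of_real)
qed

lemma project_heat_tendsto:
  "(\<lambda>m. project w ((heat D L ^^ m) (delta s)) t) \<longlonglongrightarrow> project w (harm s) t"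
  unfolding harm_def by (rule project_tendsto) (rule heat.pow_tendsto[OF ell2_delta])

end

lemma cmod_heat_pow_le: "cmod ((heat D L ^^ m) (delta s) t) \<le> 1"
proof -
  have "(cmod ((heat D L ^^ m) (delta s) t))\<^sup>2 \<le> 1"
    using entry_le_norm2[OF heat.ell2_pow[OF ell2_delta], of m s t] heat.norm2_pow_le[OF ell2_delta, of m s] by simp
  then show ?thesis by (simp add: power2_le_iff_abs_le abs_square_le_1)
qed

lemma cmod_project_heat_le:
  assumes "s \<in> L"
  shows "cmod (project w ((heat D L ^^ m) (delta s)) t) \<le> (\<Sum>g\<in>carrier G. cmod (w g))"
  unfolding project_def
proof (rule order_trans[OF norm_sum], rule sum_mono)
  fix g assume g: "g \<in> carrier G"
  have "cmod (pullback g ((heat D L ^^ m) (delta s)) t) \<le> 1"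
    using cmod_eps_act[OF g] cmod_heat_pow_le by (simp add: pullback_def norm_mult)
  then show "cmod (cnj (w g) * pullback g ((heat D L ^^ m) (delta s)) t) \<le> cmod (w g)"
    by (simp add: norm_mult mult_left_le)
qed

end

section \<open>Uniform decay of traces on finite complexes\<close>

lemma linear_expand:
  fixes T :: "('i \<Rightarrow> complex) \<Rightarrow> 'i \<Rightarrow> complex"
  assumes add: "\<And>f g. T (\<lambda>i. f i + g i) = (\<lambda>i. T f i + T g i)"
    and scale: "\<And>c f. T (\<lambda>i. c * f i) = (\<lambda>i. c * T f i)"
    and "finite L" "\<And>s. s \<notin> L \<Longrightarrow> f s = 0"
  shows "T f t = (\<Sum>s\<in>L. f s * T (delta s) t)"
proof -
  have "T (\<lambda>i. \<Sum>s\<in>L. f s * delta s i) = (\<lambda>i. \<Sum>s\<in>L. f s * T (delta s) i)"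
    using assms(3)
  proof (induction L)
    case empty
    show ?case using scale[of 0 "\<lambda>_. 0"] by simp
  next
    case (insert s L)
    then show ?case using add[of "\<lambda>i. f s * delta s i" "\<lambda>i. \<Sum>s\<in>L. f s * delta s i"] scale[of "f s" "delta s"]
      by simp
  qed
  moreover have "f = (\<lambda>i. \<Sum>s\<in>L. f s * delta s i)"
    using assms(3,4) by (auto simp: delta_def fun_eq_iff if_distrib[of "\<lambda>x. _ * x"] cong: if_cong)
  ultimately show ?thesis by metis
qed

lemma kop_Ints:
  assumes "\<And>t s. k t s \<in> \<int>" "\<And>s. f s \<in> \<int>"
  shows "kop k f t \<in> \<int>"
  unfolding kop_def by (intro Ints_sum Ints_mult assms)

lemma lapl_Ints:
  assumes cx: "simplicial_cx L" and f: "\<And>s. f s \<in> \<int>"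
  shows "lapl L f t \<in> \<int>"
proof -
  have i: "inc L t s \<in> \<int>" for t s using inc_cases[OF cx, of t s] by auto
  have i': "kadj (inc L) s t \<in> \<int>" for t s using i by (simp add: kadj_inc[OF cx])
  show ?thesis unfolding lapl_def by (intro Ints_add kop_Ints i i' f)
qed

lemma lapl_supp: "s \<notin> L \<Longrightarrow> lapl L f s = 0"
  unfolding lapl_def by (simp add: kop_def inc_def kadj_def)

text \<open>An enumeration of the simplices turns \<open>heat D L\<close> into 1 - A/c with an
  integral matrix \<open>A\<close>, since incidence numbers are -1, 0 or 1. An eigenvector of
  \<open>A\<close> is a square-summable function after extension by 0, so the bounds on the
  quadratic form of the Laplacian place its eigenvalue in [0, c]. All degrees are treated at
  once.\<close>

lemma trace_heat_pow_diff:
  fixes L :: "'v set set"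
  assumes cx: "simplicial_cx L" and deg: "vertex_degree_le L D" and D: "0 < D"
    and fin: "finite L" and m: "m \<le> m'" and e: "0 < \<epsilon>" "\<epsilon> < 1"
  shows "(\<Sum>s\<in>L. Re ((heat D L ^^ m) (delta s) s - (heat D L ^^ m') (delta s) s)) \<le>
    real (card L) * (ln (lapl_bound D) / ln (1 / \<epsilon>) + (1 - \<epsilon>) ^ m)"
proof -
  interpret heat: positive_contraction "heat D L" by (rule positive_contraction_heat[OF cx deg D])
  define n where "n = card L"
  obtain h :: "nat \<Rightarrow> 'v set" where h: "bij_betw h {..<n} L"
    using ex_bij_betw_nat_finite[OF fin] by (auto simp: n_def atLeast0LessThan)
  then have hL: "h i \<in> L" if "i < n" for i using that by (auto simp: bij_betw_def)
  have hinj: "h i = h j \<longleftrightarrow> i = j" if "i < n" "j < n" for i j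
    using h that by (auto simp: bij_betw_def inj_on_def)
  define c where "c = lapl_bound D"
  have c: "1 \<le> c" using lapl_bound_ge[OF D] by (simp add: c_def)
  \<comment> \<open>The entries are integers already; the floor serves to obtain a matrix over
    \<open>int\<close>.\<close>
  define A where "A = Matrix.mat n n (\<lambda>(i, j). \<lfloor>Re (lapl L (delta (h j)) (h i))\<rfloor>)"
  have A: "A \<in> carrier_mat n n" by (simp add: A_def)
  have entry: "complex_of_int (A $$ (i, j)) = lapl L (delta (h j)) (h i)" if "i < n" "j < n" for i j
  proof -
    have "lapl L (delta (h j)) (h i) \<in> \<int>" by (rule lapl_Ints[OF cx]) (simp add: delta_def)
    then obtain z where "lapl L (delta (h j)) (h i) = of_int z" by (auto elim: Ints_cases)
    then show ?thesis using that by (simp add: A_def)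
  qed
  define A' where "A' = map_mat complex_of_int A"
  have A': "A' \<in> carrier_mat n n" using A by (simp add: A'_def)
  define B where "B = 1\<^sub>m n - complex_of_real (1 / c) \<cdot>\<^sub>m A'"
  have B: "B \<in> carrier_mat n n" unfolding B_def by (intro minus_carrier_mat smult_carrier_mat A')
  have Bentry: "B $$ (i, j) = heat D L (delta (h j)) (h i)" if "i < n" "j < n" for i j
    using that entry[OF that] A hinj[OF that] by (simp add: B_def A'_def heat_def c_def delta_def)
  have supp: "(heat D L ^^ k) (delta (h j)) s = 0" if "s \<notin> L" "j < n" for s j k
    using that hL[OF that(2)] by (induction k) (auto simp: delta_def heat_def lapl_supp)
  have Bpow: "(B ^\<^sub>m k) $$ (i, j) = (heat D L ^^ k) (delta (h j)) (h i)" if "i < n" "j < n" for i j k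
    using that
  proof (induction k arbitrary: i j)
    case 0
    then show ?case using B hinj[OF 0] by (simp add: delta_def)
  next
    case (Suc k)
    have Bk: "B ^\<^sub>m k \<in> carrier_mat n n" by (rule pow_carrier_mat[OF B])
    have "(B ^\<^sub>m Suc k) $$ (i, j) = (\<Sum>l<n. (B ^\<^sub>m k) $$ (i, l) * B $$ (l, j))"
      using Suc.prems B Bk by (simp add: scalar_prod_def atLeast0LessThan)
    also have "\<dots> = (\<Sum>l<n. heat D L (delta (h j)) (h l) * (heat D L ^^ k) (delta (h l)) (h i))"
      using Suc by (intro sum.cong refl) (simp add: Bentry mult.commute)
    also have "\<dots> = (\<Sum>s\<in>L. heat D L (delta (h j)) s * (heat D L ^^ k) (delta s) (h i))"
      by (rule sum.reindex_bij_betw[OF h])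
    also have "\<dots> = (heat D L ^^ k) (heat D L (delta (h j))) (h i)"
      by (rule linear_expand[symmetric, OF heat.pow_add heat.pow_scale fin])
         (use supp[of _ j 1] Suc.prems in simp)
    finally show ?case by (simp add: funpow_swap1)
  qed
  have tr: "mat_trace (B ^\<^sub>m k) = (\<Sum>s\<in>L. (heat D L ^^ k) (delta s) s)" for k
  proof -
    have "mat_trace (B ^\<^sub>m k) = (\<Sum>i<n. (heat D L ^^ k) (delta (h i)) (h i))"
      using carrier_matD(1)[OF B] Bpow by (simp add: mat_trace_def)
    also have "\<dots> = (\<Sum>s\<in>L. (heat D L ^^ k) (delta s) s)" by (rule sum.reindex_bij_betw[OF h])
    finally show ?thesis .
  qed
  have ev: "\<exists>x. z = complex_of_real x \<and> 0 \<le> x \<and> x \<le> c" if ez: "eigenvalue A' z" for z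
  proof -
    obtain v where v: "v \<in> carrier_vec n" "v \<noteq> 0\<^sub>v n" "A' *\<^sub>v v = z \<cdot>\<^sub>v v"
      using ez carrier_matD(1)[OF A'] by (auto simp: eigenvalue_def eigenvector_def)
    define f where "f s = (if s \<in> L then vec_index v (the_inv_into {..<n} h s) else 0)" for s
    have fh: "f (h i) = vec_index v i" if "i < n" for i
      using that h hL[OF that] by (simp add: f_def the_inv_into_f_f bij_betw_def)
    have supp: "f s = 0" if "s \<notin> L" for s using that by (simp add: f_def)
    have ef: "ell2 f"
    proof (rule ell2_bounded(1))
      fix F :: "'v set set" assume F: "finite F"
      have "(\<Sum>i\<in>F. (cmod (f i))\<^sup>2) \<le> (\<Sum>i\<in>F \<union> L. (cmod (f i))\<^sup>2)"
        using F fin by (intro sum_mono2) auto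
      also have "\<dots> = (\<Sum>i\<in>L. (cmod (f i))\<^sup>2)"
        using F fin supp by (intro sum.mono_neutral_right) auto
      finally show "(\<Sum>i\<in>F. (cmod (f i))\<^sup>2) \<le> (\<Sum>i\<in>L. (cmod (f i))\<^sup>2)" .
    qed
    have "lapl L f = (\<lambda>s. z * f s)"
    proof
      fix s show "lapl L f s = z * f s"
      proof (cases "s \<in> L")
        case True
        then obtain i where i: "i < n" "s = h i" using h by (auto simp: bij_betw_def)
        have "lapl L f s = (\<Sum>t\<in>L. f t * lapl L (delta t) s)"
          by (rule linear_expand[OF lapl_add lapl_scale fin supp])
        also have "\<dots> = (\<Sum>j<n. f (h j) * lapl L (delta (h j)) s)"
          by (rule sum.reindex_bij_betw[OF h, symmetric])
        also have "\<dots> = vec_index (A' *\<^sub>v v) i"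
          using i v(1) A entry fh by (simp add: A'_def scalar_prod_def atLeast0LessThan mult.commute)
        also have "\<dots> = z * f s" unfolding v(3) using i v(1) fh by simp
        finally show ?thesis .
      next
        case False
        then show ?thesis by (simp add: lapl_supp supp)
      qed
    qed
    then have "z * of_real (norm2 f) = ell2_inner (lapl L f) f"
      by (simp add: ell2_inner_scale_left ell2_inner_self)
    also have "\<dots> = of_real (Re (ell2_inner (lapl L f) f))"
      unfolding inner_lapl_self[OF cx deg D ef] unfolding inner_lapl[OF cx deg D ef ef] ell2_inner_self by simp
    finally have z: "z * of_real (norm2 f) = of_real (Re (ell2_inner (lapl L f) f))" .
    obtain i where i: "i < n" "vec_index v i \<noteq> 0"
      using v(1,2) by (metis carrier_vecD eq_vecI index_zero_vec)
    then have "f (h i) \<noteq> 0" using fh by simp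
    then have "norm2 f \<noteq> 0" using norm2_eq_0[OF ef] by auto
    then have pos: "norm2 f > 0" using norm2_nonneg[of f] by linarith
    define x where "x = Re (ell2_inner (lapl L f) f) / norm2 f"
    have "z = of_real x" using z pos by (simp add: x_def field_simps)
    moreover have "0 \<le> x" "x \<le> c"
      using inner_lapl_le[OF cx deg D ef] pos by (auto simp: x_def c_def field_simps)
    ultimately show ?thesis by blast
  qed
  have "Re (mat_trace (B ^\<^sub>m m) - mat_trace (B ^\<^sub>m m')) \<le> real n * (ln c / ln (1 / \<epsilon>) + (1 - \<epsilon>) ^ m)"
    unfolding B_def A'_def by (rule trace_pow_diff_le[OF A c ev[unfolded A'_def] m e])
  then show ?thesis unfolding tr by (simp add: sum_subtractf n_def c_def)
qed

text \<open>The first summand bounds the proportion of nonzero eigenvalues below \<epsilon> c, the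
  second the decay at the remaining ones.\<close>

definition rate :: "nat \<Rightarrow> real \<Rightarrow> nat \<Rightarrow> real" where
  "rate D \<epsilon> m = ln (lapl_bound D) / ln (1 / \<epsilon>) + (1 - \<epsilon>) ^ m"

lemma rate_nonneg: "0 < D \<Longrightarrow> 0 < \<epsilon> \<Longrightarrow> \<epsilon> < 1 \<Longrightarrow> 0 \<le> rate D \<epsilon> m"
  unfolding rate_def using lapl_bound_ge[of D] by (intro add_nonneg_nonneg divide_nonneg_nonneg) auto

lemma rate_small:
  assumes "0 < D" "0 < \<delta>"
  obtains \<epsilon> M where "0 < \<epsilon>" "\<epsilon> < 1" "\<And>m. M \<le> m \<Longrightarrow> rate D \<epsilon> m < \<delta>"
proof -
  define l where "l = ln (lapl_bound D)"
  have l: "0 \<le> l" using lapl_bound_ge[OF assms(1)] by (simp add: l_def)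
  \<comment> \<open>Chosen to make ln (1/\<epsilon>) equal to 2 l / \<delta> + 1. The main term
    brings l / ln (1/\<epsilon>) down to \<delta> / 2; the summand 1 makes this strict and keeps
    \<epsilon> below 1.\<close>
  define \<epsilon> where "\<epsilon> = exp (- (2 * l / \<delta> + 1))"
  have "2 * l / \<delta> \<ge> 0" using l assms by simp
  then have e: "0 < \<epsilon>" "\<epsilon> < 1" by (auto simp: \<epsilon>_def)
  have K: "ln (1 / \<epsilon>) = 2 * l / \<delta> + 1" using e by (simp add: \<epsilon>_def ln_div)
  have "0 < 2 * l / \<delta> + 1" using l assms by (simp add: add_nonneg_pos)
  then have "l / ln (1 / \<epsilon>) < \<delta> / 2"
    unfolding K using assms(2) by (simp add: pos_divide_less_eq distrib_left)
  moreover have "(\<lambda>m. (1 - \<epsilon>) ^ m) \<longlonglongrightarrow> 0" using e by (intro LIMSEQ_realpow_zero) auto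
  then obtain M where "\<And>m. M \<le> m \<Longrightarrow> (1 - \<epsilon>) ^ m < \<delta> / 2"
    using LIMSEQ_D[of _ 0 "\<delta> / 2"] assms e by (metis diff_zero half_gt_zero abs_less_iff real_norm_def)
  ultimately have "rate D \<epsilon> m < \<delta>" if "M \<le> m" for m
    using that unfolding rate_def l_def by (smt (verit) field_sum_of_halves)
  then show thesis using e that by blast
qed

section \<open>Twisted traces on finite complexes\<close>

context gcx_action
begin

text \<open>The eigenvalue count is relative to the number of simplices, whereas the measure of a
  finite complex averages over vertices. This estimate passes from one normalization to the
  other.\<close>

lemma card_complex_le:
  assumes "finite L"
  shows "card L \<le> card (verts L) * 2 ^ D"
proof -
  have fv: "finite (verts L)"
    by (rule finite_subset[of _ "\<Union>L"]) (use assms simplex_finite in \<open>auto simp: verts_def\<close>)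
  have "L \<subseteq> (\<Union>u\<in>verts L. {s \<in> L. u \<in> s})"
  proof
    fix s assume s: "s \<in> L"
    then obtain u where "u \<in> s" using simplicial_cxD(1)[OF cx] by blast
    then show "s \<in> (\<Union>u\<in>verts L. {s \<in> L. u \<in> s})" using s simplicial_cxD(4)[OF cx s] by blast
  qed
  then have "card L \<le> card (\<Union>u\<in>verts L. {s \<in> L. u \<in> s})"
    using fv card_star_le(1)[OF cx deg] by (intro card_mono) auto
  also have "\<dots> \<le> (\<Sum>u\<in>verts L. card {s \<in> L. u \<in> s})" by (rule card_UN_le[OF fv])
  also have "\<dots> \<le> (\<Sum>u\<in>verts L. 2 ^ D)" using card_star_le(2)[OF cx deg] by (intro sum_mono)
  finally show ?thesis by simp
qed

lemma finite_verts: "finite L \<Longrightarrow> finite (verts L)"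
  by (rule finite_subset[of _ "\<Union>L"]) (use simplex_finite in \<open>auto simp: verts_def\<close>)

text \<open>The half-sum of the diagonal entries at \<open>s\<close> and at its translate, summed
  over \<open>s\<close>, is the diagonal sum again, because \<open>g\<close> permutes the
  \<open>n\<close>-simplices. Diagonal entries being nonnegative, the sum may then be enlarged to
  all degrees.\<close>

lemma sum_project_heat_diff_le:
  assumes L: "finite L" and m: "m \<le> m'" and e: "0 < \<epsilon>" "\<epsilon> < 1"
  shows "cmod (\<Sum>s | s \<in> L \<and> card s = n + 1. project w ((heat D L ^^ m) (delta s)) s - project w ((heat D L ^^ m') (delta s)) s)
    \<le> (\<Sum>g\<in>carrier G. cmod (w g)) * (real (card L) * rate D \<epsilon> m)"
proof -
  define S where "S = {s. s \<in> L \<and> card s = n + 1}"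
  have S: "finite S" "S \<subseteq> L" using L by (auto simp: S_def)
  define a where "a s = Re ((heat D L ^^ m) (delta s) s - (heat D L ^^ m') (delta s) s)" for s
  define d where "d s t = (heat D L ^^ m) (delta s) t - (heat D L ^^ m') (delta s) t" for s t
  have a_form: "a s = heat.form m (delta s) - heat.form m' (delta s)" for s
    by (simp add: a_def heat.form_def)
  have a_nonneg: "0 \<le> a s" for s using heat.form_antimono[OF ell2_delta m, of s] by (simp add: a_form)
  have d_le: "cmod (d s t) \<le> (a s + a t) / 2" for s t
    using heat.cmod_pow_diff_delta[OF m, of s t] by (simp add: d_def a_form)
  have g_le: "(\<Sum>s\<in>S. cmod (d s (act g ` s))) \<le> (\<Sum>s\<in>S. a s)" if g: "g \<in> carrier G" for g
  proof -
    have bij: "bij_betw (\<lambda>s. act g ` s) S S"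
    proof (rule bij_betwI[of _ _ _ "\<lambda>s. act (inv\<^bsub>G\<^esub> g) ` s"])
      interpret group G by (rule group)
      show "(\<lambda>s. act g ` s) \<in> S \<rightarrow> S" "(\<lambda>s. act (inv\<^bsub>G\<^esub> g) ` s) \<in> S \<rightarrow> S"
        using g by (auto simp: S_def act_simplex card_act_image)
    qed (use g in \<open>auto simp: S_def act_image_inv\<close>)
    have "(\<Sum>s\<in>S. cmod (d s (act g ` s))) \<le> (\<Sum>s\<in>S. (a s + a (act g ` s)) / 2)"
      by (intro sum_mono d_le)
    also have "\<dots> = ((\<Sum>s\<in>S. a s) + (\<Sum>s\<in>S. a (act g ` s))) / 2"
      by (simp add: sum.distrib sum_divide_distrib add_divide_distrib)
    also have "(\<Sum>s\<in>S. a (act g ` s)) = (\<Sum>s\<in>S. a s)" by (rule sum.reindex_bij_betw[OF bij])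
    finally show ?thesis by simp
  qed
  have "(\<Sum>s\<in>S. project w ((heat D L ^^ m) (delta s)) s - project w ((heat D L ^^ m') (delta s)) s) =
      (\<Sum>s\<in>S. \<Sum>g\<in>carrier G. cnj (w g) * eps (act g) s * d s (act g ` s))"
    using S by (intro sum.cong refl) (auto simp: project_simplex d_def right_diff_distrib sum_subtractf)
  also have "\<dots> = (\<Sum>g\<in>carrier G. \<Sum>s\<in>S. cnj (w g) * eps (act g) s * d s (act g ` s))" by (rule sum.swap)
  also have "cmod \<dots> \<le> (\<Sum>g\<in>carrier G. \<Sum>s\<in>S. cmod (w g) * cmod (d s (act g ` s)))"
  proof (rule order_trans[OF norm_sum], rule sum_mono, rule order_trans[OF norm_sum], rule sum_mono)
    fix g s assume "g \<in> carrier G" "s \<in> S"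
    then show "cmod (cnj (w g) * eps (act g) s * d s (act g ` s)) \<le> cmod (w g) * cmod (d s (act g ` s))"
      using S cmod_eps_act by (auto simp: norm_mult)
  qed
  also have "\<dots> = (\<Sum>g\<in>carrier G. cmod (w g) * (\<Sum>s\<in>S. cmod (d s (act g ` s))))"
    by (simp add: sum_distrib_left)
  also have "\<dots> \<le> (\<Sum>g\<in>carrier G. cmod (w g) * (\<Sum>s\<in>L. a s))"
  proof (intro sum_mono mult_left_mono)
    fix g assume "g \<in> carrier G"
    from g_le[OF this] show "(\<Sum>s\<in>S. cmod (d s (act g ` s))) \<le> (\<Sum>s\<in>L. a s)"
      using sum_mono2[OF L S(2), of a, OF a_nonneg] by linarith
  qed simp
  also have "\<dots> = (\<Sum>g\<in>carrier G. cmod (w g)) * (\<Sum>s\<in>L. a s)" by (simp add: sum_distrib_right)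
  also have "\<dots> \<le> (\<Sum>g\<in>carrier G. cmod (w g)) * (real (card L) * rate D \<epsilon> m)"
    using trace_heat_pow_diff[OF cx deg D L m e] unfolding a_def rate_def
    by (intro mult_left_mono sum_nonneg) auto
  finally show ?thesis by (simp add: S_def)
qed

lemma sum_star:
  assumes "finite L"
  shows "(\<Sum>x\<in>verts L. \<Sum>s | s \<in> L \<and> card s = n + 1 \<and> x \<in> s. f s) =
    of_nat (n + 1) * (\<Sum>s | s \<in> L \<and> card s = n + 1. f s :: complex)"
proof -
  define S where "S = {s. s \<in> L \<and> card s = n + 1}"
  have S: "finite S" using assms by (simp add: S_def)
  have "(\<Sum>x\<in>verts L. \<Sum>s | s \<in> L \<and> card s = n + 1 \<and> x \<in> s. f s) = (\<Sum>x\<in>verts L. \<Sum>s\<in>S. if x \<in> s then f s else 0)"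
  proof (rule sum.cong[OF refl])
    fix x
    have "S \<inter> {s. x \<in> s} = {s. s \<in> L \<and> card s = n + 1 \<and> x \<in> s}" by (auto simp: S_def)
    then show "(\<Sum>s | s \<in> L \<and> card s = n + 1 \<and> x \<in> s. f s) = (\<Sum>s\<in>S. if x \<in> s then f s else 0)"
      using sum.inter_restrict[OF S, of f "{s. x \<in> s}"] by simp
  qed
  also have "\<dots> = (\<Sum>s\<in>S. \<Sum>x\<in>verts L. if x \<in> s then f s else 0)" by (rule sum.swap)
  also have "\<dots> = (\<Sum>s\<in>S. of_nat (n + 1) * f s)"
  proof (rule sum.cong[OF refl])
    fix s assume s: "s \<in> S"
    then have "verts L \<inter> s = s" "card s = n + 1" using simplicial_cxD(4)[OF cx, of s] by (auto simp: S_def)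
    then show "(\<Sum>x\<in>verts L. if x \<in> s then f s else 0) = of_nat (n + 1) * f s"
      using sum.inter_restrict[OF finite_verts[OF assms], of "\<lambda>_. f s" s] by simp
  qed
  finally show ?thesis by (simp add: S_def sum_distrib_left)
qed

end

section \<open>Traces as locally constant functions of isomorphism classes\<close>

lemma gcx_action_of_simplicial_gcx:
  assumes "group G" "finite (carrier G)" "0 < D" and A: "simplicial_gcx G D A"
  shows "gcx_action G D (simps A) (action A)"
proof -
  interpret group_action G "verts (simps A)" "action A" using A by (simp add: simplicial_gcx_def)
  show ?thesis
  proof (rule gcx_action.intro)
    fix v assume "v \<in> verts (simps A)"
    then show "action A \<one>\<^bsub>G\<^esub> v = v" using id_eq_one by (metis restrict_apply')
  qed (use assms composition_rule in \<open>auto simp: simplicial_gcx_def\<close>)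
qed

lemma gcx_isoE:
  assumes "gcx_iso G A B"
  obtains f where "bij_betw f (verts (simps A)) (verts (simps B))" "(\<lambda>s. f ` s) ` simps A = simps B"
    "\<And>g v. g \<in> carrier G \<Longrightarrow> v \<in> verts (simps A) \<Longrightarrow> f (action A g v) = action B g (f v)"
    "map (\<lambda>W. f ` W) (roots A) = roots B"
proof -
  from assms show thesis unfolding gcx_iso_def
  proof (elim exE conjE)
    fix f
    assume f: "bij_betw f (verts (simps A)) (verts (simps B))" "(\<lambda>s. f ` s) ` simps A = simps B"
      "\<forall>g\<in>carrier G. \<forall>v\<in>verts (simps A). f (action A g v) = action B g (f v)"
      "map (\<lambda>W. f ` W) (roots A) = roots B"
    show thesis
    proof (rule that[OF f(1,2) _ f(4)])
      fix g v assume "g \<in> carrier G" "v \<in> verts (simps A)"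
      then show "f (action A g v) = action B g (f v)" using f(3) by simp
    qed
  qed
qed

lemma gcx_iso_refl: "gcx_iso G A A"
  unfolding gcx_iso_def by (rule exI[of _ id]) simp

lemma orbit_subset_verts:
  assumes "gcx_action G D L act" "x \<in> verts L"
  shows "orbit G act x \<subseteq> verts L" "finite (orbit G act x)" "x \<in> orbit G act x"
proof -
  interpret gcx_action G D L act by fact
  show "orbit G act x \<subseteq> verts L" using act_verts assms(2) by (auto simp: orbit_def)
  have "orbit G act x = (\<lambda>g. act g x) ` carrier G" by (auto simp: orbit_def)
  then show "finite (orbit G act x)" using fin by simp
  have "\<one>\<^bsub>G\<^esub> \<in> carrier G" using group by (simp add: group.is_monoid)
  then show "x \<in> orbit G act x" using act_one[OF assms(2)] unfolding orbit_def by force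
qed

lemma (in gcx_action) orbit_eq:
  assumes "x \<in> verts L" "y \<in> orbit G act x"
  shows "orbit G act y = orbit G act x"
proof -
  interpret group G by (rule group)
  obtain g where g: "g \<in> carrier G" "y = act g x" using assms(2) by (auto simp: orbit_def)
  show ?thesis
  proof (intro equalityI subsetI)
    fix z assume "z \<in> orbit G act y"
    then obtain h where "h \<in> carrier G" "z = act (h \<otimes>\<^bsub>G\<^esub> g) x"
      using g act_mult assms(1) by (auto simp: orbit_def)
    then show "z \<in> orbit G act x" using g by (auto simp: orbit_def)
  next
    fix z assume "z \<in> orbit G act x"
    then obtain h where h: "h \<in> carrier G" "z = act h x" by (auto simp: orbit_def)
    then have "z = act (h \<otimes>\<^bsub>G\<^esub> inv\<^bsub>G\<^esub> g) y" using g act_mult assms(1) act_verts by simp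
    then show "z \<in> orbit G act y" using g h by (auto simp: orbit_def)
  qed
qed

lemma (in gcx_action) orbit_sym: "x \<in> verts L \<Longrightarrow> y \<in> orbit G act x \<Longrightarrow> x \<in> orbit G act y"
  using orbit_eq orbit_subset_verts(3)[OF gcx_action_axioms] by blast

lemma marked_gcxD:
  assumes "group G" "finite (carrier G)" "0 < D" and A: "marked_gcx G D 1 A"
  obtains W where "gcx_action G D (simps A) (action A)" "roots A = [W]" "W \<subseteq> verts (simps A)"
    "finite W" "W \<noteq> {}" "\<And>g x. g \<in> carrier G \<Longrightarrow> x \<in> W \<Longrightarrow> action A g x \<in> W"
    "W \<in> orbits G (verts (simps A)) (action A)"
proof -
  have act: "gcx_action G D (simps A) (action A)"
    using gcx_action_of_simplicial_gcx assms by (auto simp: marked_gcx_def)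
  obtain W where W: "roots A = [W]" "W \<in> orbits G (verts (simps A)) (action A)"
    using A by (auto simp: marked_gcx_def length_Suc_conv)
  then obtain x where x: "x \<in> verts (simps A)" "W = orbit G (action A) x" by (auto simp: orbits_def)
  note o = orbit_subset_verts[OF act x(1)]
  have inv: "action A g y \<in> W" if "g \<in> carrier G" "y \<in> W" for g y
  proof -
    have "action A g y \<in> orbit G (action A) y" using that(1) by (auto simp: orbit_def)
    then show ?thesis using gcx_action.orbit_eq[OF act x(1)] that(2) x(2) by blast
  qed
  show thesis
  proof (rule that[OF act W(1)])
    show "W \<subseteq> verts (simps A)" "finite W" using o x(2) by auto
    show "W \<noteq> {}" using o(3) x(2) by blast
    show "action A g x \<in> W" if "g \<in> carrier G" "x \<in> W" for g x using that by (rule inv)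
  qed (rule W(2))
qed

text \<open>The factor \<open>n + 1\<close> compensates for counting an \<open>n\<close>-simplex at
  each of its vertices, and the root is an orbit, over which the local traces are averaged. The
  vertex type is left open to cover both representatives over \<nat> and realizations.\<close>

definition trace_fun ::
    "('g, 'm) monoid_scheme \<Rightarrow> nat \<Rightarrow> nat \<Rightarrow> ('g \<Rightarrow> complex) \<Rightarrow> nat \<Rightarrow> ('g, 'v) gcomplex \<Rightarrow> complex" where
  "trace_fun G D n w m A = (\<Sum>x\<in>hd (roots A). local_trace G D n w m A x) / of_nat (card (hd (roots A)) * (n + 1))"

lemma trace_fun_iso:
  assumes cx: "simplicial_cx (simps A)" and W: "roots A = [W]" "W \<subseteq> verts (simps A)"
    and iso: "gcx_iso G A B"
    and act: "\<And>g s x. g \<in> carrier G \<Longrightarrow> s \<in> simps A \<Longrightarrow> x \<in> W \<Longrightarrow> x \<in> s \<Longrightarrow>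
      action A g ` s \<in> simps A \<and> inj_on (action A g) s"
  shows "trace_fun G D n w m B = trace_fun G D n w m A"
proof -
  obtain f where f: "bij_betw f (verts (simps A)) (verts (simps B))" "(\<lambda>s. f ` s) ` simps A = simps B"
    "\<And>g v. g \<in> carrier G \<Longrightarrow> v \<in> verts (simps A) \<Longrightarrow> f (action A g v) = action B g (f v)"
    "map (\<lambda>W. f ` W) (roots A) = roots B"
    by (rule gcx_isoE[OF iso]) (rule that)
  have inj: "inj_on f (verts (simps A))" using f(1) by (simp add: bij_betw_def)
  have "local_trace G D n w m B (f x) = local_trace G D n w m A x" if "x \<in> W" for x
    using W(2) that by (intro local_trace_iso[OF cx inj f(2,3)]) (use act that in auto)
  moreover have "inj_on f W" using inj W(2) by (rule inj_on_subset)
  moreover have "roots B = [f ` W]" using f(4) W(1) by simp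
  ultimately show ?thesis
    unfolding trace_fun_def by (simp add: W(1) sum.reindex card_image)
qed

lemma trace_fun_full_sub:
  assumes cx: "simplicial_cx (simps A)" and deg: "vertex_degree_le (simps A) D"
    and roots: "roots A = [V]" and W: "\<And>x. x \<in> V \<Longrightarrow> reach (simps A) x (m + 1) \<subseteq> W"
  shows "trace_fun G D n w m (full_sub A W) = trace_fun G D n w m A"
proof -
  have "roots (full_sub A W) = [V]" using roots by (simp add: full_sub_def)
  moreover have "(\<Sum>x\<in>V. local_trace G D n w m (full_sub A W) x) = (\<Sum>x\<in>V. local_trace G D n w m A x)"
    by (rule sum.cong[OF refl]) (rule local_trace_full_sub[OF cx deg W])
  ultimately show ?thesis unfolding trace_fun_def roots by simp
qed

context
  fixes G :: "('g, 'm) monoid_scheme" and D n :: nat and w :: "'g \<Rightarrow> complex"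
  assumes group: "group G" and fin: "finite (carrier G)" and D: "0 < D"
begin

lemma trace_fun_iso_marked:
  assumes A: "marked_gcx G D 1 A" and iso: "gcx_iso G A B"
  shows "trace_fun G D n w m B = trace_fun G D n w m A"
proof -
  obtain W where W: "gcx_action G D (simps A) (action A)" "roots A = [W]" "W \<subseteq> verts (simps A)"
    by (rule marked_gcxD[OF group fin D A]) (rule that)
  interpret gcx_action G D "simps A" "action A" by (rule W(1))
  show ?thesis by (rule trace_fun_iso[OF cx W(2,3) iso]) (simp add: act_simplex act_inj_simplex)
qed

text \<open>By finite propagation the trace of either complex can be computed in its ball, and there
  the isomorphism applies. The bound on \<open>r\<close> is the propagation radius of
  \<open>heat_pow_restrict\<close>.\<close>

lemma trace_fun_ball_iso:
  fixes A B :: "('g, 'v) gcomplex"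
  assumes A: "marked_gcx G D 1 A" and B: "marked_gcx G D 1 B"
    and iso: "gcx_iso G (ball_cx r A) (ball_cx r B)" and r: "real (m + 1) \<le> r"
  shows "trace_fun G D n w m A = trace_fun G D n w m B"
proof -
  define ballset where "ballset A = {v \<in> verts (simps A). \<exists>u\<in>\<Union>(set (roots A)). \<exists>k::nat. real k \<le> r \<and> (u, v) \<in> adj (simps A) ^^ k}"
    for A :: "('g, 'v) gcomplex"
  have ball: "ball_cx r A = full_sub A (ballset A)" for A :: "('g, 'v) gcomplex"
    by (simp add: ball_cx_def ballset_def)
  have reach: "reach (simps A) x (m + 1) \<subseteq> ballset A"
    if mA: "marked_gcx G D 1 A" "roots A = [W]" "x \<in> W" for A :: "('g, 'v) gcomplex" and W x
  proof
    fix v assume "v \<in> reach (simps A) x (m + 1)"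
    obtain W' where W': "gcx_action G D (simps A) (action A)" "roots A = [W']" "W' \<subseteq> verts (simps A)"
      by (rule marked_gcxD[OF group fin D mA(1)]) (rule that)
    interpret gcx_action G D "simps A" "action A" by (rule W'(1))
    obtain k where k: "k \<le> m + 1" "(x, v) \<in> adj (simps A) ^^ k"
      using \<open>v \<in> reach (simps A) x (m + 1)\<close> by (auto simp: reach_def[OF cx deg])
    have "v \<in> verts (simps A)"
    proof (cases k)
      case 0
      then show ?thesis using k mA W' by auto
    next
      case (Suc j)
      then obtain u where "(u, v) \<in> adj (simps A)" using k by auto
      then have "{u, v} \<in> simps A" by (simp add: adj_def)
      then show ?thesis using simplicial_cxD(4)[OF cx] by blast
    qed
    moreover have "real k \<le> r" using k r by simp
    ultimately show "v \<in> ballset A" using k(2) mA(2,3) by (auto simp: ballset_def)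
  qed
  have sub: "trace_fun G D n w m (ball_cx r A) = trace_fun G D n w m A" if A: "marked_gcx G D 1 A" for A :: "('g, 'v) gcomplex"
  proof -
    obtain W where W: "gcx_action G D (simps A) (action A)" "roots A = [W]" "W \<subseteq> verts (simps A)"
      by (rule marked_gcxD[OF group fin D A]) (rule that)
    interpret gcx_action G D "simps A" "action A" by (rule W(1))
    show ?thesis unfolding ball using reach[OF A W(2)] by (rule trace_fun_full_sub[OF cx deg W(2)])
  qed
  obtain W where W: "gcx_action G D (simps A) (action A)" "roots A = [W]" "W \<subseteq> verts (simps A)"
    "W \<noteq> {}" "\<And>g x. g \<in> carrier G \<Longrightarrow> x \<in> W \<Longrightarrow> action A g x \<in> W"
    by (rule marked_gcxD[OF group fin D A]) (rule that)
  interpret gcx_action G D "simps A" "action A" by (rule W(1))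
  define L where "L = simps (ball_cx r A)"
  have L: "L = {s \<in> simps A. s \<subseteq> ballset A}" by (simp add: L_def ball full_sub_def)
  \<comment> \<open>The radius is at least 1, so the ball contains the full star of every root; the
    action on these simplices is all that \<open>trace_fun_iso\<close> asks for.\<close>
  have star: "s \<in> L" if "x \<in> W" "s \<in> simps A" "x \<in> s" for x s
  proof -
    have "s \<subseteq> reach (simps A) x (m + 1)"
      using simplex_reach[OF cx deg that(2,3)] reach_mono[OF cx deg, of 1 "m + 1" x] by auto
    then show ?thesis using reach[OF A W(2) that(1)] that(2) by (auto simp: L)
  qed
  obtain x where x: "x \<in> W" using W(4) by blast
  have xs: "{x} \<in> simps A" using x W(3) by (auto simp: verts_def)
  have "{x} \<in> L" using star[OF x xs] by simp
  then have cxL: "simplicial_cx L"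
    unfolding L using simplicial_cx_restrict[OF cx deg xs] by blast
  have "trace_fun G D n w m (ball_cx r B) = trace_fun G D n w m (ball_cx r A)"
  proof (rule trace_fun_iso[OF _ _ _ iso])
    show "simplicial_cx (simps (ball_cx r A))" using cxL by (simp add: L_def)
    show "roots (ball_cx r A) = [W]" using W(2) by (simp add: ball full_sub_def)
    show "W \<subseteq> verts (simps (ball_cx r A))"
    proof
      fix x assume "x \<in> W"
      then have "{x} \<in> L" using star[of x "{x}"] W(3) by (auto simp: verts_def)
      then show "x \<in> verts (simps (ball_cx r A))" by (simp add: L_def verts_def)
    qed
    fix g s x assume g: "g \<in> carrier G" and s: "s \<in> simps (ball_cx r A)" and x: "x \<in> W" "x \<in> s"
    have s': "s \<in> simps A" "s \<subseteq> ballset A" using s unfolding L_def[symmetric] by (auto simp: L)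
    have eq: "action (ball_cx r A) g v = action A g v" if "v \<in> s" for v
      using that s'(2) by (auto simp: ball full_sub_def)
    have "action (ball_cx r A) g ` s = action A g ` s" using eq by auto
    moreover have "action A g ` s \<in> L"
      using star[of "action A g x" "action A g ` s"] W(5)[OF g x(1)] act_simplex[OF g s'(1)] x(2) by blast
    moreover have "inj_on (action (ball_cx r A) g) s"
      using act_inj_simplex[OF g s'(1)] eq by (simp cong: inj_on_cong)
    ultimately show "action (ball_cx r A) g ` s \<in> simps (ball_cx r A) \<and> inj_on (action (ball_cx r A) g) s"
      by (simp add: L_def)
  qed
  then show ?thesis using sub[OF A] sub[OF B] by simp
qed

lemma SC_repD:
  assumes "a \<in> SC G D 1" "A \<in> a"
  shows "marked_gcx G D 1 A"
  using assms by (auto simp: SC_def quotient_def iso_rel_def)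

lemma some_rep_in:
  assumes "a \<in> SC G D 1"
  shows "some_rep a \<in> a"
proof -
  obtain A where A: "marked_gcx G D 1 A" "a = iso_rel G D 1 `` {A}" using assms by (auto simp: SC_def quotient_def)
  then have "A \<in> a" using gcx_iso_refl by (simp add: iso_rel_def)
  then show ?thesis unfolding some_rep_def by (rule someI)
qed

definition class_trace :: "nat \<Rightarrow> 'g gclass \<Rightarrow> complex" where
  "class_trace m a = trace_fun G D n w m (some_rep a)"

lemma class_trace_eq:
  assumes a: "a \<in> SC G D 1" and A: "A \<in> a"
  shows "class_trace m a = trace_fun G D n w m A"
proof -
  obtain A0 where A0: "marked_gcx G D 1 A0" "a = iso_rel G D 1 `` {A0}" using assms by (auto simp: SC_def quotient_def)
  have "trace_fun G D n w m B = trace_fun G D n w m A0" if "B \<in> a" for B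
    using that A0 by (intro trace_fun_iso_marked) (auto simp: iso_rel_def)
  then show ?thesis using A some_rep_in[OF a] by (simp add: class_trace_def)
qed

lemma SC_dist_self:
  assumes "a \<in> SC G D 1" "0 < e"
  shows "SC_dist G a a < ennreal e"
proof -
  obtain r :: nat where r: "r > 0" "(1 / 2) ^ r < e"
  proof -
    obtain k where "(1 / 2 :: real) ^ k < e" using real_arch_pow_inv[OF assms(2), of "1 / 2"] by auto
    moreover have "(1 / 2 :: real) ^ Suc k \<le> (1 / 2) ^ k" by simp
    ultimately show thesis using that[of "Suc k"] by linarith
  qed
  have "SC_dist G a a \<le> ennreal (2 powr (- real r))"
    unfolding SC_dist_def
  proof (intro Inf_lower CollectI exI[of _ "real r"] conjI)
    show "\<exists>A\<in>a. \<exists>B\<in>a. gcx_iso G (ball_cx (real r) A) (ball_cx (real r) B)"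
      using some_rep_in[OF assms(1)] gcx_iso_refl by blast
  qed (use r in auto)
  also have "2 powr (- real r) = (1 / 2) ^ r"
    by (simp add: powr_minus powr_realpow power_one_over inverse_eq_divide)
  also have "ennreal \<dots> < ennreal e" using r(2) assms(2) by (simp add: ennreal_less_iff)
  finally show ?thesis .
qed

lemma SC_nbhd:
  assumes "a \<in> SC G D 1" "0 < e"
  shows "openin (SC_top G D 1) {b \<in> SC G D 1. SC_dist G a b < ennreal e}"
    "a \<in> {b \<in> SC G D 1. SC_dist G a b < ennreal e}"
proof -
  show "openin (SC_top G D 1) {b \<in> SC G D 1. SC_dist G a b < ennreal e}"
    unfolding SC_top_def using assms by (intro topology_generated_by_Basis) blast
  show "a \<in> {b \<in> SC G D 1. SC_dist G a b < ennreal e}" using assms SC_dist_self by simp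
qed

lemma topspace_SC_top: "topspace (SC_top G D 1) = SC G D 1"
proof
  show "topspace (SC_top G D 1) \<subseteq> SC G D 1" by (auto simp: SC_top_def)
  show "SC G D 1 \<subseteq> topspace (SC_top G D 1)"
    using SC_nbhd[of _ 1] openin_subset by fastforce
qed

lemma class_trace_local:
  assumes "a \<in> SC G D 1" "b \<in> SC G D 1" "SC_dist G a b < ennreal (2 powr (- real (m + 1)))"
  shows "class_trace m a = class_trace m b"
proof -
  obtain r A B where r: "ennreal (2 powr (- r)) < ennreal (2 powr (- real (m + 1)))" "A \<in> a" "B \<in> b"
    "gcx_iso G (ball_cx r A) (ball_cx r B)"
    using assms(3) unfolding SC_dist_def Inf_less_iff by blast
  have "real (m + 1) \<le> r" using r(1) by (simp add: ennreal_less_iff)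
  then have "trace_fun G D n w m A = trace_fun G D n w m B"
    using trace_fun_ball_iso[OF SC_repD[OF assms(1) r(2)] SC_repD[OF assms(2) r(3)] r(4)] by blast
  then show ?thesis using class_trace_eq assms r by metis
qed

text \<open>The trace is constant on the neighbourhood of classes at distance less than
  \<open>2 powr (- real (m + 1))\<close>, so the preimage of any set whatsoever is open.\<close>

lemma continuous_class_trace: "continuous_map (SC_top G D 1) euclideanreal (\<lambda>a. Re (class_trace m a))"
  unfolding continuous_map_def
proof (intro conjI allI impI)
  fix U :: "real set"
  show "openin (SC_top G D 1) {x \<in> topspace (SC_top G D 1). Re (class_trace m x) \<in> U}"
  proof (subst openin_subopen, intro ballI)
    fix a assume a: "a \<in> {x \<in> topspace (SC_top G D 1). Re (class_trace m x) \<in> U}"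
    then have aS: "a \<in> SC G D 1" by (simp add: topspace_SC_top del: One_nat_def)
    define N where "N = {b \<in> SC G D 1. SC_dist G a b < ennreal (2 powr (- real (m + 1)))}"
    have "openin (SC_top G D 1) N" "a \<in> N"
      unfolding N_def using SC_nbhd[OF aS, of "2 powr (- real (m + 1))"] by auto
    moreover have "N \<subseteq> {x \<in> topspace (SC_top G D 1). Re (class_trace m x) \<in> U}"
      using a class_trace_local[OF aS] by (auto simp: N_def topspace_SC_top simp del: One_nat_def)
    ultimately show "\<exists>T. openin (SC_top G D 1) T \<and> a \<in> T \<and> T \<subseteq> {x \<in> topspace (SC_top G D 1). Re (class_trace m x) \<in> U}"
      by blast
  qed
qed auto

end

lemma (in gcx_action) local_trace_project:
  assumes "simps A = L" "\<And>g v. g \<in> carrier G \<Longrightarrow> v \<in> verts L \<Longrightarrow> action A g v = act g v"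
  shows "local_trace G D n w m A x = (\<Sum>s | s \<in> L \<and> card s = n + 1 \<and> x \<in> s. project w ((heat D L ^^ m) (delta s)) s)"
  unfolding local_trace_def assms(1)
proof (rule sum.cong[OF refl])
  fix s assume "s \<in> {s. s \<in> L \<and> card s = n + 1 \<and> x \<in> s}"
  then have s: "s \<in> L" by simp
  have "eps (action A g) s = eps (act g) s" "action A g ` s = act g ` s" if "g \<in> carrier G" for g
    using assms(2)[OF that] simplicial_cxD(4)[OF cx s]
    by (auto intro!: eps_cong simplex_finite s image_cong)
  then show "(\<Sum>g\<in>carrier G. cnj (w g) * eps (action A g) s * (heat D L ^^ m) (delta s) (action A g ` s)) =
    project w ((heat D L ^^ m) (delta s)) s"
    using s by (simp add: project_simplex)
qed

lemma (in gcx_action) sum_star_bound: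
  fixes f :: "'v set \<Rightarrow> complex"
  assumes "x \<in> verts L" "\<And>s. s \<in> L \<Longrightarrow> cmod (f s) \<le> C" "0 \<le> C"
  shows "cmod (\<Sum>s | s \<in> L \<and> card s = n + 1 \<and> x \<in> s. f s) \<le> 2 ^ D * C"
proof -
  define S where "S = {s. s \<in> L \<and> card s = n + 1 \<and> x \<in> s}"
  note c = card_star_le[OF cx deg assms(1)]
  have sub: "S \<subseteq> {s \<in> L. x \<in> s}" by (auto simp: S_def)
  have "cmod (sum f S) \<le> (\<Sum>s\<in>S. C)"
    by (rule order_trans[OF norm_sum], rule sum_mono) (use assms in \<open>auto simp: S_def\<close>)
  also have "\<dots> = real (card S) * C" by simp
  also have "\<dots> \<le> real (2 ^ D) * C"
    using card_mono[OF c(1) sub] c(2) assms(3) by (intro mult_right_mono of_nat_mono) auto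
  finally show ?thesis by (simp add: S_def)
qed

text \<open>At most \<open>2 ^ D\<close> simplices contain a given root, and each contributes at
  most the sum of the moduli of the weights. The bound is the same for all \<open>m\<close> and all
  classes, as both weak and dominated convergence require.\<close>

lemma class_trace_bound:
  assumes "group G" "finite (carrier G)" "0 < D" "a \<in> SC G D 1"
  shows "cmod (class_trace G D n w m a) \<le> 2 ^ D * (\<Sum>g\<in>carrier G. cmod (w g))"
proof -
  define C where "C = (\<Sum>g\<in>carrier G. cmod (w g))"
  define A where "A = some_rep a"
  have A: "marked_gcx G D 1 A" unfolding A_def using SC_repD some_rep_in assms by blast
  obtain W where W: "gcx_action G D (simps A) (action A)" "roots A = [W]" "W \<subseteq> verts (simps A)" "finite W" "W \<noteq> {}"
    by (rule marked_gcxD[OF assms(1-3) A]) (rule that)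
  interpret gcx_action G D "simps A" "action A" by (rule W(1))
  have "cmod (local_trace G D n w m A x) \<le> 2 ^ D * C" if "x \<in> W" for x
    unfolding local_trace_project[OF refl refl]
    by (rule sum_star_bound) (use W(3) that cmod_project_heat_le in \<open>auto simp: C_def intro: sum_nonneg\<close>)
  then have "cmod (\<Sum>x\<in>W. local_trace G D n w m A x) \<le> (\<Sum>x\<in>W. 2 ^ D * C)"
    by (rule sum_norm_le)
  then have *: "cmod (\<Sum>x\<in>W. local_trace G D n w m A x) \<le> real (card W) * (2 ^ D * C)" by simp
  have cW: "0 < card W" using W by (simp add: card_gt_0_iff)
  have "0 \<le> 2 ^ D * C" by (simp add: C_def sum_nonneg)
  then have "real (card W) * (2 ^ D * C) \<le> real (card W * (n + 1)) * (2 ^ D * C)"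
    by (intro mult_right_mono) auto
  then have "cmod (\<Sum>x\<in>W. local_trace G D n w m A x) \<le> real (card W * (n + 1)) * (2 ^ D * C)"
    using * by linarith
  then show ?thesis
    using cW assms unfolding class_trace_def[OF assms(1-3)] trace_fun_def A_def[symmetric] W(2) C_def[symmetric]
    by (simp add: norm_divide divide_le_eq mult.commute del: of_nat_mult of_nat_add of_nat_Suc)
qed

section \<open>Mean traces and sofic approximation\<close>

lemma space_borel_of_top: "space (borel_of_top X) = topspace X"
  unfolding borel_of_top_def by (rule space_measure_of) (auto dest: openin_subset)

lemma openin_sets_borel_of_top: "openin X U \<Longrightarrow> U \<in> sets (borel_of_top X)"
  unfolding borel_of_top_def by (subst sets_measure_of) (auto dest: openin_subset)

lemma continuous_map_borel_measurable:
  fixes f :: "'a \<Rightarrow> real"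
  assumes "continuous_map X euclideanreal f"
  shows "f \<in> borel_measurable (borel_of_top X)"
proof (rule borel_measurableI)
  fix S :: "real set" assume "open S"
  then have "openin X {x \<in> topspace X. f x \<in> S}"
    using openin_continuous_map_preimage[OF assms] by simp
  then have "{x \<in> topspace X. f x \<in> S} \<in> sets (borel_of_top X)" by (rule openin_sets_borel_of_top)
  moreover have "f -` S \<inter> space (borel_of_top X) = {x \<in> topspace X. f x \<in> S}"
    by (auto simp: space_borel_of_top)
  ultimately show "f -` S \<inter> space (borel_of_top X) \<in> sets (borel_of_top X)" by simp
qed

text \<open>Orbits partition the vertices, so replacing a function by its averages over orbits
  preserves the total. Here this is double counting over the symmetric relation of lying in one
  orbit.\<close>

lemma (in gcx_action) sum_orbit_average:
  fixes h :: "'v \<Rightarrow> complex"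
  assumes "finite L"
  shows "(\<Sum>x\<in>verts L. (\<Sum>y\<in>orbit G act x. h y) / of_nat (card (orbit G act x))) = (\<Sum>y\<in>verts L. h y)"
proof -
  note V = finite_verts[OF assms]
  note o = orbit_subset_verts[OF gcx_action_axioms]
  have "(\<Sum>x\<in>verts L. (\<Sum>y\<in>orbit G act x. h y) / of_nat (card (orbit G act x))) =
      (\<Sum>x\<in>verts L. \<Sum>y\<in>verts L. if y \<in> orbit G act x then h y / of_nat (card (orbit G act x)) else 0)"
  proof (rule sum.cong[OF refl])
    fix x assume x: "x \<in> verts L"
    have "verts L \<inter> orbit G act x = orbit G act x" using o(1)[OF x] by blast
    then show "(\<Sum>y\<in>orbit G act x. h y) / of_nat (card (orbit G act x)) =
        (\<Sum>y\<in>verts L. if y \<in> orbit G act x then h y / of_nat (card (orbit G act x)) else 0)"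
      using sum.inter_restrict[OF V, of "\<lambda>y. h y / of_nat (card (orbit G act x))" "orbit G act x"]
      by (simp add: sum_divide_distrib)
  qed
  also have "\<dots> = (\<Sum>y\<in>verts L. \<Sum>x\<in>verts L. if y \<in> orbit G act x then h y / of_nat (card (orbit G act x)) else 0)"
    by (rule sum.swap)
  also have "\<dots> = (\<Sum>y\<in>verts L. h y)"
  proof (rule sum.cong[OF refl])
    fix y assume y: "y \<in> verts L"
    have "(\<Sum>x\<in>verts L. if y \<in> orbit G act x then h y / of_nat (card (orbit G act x)) else 0) =
        (\<Sum>x\<in>verts L. if x \<in> orbit G act y then h y / of_nat (card (orbit G act y)) else 0)"
    proof (rule sum.cong[OF refl])
      fix x assume x: "x \<in> verts L"
      have "y \<in> orbit G act x \<longleftrightarrow> x \<in> orbit G act y" using orbit_sym x y by blast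
      moreover have "orbit G act x = orbit G act y" if "x \<in> orbit G act y" using orbit_eq[OF y that] .
      ultimately show "(if y \<in> orbit G act x then h y / of_nat (card (orbit G act x)) else 0) =
        (if x \<in> orbit G act y then h y / of_nat (card (orbit G act y)) else 0)" by simp
    qed
    also have "\<dots> = (\<Sum>x\<in>orbit G act y. h y / of_nat (card (orbit G act y)))"
    proof -
      have "verts L \<inter> orbit G act y = orbit G act y" using o(1)[OF y] by blast
      then show ?thesis
        using sum.inter_restrict[OF V, of "\<lambda>x. h y / of_nat (card (orbit G act y))" "orbit G act y"] by simp
    qed
    also have "\<dots> = h y"
    proof -
      have "card (orbit G act y) \<noteq> 0" using o(2,3)[OF y] by auto
      then show ?thesis by simp
    qed
    finally show "(\<Sum>x\<in>verts L. if y \<in> orbit G act x then h y / of_nat (card (orbit G act x)) else 0) = h y" .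
  qed
  finally show ?thesis .
qed

text \<open>Total mass one of the push-forward forces every \<open>[K, Gx]\<close> to be a point of the space.\<close>
lemma finite_cx_measure_points:
  assumes V: "finite (verts (simps K))" "verts (simps K) \<noteq> {}"
    and P: "borel_prob_on_SC G D (finite_cx_measure G D K)" and x: "x \<in> verts (simps K)"
  shows "cls G D 1 (rooted_component G K x) \<in> space (SC_borel G D 1)"
proof -
  define \<phi> where "\<phi> x = cls G D 1 (rooted_component G K x)" for x
  define U where "U = uniform_count_measure (verts (simps K))"
  interpret prob_space "finite_cx_measure G D K" using P by (simp add: borel_prob_on_SC_def)
  have "emeasure (distr U (SC_borel G D 1) \<phi>) (space (SC_borel G D 1)) = 1"
    using emeasure_space_1 by (simp add: finite_cx_measure_def U_def \<phi>_def[abs_def])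
  \<comment> \<open>Were the push-forward formula not a measure, \<open>distr\<close> would assign 0
    to every set by convention; total mass 1 excludes this.\<close>
  then have "emeasure U (\<phi> -` space (SC_borel G D 1) \<inter> space U) = 1"
    unfolding distr_def emeasure_measure_of_conv by (auto split: if_splits)
  moreover have sp: "space U = verts (simps K)" by (simp add: U_def space_uniform_count_measure)
  moreover define X where "X = \<phi> -` space (SC_borel G D 1) \<inter> verts (simps K)"
  ultimately have "ennreal (real (card X) / real (card (verts (simps K)))) = 1"
    using emeasure_uniform_count_measure[OF V(1), of X] by (simp add: U_def X_def)
  then have "real (card X) / real (card (verts (simps K))) = 1" by simp
  moreover have "card (verts (simps K)) \<noteq> 0" using V by simp
  ultimately have "card X = card (verts (simps K))" by simp
  then have "X = verts (simps K)" using V(1) by (intro card_subset_eq) (auto simp: X_def)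
  then show ?thesis using x by (auto simp: X_def \<phi>_def)
qed

context
  fixes G :: "('g, 'm) monoid_scheme" and D n :: nat and w :: "'g \<Rightarrow> complex"
  assumes group: "group G" and fin: "finite (carrier G)" and D: "0 < D"
begin

definition mean_trace :: "nat \<Rightarrow> 'g gclass measure \<Rightarrow> real" where
  "mean_trace m \<mu> = (\<integral>a. Re (class_trace G D n w m a) \<partial>\<mu>)"

definition weight_bound :: real where
  "weight_bound = 2 ^ D * (\<Sum>g\<in>carrier G. cmod (w g))"

lemma mean_trace_weak:
  assumes "weakly_converges G D M N"
  shows "(\<lambda>k. mean_trace m (M k)) \<longlonglongrightarrow> mean_trace m N"
proof -
  have "continuous_map (SC_top G D 1) euclideanreal (\<lambda>a. Re (class_trace G D n w m a))"
    by (rule continuous_class_trace[OF group fin D])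
  moreover have "bounded ((\<lambda>a. Re (class_trace G D n w m a)) ` topspace (SC_top G D 1))"
    unfolding topspace_SC_top[OF group fin D]
  proof (rule boundedI[of _ weight_bound])
    fix x assume "x \<in> (\<lambda>a. Re (class_trace G D n w m a)) ` SC G D 1"
    then obtain a where "a \<in> SC G D 1" "x = Re (class_trace G D n w m a)" by blast
    then show "norm x \<le> weight_bound"
      using class_trace_bound[OF group fin D, of a n w m] abs_Re_le_cmod[of "class_trace G D n w m a"]
      by (simp add: weight_bound_def)
  qed
  ultimately show ?thesis using assms unfolding weakly_converges_def mean_trace_def by blast
qed

text \<open>Averaging over the root orbit disappears in the average over all vertices, and each
  \<open>n\<close>-simplex is then counted at its \<open>n + 1\<close> vertices. What remains is an
  ordinary trace over the \<open>n\<close>-simplices, divided by the number of vertices.\<close>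

lemma mean_trace_finite:
  assumes K: "simplicial_gcx G D K" "finite (simps K)"
    and P: "borel_prob_on_SC G D (finite_cx_measure G D K)"
  shows "mean_trace m (finite_cx_measure G D K) =
    Re (\<Sum>s | s \<in> simps K \<and> card s = n + 1. gcx_action.project G (simps K) (action K) w ((heat D (simps K) ^^ m) (delta s)) s)
      / real (card (verts (simps K)))"
proof -
  define V where "V = verts (simps K)"
  interpret gcx_action G D "simps K" "action K" by (rule gcx_action_of_simplicial_gcx[OF group fin D K(1)])
  have V: "finite V" "V \<noteq> {}"
  proof -
    show "finite V" unfolding V_def by (rule finite_verts[OF K(2)])
    obtain s where s: "s \<in> simps K" using cx by (auto simp: simplicial_cx_def)
    then show "V \<noteq> {}" using simplicial_cxD(1,4)[OF cx s] by (auto simp: V_def)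
  qed
  define \<phi> where "\<phi> x = cls G D 1 (rooted_component G K x)" for x
  define f where "f a = Re (class_trace G D n w m a)" for a
  have \<phi>: "\<phi> x \<in> SC G D 1" if "x \<in> V" for x
    using finite_cx_measure_points[OF V[unfolded V_def] P] that
    by (simp add: \<phi>_def V_def space_borel_of_top topspace_SC_top[OF group fin D] del: One_nat_def)
  have "\<phi> \<in> measurable (uniform_count_measure V) (SC_borel G D 1)"
    by (rule measurableI)
       (use \<phi> in \<open>auto simp: space_uniform_count_measure sets_uniform_count_measure space_borel_of_top
          topspace_SC_top[OF group fin D] simp del: One_nat_def\<close>)
  moreover have "f \<in> borel_measurable (SC_borel G D 1)"
    unfolding f_def by (rule continuous_map_borel_measurable[OF continuous_class_trace[OF group fin D]])
  ultimately have "mean_trace m (finite_cx_measure G D K) = (\<integral>x. f (\<phi> x) \<partial>uniform_count_measure V)"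
    unfolding mean_trace_def finite_cx_measure_def f_def[symmetric] \<phi>_def[symmetric] V_def[symmetric]
    by (rule integral_distr)
  also have "\<dots> = (\<Sum>x\<in>V. f (\<phi> x)) / real (card V)"
    by (rule integral_uniform_count_measure[OF V(1)])
  also have "(\<Sum>x\<in>V. f (\<phi> x)) = Re (\<Sum>x\<in>V. (\<Sum>y\<in>orbit G (action K) x. local_trace G D n w m K y / of_nat (n + 1)) / of_nat (card (orbit G (action K) x)))"
  proof (subst Re_sum, rule sum.cong[OF refl])
    fix x assume x: "x \<in> V"
    define W where "W = {v. \<exists>u\<in>orbit G (action K) x. (u, v) \<in> (adj (simps K))\<^sup>*}"
    define R where "R = (full_sub K W)\<lparr>roots := [orbit G (action K) x]\<rparr>"
    have Rx: "rooted_component G K x = R" by (simp add: rooted_component_def R_def W_def Let_def)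
    \<comment> \<open>A point of \<open>SC G D 1\<close> is a nonempty class, and
      \<open>iso_rel\<close> relates marked complexes only; so some element of the class of
      \<open>R\<close> exists and \<open>R\<close> itself is marked.\<close>
    obtain B where "B \<in> \<phi> x" using some_rep_in[OF group fin D \<phi>[OF x]] by blast
    then have mR: "marked_gcx G D 1 R" by (simp add: \<phi>_def Rx cls_def iso_rel_def)
    then have "R \<in> \<phi> x" by (simp add: \<phi>_def Rx cls_def iso_rel_def gcx_iso_refl)
    then have "class_trace G D n w m (\<phi> x) = trace_fun G D n w m R"
      by (rule class_trace_eq[OF group fin D \<phi>[OF x]])
    also have "\<dots> = (\<Sum>y\<in>orbit G (action K) x. local_trace G D n w m K y) / of_nat (card (orbit G (action K) x) * (n + 1))"
    proof -
      have "local_trace G D n w m R y = local_trace G D n w m K y" if y: "y \<in> orbit G (action K) x" for y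
      proof -
        have "local_trace G D n w m R y = local_trace G D n w m (full_sub K W) y"
          by (simp add: local_trace_def R_def)
        also have "\<dots> = local_trace G D n w m K y"
        proof (rule local_trace_full_sub[OF cx deg], rule subsetI)
          fix v assume "v \<in> reach (simps K) y (m + 1)"
          then obtain k where "(y, v) \<in> adj (simps K) ^^ k" by (auto simp: reach_def[OF cx deg])
          then have "(y, v) \<in> (adj (simps K))\<^sup>*" by (rule relpow_imp_rtrancl)
          then show "v \<in> W" using y by (auto simp: W_def)
        qed
        finally show ?thesis .
      qed
      then show ?thesis by (simp add: trace_fun_def R_def)
    qed
    finally have eq: "class_trace G D n w m (\<phi> x) = (\<Sum>y\<in>orbit G (action K) x. local_trace G D n w m K y) / of_nat (card (orbit G (action K) x) * (n + 1))" .
    show "f (\<phi> x) = Re ((\<Sum>y\<in>orbit G (action K) x. local_trace G D n w m K y / of_nat (n + 1)) / of_nat (card (orbit G (action K) x)))"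
      unfolding f_def eq by (simp only: sum_divide_distrib[symmetric] of_nat_mult divide_divide_eq_left mult.commute)
  qed
  also have "(\<Sum>x\<in>V. (\<Sum>y\<in>orbit G (action K) x. local_trace G D n w m K y / of_nat (n + 1)) / of_nat (card (orbit G (action K) x)))
      = (\<Sum>y\<in>V. local_trace G D n w m K y / of_nat (n + 1))"
    unfolding V_def by (rule sum_orbit_average[OF K(2)])
  also have "\<dots> = (\<Sum>y\<in>V. local_trace G D n w m K y) / of_nat (n + 1)" by (simp add: sum_divide_distrib)
  also have "\<dots> = (\<Sum>s | s \<in> simps K \<and> card s = n + 1. project w ((heat D (simps K) ^^ m) (delta s)) s)"
    unfolding local_trace_project[OF refl refl] V_def sum_star[OF K(2)]
    by (simp del: of_nat_add of_nat_Suc)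
  finally show ?thesis by (simp add: V_def)
qed

lemma mean_trace_finite_diff:
  assumes K: "simplicial_gcx G D K" "finite (simps K)"
    and P: "borel_prob_on_SC G D (finite_cx_measure G D K)"
    and m: "m \<le> m'" and e: "0 < \<epsilon>" "\<epsilon> < 1"
  shows "\<bar>mean_trace m (finite_cx_measure G D K) - mean_trace m' (finite_cx_measure G D K)\<bar> \<le> weight_bound * rate D \<epsilon> m"
proof -
  interpret gcx_action G D "simps K" "action K" by (rule gcx_action_of_simplicial_gcx[OF group fin D K(1)])
  define V where "V = card (verts (simps K))"
  define C where "C = (\<Sum>g\<in>carrier G. cmod (w g))"
  have C: "0 \<le> C" by (simp add: C_def sum_nonneg)
  define z where "z = (\<Sum>s | s \<in> simps K \<and> card s = n + 1. project w ((heat D (simps K) ^^ m) (delta s)) s - project w ((heat D (simps K) ^^ m') (delta s)) s)"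
  have "cmod z \<le> C * (real (card (simps K)) * rate D \<epsilon> m)"
    unfolding z_def C_def by (rule sum_project_heat_diff_le[OF K(2) m e])
  also have "\<dots> \<le> C * (real (V * 2 ^ D) * rate D \<epsilon> m)"
    unfolding V_def using card_complex_le[OF K(2)] rate_nonneg[OF D e] C
    by (intro mult_left_mono mult_right_mono of_nat_mono) auto
  also have "\<dots> = real V * (weight_bound * rate D \<epsilon> m)" by (simp add: weight_bound_def C_def)
  finally have z: "cmod z \<le> real V * (weight_bound * rate D \<epsilon> m)" .
  have "mean_trace m (finite_cx_measure G D K) - mean_trace m' (finite_cx_measure G D K) = Re z / real V"
    unfolding mean_trace_finite[OF K P] z_def V_def by (simp add: sum_subtractf diff_divide_distrib)
  then have "\<bar>mean_trace m (finite_cx_measure G D K) - mean_trace m' (finite_cx_measure G D K)\<bar> = \<bar>Re z\<bar> / real V" by simp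
  also have "\<dots> \<le> cmod z / real V" by (intro divide_right_mono abs_Re_le_cmod) simp
  also have "\<dots> \<le> weight_bound * rate D \<epsilon> m"
  proof (cases "V = 0")
    case True
    then show ?thesis using rate_nonneg[OF D e] C by (simp add: weight_bound_def C_def)
  next
    case False
    then show ?thesis using z by (simp add: divide_le_eq mult.commute)
  qed
  finally show ?thesis .
qed

lemma mean_trace_sofic_diff:
  assumes \<mu>: "sofic G D \<mu>" and m: "m \<le> m'" and e: "0 < \<epsilon>" "\<epsilon> < 1"
  shows "\<bar>mean_trace m \<mu> - mean_trace m' \<mu>\<bar> \<le> weight_bound * rate D \<epsilon> m"
proof -
  obtain K :: "nat \<Rightarrow> ('g, nat) gcomplex" where K: "\<And>j. simplicial_gcx G D (K j)" "\<And>j. finite (simps (K j))"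
    "weakly_converges G D (\<lambda>j. finite_cx_measure G D (K j)) \<mu>"
    using \<mu> unfolding sofic_def by blast
  have lim: "(\<lambda>j. \<bar>mean_trace m (finite_cx_measure G D (K j)) - mean_trace m' (finite_cx_measure G D (K j))\<bar>)
      \<longlonglongrightarrow> \<bar>mean_trace m \<mu> - mean_trace m' \<mu>\<bar>"
    by (intro tendsto_rabs tendsto_diff mean_trace_weak K(3))
  have "\<bar>mean_trace m (finite_cx_measure G D (K j)) - mean_trace m' (finite_cx_measure G D (K j))\<bar> \<le> weight_bound * rate D \<epsilon> m" for j
    using K(3) by (intro mean_trace_finite_diff K m e) (auto simp: weakly_converges_def)
  then show ?thesis by (intro LIMSEQ_le_const2[OF lim]) blast
qed

end

text \<open>The Moore-Osgood argument. Three errors of size r / 4 occur: at stage \<open>M\<close>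
  for \<open>A k\<close>, at stage \<open>M\<close> for \<open>B\<close>, and the convergence in
  \<open>k\<close> at this fixed stage.\<close>

lemma interchange_limits:
  fixes a :: "nat \<Rightarrow> nat \<Rightarrow> real"
  assumes k: "\<And>m. (\<lambda>k. a k m) \<longlonglongrightarrow> b m" and A: "\<And>k. (\<lambda>m. a k m) \<longlonglongrightarrow> A k" and B: "b \<longlonglongrightarrow> B"
    and unif: "\<And>\<delta>. 0 < \<delta> \<Longrightarrow> \<exists>M. \<forall>k. \<forall>m\<ge>M. \<bar>a k M - a k m\<bar> \<le> \<delta>"
  shows "A \<longlonglongrightarrow> B"
proof (rule LIMSEQ_I)
  fix r :: real assume r: "0 < r"
  obtain M where M: "\<And>k m. m \<ge> M \<Longrightarrow> \<bar>a k M - a k m\<bar> \<le> r / 4" using unif[of "r / 4"] r by auto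
  have A': "\<bar>a k M - A k\<bar> \<le> r / 4" for k
  proof (rule LIMSEQ_le_const2)
    show "(\<lambda>m. \<bar>a k M - a k m\<bar>) \<longlonglongrightarrow> \<bar>a k M - A k\<bar>" by (intro tendsto_rabs tendsto_diff tendsto_const A)
  qed (use M in blast)
  have bm: "\<bar>b M - b m\<bar> \<le> r / 4" if "m \<ge> M" for m
  proof (rule LIMSEQ_le_const2)
    show "(\<lambda>k. \<bar>a k M - a k m\<bar>) \<longlonglongrightarrow> \<bar>b M - b m\<bar>" by (intro tendsto_rabs tendsto_diff k)
  qed (use M that in blast)
  have B': "\<bar>b M - B\<bar> \<le> r / 4"
  proof (rule LIMSEQ_le_const2)
    show "(\<lambda>m. \<bar>b M - b m\<bar>) \<longlonglongrightarrow> \<bar>b M - B\<bar>" by (intro tendsto_rabs tendsto_diff tendsto_const B)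
  qed (use bm in blast)
  obtain N where N: "\<And>k. k \<ge> N \<Longrightarrow> \<bar>a k M - b M\<bar> < r / 4"
    using LIMSEQ_D[OF k, of "r / 4" M] r by auto
  have "norm (A k - B) < r" if "k \<ge> N" for k
    using A'[of k] B' N[OF that] unfolding real_norm_def by linarith
  then show "\<exists>N. \<forall>k\<ge>N. norm (A k - B) < r" by blast
qed

section \<open>Chains and their coordinates\<close>

definition coord :: "'v set set \<Rightarrow> 'v chain \<Rightarrow> 'v set \<Rightarrow> complex" where
  "coord L c s = (if s \<in> L then c (orient s) else 0)"

text \<open>The alternating extension of values at the chosen orientations. On chains of fixed
  degree it is inverse to \<open>coord\<close>, by \<open>coord_ext\<close> and
  \<open>chains2D\<close>.\<close>

definition ext :: "'v set set \<Rightarrow> ('v set \<Rightarrow> complex) \<Rightarrow> 'v chain" where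
  "ext L f l = (if distinct l \<and> set l \<in> L then elem_chain (orient (set l)) l * f (set l) else 0)"

lemma chain_inner_coord: "chain_inner L a b = ell2_inner (coord L a) (coord L b)"
  unfolding chain_inner_def ell2_inner_def by (rule infsum_cong_neutral) (auto simp: coord_def)

lemma coord_diff: "coord L (\<lambda>u. a u - b u) = (\<lambda>s. coord L a s - coord L b s)"
  by (auto simp: coord_def)

lemma coord_zero [simp]: "coord L (\<lambda>_. 0) = (\<lambda>_. 0)"
  by (auto simp: coord_def)

lemma ext_zero [simp]: "ext L (\<lambda>_. 0) = (\<lambda>_. 0)"
  by (auto simp: ext_def)

lemma ext_add: "ext L (\<lambda>s. f s + g s) = (\<lambda>l. ext L f l + ext L g l)"
  by (auto simp: ext_def distrib_left)

lemma ext_sum: "ext L (\<lambda>s. \<Sum>x\<in>X. c x * f x s) = (\<lambda>l. \<Sum>x\<in>X. c x * ext L (f x) l)"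
proof
  fix l show "ext L (\<lambda>s. \<Sum>x\<in>X. c x * f x s) l = (\<Sum>x\<in>X. c x * ext L (f x) l)"
    by (cases "distinct l \<and> set l \<in> L") (auto simp: ext_def sum_distrib_left mult_ac)
qed

context
  fixes L :: "'v set set" and D :: nat
  assumes cx: "simplicial_cx L" and deg: "vertex_degree_le L D" and D: "0 < D"
begin

lemma coord_ext:
  assumes "\<And>s. s \<notin> L \<Longrightarrow> f s = 0"
  shows "coord L (ext L f) = f"
proof
  fix s show "coord L (ext L f) s = f s"
    using assms simplicial_cxD(2)[OF cx, of s] by (auto simp: coord_def ext_def orient)
qed

lemma on_simplices_supp: "on_simplices n L f \<Longrightarrow> s \<notin> L \<Longrightarrow> f s = 0"
  by (auto simp: on_simplices_def)

lemma chains2D: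
  assumes c: "c \<in> chains2 L n"
  shows "on_simplices n L (coord L c)" "ell2 (coord L c)" "ext L (coord L c) = c"
proof -
  show "on_simplices n L (coord L c)"
    unfolding on_simplices_def
  proof (intro allI impI)
    fix s assume "coord L c s \<noteq> 0"
    then have s: "s \<in> L" "c (orient s) \<noteq> 0" by (auto simp: coord_def split: if_splits)
    then have "length (orient s) = n + 1" using c by (auto simp: chains2_def)
    then show "s \<in> L \<and> card s = n + 1" using s simplicial_cxD(2)[OF cx s(1)] by (simp add: orient)
  qed
  have "(\<lambda>s. (cmod (c (orient s)))\<^sup>2) summable_on L" using c by (simp add: chains2_def)
  also have "?this \<longleftrightarrow> (\<lambda>s. (cmod (coord L c s))\<^sup>2) summable_on UNIV"
    by (rule summable_on_cong_neutral) (auto simp: coord_def)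
  finally show "ell2 (coord L c)" by (simp add: ell2_def)
  show "ext L (coord L c) = c"
  proof
    fix l show "ext L (coord L c) l = c l"
    proof (cases "distinct l \<and> set l \<in> L")
      case True
      note o = orient[OF finite_set[of l]]
      have "mset l = mset (orient (set l))" using True o by (simp add: set_eq_iff_mset_eq_distinct[symmetric])
      then obtain p where p: "p permutes {..<length (orient (set l))}" "l = permute_list p (orient (set l))"
        by (rule mset_eq_permute)
      have "elem_chain (orient (set l)) l = of_int (sign p)"
        using elem_chain_permute[OF o(1) p(1)] p(2) by simp
      moreover have "c l = of_int (sign p) * c (orient (set l))"
        using c p unfolding chains2_def by (metis (mono_tags, lifting) mem_Collect_eq)
      ultimately show ?thesis using True by (simp add: ext_def coord_def)
    next
      case False
      then have "c l = 0" using c unfolding chains2_def by blast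
      then show ?thesis using False by (auto simp: ext_def)
    qed
  qed
qed

lemma ext_in_chains2:
  assumes f: "on_simplices n L f" "ell2 f"
  shows "ext L f \<in> chains2 L n"
  unfolding chains2_def mem_Collect_eq
proof (intro conjI allI impI)
  fix l assume "ext L f l \<noteq> 0"
  then have *: "distinct l" "set l \<in> L" "f (set l) \<noteq> 0" by (auto simp: ext_def split: if_splits)
  then have "card (set l) = n + 1" using f by (auto simp: on_simplices_def)
  then show "distinct l" "length l = n + 1" "set l \<in> L" using * by (auto simp: distinct_card)
next
  fix l :: "'v list" and p assume p: "p permutes {..<length l}"
  then show "ext L f (permute_list p l) = of_int (sign p) * ext L f l"
    by (simp add: ext_def elem_chain_permute_right orient)
next
  have "(\<lambda>s. (cmod (f s))\<^sup>2) summable_on UNIV" using f(2) by (simp add: ell2_def)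
  also have "?this \<longleftrightarrow> (\<lambda>s. (cmod (ext L f (orient s)))\<^sup>2) summable_on L"
    by (rule summable_on_cong_neutral)
       (use on_simplices_supp[OF f(1)] simplicial_cxD(2)[OF cx] in \<open>auto simp: ext_def orient\<close>)
  finally show "(\<lambda>s. (cmod (ext L f (orient s)))\<^sup>2) summable_on L" .
qed

lemma ext_delta:
  assumes "s \<in> L"
  shows "ext L (delta s) = elem_chain (orient s)"
proof
  fix l
  note o = orient[OF simplicial_cxD(2)[OF cx assms]]
  show "ext L (delta s) l = elem_chain (orient s) l"
    using assms elem_chain_nonzeroD[OF o(1), of l] o by (auto simp: ext_def delta_def)
qed

section \<open>Boundary, coboundary and Laplacian of chains\<close>

lemma on_simplices_kop_inc:
  assumes "on_simplices (Suc n) L f"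
  shows "on_simplices n L (kop (inc L) f)"
  unfolding on_simplices_def
proof (intro allI impI)
  fix t assume "kop (inc L) f t \<noteq> 0"
  then obtain s where "inc L t s \<noteq> 0" "f s \<noteq> 0" by (rule kop_nonzeroD)
  then show "t \<in> L \<and> card t = n + 1"
    using assms inc_nonzeroD(1)[OF cx, of t s] inc_card[OF cx, of t s] by (auto simp: on_simplices_def)
qed

lemma on_simplices_kop_kadj:
  assumes "on_simplices n L f"
  shows "on_simplices (Suc n) L (kop (kadj (inc L)) f)"
  unfolding on_simplices_def
proof (intro allI impI)
  fix s assume "kop (kadj (inc L)) f s \<noteq> 0"
  then obtain t where "kadj (inc L) s t \<noteq> 0" "f t \<noteq> 0" by (rule kop_nonzeroD)
  then have "inc L t s \<noteq> 0" "f t \<noteq> 0" by (auto simp: kadj_def)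
  then show "s \<in> L \<and> card s = Suc n + 1"
    using assms inc_nonzeroD(2)[OF cx, of t s] inc_card[OF cx, of t s] by (auto simp: on_simplices_def)
qed

text \<open>A face of a vertex would be empty, and the empty set is not a simplex.\<close>

lemma kop_inc_0:
  assumes "on_simplices 0 L f"
  shows "kop (inc L) f = (\<lambda>_. 0)"
proof (rule ext, rule ccontr)
  fix t assume "kop (inc L) f t \<noteq> 0"
  then obtain s where *: "inc L t s \<noteq> 0" "f s \<noteq> 0" by (rule kop_nonzeroD)
  then have "card s = 1" using assms by (auto simp: on_simplices_def)
  then have "card t = 0" using inc_card[OF cx *(1)] by simp
  then show False using simplicial_cxD(1,2)[OF cx inc_nonzeroD(1)[OF cx *(1)]] by simp
qed

lemma boundary_ext:
  assumes f: "on_simplices n L f"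
  shows "boundary L n (ext L f) = ext L (kop (inc L) f)"
proof (cases n)
  case 0
  then show ?thesis using f kop_inc_0 by (simp add: boundary_def)
next
  case (Suc m)
  show ?thesis
  proof
    fix u
    have fin: "finite s" if "s \<in> L" for s using simplicial_cxD(2)[OF cx that] .
    have lhs: "boundary L n (ext L f) u = infsum (\<lambda>s. f s * simplex_boundary (orient s) u) L"
      unfolding boundary_def lin_ext_def using Suc fin by (simp add: ext_def orient cong: infsum_cong)
    show "boundary L n (ext L f) u = ext L (kop (inc L) f) u"
    proof (cases "distinct u \<and> set u \<in> L")
      case True
      have "infsum (\<lambda>s. f s * simplex_boundary (orient s) u) L =
          infsum (\<lambda>s. elem_chain (orient (set u)) u * (inc L (set u) s * f s)) UNIV"
      proof (rule infsum_cong_neutral)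
        fix s assume "s \<in> L \<inter> UNIV"
        then have s: "s \<in> L" by simp
        have "simplex_boundary (orient s) u = simplex_boundary (orient s) (orient (set u)) * elem_chain (orient (set u)) u"
          by (rule simplex_boundary_reorder_right) (use True fin[OF s] in \<open>auto simp: orient\<close>)
        then show "f s * simplex_boundary (orient s) u = elem_chain (orient (set u)) u * (inc L (set u) s * f s)"
          using s True by (simp add: inc_def mult_ac)
      qed (auto simp: inc_def)
      also have "\<dots> = elem_chain (orient (set u)) u * kop (inc L) f (set u)"
        unfolding kop_infsum[OF band_inc[OF cx deg]] by (rule infsum_cmult_right')
      finally show ?thesis using True lhs by (simp add: ext_def)
    next
      case False
      \<comment> \<open>A list with nonzero coefficient in the boundary of \<open>s\<close> spans a
        face of \<open>s\<close>. In positive degree this face is nonempty, hence a simplex,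
        contrary to the case assumption.\<close>
      have "f s * simplex_boundary (orient s) u = 0" if s: "s \<in> L" for s
      proof (rule ccontr)
        assume nz: "f s * simplex_boundary (orient s) u \<noteq> 0"
        then have cs: "card s = Suc m + 1" using f Suc by (auto simp: on_simplices_def)
        from nz have "simplex_boundary (orient s) u \<noteq> 0" by auto
        note D = simplex_boundary_nonzeroD[OF orient(1)[OF fin[OF s]] this]
        then obtain v where v: "v \<notin> set u" "s = insert v (set u)" using orient(2)[OF fin[OF s]] by auto
        then have "card (set u) = Suc m" using cs by simp
        then have "set u \<noteq> {}" by auto
        then have "set u \<in> L" using simplicial_cxD(3)[OF cx s] v by blast
        then show False using False D(1) by blast
      qed
      then have "infsum (\<lambda>s. f s * simplex_boundary (orient s) u) L = 0" by (intro infsum_0)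
      then show ?thesis using False lhs by (auto simp: ext_def)
    qed
  qed
qed

text \<open>The adjoint kernel provides a chain with the required pairing. Uniqueness comes from
  testing against elementary chains, which recovers each coefficient.\<close>

lemma coboundary_ext:
  assumes f: "ell2 f" "\<And>s. s \<notin> L \<Longrightarrow> f s = 0" and g: "on_simplices n L (kop (kadj (inc L)) f)"
  shows "coboundary L n (ext L f) = ext L (kop (kadj (inc L)) f)"
  unfolding coboundary_def
proof (rule the_equality)
  let ?g = "kop (kadj (inc L)) f"
  note eg = kop_inc_bounded(3)[OF cx deg D f(1)]
  have cf: "coord L (ext L f) = f" by (rule coord_ext) (rule f(2))
  have inner: "chain_inner L (ext L f) (boundary L n a) = ell2_inner ?g (coord L a)" if a: "a \<in> chains2 L n" for a
  proof -
    note a' = chains2D[OF a]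
    have "boundary L n a = ext L (kop (inc L) (coord L a))" using boundary_ext[OF a'(1)] a'(3) by simp
    moreover have "kop (inc L) (coord L a) s = 0" if "s \<notin> L" for s using that by (simp add: kop_def inc_def)
    ultimately have "coord L (boundary L n a) = kop (inc L) (coord L a)" by (simp add: coord_ext)
    then show ?thesis
      unfolding chain_inner_coord cf
      using kop_adjoint[OF band_kadj[OF band_inc[OF cx deg]] f(1) a'(2)] by simp
  qed
  have supp: "?g s = 0" if "s \<notin> L" for s using on_simplices_supp[OF g that] .
  show "ext L ?g \<in> chains2 L n \<and> (\<forall>a\<in>chains2 L n. chain_inner L (ext L ?g) a = chain_inner L (ext L f) (boundary L n a))"
    using ext_in_chains2[OF g eg] inner by (simp add: chain_inner_coord coord_ext supp)
  fix b assume b: "b \<in> chains2 L n \<and> (\<forall>a\<in>chains2 L n. chain_inner L b a = chain_inner L (ext L f) (boundary L n a))"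
  then have bc: "b \<in> chains2 L n" by simp
  note b' = chains2D[OF bc]
  have "coord L b s = ?g s" for s
  proof (cases "s \<in> L \<and> card s = n + 1")
    case True
    have d: "ext L (delta s) \<in> chains2 L n" using True by (intro ext_in_chains2 on_simplices_delta) auto
    have cd: "coord L (ext L (delta s)) = delta s" using True by (intro coord_ext) (auto simp: delta_def)
    have "ell2_inner (coord L b) (delta s) = chain_inner L b (ext L (delta s))"
      unfolding chain_inner_coord cd ..
    also have "\<dots> = chain_inner L (ext L f) (boundary L n (ext L (delta s)))" using b d by blast
    also have "\<dots> = ell2_inner ?g (delta s)" unfolding inner[OF d] cd ..
    finally show ?thesis by simp
  next
    case False
    then show ?thesis using b'(1) g unfolding on_simplices_def by metis
  qed
  then have "coord L b = ?g" by blast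
  then show "b = ext L ?g" using b'(3) by simp
qed

lemma laplacian_ext:
  assumes c: "c \<in> chains2 L n"
  shows "laplacian L n c = ext L (lapl L (coord L c))"
proof -
  define f where "f = coord L c"
  have f: "on_simplices n L f" "ell2 f" "ext L f = c" using chains2D[OF c] by (simp_all add: f_def)
  note fs = on_simplices_supp[OF f(1)]
  have "coboundary L (n + 1) c = ext L (kop (kadj (inc L)) f)"
    using coboundary_ext[OF f(2) fs] on_simplices_kop_kadj[OF f(1)] f(3) by simp
  then have 1: "boundary L (n + 1) (coboundary L (n + 1) c) = ext L (kop (inc L) (kop (kadj (inc L)) f))"
    using boundary_ext[of "n + 1" "kop (kadj (inc L)) f"] on_simplices_kop_kadj[OF f(1)] by simp
  have "on_simplices n L (kop (kadj (inc L)) (kop (inc L) f))"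
  proof (cases n)
    case 0
    then show ?thesis using kop_inc_0 f(1) by (simp add: on_simplices_def kop_def)
  next
    case (Suc m)
    then show ?thesis using on_simplices_kop_kadj on_simplices_kop_inc f(1) by blast
  qed
  moreover have "kop (inc L) f s = 0" if "s \<notin> L" for s using that by (simp add: kop_def inc_def)
  ultimately have 2: "coboundary L n (boundary L n c) = ext L (kop (kadj (inc L)) (kop (inc L) f))"
    using boundary_ext[OF f(1)] f(3) coboundary_ext[OF kop_inc_bounded(1)[OF cx deg D f(2)]] by simp
  show ?thesis unfolding laplacian_def 1 2 lapl_def ext_add f_def ..
qed

lemma laplacian_zero_iff:
  assumes "c \<in> chains2 L n"
  shows "laplacian L n c = (\<lambda>_. 0) \<longleftrightarrow> lapl L (coord L c) = (\<lambda>_. 0)"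
proof
  assume "laplacian L n c = (\<lambda>_. 0)"
  then have "coord L (ext L (lapl L (coord L c))) = (\<lambda>_. 0)" using laplacian_ext[OF assms] by simp
  then show "lapl L (coord L c) = (\<lambda>_. 0)" by (simp add: coord_ext lapl_supp)
qed (simp add: laplacian_ext[OF assms])

end

section \<open>The group action on chains\<close>

lemma (in gcx_action) push_chain_ext:
  assumes g: "g \<in> carrier G" and f: "\<And>s. s \<notin> L \<Longrightarrow> f s = 0"
  shows "push_chain L (act g) (ext L f) = ext L (pullback (inv\<^bsub>G\<^esub> g) f)"
proof
  interpret group G by (rule group)
  fix u
  have eq: "push_chain L (act g) (ext L f) u = infsum (\<lambda>s. f s * elem_chain (map (act g) (orient s)) u) L"
    unfolding push_chain_def lin_ext_def using simplex_finite by (simp add: ext_def orient cong: infsum_cong)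
  have d: "distinct (map (act g) (orient s))" "set (map (act g) (orient s)) = act g ` s" if "s \<in> L" for s
    using act_inj_simplex[OF g that] simplex_finite[OF that] by (auto simp: distinct_map orient)
  show "push_chain L (act g) (ext L f) u = ext L (pullback (inv\<^bsub>G\<^esub> g) f) u"
  proof (cases "distinct u \<and> set u \<in> L")
    case True
    \<comment> \<open>The only simplex whose image is \<open>set u\<close>, hence the only one that
      contributes; this is where the inverse of \<open>g\<close> comes from.\<close>
    define s0 where "s0 = act (inv\<^bsub>G\<^esub> g) ` set u"
    have s0: "s0 \<in> L" "act g ` s0 = set u" using True g by (auto simp: s0_def act_simplex act_image_inv)
    have zero: "elem_chain (map (act g) (orient s)) u = 0" if "s \<in> L" "s \<noteq> s0" for s
    proof (rule ccontr)
      assume "elem_chain (map (act g) (orient s)) u \<noteq> 0"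
      then have "set u = act g ` s" using elem_chain_nonzeroD(2)[OF d(1)[OF that(1)]] d(2)[OF that(1)] by metis
      then have "s0 = s" using that(1) g by (simp add: s0_def act_image_inv)
      then show False using that by simp
    qed
    have "infsum (\<lambda>s. f s * elem_chain (map (act g) (orient s)) u) L =
        infsum (\<lambda>s. f s * elem_chain (map (act g) (orient s)) u) {s0}"
      by (rule infsum_cong_neutral) (use zero s0 in auto)
    also have "\<dots> = f s0 * elem_chain (map (act g) (orient s0)) u" by simp
    also have "elem_chain (map (act g) (orient s0)) u =
        elem_chain (map (act g) (orient s0)) (orient (set u)) * elem_chain (orient (set u)) u"
      by (rule elem_chain_trans[symmetric]) (use d[OF s0(1)] s0 in \<open>auto simp: orient\<close>)
    also have "elem_chain (map (act g) (orient s0)) (orient (set u)) = eps (act g) s0"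
      unfolding eps_def s0(2) by (rule elem_chain_sym) (use d[OF s0(1)] in \<open>auto simp: orient\<close>)
    also have "eps (act g) s0 = eps (act (inv\<^bsub>G\<^esub> g)) (set u)"
      using eps_act_inv[OF g, of "set u"] True by (simp add: s0_def)
    finally show ?thesis using True unfolding eq by (simp add: ext_def pullback_def s0_def mult_ac)
  next
    case False
    have "f s * elem_chain (map (act g) (orient s)) u = 0" if "s \<in> L" for s
    proof (rule ccontr)
      assume "f s * elem_chain (map (act g) (orient s)) u \<noteq> 0"
      then have "elem_chain (map (act g) (orient s)) u \<noteq> 0" by auto
      from elem_chain_nonzeroD(1,2)[OF d(1)[OF that] this] d(2)[OF that] act_simplex[OF g that]
      show False using False by auto
    qed
    then have "infsum (\<lambda>s. f s * elem_chain (map (act g) (orient s)) u) L = 0" by (intro infsum_0)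
    then show ?thesis unfolding eq using False by (auto simp: ext_def)
  qed
qed

text \<open>Pushing forward by \<open>g\<close> is pulling back by its inverse. Reindexing the sum
  by inverses turns \<open>w\<close> into its conjugate, which is the form chosen for
  \<open>project\<close>.\<close>

lemma (in gcx_action) isotypic_sum_ext:
  assumes w: "\<And>g. g \<in> carrier G \<Longrightarrow> w (inv\<^bsub>G\<^esub> g) = cnj (w g)" and f: "\<And>s. s \<notin> L \<Longrightarrow> f s = 0"
  shows "(\<lambda>u. \<Sum>g\<in>carrier G. w g * push_chain L (act g) (ext L f) u) = ext L (project w f)"
proof -
  interpret group G by (rule group)
  have "(\<lambda>u. \<Sum>g\<in>carrier G. w g * push_chain L (act g) (ext L f) u) =
      ext L (\<lambda>s. \<Sum>g\<in>carrier G. w g * pullback (inv\<^bsub>G\<^esub> g) f s)"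
    unfolding ext_sum using push_chain_ext[OF _ f] by (auto intro!: sum.cong)
  also have "(\<lambda>s. \<Sum>g\<in>carrier G. w g * pullback (inv\<^bsub>G\<^esub> g) f s) = project w f"
    unfolding project_def
  proof
    fix s
    show "(\<Sum>g\<in>carrier G. w g * pullback (inv\<^bsub>G\<^esub> g) f s) = (\<Sum>g\<in>carrier G. cnj (w g) * pullback g f s)"
      by (rule sum.reindex_bij_witness[where i = "\<lambda>g. inv\<^bsub>G\<^esub> g" and j = "\<lambda>g. inv\<^bsub>G\<^esub> g"]) (auto simp: w)
  qed
  finally show ?thesis .
qed

text \<open>A self-adjoint idempotent is a contraction: |p|^2 = \<langle>f, p\<rangle> for the image
  \<open>p\<close> of \<open>f\<close>, and Cauchy-Schwarz allows a division by |p|.\<close>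

lemma (in gcx_action) norm2_project_le:
  assumes w: "\<And>g. g \<in> carrier G \<Longrightarrow> w (inv\<^bsub>G\<^esub> g) = cnj (w g)"
    "\<And>g. g \<in> carrier G \<Longrightarrow> (\<Sum>h\<in>carrier G. w h * w (inv\<^bsub>G\<^esub> h \<otimes>\<^bsub>G\<^esub> g)) = w g"
    and f: "ell2 f"
  shows "norm2 (project w f) \<le> norm2 f"
proof -
  define p where "p = project w f"
  have p: "ell2 p" by (simp add: p_def ell2_project f)
  have "ell2_inner p p = ell2_inner f p"
    using project_self_adjoint[OF w f p] project_idem[OF w, of f] by (simp add: p_def)
  then have "norm2 p = cmod (ell2_inner f p)"
    using ell2_inner_self[of p] by (metis norm2_nonneg abs_of_nonneg norm_of_real)
  also have "\<dots> \<le> sqrt (norm2 f) * sqrt (norm2 p)" by (rule ell2_Cauchy_Schwarz[OF f p])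
  finally have "sqrt (norm2 p) * sqrt (norm2 p) \<le> sqrt (norm2 f) * sqrt (norm2 p)"
    unfolding real_sqrt_mult_self by simp
  then have "norm2 p \<le> norm2 f" if "norm2 p \<noteq> 0"
    using that norm2_nonneg[of p] mult_right_le_imp_le[of "sqrt (norm2 p)" "sqrt (norm2 p)" "sqrt (norm2 f)"]
    by (simp del: real_sqrt_mult_self)
  then show ?thesis by (cases "norm2 p = 0") (auto simp: p_def)
qed

section \<open>Fibres of the direct integral\<close>

text \<open>Measurability and integration theorems speak about series over \<nat>. An enumeration,
  continued by 0 outside its range, reduces unordered countable sums to that case.\<close>

lemma infsum_to_nat:
  fixes f :: "'s \<Rightarrow> complex"
  assumes "countable S"
  defines "f' \<equiv> (\<lambda>k. if k \<in> to_nat_on S ` S then f (from_nat_into S k) else 0)"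
  shows "infsum f S = infsum f' UNIV" "f summable_on S \<longleftrightarrow> f' summable_on UNIV"
proof -
  define g where "g k = f (from_nat_into S k)" for k
  have inj: "inj_on (to_nat_on S) S" using assms(1) by (rule inj_on_to_nat_on)
  have comp: "(g \<circ> to_nat_on S) s = f s" if "s \<in> S" for s
    using that assms(1) by (simp add: g_def)
  have "infsum f' UNIV = infsum g (to_nat_on S ` S)"
    by (rule infsum_cong_neutral) (auto simp: f'_def g_def)
  also have "\<dots> = infsum (g \<circ> to_nat_on S) S" by (rule infsum_reindex[OF inj])
  also have "\<dots> = infsum f S" by (rule infsum_cong[OF comp])
  finally show "infsum f S = infsum f' UNIV" ..
  have "f' summable_on UNIV \<longleftrightarrow> g summable_on (to_nat_on S ` S)"
    by (rule summable_on_cong_neutral) (auto simp: f'_def g_def)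
  also have "\<dots> \<longleftrightarrow> (g \<circ> to_nat_on S) summable_on S" by (rule summable_on_reindex[OF inj])
  also have "\<dots> \<longleftrightarrow> f summable_on S" by (rule summable_on_cong[OF comp])
  finally show "f summable_on S \<longleftrightarrow> f' summable_on UNIV" ..
qed

lemma borel_measurable_infsum_countable:
  fixes F :: "'s \<Rightarrow> 'a \<Rightarrow> complex"
  assumes S: "countable S" and meas: "\<And>s. s \<in> S \<Longrightarrow> F s \<in> borel_measurable M"
    and summ: "\<And>a. a \<in> space M \<Longrightarrow> (\<lambda>s. F s a) summable_on S"
  shows "(\<lambda>a. infsum (\<lambda>s. F s a) S) \<in> borel_measurable M"
proof -
  define F' where "F' k a = (if k \<in> to_nat_on S ` S then F (from_nat_into S k) a else 0)" for k a
  have meas': "F' k \<in> borel_measurable M" for k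
  proof (cases "k \<in> to_nat_on S ` S")
    case True
    then have "from_nat_into S k \<in> S" using S by auto
    then show ?thesis using True meas by (simp add: F'_def[abs_def])
  qed (simp add: F'_def[abs_def])
  have "infsum (\<lambda>s. F s a) S = (\<Sum>k. F' k a)" if "a \<in> space M" for a
  proof -
    have "(\<lambda>k. F' k a) summable_on UNIV"
      using summ[OF that] infsum_to_nat(2)[OF S, of "\<lambda>s. F s a"] by (simp add: F'_def)
    then have "(\<lambda>k. F' k a) sums infsum (\<lambda>k. F' k a) UNIV"
      by (intro has_sum_imp_sums has_sum_infsum)
    then show ?thesis using infsum_to_nat(1)[OF S, of "\<lambda>s. F s a"] by (simp add: F'_def sums_iff)
  qed
  then show ?thesis
    using borel_measurable_suminf[OF meas'] by (simp cong: measurable_cong)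
qed

text \<open>The uniform bound on absolute partial sums gives absolute convergence of each fibre
  series and, over a finite measure, of the series of integrals. Both unordered sums are then
  ordinary series and may be exchanged.\<close>

lemma (in finite_measure) integral_infsum_countable:
  fixes F :: "'s \<Rightarrow> 'a \<Rightarrow> complex"
  assumes S: "countable S" and int: "\<And>s. s \<in> S \<Longrightarrow> integrable M (F s)"
    and bound: "\<And>a X. a \<in> space M \<Longrightarrow> finite X \<Longrightarrow> X \<subseteq> S \<Longrightarrow> (\<Sum>s\<in>X. cmod (F s a)) \<le> B"
  shows "(\<Sum>\<^sub>\<infinity>s\<in>S. \<integral>a. F s a \<partial>M) = (\<integral>a. (\<Sum>\<^sub>\<infinity>s\<in>S. F s a) \<partial>M)"
proof -
  define F' where "F' k a = (if k \<in> to_nat_on S ` S then F (from_nat_into S k) a else 0)" for k a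
  have int': "integrable M (F' k)" for k
  proof (cases "k \<in> to_nat_on S ` S")
    case True
    then have "from_nat_into S k \<in> S" using S by auto
    then show ?thesis using True int by (simp add: F'_def[abs_def])
  qed (simp add: F'_def[abs_def])
  have bound': "(\<Sum>k<n. cmod (F' k a)) \<le> B" if "a \<in> space M" for n a
  proof -
    define X where "X = {k. k < n \<and> k \<in> to_nat_on S ` S}"
    have "(\<Sum>k<n. cmod (F' k a)) = (\<Sum>k\<in>X. cmod (F (from_nat_into S k) a))"
      by (rule sum.mono_neutral_cong_right) (auto simp: X_def F'_def)
    also have "\<dots> = (\<Sum>s\<in>from_nat_into S ` X. cmod (F s a))"
      by (rule sum.reindex_cong[OF _ refl refl, symmetric]) (auto simp: inj_on_def X_def S)
    also have "\<dots> \<le> B" by (rule bound[OF that]) (auto simp: X_def S)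
    finally show ?thesis .
  qed
  have summ: "summable (\<lambda>k. cmod (F' k a))" if "a \<in> space M" for a
  proof (rule bounded_imp_summable)
    show "(\<Sum>k\<le>n. cmod (F' k a)) \<le> B" for n
      using bound'[OF that, of "Suc n"] by (simp only: lessThan_Suc_atMost)
  qed simp
  have summ_int: "summable (\<lambda>k. \<integral>a. cmod (F' k a) \<partial>M)"
  proof (rule bounded_imp_summable)
    fix n
    have "(\<Sum>k\<le>n. \<integral>a. cmod (F' k a) \<partial>M) = (\<integral>a. (\<Sum>k\<le>n. cmod (F' k a)) \<partial>M)"
      using int' by (intro Bochner_Integration.integral_sum[symmetric]) auto
    also have "\<dots> \<le> (\<integral>a. B \<partial>M)"
      using int' bound'[of _ "Suc n"] by (intro integral_mono) (auto simp: lessThan_Suc_atMost)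
    finally show "(\<Sum>k\<le>n. \<integral>a. cmod (F' k a) \<partial>M) \<le> (\<integral>a. B \<partial>M)" .
  qed simp
  have as_suminf: "infsum f UNIV = suminf f" if "summable (\<lambda>k. norm (f k))" for f :: "nat \<Rightarrow> complex"
    using norm_summable_imp_has_sum[OF that summable_sums[OF summable_norm_cancel[OF that]]] by (rule infsumI)
  have "(\<Sum>\<^sub>\<infinity>s\<in>S. \<integral>a. F s a \<partial>M) = (\<Sum>\<^sub>\<infinity>k. \<integral>a. F' k a \<partial>M)"
    unfolding infsum_to_nat(1)[OF S] by (intro infsum_cong) (auto simp: F'_def)
  also have "\<dots> = (\<Sum>k. \<integral>a. F' k a \<partial>M)"
  proof (rule as_suminf, rule summable_comparison_test[OF _ summ_int], intro exI allI impI)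
    fix k show "norm (norm (\<integral>a. F' k a \<partial>M)) \<le> (\<integral>a. cmod (F' k a) \<partial>M)" by simp
  qed
  also have "\<dots> = (\<integral>a. (\<Sum>k. F' k a) \<partial>M)"
    by (rule integral_suminf[symmetric, OF int' _ summ_int]) (use summ in auto)
  also have "\<dots> = (\<integral>a. (\<Sum>\<^sub>\<infinity>s\<in>S. F s a) \<partial>M)"
  proof (rule Bochner_Integration.integral_cong[OF refl])
    fix a assume "a \<in> space M"
    from as_suminf[OF summ[OF this]]
    show "(\<Sum>k. F' k a) = (\<Sum>\<^sub>\<infinity>s\<in>S. F s a)"
      unfolding infsum_to_nat(1)[OF S] by (simp add: F'_def)
  qed
  finally show ?thesis .
qed

section \<open>Realizations of rooted complexes\<close>

lemma gcx_action_iso: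
  assumes A: "gcx_action G D (simps A) (action A)" and iso: "gcx_iso G A B" and cxB: "simplicial_cx (simps B)"
  shows "gcx_action G D (simps B) (action B)"
proof -
  interpret A: gcx_action G D "simps A" "action A" by (rule A)
  obtain f where f: "bij_betw f (verts (simps A)) (verts (simps B))" "(\<lambda>s. f ` s) ` simps A = simps B"
    "\<And>g v. g \<in> carrier G \<Longrightarrow> v \<in> verts (simps A) \<Longrightarrow> f (action A g v) = action B g (f v)"
    "map (\<lambda>W. f ` W) (roots A) = roots B"
    by (rule gcx_isoE[OF iso]) (rule that)
  have vB: "\<exists>u\<in>verts (simps A). v = f u" if "v \<in> verts (simps B)" for v
    using f(1) that by (auto simp: bij_betw_def)
  have inj: "inj_on f (verts (simps A))" using f(1) by (simp add: bij_betw_def)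
  show ?thesis
  proof (rule gcx_action.intro)
    show "vertex_degree_le (simps B) D"
      unfolding vertex_degree_le_def
    proof
      fix v assume "v \<in> verts (simps B)"
      then obtain u where u: "u \<in> verts (simps A)" "v = f u" using vB by blast
      then have e: "finite (edges_at (simps A) u)" "card (edges_at (simps A) u) \<le> D"
        using A.deg by (auto simp: vertex_degree_le_def)
      have sub: "edges_at (simps B) v \<subseteq> (`) f ` edges_at (simps A) u"
      proof
        fix e' assume "e' \<in> edges_at (simps B) v"
        then have e': "e' \<in> simps B" "card e' = 2" "f u \<in> e'" by (auto simp: edges_at_def u)
        then obtain e where e: "e \<in> simps A" "e' = f ` e" unfolding f(2)[symmetric] by blast
        note ev = simplicial_cxD(4)[OF A.cx e(1)]
        have "card e = 2" using e' e card_image[OF inj_on_subset[OF inj ev]] by simp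
        moreover have "u \<in> e" using e' e ev u(1) inj by (auto simp: inj_on_def)
        ultimately show "e' \<in> (`) f ` edges_at (simps A) u" using e by (auto simp: edges_at_def)
      qed
      show "finite (edges_at (simps B) v) \<and> card (edges_at (simps B) v) \<le> D"
        using finite_subset[OF sub] card_mono[OF _ sub] card_image_le[OF e(1), of "(`) f"] e by auto
    qed
    fix g h assume g: "g \<in> carrier G"
    { fix s assume "s \<in> simps B"
      then obtain t where t: "t \<in> simps A" "s = f ` t" unfolding f(2)[symmetric] by blast
      have "action B g ` s = f ` action A g ` t"
        using simplicial_cxD(4)[OF A.cx t(1)] f(3)[OF g] unfolding t(2) image_image by (intro image_cong) auto
      then show "action B g ` s \<in> simps B"
        using A.act_simplex[OF g t(1)] unfolding f(2)[symmetric] by blast }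
    fix v assume h: "h \<in> carrier G" and "v \<in> verts (simps B)"
    then obtain u where u: "u \<in> verts (simps A)" "v = f u" using vB by blast
    have "action B (g \<otimes>\<^bsub>G\<^esub> h) v = f (action A (g \<otimes>\<^bsub>G\<^esub> h) u)"
      using f(3)[of "g \<otimes>\<^bsub>G\<^esub> h" u] g h u A.group by (simp add: group.is_monoid monoid.m_closed)
    then show "action B (g \<otimes>\<^bsub>G\<^esub> h) v = action B g (action B h v)"
      using f(3)[OF g A.act_verts[OF h u(1)]] f(3)[OF h u(1)] A.act_mult[OF g h u(1)] u(2) by simp
  next
    fix v assume "v \<in> verts (simps B)"
    then obtain u where u: "u \<in> verts (simps A)" "v = f u" using vB by blast
    have "\<one>\<^bsub>G\<^esub> \<in> carrier G" using A.group by (simp add: group.is_monoid)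
    then show "action B \<one>\<^bsub>G\<^esub> v = v" using f(3)[of "\<one>\<^bsub>G\<^esub>" u] A.act_one u by simp
  qed (rule A.group A.fin A.D cxB)+
qed

text \<open>The complex \<open>sub_gcx\<close> carries the action cut down to its vertices. This
  exchanges it for \<open>NG_act\<close>, which does not depend on the fibre.\<close>

lemma gcx_action_cong:
  assumes "gcx_action G D L act" "\<And>g v. g \<in> carrier G \<Longrightarrow> v \<in> verts L \<Longrightarrow> act' g v = act g v"
  shows "gcx_action G D L act'"
proof -
  interpret gcx_action G D L act by (rule assms(1))
  have sub: "v \<in> verts L" if "s \<in> L" "v \<in> s" for s v using simplicial_cxD(4)[OF cx that(1)] that(2) by blast
  show ?thesis
  proof (rule gcx_action.intro)
    fix g s assume g: "g \<in> carrier G" and s: "s \<in> L"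
    have "act' g ` s = act g ` s" using assms(2)[OF g] sub[OF s] by (intro image_cong) auto
    then show "act' g ` s \<in> L" using act_simplex[OF g s] by simp
  next
    fix g h v assume "g \<in> carrier G" "h \<in> carrier G" "v \<in> verts L"
    then show "act' (g \<otimes>\<^bsub>G\<^esub> h) v = act' g (act' h v)"
      using assms(2) act_mult act_verts group by (simp add: group.is_monoid monoid.m_closed)
  next
    fix v assume "v \<in> verts L"
    then show "act' \<one>\<^bsub>G\<^esub> v = v" using assms(2) act_one group by (simp add: group.is_monoid)
  qed (rule group fin D cx deg)+
qed

lemma Orb_rep:
  assumes "c \<in> Orb G"
  shows "transitive_action G (orb_pts c) (orb_act c)" "orb_pts c \<noteq> {}"
proof -
  obtain X where X: "X \<in> transitive_gsets G" "c = gset_iso_rel G `` {X}"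
    using assms by (auto simp: Orb_def quotient_def)
  have "(X, X) \<in> gset_iso_rel G"
  proof (cases X)
    case (Pair Y \<phi>)
    have "\<exists>f. bij_betw f Y Y \<and> (\<forall>g\<in>carrier G. \<forall>x\<in>Y. f (\<phi> g x) = \<phi> g (f x))"
      by (rule exI[of _ id]) simp
    then show ?thesis using X(1) by (simp add: gset_iso_rel_def Pair)
  qed
  then have "X \<in> c" using X(2) by simp
  then have "(SOME X. X \<in> c) \<in> c" by (rule someI)
  then have "(SOME X. X \<in> c) \<in> transitive_gsets G" unfolding X(2) by (auto simp: gset_iso_rel_def)
  then show "transitive_action G (orb_pts c) (orb_act c)" "orb_pts c \<noteq> {}"
    by (auto simp: transitive_gsets_def orb_pts_def orb_act_def)
qed

locale realization =
  fixes G :: "('g, 'm) monoid_scheme" and D n :: nat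
    and \<Psi> :: "'g gclass \<Rightarrow> 'g nvert set set" and \<rho> :: "'g \<Rightarrow> complex^'d^'d"
  assumes group: "group G" and fin: "finite (carrier G)" and D: "0 < D"
    and real: "realization_map G D \<Psi>" and irr: "irreducible_rep G \<rho>" and fin_Orb: "finite (Orb G)"
begin

abbreviation w :: "'g \<Rightarrow> complex" where "w \<equiv> coef G \<rho>"

lemmas w_inv = coef_inv[OF group fin irr]
lemmas w_conv = coef_convolution[OF group fin irr]

lemma Psi_Sub:
  assumes "a \<in> SC G D 1"
  shows "\<Psi> a \<in> Sub G D"
proof -
  have "\<Psi> a \<in> topspace (Sub_top G D)"
    using real assms topspace_SC_top[OF group fin D]
    by (auto simp: realization_map_def continuous_map_def)
  then show ?thesis by (simp add: Sub_top_def topspace_pullback_topology)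
qed

lemma Psi_Delta: "a \<in> SC G D 1 \<Longrightarrow> \<Psi> a \<subseteq> Delta G D"
  using Psi_Sub by (auto simp: Sub_def)

text \<open>The realization is isomorphic to a representative of the class, from which it inherits
  the degree bound, the action laws and the local traces. The index \<open>c\<close> is the
  isomorphism type of the root orbit.\<close>

lemma fibre:
  assumes a: "a \<in> SC G D 1"
  obtains c where "gcx_action G D (\<Psi> a) NG_act" "c \<in> Orb G" "zero_orbit c \<subseteq> verts (\<Psi> a)"
    "finite (orb_pts c)" "\<And>m. class_trace G D n w m a = trace_fun G D n w m (sub_gcx (\<Psi> a) c)"
proof -
  define A where "A = some_rep a"
  have Aa: "A \<in> a" unfolding A_def by (rule some_rep_in[OF group fin D a])
  note A = SC_repD[OF group fin D a Aa]
  obtain W where W: "gcx_action G D (simps A) (action A)" "roots A = [W]" "W \<subseteq> verts (simps A)" "finite W"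
    by (rule marked_gcxD[OF group fin D A]) (rule that)
  obtain c where c: "c \<in> Orb G" "gcx_iso G A (sub_gcx (\<Psi> a) c)"
    using real a Aa unfolding realization_map_def by blast
  have s: "simps (sub_gcx (\<Psi> a) c) = \<Psi> a" by (simp add: sub_gcx_def)
  have cx: "simplicial_cx (\<Psi> a)" using Psi_Sub[OF a] by (simp add: Sub_def)
  have "gcx_action G D (\<Psi> a) (action (sub_gcx (\<Psi> a) c))"
    using gcx_action_iso[OF W(1) c(2)] cx s by simp
  then have act: "gcx_action G D (\<Psi> a) NG_act"
    by (rule gcx_action_cong) (simp add: sub_gcx_def)
  obtain f where f: "bij_betw f (verts (simps A)) (verts (simps (sub_gcx (\<Psi> a) c)))"
    "(\<lambda>s. f ` s) ` simps A = simps (sub_gcx (\<Psi> a) c)"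
    "\<And>g v. g \<in> carrier G \<Longrightarrow> v \<in> verts (simps A) \<Longrightarrow> f (action A g v) = action (sub_gcx (\<Psi> a) c) g (f v)"
    "map (\<lambda>W. f ` W) (roots A) = roots (sub_gcx (\<Psi> a) c)"
    by (rule gcx_isoE[OF c(2)]) (rule that)
  have z: "zero_orbit c = f ` W" using f(4) W(2) by (simp add: sub_gcx_def)
  have sub: "zero_orbit c \<subseteq> verts (\<Psi> a)" using f(1) W(3) unfolding z s by (auto simp: bij_betw_def)
  have zc: "zero_orbit c = (\<lambda>x. (c, 0, x)) ` orb_pts c" by (auto simp: zero_orbit_def)
  have "finite (zero_orbit c)" unfolding z using W(4) by simp
  then have finc: "finite (orb_pts c)" unfolding zc by (rule finite_imageD) (simp add: inj_on_def)
  have "class_trace G D n w m a = trace_fun G D n w m (sub_gcx (\<Psi> a) c)" for m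
    using trace_fun_iso_marked[OF group fin D A c(2)] class_trace_eq[OF group fin D a Aa] by simp
  from that[OF act c(1) sub finc this] show thesis .
qed

lemma fibre_action: "a \<in> SC G D 1 \<Longrightarrow> gcx_action G D (\<Psi> a) NG_act"
  by (rule fibre)

text \<open>The fibre of \<open>vn_trace\<close>, with diagonal entries \<open>q\<close>. The two
  outer sums run over all possible root orbits, the same for each fibre, which lets them be
  exchanged with the integral.\<close>

definition root_sum :: "'g gclass \<Rightarrow> ('g nvert set \<Rightarrow> complex) \<Rightarrow> complex" where
  "root_sum a q = (\<Sum>c\<in>Orb G. \<Sum>x\<in>orb_pts c.
     (\<Sum>s | s \<in> \<Psi> a \<and> card s = n + 1 \<and> (c, 0, x) \<in> s. q s) / of_nat (card (orb_pts c) * (n + 1)))"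

text \<open>By transitivity and invariance, a single vertex of \<open>zero_orbit c'\<close> in the
  fibre brings in the whole orbit, and an element of \<open>Sub G D\<close> contains exactly one
  such orbit.\<close>

lemma zero_orbit_unique:
  assumes a: "a \<in> SC G D 1" and c: "c \<in> Orb G" "zero_orbit c \<subseteq> verts (\<Psi> a)"
    and c': "c' \<in> Orb G" "x \<in> orb_pts c'" "(c', 0, x) \<in> verts (\<Psi> a)"
  shows "c' = c"
proof -
  interpret gcx_action G D "\<Psi> a" NG_act by (rule fibre_action[OF a])
  interpret T: transitive_action G "orb_pts c'" "orb_act c'" by (rule Orb_rep(1)[OF c'(1)])
  have "zero_orbit c' \<subseteq> verts (\<Psi> a)"
  proof
    fix v assume "v \<in> zero_orbit c'"
    then obtain y where y: "y \<in> orb_pts c'" "v = (c', 0, y)" by (auto simp: zero_orbit_def)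
    then obtain g where g: "g \<in> carrier G" "orb_act c' g x = y" using T.unique_orbit c'(2) by blast
    then have "v = NG_act g (c', 0, x)" using y by (simp add: NG_act_def)
    then show "v \<in> verts (\<Psi> a)" using act_verts[OF g(1) c'(3)] by simp
  qed
  moreover have "\<exists>!c. c \<in> Orb G \<and> zero_orbit c \<subseteq> verts (\<Psi> a)" using Psi_Sub[OF a] by (simp add: Sub_def)
  ultimately show ?thesis using c c'(1) by blast
qed

text \<open>For an index other than the type of the root, no point of the zero orbit is a vertex of
  the fibre, so the sums over simplices at these points are empty.\<close>

lemma class_trace_root_sum:
  assumes a: "a \<in> SC G D 1"
  shows "class_trace G D n w m a =
    root_sum a (\<lambda>s. gcx_action.project G (\<Psi> a) NG_act w ((heat D (\<Psi> a) ^^ m) (delta s)) s)"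
proof -
  obtain c where c: "gcx_action G D (\<Psi> a) NG_act" "c \<in> Orb G" "zero_orbit c \<subseteq> verts (\<Psi> a)"
    "finite (orb_pts c)" "\<And>m. class_trace G D n w m a = trace_fun G D n w m (sub_gcx (\<Psi> a) c)"
    by (rule fibre[OF a]) (rule that)
  interpret gcx_action G D "\<Psi> a" NG_act by (rule c(1))
  define q where "q s = project w ((heat D (\<Psi> a) ^^ m) (delta s)) s" for s
  define N where "N c = (of_nat (card (orb_pts c) * (n + 1)) :: complex)" for c :: "'g gset set"
  define R where "R v = (\<Sum>s | s \<in> \<Psi> a \<and> card s = n + 1 \<and> v \<in> s. q s)" for v
  have zc: "zero_orbit c = (\<lambda>x. (c, 0, x)) ` orb_pts c" by (auto simp: zero_orbit_def)
  have inj: "inj_on (\<lambda>x. (c, 0 :: nat, x)) (orb_pts c)" by (simp add: inj_on_def)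
  have "class_trace G D n w m a = (\<Sum>v\<in>zero_orbit c. R v) / of_nat (card (zero_orbit c) * (n + 1))"
  proof -
    have "local_trace G D n w m (sub_gcx (\<Psi> a) c) v = R v" for v
      unfolding R_def q_def by (rule local_trace_project) (auto simp: sub_gcx_def)
    then show ?thesis unfolding c(5) trace_fun_def by (simp add: sub_gcx_def)
  qed
  also have "\<dots> = (\<Sum>x\<in>orb_pts c. R (c, 0, x) / N c)"
    unfolding zc sum.reindex[OF inj] card_image[OF inj] N_def by (simp add: sum_divide_distrib)
  also have "\<dots> = (\<Sum>c'\<in>Orb G. \<Sum>x\<in>orb_pts c'. R (c', 0, x) / N c')"
  proof -
    have "(\<Sum>x\<in>orb_pts c'. R (c', 0, x) / N c') = 0" if c': "c' \<in> Orb G - {c}" for c'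
    proof (rule sum.neutral, rule ballI)
      fix x assume x: "x \<in> orb_pts c'"
      have empty: "{s. s \<in> \<Psi> a \<and> card s = n + 1 \<and> (c', 0, x) \<in> s} = {}"
        using zero_orbit_unique[OF a c(2,3) _ x] c' simplicial_cxD(4)[OF cx] by blast
      show "R (c', 0, x) / N c' = 0" unfolding R_def empty by simp
    qed
    then show ?thesis using fin_Orb c(2) by (simp add: sum.remove[of "Orb G" c])
  qed
  finally show ?thesis by (simp add: root_sum_def R_def q_def N_def)
qed

end

locale realization_measure = realization G D n \<Psi> \<rho>
  for G :: "('g, 'm) monoid_scheme" and D n \<Psi> and \<rho> :: "'g \<Rightarrow> complex^'d^'d" +
  fixes \<mu> :: "'g gclass measure"
  assumes borel: "borel_prob_on_SC G D \<mu>"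
begin

sublocale prob_space \<mu>
  using borel by (simp add: borel_prob_on_SC_def)

lemma sets_mu: "sets \<mu> = sets (SC_borel G D 1)"
  using borel by (simp add: borel_prob_on_SC_def)

lemma space_mu: "space \<mu> = SC G D 1"
  using sets_eq_imp_space_eq[OF sets_mu] by (simp add: space_borel_of_top topspace_SC_top[OF group fin D] del: One_nat_def)

lemma fibre_mu: "a \<in> space \<mu> \<Longrightarrow> gcx_action G D (\<Psi> a) NG_act"
  using fibre_action by (simp add: space_mu)

lemma Psi_mu: "a \<in> space \<mu> \<Longrightarrow> \<Psi> a \<subseteq> Delta G D"
  using Psi_Delta by (simp add: space_mu)

section \<open>Measurability in the base\<close>

lemma countable_Delta: "countable (Delta G D)"
proof -
  have "NG G \<subseteq> Orb G \<times> (UNIV \<times> UNIV)" by (auto simp: NG_def)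
  moreover have "countable (Orb G \<times> (UNIV :: (nat \<times> nat) set))" using countable_finite[OF fin_Orb] by (intro countable_SIGMA) auto
  ultimately have "countable (NG G)" by (simp add: countable_subset)
  then have "countable {s. finite s \<and> s \<subseteq> NG G}" by (rule countable_Collect_finite_subset)
  then show ?thesis by (rule countable_subset[rotated]) (auto simp: Delta_def)
qed

text \<open>Membership of a fixed simplex is a coordinate of the product topology, so it is an open
  condition on \<open>Sub G D\<close>, and \<open>\<Psi>\<close> is continuous.\<close>

lemma measurable_mem_Psi [measurable]:
  assumes "s \<in> Delta G D"
  shows "Measurable.pred \<mu> (\<lambda>a. s \<in> \<Psi> a)"
proof -
  let ?P = "product_topology (\<lambda>_. discrete_topology (UNIV :: bool set)) (Delta G D)"
  define U where "U = {x \<in> topspace ?P. x s \<in> {True}}"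
  have "continuous_map ?P (discrete_topology UNIV) (\<lambda>x. x s)"
    using continuous_map_product_projection[OF assms] .
  then have "openin ?P U" unfolding U_def by (rule openin_continuous_map_preimage) simp
  then have "openin (Sub_top G D) ((\<lambda>S. restrict (\<lambda>s. s \<in> S) (Delta G D)) -` U \<inter> Sub G D)"
    unfolding Sub_top_def openin_pullback_topology by blast
  also have "(\<lambda>S. restrict (\<lambda>s. s \<in> S) (Delta G D)) -` U \<inter> Sub G D = {S \<in> Sub G D. s \<in> S}"
    using assms by (auto simp: U_def topspace_product_topology)
  finally have "openin (Sub_top G D) {S \<in> Sub G D. s \<in> S}" .
  then have "openin (SC_top G D 1) {a \<in> topspace (SC_top G D 1). \<Psi> a \<in> {S \<in> Sub G D. s \<in> S}}"
    using real by (intro openin_continuous_map_preimage) (auto simp: realization_map_def)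
  also have "{a \<in> topspace (SC_top G D 1). \<Psi> a \<in> {S \<in> Sub G D. s \<in> S}} = {a \<in> space \<mu>. s \<in> \<Psi> a}"
    unfolding topspace_SC_top[OF group fin D] space_mu using Psi_Sub by auto
  finally show ?thesis unfolding pred_def sets_mu by (rule openin_sets_borel_of_top)
qed

text \<open>The support of a row varies with the base point. The finite sum is therefore rewritten
  as a sum over the fixed countable set \<open>Delta G D\<close>, with measurable terms.\<close>

lemma borel_measurable_kop:
  fixes b :: "'g gclass \<Rightarrow> 'g nvert set \<Rightarrow> 'g nvert set \<Rightarrow> complex"
  assumes band: "\<And>a. a \<in> space \<mu> \<Longrightarrow> band p q (b a)"
    and supp: "\<And>a t s. a \<in> space \<mu> \<Longrightarrow> b a t s \<noteq> 0 \<Longrightarrow> t \<in> Delta G D \<and> s \<in> Delta G D"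
    and meas: "\<And>t s. t \<in> Delta G D \<Longrightarrow> s \<in> Delta G D \<Longrightarrow> (\<lambda>a. b a t s) \<in> borel_measurable \<mu>"
    and F: "\<And>t. (\<lambda>a. F a t) \<in> borel_measurable \<mu>"
  shows "(\<lambda>a. kop (b a) (F a) t) \<in> borel_measurable \<mu>"
proof (cases "t \<in> Delta G D")
  case True
  have "kop (b a) (F a) t = infsum (\<lambda>s. b a t s * F a s) (Delta G D)" if "a \<in> space \<mu>" for a
    unfolding kop_infsum[OF band[OF that]]
    by (rule infsum_cong_neutral) (use supp[OF that] in auto)
  moreover have "(\<lambda>a. infsum (\<lambda>s. b a t s * F a s) (Delta G D)) \<in> borel_measurable \<mu>"
  proof (rule borel_measurable_infsum_countable[OF countable_Delta])
    fix a assume "a \<in> space \<mu>"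
    then have "finite {s. b a t s \<noteq> 0}" using band by (auto simp: band_def)
    then have "finite {s \<in> Delta G D. b a t s * F a s \<noteq> 0}" by (rule rev_finite_subset) auto
    then show "(\<lambda>s. b a t s * F a s) summable_on Delta G D" by (rule finite_nonzero_values_imp_summable_on)
  qed (intro borel_measurable_times meas F True)
  ultimately show ?thesis by (simp cong: measurable_cong)
next
  case False
  have "kop (b a) (F a) t = 0" if "a \<in> space \<mu>" for a
    unfolding kop_def using supp[OF that] False by (intro sum.neutral) blast
  then show ?thesis by (simp cong: measurable_cong)
qed

lemma borel_measurable_inc:
  assumes "t \<in> Delta G D" "s \<in> Delta G D"
  shows "(\<lambda>a. inc (\<Psi> a) t s) \<in> borel_measurable \<mu>"
  using assms unfolding inc_def by measurable

lemma borel_measurable_heat_pow: "(\<lambda>a. (heat D (\<Psi> a) ^^ m) (delta s) t) \<in> borel_measurable \<mu>"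
proof (induction m arbitrary: t)
  case 0
  then show ?case by simp
next
  case (Suc m)
  have band: "band D (D + 1) (inc (\<Psi> a))" if "a \<in> space \<mu>" for a
    using fibre_mu[OF that] by (intro band_inc) (auto simp: gcx_action_def)
  have supp: "t \<in> Delta G D \<and> s \<in> Delta G D" if "a \<in> space \<mu>" "inc (\<Psi> a) t s \<noteq> 0" for a t s
    using that(2) Psi_mu[OF that(1)] by (auto simp: inc_def split: if_splits)
  have d: "(\<lambda>a. kop (inc (\<Psi> a)) (F a) t) \<in> borel_measurable \<mu>" if "\<And>t. (\<lambda>a. F a t) \<in> borel_measurable \<mu>" for F t
    by (rule borel_measurable_kop[OF band supp borel_measurable_inc that])
  have u: "(\<lambda>a. kop (kadj (inc (\<Psi> a))) (F a) t) \<in> borel_measurable \<mu>" if "\<And>t. (\<lambda>a. F a t) \<in> borel_measurable \<mu>" for F t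
  proof (rule borel_measurable_kop[OF band_kadj[OF band] _ _ that])
    fix a t s assume "a \<in> space \<mu>" "kadj (inc (\<Psi> a)) t s \<noteq> 0"
    then show "t \<in> Delta G D \<and> s \<in> Delta G D" using supp[of a s t] by (simp add: kadj_def)
  next
    fix t s assume ts: "t \<in> Delta G D" "s \<in> Delta G D"
    have "(\<lambda>a. cnj (inc (\<Psi> a) s t)) \<in> borel_measurable \<mu>"
      using borel_measurable_inc[OF ts(2,1)] by (rule borel_measurable_continuous_on[OF continuous_on_cnj[OF continuous_on_id]])
    then show "(\<lambda>a. kadj (inc (\<Psi> a)) t s) \<in> borel_measurable \<mu>" by (simp add: kadj_def)
  qed
  have "(\<lambda>a. lapl (\<Psi> a) ((heat D (\<Psi> a) ^^ m) (delta s)) t) \<in> borel_measurable \<mu>"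
    unfolding lapl_def by (intro borel_measurable_add d u Suc)
  then show ?case
    unfolding funpow.simps o_def heat_def[of D _ "(heat D _ ^^ m) (delta s)"]
    by (intro borel_measurable_diff borel_measurable_times borel_measurable_const Suc)
qed

section \<open>Square-integrable sections in coordinates\<close>

definition sec :: "('g gclass \<Rightarrow> 'g nvert set \<Rightarrow> complex) \<Rightarrow> bool" where
  "sec f \<longleftrightarrow> (\<forall>a\<in>space \<mu>. on_simplices n (\<Psi> a) (f a) \<and> ell2 (f a)) \<and>
     (\<forall>t. (\<lambda>a. f a t) \<in> borel_measurable \<mu>) \<and> integrable \<mu> (\<lambda>a. norm2 (f a))"

abbreviation cut :: "('g gclass \<Rightarrow> 'g nvert set \<Rightarrow> complex) \<Rightarrow> 'g gclass \<Rightarrow> 'g nvert set \<Rightarrow> complex" where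
  "cut f a t \<equiv> (if a \<in> space \<mu> then f a t else 0)"

lemma fibreD:
  assumes "a \<in> space \<mu>"
  shows "simplicial_cx (\<Psi> a)" "vertex_degree_le (\<Psi> a) D"
  using fibre_mu[OF assms] by (auto simp: gcx_action_def)

lemma borel_measurable_ell2_inner:
  assumes "\<And>a. a \<in> space \<mu> \<Longrightarrow> on_simplices n (\<Psi> a) (f a) \<and> ell2 (f a)" "\<And>t. (\<lambda>a. f a t) \<in> borel_measurable \<mu>"
    and "\<And>a. a \<in> space \<mu> \<Longrightarrow> on_simplices n (\<Psi> a) (k a) \<and> ell2 (k a)" "\<And>t. (\<lambda>a. k a t) \<in> borel_measurable \<mu>"
  shows "(\<lambda>a. ell2_inner (f a) (k a)) \<in> borel_measurable \<mu>"
proof -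
  have supp: "f a t = 0" if "a \<in> space \<mu>" "t \<notin> Delta G D" for a t
    using assms(1)[OF that(1)] Psi_mu[OF that(1)] that(2) by (auto simp: on_simplices_def)
  have "ell2_inner (f a) (k a) = infsum (\<lambda>t. f a t * cnj (k a t)) (Delta G D)" if "a \<in> space \<mu>" for a
    unfolding ell2_inner_def by (rule infsum_cong_neutral) (use supp[OF that] in auto)
  moreover have "(\<lambda>a. infsum (\<lambda>t. f a t * cnj (k a t)) (Delta G D)) \<in> borel_measurable \<mu>"
  proof (rule borel_measurable_infsum_countable[OF countable_Delta])
    fix t show "(\<lambda>a. f a t * cnj (k a t)) \<in> borel_measurable \<mu>"
      using assms(2)[of t] borel_measurable_continuous_on[OF continuous_on_cnj[OF continuous_on_id] assms(4)[of t]]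
      by (rule borel_measurable_times)
  next
    fix a assume "a \<in> space \<mu>"
    then have "(\<lambda>t. f a t * cnj (k a t)) summable_on UNIV" using assms(1,3) ell2_inner_summable' by blast
    then show "(\<lambda>t. f a t * cnj (k a t)) summable_on Delta G D" by (rule summable_on_subset_banach) simp
  qed
  ultimately show ?thesis by (simp cong: measurable_cong)
qed

lemma integrable_ell2_inner:
  assumes f: "sec f" and k: "sec k"
  shows "integrable \<mu> (\<lambda>a. ell2_inner (f a) (k a))"
proof (rule Bochner_Integration.integrable_bound)
  show "integrable \<mu> (\<lambda>a. norm2 (f a) + norm2 (k a))" using f k by (simp add: sec_def)
  show "(\<lambda>a. ell2_inner (f a) (k a)) \<in> borel_measurable \<mu>"
    using f k by (intro borel_measurable_ell2_inner) (auto simp: sec_def)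
  show "AE a in \<mu>. norm (ell2_inner (f a) (k a)) \<le> norm (norm2 (f a) + norm2 (k a))"
  proof (rule AE_I2)
    fix a assume "a \<in> space \<mu>"
    then have "cmod (ell2_inner (f a) (k a)) \<le> sqrt (norm2 (f a)) * sqrt (norm2 (k a))"
      using f k by (intro ell2_Cauchy_Schwarz) (auto simp: sec_def)
    also have "\<dots> \<le> norm2 (f a) + norm2 (k a)"
    proof -
      have "2 * (sqrt (norm2 (f a)) * sqrt (norm2 (k a))) \<le> norm2 (f a) + norm2 (k a)"
        using sum_squares_bound[of "sqrt (norm2 (f a))" "sqrt (norm2 (k a))"] by (simp add: mult.assoc)
      moreover have "0 \<le> sqrt (norm2 (f a)) * sqrt (norm2 (k a))" by (intro mult_nonneg_nonneg) auto
      ultimately show ?thesis by linarith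
    qed
    finally show "norm (ell2_inner (f a) (k a)) \<le> norm (norm2 (f a) + norm2 (k a))" by simp
  qed
qed

lemma secI:
  assumes "\<And>a. a \<in> space \<mu> \<Longrightarrow> on_simplices n (\<Psi> a) (f a) \<and> ell2 (f a)" "\<And>t. (\<lambda>a. f a t) \<in> borel_measurable \<mu>"
    and "\<And>a. a \<in> space \<mu> \<Longrightarrow> norm2 (f a) \<le> b a" "integrable \<mu> b"
  shows "sec f"
proof -
  have "(\<lambda>a. Re (ell2_inner (f a) (f a))) \<in> borel_measurable \<mu>"
    using borel_measurable_ell2_inner[OF assms(1,2,1,2)] by (rule borel_measurable_continuous_on[OF continuous_on_Re[OF continuous_on_id]])
  then have "(\<lambda>a. norm2 (f a)) \<in> borel_measurable \<mu>" by (simp add: ell2_inner_self)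
  moreover have "AE a in \<mu>. norm (norm2 (f a)) \<le> norm (b a)"
  proof (rule AE_I2)
    fix a assume "a \<in> space \<mu>"
    from assms(3)[OF this] show "norm (norm2 (f a)) \<le> norm (b a)" by simp
  qed
  ultimately have "integrable \<mu> (\<lambda>a. norm2 (f a))" by (rule Bochner_Integration.integrable_bound[OF assms(4)])
  then show ?thesis using assms(1,2) by (simp add: sec_def)
qed

text \<open>Pairing with the fundamental section at \<open>t\<close> extracts the coordinate at
  \<open>t\<close>, so the measurability demanded of sections is that of their coordinates.
  Coordinates at other indices vanish.\<close>

lemma dint_chains_sec:
  assumes \<sigma>: "\<sigma> \<in> dint_chains G D \<Psi> n \<mu>"
  shows "sec (cut (\<lambda>a. coord (\<Psi> a) (\<sigma> a)))"
proof -
  have ch: "\<sigma> a \<in> chains2 (\<Psi> a) n" if "a \<in> space \<mu>" for a using \<sigma> that by (simp add: dint_chains_def)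
  have on: "on_simplices n (\<Psi> a) (coord (\<Psi> a) (\<sigma> a))" "ell2 (coord (\<Psi> a) (\<sigma> a))" if "a \<in> space \<mu>" for a
    using chains2D(1,2)[OF fibreD[OF that] D ch[OF that]] .
  have "integrable \<mu> (\<lambda>a. complex_of_real (norm2 (coord (\<Psi> a) (\<sigma> a))))"
    using \<sigma> by (simp add: dint_chains_def chain_inner_coord ell2_inner_self)
  from integrable_Re[OF this] have int: "integrable \<mu> (\<lambda>a. norm2 (coord (\<Psi> a) (\<sigma> a)))" by simp
  show ?thesis
  proof (rule secI[OF _ _ _ int])
    fix t
    show "(\<lambda>a. cut (\<lambda>a. coord (\<Psi> a) (\<sigma> a)) a t) \<in> borel_measurable \<mu>"
    proof (cases "t \<in> Delta G D \<and> card t = n + 1")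
      case True
      then have m: "(\<lambda>a. chain_inner (\<Psi> a) (\<sigma> a) (xi \<Psi> (orient t) a)) \<in> borel_measurable \<mu>"
        using \<sigma> by (simp add: dint_chains_def)
      have ft: "finite t" using True by (simp add: Delta_def)
      have "chain_inner (\<Psi> a) (\<sigma> a) (xi \<Psi> (orient t) a) = coord (\<Psi> a) (\<sigma> a) t" if "a \<in> space \<mu>" for a
      proof (cases "t \<in> \<Psi> a")
        case True
        have "coord (\<Psi> a) (ext (\<Psi> a) (delta t)) = delta t"
          using True by (intro coord_ext[OF fibreD[OF that] D]) (auto simp: delta_def)
        then show ?thesis
          using True ft ext_delta[OF fibreD[OF that] D True] by (simp add: chain_inner_coord xi_def orient)
      next
        case False
        then show ?thesis using ft by (simp add: chain_inner_coord xi_def orient coord_def[of _ _ t] ell2_inner_def)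
      qed
      with m show ?thesis by (simp cong: measurable_cong)
    next
      case False
      then have "coord (\<Psi> a) (\<sigma> a) t = 0" if "a \<in> space \<mu>" for a
        using on(1)[OF that] Psi_mu[OF that] by (auto simp: on_simplices_def)
      then show ?thesis by (simp cong: measurable_cong)
    qed
  qed (use on in \<open>simp_all cong: if_cong\<close>)
qed

lemma sec_cut: "sec (cut f) \<longleftrightarrow> sec f"
  unfolding sec_def by (simp cong: measurable_cong Bochner_Integration.integrable_cong)

lemma dint_chains_sec': "\<sigma> \<in> dint_chains G D \<Psi> n \<mu> \<Longrightarrow> sec (\<lambda>a. coord (\<Psi> a) (\<sigma> a))"
  using dint_chains_sec sec_cut by blast

lemma ext_dint_chains:
  assumes f: "sec f"
  shows "(\<lambda>a. ext (\<Psi> a) (f a)) \<in> dint_chains G D \<Psi> n \<mu>"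
proof -
  have on: "on_simplices n (\<Psi> a) (f a)" "ell2 (f a)" if "a \<in> space \<mu>" for a using f that by (auto simp: sec_def)
  have co: "coord (\<Psi> a) (ext (\<Psi> a) (f a)) = f a" if "a \<in> space \<mu>" for a
    using on(1)[OF that] by (intro coord_ext[OF fibreD[OF that] D]) (auto simp: on_simplices_def)
  show ?thesis unfolding dint_chains_def mem_Collect_eq
  proof (intro conjI ballI impI)
    fix a assume a: "a \<in> space \<mu>"
    show "ext (\<Psi> a) (f a) \<in> chains2 (\<Psi> a) n" by (rule ext_in_chains2[OF fibreD[OF a] D on[OF a]])
  next
    fix s assume s: "s \<in> Delta G D" "card s = n + 1"
    have fs: "finite s" using s by (simp add: Delta_def)
    have "chain_inner (\<Psi> a) (ext (\<Psi> a) (f a)) (xi \<Psi> (orient s) a) = f a s" if a: "a \<in> space \<mu>" for a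
    proof (cases "s \<in> \<Psi> a")
      case True
      have "coord (\<Psi> a) (ext (\<Psi> a) (delta s)) = delta s"
        using True by (intro coord_ext[OF fibreD[OF a] D]) (auto simp: delta_def)
      then show ?thesis
        using True fs ext_delta[OF fibreD[OF a] D True] co[OF a] by (simp add: chain_inner_coord xi_def orient)
    next
      case False
      then have "f a s = 0" using on(1)[OF a] by (auto simp: on_simplices_def)
      then show ?thesis using False fs by (simp add: chain_inner_coord xi_def orient ell2_inner_def)
    qed
    moreover have "(\<lambda>a. f a s) \<in> borel_measurable \<mu>" using f by (simp add: sec_def)
    ultimately show "(\<lambda>a. chain_inner (\<Psi> a) (ext (\<Psi> a) (f a)) (xi \<Psi> (orient s) a)) \<in> borel_measurable \<mu>"
      by (simp cong: measurable_cong)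
  next
    have "integrable \<mu> (\<lambda>a. complex_of_real (norm2 (f a)))" using f by (simp add: sec_def)
    then show "integrable \<mu> (\<lambda>a. chain_inner (\<Psi> a) (ext (\<Psi> a) (f a)) (ext (\<Psi> a) (f a)))"
      by (simp add: chain_inner_coord co ell2_inner_self cong: Bochner_Integration.integrable_cong)
  qed
qed

abbreviation proj :: "'g gclass \<Rightarrow> ('g nvert set \<Rightarrow> complex) \<Rightarrow> 'g nvert set \<Rightarrow> complex" where
  "proj a f \<equiv> gcx_action.project G (\<Psi> a) NG_act w f"

lemma borel_measurable_proj:
  assumes fm: "\<And>t. (\<lambda>a. f a t) \<in> borel_measurable \<mu>"
  shows "(\<lambda>a. proj a (f a) t) \<in> borel_measurable \<mu>"
proof (cases "t \<in> Delta G D")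
  case True
  have "proj a (f a) t = (\<Sum>g\<in>carrier G. cnj (w g) * (if t \<in> \<Psi> a then eps (NG_act g) t * f a (NG_act g ` t) else 0))"
    if "a \<in> space \<mu>" for a
  proof -
    interpret gcx_action G D "\<Psi> a" NG_act by (rule fibre_mu[OF that])
    show ?thesis by (simp add: project_def pullback_def)
  qed
  moreover have "(\<lambda>a. \<Sum>g\<in>carrier G. cnj (w g) * (if t \<in> \<Psi> a then eps (NG_act g) t * f a (NG_act g ` t) else 0)) \<in> borel_measurable \<mu>"
    using True fm by measurable
  ultimately show ?thesis by (simp cong: measurable_cong)
next
  case False
  have "proj a (f a) t = 0" if "a \<in> space \<mu>" for a
  proof -
    interpret gcx_action G D "\<Psi> a" NG_act by (rule fibre_mu[OF that])
    show ?thesis using False Psi_mu[OF that] by (auto simp: project_def pullback_def intro!: sum.neutral)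
  qed
  then show ?thesis by (simp cong: measurable_cong)
qed

text \<open>The fibrewise projection is a contraction, so the squared norm of the original section
  is an integrable bound.\<close>

lemma sec_proj:
  assumes f: "sec f"
  shows "sec (cut (\<lambda>a. proj a (f a)))"
proof (rule secI)
  have on: "on_simplices n (\<Psi> a) (f a)" "ell2 (f a)" if "a \<in> space \<mu>" for a using f that by (auto simp: sec_def)
  show "integrable \<mu> (\<lambda>a. norm2 (f a))" using f by (simp add: sec_def)
  { fix a assume a: "a \<in> space \<mu>"
    interpret gcx_action G D "\<Psi> a" NG_act by (rule fibre_mu[OF a])
    have "cut (\<lambda>a. proj a (f a)) a = proj a (f a)" using a by simp
    then show "on_simplices n (\<Psi> a) (cut (\<lambda>a. proj a (f a)) a) \<and> ell2 (cut (\<lambda>a. proj a (f a)) a)"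
      using on_simplices_project[OF on(1)[OF a]] ell2_project[OF on(2)[OF a]] by simp
    show "norm2 (cut (\<lambda>a. proj a (f a)) a) \<le> norm2 (f a)"
      using norm2_project_le[OF w_inv w_conv on(2)[OF a]] a by simp }
  fix t
  have fm: "(\<lambda>a. f a t) \<in> borel_measurable \<mu>" for t using f by (simp add: sec_def)
  show "(\<lambda>a. cut (\<lambda>a. proj a (f a)) a t) \<in> borel_measurable \<mu>"
    using borel_measurable_proj[where t = t, OF fm] by (simp cong: measurable_cong)
qed

lemma isotypic_proj_ext:
  assumes a: "a \<in> space \<mu>" and \<sigma>: "\<sigma> a \<in> chains2 (\<Psi> a) n"
  shows "isotypic_proj G \<Psi> \<rho> \<sigma> a = ext (\<Psi> a) (proj a (coord (\<Psi> a) (\<sigma> a)))"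
    "coord (\<Psi> a) (isotypic_proj G \<Psi> \<rho> \<sigma> a) = proj a (coord (\<Psi> a) (\<sigma> a))"
proof -
  interpret gcx_action G D "\<Psi> a" NG_act by (rule fibre_mu[OF a])
  note c = chains2D[OF cx deg D \<sigma>]
  have "isotypic_proj G \<Psi> \<rho> \<sigma> a = (\<lambda>u. \<Sum>g\<in>carrier G. w g * push_chain (\<Psi> a) (NG_act g) (ext (\<Psi> a) (coord (\<Psi> a) (\<sigma> a))) u)"
    unfolding c(3) isotypic_proj_def
    by (simp add: coef_def[OF group fin irr] sum_distrib_left mult.assoc)
  also have "\<dots> = ext (\<Psi> a) (proj a (coord (\<Psi> a) (\<sigma> a)))"
    by (rule isotypic_sum_ext) (auto simp: coord_def w_inv)
  finally show *: "isotypic_proj G \<Psi> \<rho> \<sigma> a = ext (\<Psi> a) (proj a (coord (\<Psi> a) (\<sigma> a)))" .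
  show "coord (\<Psi> a) (isotypic_proj G \<Psi> \<rho> \<sigma> a) = proj a (coord (\<Psi> a) (\<sigma> a))"
    unfolding * using on_simplices_project[OF c(1)] by (intro coord_ext[OF cx deg D]) (auto simp: on_simplices_def)
qed

end

section \<open>Dimensions of harmonic spaces\<close>

context realization_measure
begin

abbreviation hspace :: "'g csection set" where
  "hspace \<equiv> isotypic_proj G \<Psi> \<rho> ` l2_homology G D \<Psi> n \<mu>"

abbreviation harmv :: "'g gclass \<Rightarrow> 'g nvert set \<Rightarrow> 'g nvert set \<Rightarrow> complex" where
  "harmv a s \<equiv> gcx_action.harm D (\<Psi> a) s"

text \<open>The fibrewise harmonic projection of the fundamental section at \<open>s\<close>, which
  is 0 in fibres without \<open>s\<close>.\<close>

definition hcut :: "'g nvert set \<Rightarrow> 'g gclass \<Rightarrow> 'g nvert set \<Rightarrow> complex" where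
  "hcut s a = (if a \<in> space \<mu> \<and> s \<in> \<Psi> a then harmv a s else (\<lambda>_. 0))"

definition dcut :: "'g nvert set \<Rightarrow> 'g gclass \<Rightarrow> 'g nvert set \<Rightarrow> complex" where
  "dcut s a = (if s \<in> \<Psi> a then delta s else (\<lambda>_. 0))"

lemma on_simplices_zero [simp]: "on_simplices n L (\<lambda>_. 0)"
  by (simp add: on_simplices_def)

lemma norm2_zero [simp]: "norm2 (\<lambda>_. 0) = 0"
  by (simp add: norm2_def)

lemma sec_dcut:
  assumes s: "s \<in> Delta G D" "card s = n + 1"
  shows "sec (dcut s)"
proof (rule secI)
  fix a assume "a \<in> space \<mu>"
  show "on_simplices n (\<Psi> a) (dcut s a) \<and> ell2 (dcut s a)"
    using s by (auto simp: dcut_def intro: on_simplices_delta)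
  show "norm2 (dcut s a) \<le> 1" by (simp add: dcut_def)
next
  fix t
  have "(\<lambda>a. if s \<in> \<Psi> a then delta s t else 0) \<in> borel_measurable \<mu>" using s by measurable
  also have "(\<lambda>a. if s \<in> \<Psi> a then delta s t else 0) = (\<lambda>a. dcut s a t)" by (auto simp: dcut_def)
  finally show "(\<lambda>a. dcut s a t) \<in> borel_measurable \<mu>" .
qed simp

text \<open>Measurability holds because harmonic projections are entrywise limits of heat powers.
  The norm is at most 1, since projecting a unit vector gives x \<le> sqrt x for its squared norm
  x.\<close>

lemma sec_hcut:
  assumes s: "s \<in> Delta G D" "card s = n + 1"
  shows "sec (hcut s)"
proof (rule secI)
  fix a assume a: "a \<in> space \<mu>"
  interpret gcx_action G D "\<Psi> a" NG_act by (rule fibre_mu[OF a])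
  note e = ell2_harm[where w = w, OF w_inv w_conv, of s]
  show "on_simplices n (\<Psi> a) (hcut s a) \<and> ell2 (hcut s a)"
    using s on_simplices_harm[where w = w, OF w_inv w_conv, of s n] e by (auto simp: hcut_def)
  show "norm2 (hcut s a) \<le> 1"
  proof (cases "s \<in> \<Psi> a")
    case True
    have "ell2_inner (harm s) (harm s) = ell2_inner (delta s) (harm s)"
      by (rule inner_harm[where w = w, OF w_inv w_conv e lapl_harm[where w = w, OF w_inv w_conv]])
    then have "norm2 (harm s) = cmod (ell2_inner (delta s) (harm s))"
      unfolding ell2_inner_self by (metis norm2_nonneg abs_of_nonneg norm_of_real)
    also have "\<dots> \<le> sqrt (norm2 (harm s))"
      using ell2_Cauchy_Schwarz[OF ell2_delta e, of s] by simp
    finally have le: "norm2 (harm s) \<le> sqrt (norm2 (harm s))" .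
    have "norm2 (harm s) \<le> 1"
    proof (rule ccontr)
      assume "\<not> ?thesis"
      then have g: "1 < norm2 (harm s)" by simp
      then have "sqrt (norm2 (harm s)) < norm2 (harm s)"
        by (intro real_less_lsqrt) (auto simp: power2_eq_square)
      then show False using le by simp
    qed
    then show ?thesis using True a by (simp add: hcut_def)
  qed (simp add: hcut_def)
next
  fix t
  have "(\<lambda>a. if s \<in> \<Psi> a then (heat D (\<Psi> a) ^^ m) (delta s) t else 0) \<in> borel_measurable \<mu>" for m
    using s borel_measurable_heat_pow[of m s t] by measurable
  then show "(\<lambda>a. hcut s a t) \<in> borel_measurable \<mu>"
  proof (rule borel_measurable_LIMSEQ_metric)
    fix a assume a: "a \<in> space \<mu>"
    interpret gcx_action G D "\<Psi> a" NG_act by (rule fibre_mu[OF a])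
    show "(\<lambda>m. if s \<in> \<Psi> a then (heat D (\<Psi> a) ^^ m) (delta s) t else 0) \<longlonglongrightarrow> hcut s a t"
      using heat.pow_tendsto[OF ell2_delta, of s t] a
      by (simp add: hcut_def harm_def[where w = w, OF w_inv w_conv])
  qed
qed simp

lemma l2_homologyD:
  assumes "\<kappa> \<in> l2_homology G D \<Psi> n \<mu>"
  shows "\<kappa> \<in> dint_chains G D \<Psi> n \<mu>" "AE a in \<mu>. lapl (\<Psi> a) (coord (\<Psi> a) (\<kappa> a)) = (\<lambda>_. 0)"
proof -
  show d: "\<kappa> \<in> dint_chains G D \<Psi> n \<mu>" using assms by (simp add: l2_homology_def)
  have "AE a in \<mu>. laplacian (\<Psi> a) n (\<kappa> a) = (\<lambda>_. 0)" using assms by (simp add: l2_homology_def)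
  moreover have "AE a in \<mu>. laplacian (\<Psi> a) n (\<kappa> a) = (\<lambda>_. 0) \<longrightarrow> lapl (\<Psi> a) (coord (\<Psi> a) (\<kappa> a)) = (\<lambda>_. 0)"
  proof (rule AE_I2)
    fix a assume a: "a \<in> space \<mu>"
    then have "\<kappa> a \<in> chains2 (\<Psi> a) n" using d by (simp add: dint_chains_def)
    from laplacian_zero_iff[OF fibreD[OF a] D this]
    show "laplacian (\<Psi> a) n (\<kappa> a) = (\<lambda>_. 0) \<longrightarrow> lapl (\<Psi> a) (coord (\<Psi> a) (\<kappa> a)) = (\<lambda>_. 0)" by simp
  qed
  ultimately show "AE a in \<mu>. lapl (\<Psi> a) (coord (\<Psi> a) (\<kappa> a)) = (\<lambda>_. 0)" by eventually_elim simp
qed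

lemma isotypic_coord:
  assumes \<kappa>: "\<kappa> \<in> dint_chains G D \<Psi> n \<mu>" and a: "a \<in> space \<mu>"
  shows "coord (\<Psi> a) (isotypic_proj G \<Psi> \<rho> \<kappa> a) = proj a (coord (\<Psi> a) (\<kappa> a))"
  by (rule isotypic_proj_ext(2)[OF a]) (use \<kappa> a in \<open>simp add: dint_chains_def\<close>)

lemma hspace_sec:
  assumes "\<kappa> \<in> hspace"
  shows "sec (\<lambda>a. coord (\<Psi> a) (\<kappa> a))"
proof -
  obtain \<kappa>' where k: "\<kappa>' \<in> l2_homology G D \<Psi> n \<mu>" "\<kappa> = isotypic_proj G \<Psi> \<rho> \<kappa>'" using assms by blast
  note d = l2_homologyD(1)[OF k(1)]
  have "sec (cut (\<lambda>a. proj a (coord (\<Psi> a) (\<kappa>' a))))" by (rule sec_proj[OF dint_chains_sec'[OF d]])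
  also have "cut (\<lambda>a. proj a (coord (\<Psi> a) (\<kappa>' a))) = cut (\<lambda>a. coord (\<Psi> a) (\<kappa> a))"
    unfolding k(2) using isotypic_coord[OF d] by (auto simp: fun_eq_iff)
  finally show ?thesis unfolding sec_cut .
qed

lemma dint_inner_diff_left:
  assumes "sec (\<lambda>a. coord (\<Psi> a) (\<sigma> a))" "sec (\<lambda>a. coord (\<Psi> a) (\<tau> a))" "sec (\<lambda>a. coord (\<Psi> a) (\<kappa> a))"
  shows "dint_inner \<Psi> \<mu> (\<lambda>a u. \<sigma> a u - \<tau> a u) \<kappa> = dint_inner \<Psi> \<mu> \<sigma> \<kappa> - dint_inner \<Psi> \<mu> \<tau> \<kappa>"
proof -
  have "dint_inner \<Psi> \<mu> (\<lambda>a u. \<sigma> a u - \<tau> a u) \<kappa> =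
      (\<integral>a. ell2_inner (coord (\<Psi> a) (\<sigma> a)) (coord (\<Psi> a) (\<kappa> a)) - ell2_inner (coord (\<Psi> a) (\<tau> a)) (coord (\<Psi> a) (\<kappa> a)) \<partial>\<mu>)"
    unfolding dint_inner_def chain_inner_coord coord_diff
    by (rule Bochner_Integration.integral_cong[OF refl], rule ell2_inner_diff_left) (use assms in \<open>auto simp: sec_def\<close>)
  also have "\<dots> = dint_inner \<Psi> \<mu> \<sigma> \<kappa> - dint_inner \<Psi> \<mu> \<tau> \<kappa>"
    unfolding dint_inner_def chain_inner_coord
    by (rule Bochner_Integration.integral_diff) (intro integrable_ell2_inner assms)+
  finally show ?thesis .
qed

lemma dint_inner_cnj: "cnj (dint_inner \<Psi> \<mu> \<sigma> \<tau>) = dint_inner \<Psi> \<mu> \<tau> \<sigma>"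
  unfolding dint_inner_def chain_inner_coord
  by (simp add: ell2_inner_cnj flip: Bochner_Integration.integral_cnj)

text \<open>The diagonal entry at \<open>s\<close> of the fibrewise projection to the isotypic
  harmonic part.\<close>

definition phi :: "'g nvert set \<Rightarrow> 'g gclass \<Rightarrow> complex" where
  "phi s a = proj a (hcut s a) s"

lemma phi_eq:
  assumes a: "a \<in> space \<mu>"
  shows "phi s a = (if s \<in> \<Psi> a then proj a (harmv a s) s else 0)"
proof -
  interpret gcx_action G D "\<Psi> a" NG_act by (rule fibre_mu[OF a])
  show ?thesis using a by (simp add: phi_def hcut_def project_def pullback_def)
qed

lemma phi_real:
  assumes a: "a \<in> space \<mu>" and s: "card s = n + 1"
  shows "phi s a = of_real (Re (phi s a))"
proof (cases "s \<in> \<Psi> a")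
  case True
  interpret gcx_action G D "\<Psi> a" NG_act by (rule fibre_mu[OF a])
  show ?thesis using project_harm_real[where w = w, OF w_inv w_conv True s] True by (simp add: phi_eq[OF a])
qed (simp add: phi_eq[OF a])

lemma phi_le:
  assumes a: "a \<in> space \<mu>"
  shows "cmod (phi s a) \<le> (\<Sum>g\<in>carrier G. cmod (w g))"
proof (cases "s \<in> \<Psi> a")
  case True
  interpret gcx_action G D "\<Psi> a" NG_act by (rule fibre_mu[OF a])
  have "(\<lambda>m. cmod (project w ((heat D (\<Psi> a) ^^ m) (delta s)) s)) \<longlonglongrightarrow> cmod (phi s a)"
    using project_heat_tendsto[where w = w, OF w_inv w_conv, of s s] True
    by (intro tendsto_norm) (simp add: phi_eq[OF a])
  then show ?thesis by (rule LIMSEQ_le_const2) (use cmod_project_heat_le[OF True] in blast)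
qed (simp add: phi_eq[OF a] sum_nonneg)

lemma phi_measurable:
  assumes s: "s \<in> Delta G D" "card s = n + 1"
  shows "phi s \<in> borel_measurable \<mu>"
proof -
  have "(\<lambda>a. hcut s a t) \<in> borel_measurable \<mu>" for t using sec_hcut[OF s] by (simp add: sec_def)
  from borel_measurable_proj[OF this] show ?thesis by (simp add: phi_def[abs_def])
qed

lemma phi_integrable:
  assumes s: "s \<in> Delta G D" "card s = n + 1"
  shows "integrable \<mu> (phi s)"
  by (rule integrable_const_bound[of _ "\<Sum>g\<in>carrier G. cmod (w g)"])
     (use phi_le phi_measurable[OF s] in auto)

text \<open>\<open>pr\<close> is a choice of a representative, but its matrix coefficients do not depend on the choice.\<close>
lemma dint_inner_pr:
  assumes s: "s \<in> Delta G D" "card s = n + 1"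
  shows "dint_inner \<Psi> \<mu> (pr \<Psi> \<mu> hspace (xi \<Psi> (orient s))) (xi \<Psi> (orient s)) = (\<integral>a. phi s a \<partial>\<mu>)"
proof -
  have fs: "finite s" using s by (simp add: Delta_def)
  define X where "X = xi \<Psi> (orient s)"
  have cX: "coord (\<Psi> a) (X a) = dcut s a" if a: "a \<in> space \<mu>" for a
  proof (cases "s \<in> \<Psi> a")
    case True
    have "coord (\<Psi> a) (ext (\<Psi> a) (delta s)) = delta s"
      using True by (intro coord_ext[OF fibreD[OF a] D]) (auto simp: delta_def)
    then show ?thesis using True fs ext_delta[OF fibreD[OF a] D True] by (simp add: X_def xi_def orient dcut_def)
  next
    case False
    then show ?thesis using fs by (simp add: X_def xi_def orient dcut_def)
  qed
  have sX: "sec (\<lambda>a. coord (\<Psi> a) (X a))"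
  proof -
    have eq: "cut (\<lambda>a. coord (\<Psi> a) (X a)) = cut (dcut s)" using cX by (auto simp: fun_eq_iff)
    have "sec (cut (dcut s))" unfolding sec_cut by (rule sec_dcut[OF s])
    then show ?thesis unfolding eq[symmetric] sec_cut .
  qed
  define \<sigma>0 where "\<sigma>0 a = ext (\<Psi> a) (hcut s a)" for a
  have d0: "\<sigma>0 \<in> dint_chains G D \<Psi> n \<mu>" unfolding \<sigma>0_def by (rule ext_dint_chains[OF sec_hcut[OF s]])
  have c0: "coord (\<Psi> a) (\<sigma>0 a) = hcut s a" if a: "a \<in> space \<mu>" for a
  proof -
    have "on_simplices n (\<Psi> a) (hcut s a)" using sec_hcut[OF s] a by (simp add: sec_def)
    then show ?thesis unfolding \<sigma>0_def by (intro coord_ext[OF fibreD[OF a] D]) (auto simp: on_simplices_def)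
  qed
  have h0: "lapl (\<Psi> a) (hcut s a) = (\<lambda>_. 0)" if a: "a \<in> space \<mu>" for a
  proof -
    interpret gcx_action G D "\<Psi> a" NG_act by (rule fibre_mu[OF a])
    show ?thesis using lapl_harm[where w = w, OF w_inv w_conv, of s] lapl_scale[of "\<Psi> a" 0 "\<lambda>_. 0"]
      by (simp add: hcut_def)
  qed
  have l0: "\<sigma>0 \<in> l2_homology G D \<Psi> n \<mu>"
    unfolding l2_homology_def mem_Collect_eq
  proof (intro conjI d0 AE_I2)
    fix a assume a: "a \<in> space \<mu>"
    then have "\<sigma>0 a \<in> chains2 (\<Psi> a) n" using d0 by (simp add: dint_chains_def)
    from laplacian_zero_iff[OF fibreD[OF a] D this] show "laplacian (\<Psi> a) n (\<sigma>0 a) = (\<lambda>_. 0)"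
      using h0[OF a] c0[OF a] by simp
  qed
  define \<tau>0 where "\<tau>0 = isotypic_proj G \<Psi> \<rho> \<sigma>0"
  have t0: "\<tau>0 \<in> hspace" using l0 by (simp add: \<tau>0_def)
  have ct: "coord (\<Psi> a) (\<tau>0 a) = proj a (hcut s a)" if "a \<in> space \<mu>" for a
    unfolding \<tau>0_def isotypic_coord[OF d0 that] c0[OF that] ..
  define P where "P \<tau> \<longleftrightarrow> \<tau> \<in> hspace \<and> (\<forall>\<kappa>\<in>hspace. dint_inner \<Psi> \<mu> (\<lambda>a u. X a u - \<tau> a u) \<kappa> = 0)" for \<tau>
  have P0: "P \<tau>0"
    unfolding P_def
  proof (intro conjI t0 ballI)
    fix \<kappa> assume "\<kappa> \<in> hspace"
    then obtain \<kappa>' where k: "\<kappa>' \<in> l2_homology G D \<Psi> n \<mu>" "\<kappa> = isotypic_proj G \<Psi> \<rho> \<kappa>'" by blast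
    note dk = l2_homologyD(1)[OF k(1)]
    have "AE a in \<mu>. chain_inner (\<Psi> a) (\<lambda>u. X a u - \<tau>0 a u) (\<kappa> a) = 0"
      using l2_homologyD(2)[OF k(1)] AE_space
    proof eventually_elim
      case (elim a)
      then have a: "a \<in> space \<mu>" by simp
      interpret gcx_action G D "\<Psi> a" NG_act by (rule fibre_mu[OF a])
      define k' where "k' = coord (\<Psi> a) (\<kappa>' a)"
      have k': "ell2 k'" "on_simplices n (\<Psi> a) k'" "lapl (\<Psi> a) k' = (\<lambda>_. 0)"
        using dint_chains_sec'[OF dk] a elim by (auto simp: sec_def k'_def)
      have "ell2_inner (\<lambda>t. dcut s a t - proj a (hcut s a) t) (proj a k') = 0"
      proof (cases "s \<in> \<Psi> a")
        case True
        then show ?thesis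
          using inner_delta_minus_project[where w = w, OF w_inv w_conv k', of s] a by (simp add: dcut_def hcut_def)
      next
        case False
        then have "proj a (hcut s a) = (\<lambda>_. 0)" by (simp add: hcut_def project_def pullback_def)
        then show ?thesis using False by (simp add: dcut_def ell2_inner_def)
      qed
      then show ?case
        unfolding chain_inner_coord coord_diff cX[OF a] ct[OF a] k(2) isotypic_coord[OF dk a] k'_def .
    qed
    then show "dint_inner \<Psi> \<mu> (\<lambda>a u. X a u - \<tau>0 a u) \<kappa> = 0"
      unfolding dint_inner_def by (rule integral_eq_zero_AE)
  qed
  define \<tau> where "\<tau> = pr \<Psi> \<mu> hspace X"
  have "\<tau> = (SOME \<tau>. P \<tau>)" unfolding \<tau>_def pr_def P_def ..
  then have "P \<tau>" using someI[of P, OF P0] by simp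
  have orth: "dint_inner \<Psi> \<mu> X \<kappa> = dint_inner \<Psi> \<mu> \<tau>' \<kappa>" if "P \<tau>'" "\<kappa> \<in> hspace" for \<tau>' \<kappa>
  proof -
    have "\<tau>' \<in> hspace" "dint_inner \<Psi> \<mu> (\<lambda>a u. X a u - \<tau>' a u) \<kappa> = 0" using that by (auto simp: P_def)
    then show ?thesis
      using dint_inner_diff_left[OF sX hspace_sec hspace_sec[OF that(2)]] by simp
  qed
  have th: "\<tau> \<in> hspace" using \<open>P \<tau>\<close> by (simp add: P_def)
  \<comment> \<open>Both \<open>\<tau>\<close> and \<open>\<tau>0\<close> lie in the subspace and
    satisfy the orthogonality relation, so each is tested against the other. This ends at the
    conjugate of the coefficient for \<open>\<tau>0\<close>, which is real.\<close>
  have "dint_inner \<Psi> \<mu> \<tau> X = cnj (dint_inner \<Psi> \<mu> X \<tau>)" by (simp add: dint_inner_cnj)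
  also have "\<dots> = cnj (dint_inner \<Psi> \<mu> \<tau>0 \<tau>)" using orth[OF P0 th] by simp
  also have "\<dots> = dint_inner \<Psi> \<mu> \<tau> \<tau>0" by (rule dint_inner_cnj)
  also have "\<dots> = dint_inner \<Psi> \<mu> X \<tau>0" using orth[OF \<open>P \<tau>\<close> t0] by simp
  also have "\<dots> = cnj (dint_inner \<Psi> \<mu> \<tau>0 X)" by (simp add: dint_inner_cnj)
  also have "dint_inner \<Psi> \<mu> \<tau>0 X = (\<integral>a. phi s a \<partial>\<mu>)"
    unfolding dint_inner_def chain_inner_coord
  proof (rule Bochner_Integration.integral_cong[OF refl])
    fix a assume a: "a \<in> space \<mu>"
    show "ell2_inner (coord (\<Psi> a) (\<tau>0 a)) (coord (\<Psi> a) (X a)) = phi s a"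
      unfolding ct[OF a] cX[OF a] using phi_eq[OF a, of s] a
      by (auto simp: dcut_def phi_def) (simp add: ell2_inner_def)
  qed
  also have "cnj (\<integral>a. phi s a \<partial>\<mu>) = (\<integral>a. cnj (phi s a) \<partial>\<mu>)" by simp
  also have "\<dots> = (\<integral>a. phi s a \<partial>\<mu>)"
  proof (rule Bochner_Integration.integral_cong[OF refl])
    fix a assume "a \<in> space \<mu>"
    from phi_real[OF this s(2)] show "cnj (phi s a) = phi s a" by (metis complex_cnj_complex_of_real)
  qed
  finally show ?thesis by (simp add: \<tau>_def X_def)
qed

definition star_sum :: "'g nvert \<Rightarrow> 'g gclass \<Rightarrow> complex" where
  "star_sum v a = (\<Sum>s | s \<in> \<Psi> a \<and> card s = n + 1 \<and> v \<in> s. phi s a)"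

lemma star_finite:
  assumes a: "a \<in> space \<mu>"
  shows "finite {s. s \<in> \<Psi> a \<and> card s = n + 1 \<and> v \<in> s}" "card {s. s \<in> \<Psi> a \<and> card s = n + 1 \<and> v \<in> s} \<le> 2 ^ D"
proof -
  have "finite {s. s \<in> \<Psi> a \<and> card s = n + 1 \<and> v \<in> s} \<and> card {s. s \<in> \<Psi> a \<and> card s = n + 1 \<and> v \<in> s} \<le> 2 ^ D"
  proof (cases "v \<in> verts (\<Psi> a)")
    case True
    note c = card_star_le[OF fibreD[OF a] True]
    have sub: "{s. s \<in> \<Psi> a \<and> card s = n + 1 \<and> v \<in> s} \<subseteq> {s \<in> \<Psi> a. v \<in> s}" by auto
    show ?thesis using finite_subset[OF sub c(1)] card_mono[OF c(1) sub] c(2) by simp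
  next
    case False
    have empty: "{s. s \<in> \<Psi> a \<and> card s = n + 1 \<and> v \<in> s} = {}"
      using False simplicial_cxD(4)[OF fibreD(1)[OF a]] by blast
    show ?thesis unfolding empty by simp
  qed
  then show "finite {s. s \<in> \<Psi> a \<and> card s = n + 1 \<and> v \<in> s}" "card {s. s \<in> \<Psi> a \<and> card s = n + 1 \<and> v \<in> s} \<le> 2 ^ D" by auto
qed

lemma sum_phi_le:
  assumes a: "a \<in> space \<mu>" and X: "finite X" "X \<subseteq> {s \<in> Delta G D. card s = n + 1 \<and> v \<in> s}"
  shows "(\<Sum>s\<in>X. cmod (phi s a)) \<le> weight_bound G D w"
proof -
  define S where "S = {s. s \<in> \<Psi> a \<and> card s = n + 1 \<and> v \<in> s}"
  have "(\<Sum>s\<in>X. cmod (phi s a)) = (\<Sum>s\<in>X \<inter> S. cmod (phi s a))"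
    using X by (intro sum.mono_neutral_right) (auto simp: S_def phi_eq[OF a])
  also have "\<dots> \<le> (\<Sum>s\<in>X \<inter> S. \<Sum>g\<in>carrier G. cmod (w g))" by (intro sum_mono phi_le a)
  also have "\<dots> = real (card (X \<inter> S)) * (\<Sum>g\<in>carrier G. cmod (w g))" by simp
  also have "\<dots> \<le> real (2 ^ D) * (\<Sum>g\<in>carrier G. cmod (w g))"
    using card_mono[of S "X \<inter> S"] star_finite[OF a, of v] unfolding S_def[symmetric]
    by (intro mult_right_mono of_nat_mono sum_nonneg) auto
  finally show ?thesis by (simp add: weight_bound_def[OF group fin D])
qed

lemma infsum_phi:
  assumes a: "a \<in> space \<mu>"
  shows "(\<Sum>\<^sub>\<infinity>s\<in>{s \<in> Delta G D. card s = n + 1 \<and> v \<in> s}. phi s a) = star_sum v a"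
proof -
  have "(\<Sum>\<^sub>\<infinity>s\<in>{s \<in> Delta G D. card s = n + 1 \<and> v \<in> s}. phi s a) =
      infsum (\<lambda>s. phi s a) {s. s \<in> \<Psi> a \<and> card s = n + 1 \<and> v \<in> s}"
    by (rule infsum_cong_neutral) (use Psi_mu[OF a] in \<open>auto simp: phi_eq[OF a]\<close>)
  then show ?thesis using star_finite(1)[OF a] by (simp add: star_sum_def)
qed

lemma countable_star: "countable {s \<in> Delta G D. card s = n + 1 \<and> v \<in> s}"
  by (rule countable_subset[OF _ countable_Delta]) auto

lemma integrable_star_sum: "integrable \<mu> (star_sum v)"
proof (rule integrable_const_bound[of _ "weight_bound G D w"])
  have "(\<lambda>a. \<Sum>\<^sub>\<infinity>s\<in>{s \<in> Delta G D. card s = n + 1 \<and> v \<in> s}. phi s a) \<in> borel_measurable \<mu>"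
  proof (rule borel_measurable_infsum_countable[OF countable_star])
    fix a assume a: "a \<in> space \<mu>"
    have "finite {s \<in> {s \<in> Delta G D. card s = n + 1 \<and> v \<in> s}. phi s a \<noteq> 0}"
      by (rule finite_subset[OF _ star_finite(1)[OF a, of v]]) (auto simp: phi_eq[OF a])
    then show "(\<lambda>s. phi s a) summable_on {s \<in> Delta G D. card s = n + 1 \<and> v \<in> s}"
      by (rule finite_nonzero_values_imp_summable_on)
  qed (simp add: phi_measurable)
  also have "?this \<longleftrightarrow> star_sum v \<in> borel_measurable \<mu>" by (rule measurable_cong[OF infsum_phi])
  finally show "star_sum v \<in> borel_measurable \<mu>" .
  show "AE a in \<mu>. norm (star_sum v a) \<le> weight_bound G D w"
  proof (rule AE_I2)
    fix a assume a: "a \<in> space \<mu>"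
    have "norm (star_sum v a) \<le> (\<Sum>s | s \<in> \<Psi> a \<and> card s = n + 1 \<and> v \<in> s. cmod (phi s a))"
      unfolding star_sum_def by (rule norm_sum)
    also have "\<dots> \<le> weight_bound G D w"
      using Psi_mu[OF a] by (intro sum_phi_le[OF a star_finite(1)[OF a]]) auto
    finally show "norm (star_sum v a) \<le> weight_bound G D w" .
  qed
qed

text \<open>Infinitely many simplices of \<open>Delta G D\<close> contain \<open>v\<close>, but at
  most \<open>2 ^ D\<close> of them lie in any one fibre. This gives the uniform bound for
  exchanging the sum with the integral.\<close>

lemma infsum_dint_inner_pr:
  "(\<Sum>\<^sub>\<infinity>s\<in>{s \<in> Delta G D. card s = n + 1 \<and> v \<in> s}.
     dint_inner \<Psi> \<mu> (pr \<Psi> \<mu> hspace (xi \<Psi> (orient s))) (xi \<Psi> (orient s)) / z) = (\<integral>a. star_sum v a \<partial>\<mu>) / z"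
proof -
  have "(\<Sum>\<^sub>\<infinity>s\<in>{s \<in> Delta G D. card s = n + 1 \<and> v \<in> s}.
     dint_inner \<Psi> \<mu> (pr \<Psi> \<mu> hspace (xi \<Psi> (orient s))) (xi \<Psi> (orient s)) / z) =
    (\<Sum>\<^sub>\<infinity>s\<in>{s \<in> Delta G D. card s = n + 1 \<and> v \<in> s}. (\<integral>a. phi s a \<partial>\<mu>) * inverse z)"
    by (intro infsum_cong) (simp add: dint_inner_pr divide_inverse)
  also have "\<dots> = (\<Sum>\<^sub>\<infinity>s\<in>{s \<in> Delta G D. card s = n + 1 \<and> v \<in> s}. (\<integral>a. phi s a \<partial>\<mu>)) * inverse z"
    by (rule infsum_cmult_left')
  also have "(\<Sum>\<^sub>\<infinity>s\<in>{s \<in> Delta G D. card s = n + 1 \<and> v \<in> s}. (\<integral>a. phi s a \<partial>\<mu>)) =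
      (\<integral>a. (\<Sum>\<^sub>\<infinity>s\<in>{s \<in> Delta G D. card s = n + 1 \<and> v \<in> s}. phi s a) \<partial>\<mu>)"
    by (rule integral_infsum_countable[OF countable_star _ sum_phi_le]) (auto intro: phi_integrable)
  also have "\<dots> = (\<integral>a. star_sum v a \<partial>\<mu>)"
    by (rule Bochner_Integration.integral_cong[OF refl infsum_phi])
  finally show ?thesis by (simp add: divide_inverse)
qed

lemma dim_vN_hspace: "dim_vN G D \<Psi> n \<mu> hspace = (\<integral>a. root_sum a (\<lambda>s. phi s a) \<partial>\<mu>)"
proof -
  have "dim_vN G D \<Psi> n \<mu> hspace =
      (\<Sum>c\<in>Orb G. \<Sum>x\<in>orb_pts c. (\<integral>a. star_sum (c, 0, x) a \<partial>\<mu>) / of_nat (card (orb_pts c) * (n + 1)))"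
    unfolding dim_vN_def vn_trace_def infsum_dint_inner_pr ..
  also have "\<dots> = (\<Sum>c\<in>Orb G. \<Sum>x\<in>orb_pts c. (\<integral>a. star_sum (c, 0, x) a / of_nat (card (orb_pts c) * (n + 1)) \<partial>\<mu>))"
    by simp
  also have "\<dots> = (\<integral>a. (\<Sum>c\<in>Orb G. \<Sum>x\<in>orb_pts c. star_sum (c, 0, x) a / of_nat (card (orb_pts c) * (n + 1))) \<partial>\<mu>)"
    using integrable_star_sum
    by (subst Bochner_Integration.integral_sum) (auto simp del: of_nat_mult of_nat_add of_nat_Suc)
  finally show ?thesis by (simp add: root_sum_def star_sum_def)
qed

text \<open>In each fibre the trace is a finite sum of entries that converge to those of the
  projection, and \<open>weight_bound\<close> dominates all of them, so dominated convergence
  applies. The dimension is real, which justifies following real parts only.\<close>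

lemma mean_trace_tendsto:
  "(\<lambda>m. mean_trace G D n w m \<mu>) \<longlonglongrightarrow> Re (dim_vN G D \<Psi> n \<mu> hspace)"
  "dim_vN G D \<Psi> n \<mu> hspace = of_real (Re (dim_vN G D \<Psi> n \<mu> hspace))"
proof -
  define R where "R a = root_sum a (\<lambda>s. phi s a)" for a
  have "R a = of_real (Re (R a))" if a: "a \<in> space \<mu>" for a
  proof -
    have "(\<Sum>s | s \<in> \<Psi> a \<and> card s = n + 1 \<and> v \<in> s. phi s a) = of_real (\<Sum>s | s \<in> \<Psi> a \<and> card s = n + 1 \<and> v \<in> s. Re (phi s a))" for v
      unfolding of_real_sum by (intro sum.cong refl) (simp add: phi_real[OF a, symmetric])
    then have z: "R a = of_real (\<Sum>c\<in>Orb G. \<Sum>x\<in>orb_pts c.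
       (\<Sum>s | s \<in> \<Psi> a \<and> card s = n + 1 \<and> (c, 0, x) \<in> s. Re (phi s a)) / real (card (orb_pts c) * (n + 1)))"
      unfolding R_def root_sum_def by simp
    show ?thesis unfolding z Re_complex_of_real ..
  qed
  then have "(\<integral>a. R a \<partial>\<mu>) = (\<integral>a. complex_of_real (Re (R a)) \<partial>\<mu>)"
    by (rule Bochner_Integration.integral_cong[OF refl])
  also have "\<dots> = of_real (\<integral>a. Re (R a) \<partial>\<mu>)" by (rule integral_complex_of_real)
  finally have dim: "dim_vN G D \<Psi> n \<mu> hspace = of_real (\<integral>a. Re (R a) \<partial>\<mu>)" by (simp add: dim_vN_hspace R_def)
  then show "dim_vN G D \<Psi> n \<mu> hspace = of_real (Re (dim_vN G D \<Psi> n \<mu> hspace))" by simp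
  have lim: "(\<lambda>m. Re (class_trace G D n w m a)) \<longlonglongrightarrow> Re (R a)" if a: "a \<in> space \<mu>" for a
  proof -
    interpret gcx_action G D "\<Psi> a" NG_act by (rule fibre_mu[OF a])
    have "(\<lambda>m. class_trace G D n w m a) \<longlonglongrightarrow> R a"
      unfolding class_trace_root_sum[OF a[unfolded space_mu]] R_def root_sum_def
    proof (rule tendsto_sum, rule tendsto_sum, unfold divide_inverse, rule tendsto_mult[OF _ tendsto_const], rule tendsto_sum)
      fix c x s assume "s \<in> {s. s \<in> \<Psi> a \<and> card s = n + 1 \<and> (c, 0, x) \<in> s}"
      then show "(\<lambda>m. project w ((heat D (\<Psi> a) ^^ m) (delta s)) s) \<longlonglongrightarrow> phi s a"
        using project_heat_tendsto[where w = w, OF w_inv w_conv, of s s] by (simp add: phi_eq[OF a])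
    qed
    then show ?thesis by (rule tendsto_Re)
  qed
  have meas: "(\<lambda>a. Re (class_trace G D n w m a)) \<in> borel_measurable \<mu>" for m
    using continuous_map_borel_measurable[OF continuous_class_trace[OF group fin D]]
    by (simp add: measurable_cong_sets[OF sets_mu refl])
  have "(\<lambda>m. \<integral>a. Re (class_trace G D n w m a) \<partial>\<mu>) \<longlonglongrightarrow> (\<integral>a. Re (R a) \<partial>\<mu>)"
  proof (rule integral_dominated_convergence[where w = "\<lambda>_. weight_bound G D w"])
    show "(\<lambda>a. Re (R a)) \<in> borel_measurable \<mu>" by (rule borel_measurable_LIMSEQ_metric[OF meas lim])
    show "AE a in \<mu>. norm (Re (class_trace G D n w m a)) \<le> weight_bound G D w" for m
    proof (rule AE_I2)
      fix a assume "a \<in> space \<mu>"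
      then have "cmod (class_trace G D n w m a) \<le> weight_bound G D w"
        unfolding weight_bound_def[OF group fin D] by (intro class_trace_bound group fin D) (simp add: space_mu)
      then show "norm (Re (class_trace G D n w m a)) \<le> weight_bound G D w"
        using abs_Re_le_cmod[of "class_trace G D n w m a"] by simp
    qed
  qed (use meas lim in auto)
  then show "(\<lambda>m. mean_trace G D n w m \<mu>) \<longlonglongrightarrow> Re (dim_vN G D \<Psi> n \<mu> hspace)"
    unfolding mean_trace_def[OF group fin D] dim by simp
qed

end

theorem theorem1p1:
  fixes G :: "('g, 'm) monoid_scheme"
    and D n :: nat
    and \<Psi> :: "'g gclass \<Rightarrow> 'g nvert set set"
    and \<mu> :: "nat \<Rightarrow> 'g gclass measure"
    and \<mu>_inf :: "'g gclass measure"
    and \<rho> :: "'g \<Rightarrow> complex^'d^'d"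
  assumes "group G" and "finite (carrier G)" and "D > 0"
    and "realization_map G D \<Psi>"
    and "\<And>k. random_rooted_gcx G D (\<mu> k)"
    and "\<And>k. sofic G D (\<mu> k)"
    and "weakly_converges G D \<mu> \<mu>_inf"
    and "irreducible_rep G \<rho>"
  shows "(\<lambda>k. l2_multiplicity G D \<Psi> n \<rho> (\<mu> k)) \<longlonglongrightarrow> l2_multiplicity G D \<Psi> n \<rho> \<mu>_inf"
proof (cases "finite (Orb G)")
  case False
  \<comment> \<open>A sum over an infinite index set is 0 by convention, so every multiplicity
    vanishes. The case split takes the place of a count of transitive \<open>G\<close>-sets up to
    isomorphism.\<close>
  then show ?thesis by (simp add: l2_multiplicity_def dim_vN_def vn_trace_def)
next
  case True
  interpret realization G D n \<Psi> \<rho> by (rule realization.intro[OF assms(1-4,8) True])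
  define d where "d \<mu> = Re (dim_vN G D \<Psi> n \<mu> (isotypic_proj G \<Psi> \<rho> ` l2_homology G D \<Psi> n \<mu>))" for \<mu>
  have mult: "l2_multiplicity G D \<Psi> n \<rho> \<nu> = 1 / character \<rho> \<one>\<^bsub>G\<^esub> * of_real (d \<nu>)"
    and lim: "(\<lambda>m. mean_trace G D n w m \<nu>) \<longlonglongrightarrow> d \<nu>" if "borel_prob_on_SC G D \<nu>" for \<nu>
  proof -
    interpret realization_measure G D n \<Psi> \<rho> \<nu> by unfold_locales (rule that)
    show "l2_multiplicity G D \<Psi> n \<rho> \<nu> = 1 / character \<rho> \<one>\<^bsub>G\<^esub> * of_real (d \<nu>)"
      unfolding l2_multiplicity_def d_def mean_trace_tendsto(2)[symmetric] ..
    show "(\<lambda>m. mean_trace G D n w m \<nu>) \<longlonglongrightarrow> d \<nu>" unfolding d_def by (rule mean_trace_tendsto(1))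
  qed
  have P: "borel_prob_on_SC G D (\<mu> k)" "borel_prob_on_SC G D \<mu>_inf" for k
    using assms(7) by (auto simp: weakly_converges_def)
  have "(\<lambda>k. d (\<mu> k)) \<longlonglongrightarrow> d \<mu>_inf"
  proof (rule interchange_limits[where a = "\<lambda>k m. mean_trace G D n w m (\<mu> k)"])
    show "(\<lambda>k. mean_trace G D n w m (\<mu> k)) \<longlonglongrightarrow> mean_trace G D n w m \<mu>_inf" for m
      by (rule mean_trace_weak[OF assms(1-3,7)])
    fix \<delta> :: real assume \<delta>: "0 < \<delta>"
    define B where "B = weight_bound G D w"
    have B: "0 \<le> B" by (simp add: B_def weight_bound_def[OF assms(1-3)] sum_nonneg)
    \<comment> \<open>The bound \<open>B\<close> is only known to be nonnegative; the summand 1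
      keeps the quotient meaningful.\<close>
    have "0 < \<delta> / (B + 1)" using \<delta> B by simp
    then obtain \<epsilon> M where e: "0 < \<epsilon>" "\<epsilon> < 1" "\<And>m. M \<le> m \<Longrightarrow> rate D \<epsilon> m < \<delta> / (B + 1)"
      by (rule rate_small[OF assms(3)]) (rule that)
    have "\<bar>mean_trace G D n w M (\<mu> k) - mean_trace G D n w m (\<mu> k)\<bar> \<le> \<delta>" if "M \<le> m" for k m
    proof -
      have "\<bar>mean_trace G D n w M (\<mu> k) - mean_trace G D n w m (\<mu> k)\<bar> \<le> B * rate D \<epsilon> M"
        unfolding B_def by (rule mean_trace_sofic_diff[OF assms(1-3,6) that e(1,2)])
      also have "\<dots> \<le> (B + 1) * (\<delta> / (B + 1))"
        using e(3)[of M] B rate_nonneg[OF assms(3) e(1,2), of M] by (intro mult_mono) auto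
      also have "\<dots> = \<delta>" using B by simp
      finally show ?thesis .
    qed
    then show "\<exists>M. \<forall>k. \<forall>m\<ge>M. \<bar>mean_trace G D n w M (\<mu> k) - mean_trace G D n w m (\<mu> k)\<bar> \<le> \<delta>" by blast
  qed (use lim P in auto)
  then show ?thesis unfolding mult[OF P(1)] mult[OF P(2)]
    by (intro tendsto_mult tendsto_const tendsto_of_real)
qed

end
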